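(* Let $\widehat Z\in\mathrm{Mp}_0(d,\mathbb{C})$ be written as $\widehat Z=\widehat V\widehat\Xi\widehat V^{-1}$ with $\widehat V\in\mathrm{Mp}(d,\mathbb{R})$, $V\in\mathrm{Sp}(d,\mathbb{R})$ its projection, and $\widehat\Xi=\bigotimes_{j=1}^d\widehat\Xi_j$ an atomic metaplectic contraction, where each $\widehat\Xi_j$ is $\mathfrak{p}_{i\alpha_j}$ ($\alpha_j>0$), the identity, or $\mathfrak{R}_{\vartheta_j}$ ($\vartheta_j>0$). Let $\Sigma$ be the $2d\times2d$ diagonal matrix with diagonal entries, for $j=1,\dots,d$, $$\Sigma_{j,j}=\begin{cases}\alpha_j&\text{if }\widehat\Xi_j=\mathfrak{p}_{i\alpha_j},\\0&\text{if }\widehat\Xi_j=\mathrm{id}_{L^2},\\2\tanh(\vartheta_j/2)&\text{if }\widehat\Xi_j=\mathfrak{R}_{\vartheta_j},\end{cases}\qquad\Sigma_{j+d,j+d}=\begin{cases}0&\text{if }\widehat\Xi_j=\mathfrak{p}_{i\alpha_j},\\0&\text{if }\widehat\Xi_j=\mathrm{id}_{L^2},\\2\tanh(\vartheta_j/2)&\text{if }\widehat\Xi_j=\mathfrak{R}_{\vartheta_j}.\end{cases}$$ Then $\widehat Z=\mathrm{Op}^{\mathrm{w}}(a)$, where $$a(z)=\prod_{j=1}^d\cosh(\vartheta_j/2)^{-1}\,e^{-\pi V^{-\top}\Sigma V^{-1}z\cdot z},\qquad z\in\mathbb{R}^{2d},$$ with $\vartheta_j=0$ if $\widehat\Xi_j$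 is not of the form $\mathfrak{R}_{\vartheta_j}$ with $\vartheta_j>0$. Consequently, if $\widehat Z\in\mathrm{Mp}_0(d,\mathbb{C})$, then $\widehat Z:M^{p,q}_{v_s}(\mathbb{R}^d)\to M^{p,q}_{v_s}(\mathbb{R}^d)$ is bounded for every $1\le p,q\le\infty$ and $s\ge0$, with $$\|\widehat Z\|_{M^{p,q}_{v_s}\to M^{p,q}_{v_s}}\lesssim c(s)\prod_{j=1}^d\cosh(\vartheta_j/2)^{-1}\big(1+\sigma_{\max}(\Sigma^{1/2}V^{-1})^2\big)^{s/2},$$ where $\sigma_{\max}(\Sigma^{1/2}V^{-1})$ is the largest singular value of $\Sigma^{1/2}V^{-1}$ and $c(s)=\int_{\mathbb{R}^{2d}}e^{-\pi|x|^2}v_s(x)dx$.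
   Context: $v_s(z)=(1+|z|^2)^{s/2}$ for $z\in\mathbb{R}^{2d}$. Fix a window $g\in\mathcal{S}(\mathbb{R}^d)\setminus\{0\}$; $V_gf(x,\xi)=\int f(y)\overline{g(y-x)}e^{-2\pi i\xi\cdot y}dy$ is the short-time Fourier transform, and $M^{p,q}_{v_s}(\mathbb{R}^d)$ is the space of $f\in\mathcal{S}'(\mathbb{R}^d)$ with $\|f\|_{M^{p,q}_{v_s}}=\|v_sV_gf\|_{L^{p,q}}<\infty$, where $\|F\|_{L^{p,q}}=\big\|\xi\mapsto\|F(\cdot,\xi)\|_{L^p}\big\|_{L^q}$. The symbol $\lesssim$ means inequality up to a constant not depending on $\widehat Z$ (it may depend on $d,p,q,s$ and the window). Elements of $\mathrm{Mp}_+(d,\mathbb{C})$ (defined below) extend to continuous operators on $\mathcal{S}'(\mathbb{R}^d)$. Weyl quantization: for $a\in\mathcal{S}'(\mathbb{R}^{2d})$, $\langle\mathrm{Op}^{\mathrm{w}}(a)f,g\rangle=\langle a,W(g,f)\rangle$, $f,g\in\mathcal{S}(\mathbb{R}^d)$, with $W(f,g)(x,\xi)=\int f(x+\tfrac y2)\overline{g(x-\tfrac y2)}e^{-2\pi iy\cdot\xi}dy$; formally $\mathrm{Op}^{\mathrm{w}}(a)f(x)=\int_{\mathbb{R}^{2d}}e^{2\pi i(x-y)\cdot\xi}a(\tfrac{x+y}2,\xi)f(y)dyd\xi$. $\mathrm{Mp}(d,\mathbb{R})$ is the group of unitary operators on $L^2(\mathbb{R}^d)$ generated by $\mathcal{F}f=i^{-d/2}\widehat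 f$ (with $\widehat f(\eta)=\int f(x)e^{-2\pi i\eta\cdot x}dx$), $\mathfrak{p}_Qf(x)=e^{i\pi Qx\cdot x}f(x)$ ($Q$ real symmetric), $\mathfrak{T}_Ef(x)=i^m|\det E|^{1/2}f(Ex)$ ($E\in\mathrm{GL}(d,\mathbb{R})$, $m\pi$ an argument of $\det E$); the projection onto $\mathrm{Sp}(d,\mathbb{R})$ is the two-fold covering homomorphism sending these to $\begin{pmatrix}O&I\\-I&O\end{pmatrix}$, $\begin{pmatrix}I&O\\Q&I\end{pmatrix}$, $\begin{pmatrix}E^{-1}&O\\O&E^\top\end{pmatrix}$. On $L^2(\mathbb{R})$: $\mathfrak{R}_\vartheta f(x)=(\cosh\vartheta)^{-1/2}\int_{\mathbb{R}}e^{i\pi(2x\eta+i(x^2+\eta^2)\sinh\vartheta)/\cosh\vartheta}\widehat f(\eta)d\eta$ ($\vartheta\ge0$, $\mathfrak{R}_0=\mathrm{id}$) and $\mathfrak{p}_{i\alpha}f(x)=e^{-\pi\alpha x^2}f(x)$ ($\alpha>0$). Atomic metaplectic contractions are tensor products of $d$ such operators; $\mathrm{Mp}_+(d,\mathbb{C})$ is the semigroup generated by $\mathrm{Mp}(d,\mathbb{R})$ and atomic metaplectic contractions; $\mathrm{Mp}_0(d,\mathbb{C})$ is the set of positive self-adjoint elements of $\mathrm{Mp}_+(d,\mathbb{C})$. Every element of $\mathrm{Mp}_0(d,\mathbb{C})$ can be written (non-uniquely) as $\widehat V\widehat\Xi\widehat V^{-1}$ as in the statement. *)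

theory Defs
  imports "HOL-Analysis.Analysis" "HOL-Probability.Essential_Supremum"
begin

section \<open>The Hilbert space of square-integrable functions\<close>

definition square_integrable :: "('a::euclidean_space \<Rightarrow> complex) \<Rightarrow> bool" where
  "square_integrable f \<longleftrightarrow>
     f \<in> borel_measurable lborel \<and> integrable lborel (\<lambda>x. (norm (f x))\<^sup>2)"

lemma square_integrable_zero: "square_integrable (\<lambda>x. 0)"
  by (simp add: square_integrable_def)

lemma square_integrable_scale:
  "square_integrable f \<Longrightarrow> square_integrable (\<lambda>x. c * f x)"
  by (auto simp: square_integrable_def norm_mult power_mult_distrib)

lemma square_integrable_add:
  assumes "square_integrable f" "square_integrable g"
  shows "square_integrable (\<lambda>x. f x + g x)"
proof -
  have "integrable lborel (\<lambda>x. (norm (f x + g x))\<^sup>2)"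
  proof (rule Bochner_Integration.integrable_bound)
    show "integrable lborel (\<lambda>x. 2 * (norm (f x))\<^sup>2 + 2 * (norm (g x))\<^sup>2)"
      using assms by (simp add: square_integrable_def)
    show "(\<lambda>x. (norm (f x + g x))\<^sup>2) \<in> borel_measurable lborel"
      using assms by (auto simp: square_integrable_def)
    show "AE x in lborel. norm ((norm (f x + g x))\<^sup>2)
            \<le> norm (2 * (norm (f x))\<^sup>2 + 2 * (norm (g x))\<^sup>2)"
    proof (rule AE_I2)
      fix x
      have "(norm (f x + g x))\<^sup>2 \<le> (norm (f x) + norm (g x))\<^sup>2"
        by (simp add: norm_triangle_ineq power_mono)
      also have "\<dots> \<le> 2 * (norm (f x))\<^sup>2 + 2 * (norm (g x))\<^sup>2"
        using sum_squares_bound[of "norm (f x)" "norm (g x)"]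
        by (simp add: power2_sum)
      finally show "norm ((norm (f x + g x))\<^sup>2)
            \<le> norm (2 * (norm (f x))\<^sup>2 + 2 * (norm (g x))\<^sup>2)"
        by simp
    qed
  qed
  with assms show ?thesis
    by (auto simp: square_integrable_def)
qed

lemma square_integrable_prod:
  assumes "square_integrable f" "square_integrable g"
  shows "integrable lborel (\<lambda>x. f x * cnj (g x))"
proof (rule Bochner_Integration.integrable_bound)
  show "integrable lborel (\<lambda>x. (norm (f x))\<^sup>2 + (norm (g x))\<^sup>2)"
    using assms by (simp add: square_integrable_def)
  have "g \<in> borel_measurable lborel" using assms by (simp add: square_integrable_def)
  then have "(\<lambda>x. cnj (g x)) \<in> borel_measurable lborel"
    by (intro borel_measurable_continuous_on[where f=cnj]) (auto intro: continuous_intros)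
  then show "(\<lambda>x. f x * cnj (g x)) \<in> borel_measurable lborel"
    using assms by (auto simp: square_integrable_def)
  show "AE x in lborel. norm (f x * cnj (g x)) \<le> norm ((norm (f x))\<^sup>2 + (norm (g x))\<^sup>2)"
  proof (rule AE_I2)
    fix x
    have "2 * (norm (f x) * norm (g x)) \<le> (norm (f x))\<^sup>2 + (norm (g x))\<^sup>2"
      using sum_squares_bound[of "norm (f x)" "norm (g x)"] by simp
    moreover have "0 \<le> norm (f x) * norm (g x)" by simp
    ultimately have "norm (f x) * norm (g x) \<le> (norm (f x))\<^sup>2 + (norm (g x))\<^sup>2"
      by linarith
    then show "norm (f x * cnj (g x)) \<le> norm ((norm (f x))\<^sup>2 + (norm (g x))\<^sup>2)"
      by (simp add: norm_mult)
  qed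
qed

quotient_type (overloaded) 'a L2 = "'a::euclidean_space \<Rightarrow> complex" /
  partial: "\<lambda>f g. square_integrable f \<and> square_integrable g \<and> (AE x in lborel. f x = g x)"
  morphisms rep_L2 abs_L2
proof (rule part_equivpI)
  show "\<exists>f::'a \<Rightarrow> complex. square_integrable f \<and> square_integrable f \<and> (AE x in lborel. f x = f x)"
    using square_integrable_zero by auto
  show "symp (\<lambda>f g. square_integrable f \<and> square_integrable g \<and> (AE x in lborel. f x = g (x::'a)))"
    by (auto intro!: sympI elim: eventually_mono)
  show "transp (\<lambda>f g. square_integrable f \<and> square_integrable g \<and> (AE x in lborel. f x = g (x::'a)))"
    by (auto intro!: transpI elim: eventually_elim2)
qed

lift_definition cinner_L2 :: "'a::euclidean_space L2 \<Rightarrow> 'a L2 \<Rightarrow> complex"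
  is "\<lambda>f g. \<integral>x. f x * cnj (g x) \<partial>lborel"
proof -
  fix f f' g g' :: "'a \<Rightarrow> complex"
  assume 1: "square_integrable f \<and> square_integrable f' \<and> (AE x in lborel. f x = f' x)"
    and 2: "square_integrable g \<and> square_integrable g' \<and> (AE x in lborel. g x = g' x)"
  show "(\<integral>x. f x * cnj (g x) \<partial>lborel) = (\<integral>x. f' x * cnj (g' x) \<partial>lborel)"
  proof (rule integral_cong_AE)
    show "(\<lambda>x. f x * cnj (g x)) \<in> borel_measurable lborel"
      and "(\<lambda>x. f' x * cnj (g' x)) \<in> borel_measurable lborel"
      using 1 2 by (blast intro: borel_measurable_integrable square_integrable_prod)+
    show "AE x in lborel. f x * cnj (g x) = f' x * cnj (g' x)"
      using 1 2 by (auto elim: eventually_elim2)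
  qed
qed

lift_definition scaleC_L2 :: "complex \<Rightarrow> 'a::euclidean_space L2 \<Rightarrow> 'a L2"
  is "\<lambda>c f x. c * f x"
  by (auto intro: square_integrable_scale elim: eventually_mono)

instantiation L2 :: (euclidean_space) real_inner
begin

lift_definition zero_L2 :: "'a L2" is "\<lambda>x. 0"
  by (simp add: square_integrable_zero)

lift_definition plus_L2 :: "'a L2 \<Rightarrow> 'a L2 \<Rightarrow> 'a L2" is "\<lambda>f g x. f x + g x"
  by (auto intro: square_integrable_add elim: eventually_elim2)

definition scaleR_L2 :: "real \<Rightarrow> 'a L2 \<Rightarrow> 'a L2" where
  "scaleR_L2 r f = scaleC_L2 (complex_of_real r) f"

definition uminus_L2 :: "'a L2 \<Rightarrow> 'a L2" where
  "uminus_L2 f = scaleC_L2 (- 1) f"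

definition minus_L2 :: "'a L2 \<Rightarrow> 'a L2 \<Rightarrow> 'a L2" where
  "minus_L2 f g = f + (- g)"

definition inner_L2 :: "'a L2 \<Rightarrow> 'a L2 \<Rightarrow> real" where
  "inner_L2 f g = Re (cinner_L2 f g)"

definition norm_L2 :: "'a L2 \<Rightarrow> real" where
  "norm_L2 f = sqrt (inner f f)"

definition dist_L2 :: "'a L2 \<Rightarrow> 'a L2 \<Rightarrow> real" where
  "dist_L2 f g = norm (f - g)"

definition sgn_L2 :: "'a L2 \<Rightarrow> 'a L2" where
  "sgn_L2 f = scaleR (inverse (norm f)) f"

definition uniformity_L2 :: "('a L2 \<times> 'a L2) filter" where
  "uniformity_L2 = (INF e\<in>{0 <..}. principal {(x, y). dist x y < e})"

definition open_L2 :: "'a L2 set \<Rightarrow> bool" where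
  "open_L2 S = (\<forall>x\<in>S. \<forall>\<^sub>F (x', y) in uniformity. x' = x \<longrightarrow> y \<in> S)"

instance
proof
  fix a b c :: "'a L2" and r s :: real and U :: "'a L2 set"
  show "a + b + c = a + (b + c)"
    by transfer (auto intro!: square_integrable_add simp: add.assoc)
  show "a + b = b + a"
    by transfer (auto intro!: square_integrable_add simp: add.commute)
  show "0 + a = a"
    by transfer (auto elim: eventually_mono)
  show "- a + a = 0"
    unfolding uminus_L2_def
    by transfer (auto intro!: square_integrable_add square_integrable_zero square_integrable_scale
        dest: square_integrable_scale[of _ "-1"])
  show "a - b = a + - b" by (simp add: minus_L2_def)
  show "r *\<^sub>R (a + b) = r *\<^sub>R a + r *\<^sub>R b"
    unfolding scaleR_L2_def
    by transfer (auto intro!: square_integrable_add square_integrable_scale simp: distrib_left)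
  show "(r + s) *\<^sub>R a = r *\<^sub>R a + s *\<^sub>R a"
    unfolding scaleR_L2_def
    by transfer (auto intro!: square_integrable_add square_integrable_scale simp: distrib_right)
  show "r *\<^sub>R s *\<^sub>R a = (r * s) *\<^sub>R a"
    unfolding scaleR_L2_def
    by transfer (auto intro!: square_integrable_scale simp: mult.assoc)
  show "1 *\<^sub>R a = a"
    unfolding scaleR_L2_def by transfer (auto elim: eventually_mono)
  show "dist a b = norm (a - b)" by (simp add: dist_L2_def)
  show "sgn a = scaleR (inverse (norm a)) a" by (simp add: sgn_L2_def)
  show "(uniformity :: ('a L2 \<times> 'a L2) filter) = (INF e\<in>{0 <..}. principal {(x, y). dist x y < e})"
    by (simp add: uniformity_L2_def)
  show "open U = (\<forall>x\<in>U. \<forall>\<^sub>F (x', y) in uniformity. x' = x \<longrightarrow> y \<in> U)"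
    by (simp add: open_L2_def)
  show "inner a b = inner b a"
  proof -
    have "cinner_L2 a b = cnj (cinner_L2 b a)"
      by transfer (simp add: mult.commute flip: Bochner_Integration.integral_cnj)
    then show ?thesis by (simp add: inner_L2_def)
  qed
  show "inner (a + b) c = inner a c + inner b c"
  proof -
    have "cinner_L2 (a + b) c = cinner_L2 a c + cinner_L2 b c"
      by transfer (simp add: distrib_right square_integrable_prod)
    then show ?thesis by (simp add: inner_L2_def)
  qed
  show "inner (r *\<^sub>R a) b = r * inner a b"
  proof -
    have "cinner_L2 (scaleC_L2 (complex_of_real r) a) b = complex_of_real r * cinner_L2 a b"
      by transfer (simp add: mult.assoc)
    then show ?thesis by (simp add: inner_L2_def scaleR_L2_def)
  qed
  have *: "inner a a = (\<integral>x. (norm (rep_L2 a x))\<^sup>2 \<partial>lborel)" and sq: "square_integrable (rep_L2 a)" for a :: "'a L2"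
  proof -
    show "square_integrable (rep_L2 a)"
      using Quotient_rep_reflp[OF Quotient_L2, of a] by simp
    have "cinner_L2 a a = (\<integral>x. complex_of_real ((norm (rep_L2 a x))\<^sup>2) \<partial>lborel)"
      by (simp only: cinner_L2.rep_eq complex_norm_square)
    then show "inner a a = (\<integral>x. (norm (rep_L2 a x))\<^sup>2 \<partial>lborel)"
      by (simp only: inner_L2_def integral_complex_of_real Re_complex_of_real)
  qed
  show "0 \<le> inner a a" unfolding * by simp
  show "inner a a = 0 \<longleftrightarrow> a = 0"
  proof -
    have "inner a a = 0 \<longleftrightarrow> (AE x in lborel. (norm (rep_L2 a x))\<^sup>2 = 0)"
      unfolding * using sq[of a] by (intro integral_nonneg_eq_0_iff_AE) (auto simp: square_integrable_def)
    also have "\<dots> \<longleftrightarrow> (AE x in lborel. rep_L2 a x = 0)" by simp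
    also have "\<dots> \<longleftrightarrow> a = 0"
    proof
      assume "AE x in lborel. rep_L2 a x = 0"
      then have "abs_L2 (rep_L2 a) = (abs_L2 (\<lambda>x. 0) :: 'a L2)"
        using sq[of a] square_integrable_zero
        by (intro Quotient_rel_abs[OF Quotient_L2]) auto
      then show "a = 0" by (simp add: zero_L2.abs_eq Quotient_abs_rep[OF Quotient_L2] zero_L2_def)
    next
      assume "a = 0"
      then have "inner a a = 0"
        by (simp add: inner_L2_def, transfer) simp
      then show "AE x in lborel. rep_L2 a x = 0"
        unfolding * using sq[of a]
        by (subst (asm) integral_nonneg_eq_0_iff_AE) (auto simp: square_integrable_def)
    qed
    finally show ?thesis .
  qed
  show "norm a = sqrt (inner a a)" by (simp add: norm_L2_def)
qed

end


section \<open>Real metaplectic operators\<close>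

definition fourier_integral :: "('a::euclidean_space \<Rightarrow> complex) \<Rightarrow> 'a \<Rightarrow> complex" where
  "fourier_integral f \<eta> = (\<integral>x. f x * cis (- 2 * pi * (\<eta> \<bullet> x)) \<partial>lborel)"

text \<open>The \<open>L\<^sup>2\<close> Fourier transform is the \<open>L\<^sup>2\<close>-limit of the Fourier integrals of the truncations
  of \<open>f\<close> to balls (Plancherel).\<close>

definition fourier_L2 :: "'a::euclidean_space L2 \<Rightarrow> 'a L2" where
  "fourier_L2 f =
     lim (\<lambda>n. abs_L2 (fourier_integral (\<lambda>x. if norm x \<le> real n then rep_L2 f x else 0)))"

definition mp_fourier :: "(real^'d) L2 \<Rightarrow> (real^'d) L2" where
  "mp_fourier f = scaleC_L2 (\<i> powr (- of_nat CARD('d) / 2)) (fourier_L2 f)"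

definition mp_chirp :: "real^'d^'d \<Rightarrow> (real^'d) L2 \<Rightarrow> (real^'d) L2" where
  "mp_chirp Q f = abs_L2 (\<lambda>x. cis (pi * ((Q *v x) \<bullet> x)) * rep_L2 f x)"

definition mp_dilation :: "int \<Rightarrow> real^'d^'d \<Rightarrow> (real^'d) L2 \<Rightarrow> (real^'d) L2" where
  "mp_dilation m E f =
     abs_L2 (\<lambda>x. \<i> powi m * complex_of_real (sqrt \<bar>det E\<bar>) * rep_L2 f (E *v x))"

text \<open>Phase space is \<open>real^('d + 'd)\<close>: the \<open>Inl\<close> coordinates are positions and the \<open>Inr\<close>
  coordinates are frequencies.\<close>

definition block_matrix ::
  "real^'d^'d \<Rightarrow> real^'d^'d \<Rightarrow> real^'d^'d \<Rightarrow> real^'d^'d \<Rightarrow> real^('d + 'd)^('d + 'd)" where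
  "block_matrix A B C D = (\<chi> i j.
     case (i, j) of
       (Inl k, Inl l) \<Rightarrow> A $ k $ l
     | (Inl k, Inr l) \<Rightarrow> B $ k $ l
     | (Inr k, Inl l) \<Rightarrow> C $ k $ l
     | (Inr k, Inr l) \<Rightarrow> D $ k $ l)"

text \<open>\<open>mp_projection U V\<close> is the graph of the covering homomorphism from the metaplectic group
  to the symplectic group: it is the group of pairs generated by the generators of the
  metaplectic group together with their projections. Its domain is therefore the group
  generated by these operators.\<close>

inductive mp_projection ::
  "((real^'d) L2 \<Rightarrow> (real^'d) L2) \<Rightarrow> real^('d + 'd)^('d + 'd) \<Rightarrow> bool" where
  fourier: "mp_projection mp_fourier (block_matrix 0 (mat 1) (- mat 1) 0)"
| chirp: "transpose Q = Q \<Longrightarrow> mp_projection (mp_chirp Q) (block_matrix (mat 1) 0 Q (mat 1))"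
| dilation: "invertible E \<Longrightarrow> complex_of_real (det E) = complex_of_real \<bar>det E\<bar> * cis (of_int m * pi) \<Longrightarrow>
    mp_projection (mp_dilation m E) (block_matrix (matrix_inv E) 0 0 (transpose E))"
| compose: "mp_projection U V \<Longrightarrow> mp_projection U' V' \<Longrightarrow> mp_projection (U \<circ> U') (V ** V')"
| inverse: "mp_projection U V \<Longrightarrow> mp_projection (inv U) (matrix_inv V)"

definition Mp :: "((real^'d) L2 \<Rightarrow> (real^'d) L2) set" where
  "Mp = {U. \<exists>V. mp_projection U V}"


section \<open>Metaplectic contractions\<close>

definition gauss_mult :: "real \<Rightarrow> real L2 \<Rightarrow> real L2" where
  "gauss_mult \<alpha> f = abs_L2 (\<lambda>x. exp (- pi * \<alpha> * x\<^sup>2) * rep_L2 f x)"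

definition hermite_op :: "real \<Rightarrow> real L2 \<Rightarrow> real L2" where
  "hermite_op \<theta> f = (if \<theta> = 0 then f else
     abs_L2 (\<lambda>x. complex_of_real (cosh \<theta> powr (- 1 / 2)) *
       (\<integral>\<eta>. exp (\<i> * pi * (2 * x * \<eta> + \<i> * (x\<^sup>2 + \<eta>\<^sup>2) * sinh \<theta>) / cosh \<theta>) *
             rep_L2 (fourier_L2 f) \<eta> \<partial>lborel)))"

datatype atom = Gauss real | Ident | Hermite real

fun valid_atom :: "atom \<Rightarrow> bool" where
  "valid_atom (Gauss \<alpha>) \<longleftrightarrow> \<alpha> > 0"
| "valid_atom Ident \<longleftrightarrow> True"
| "valid_atom (Hermite \<theta>) \<longleftrightarrow> \<theta> > 0"

fun atom_op :: "atom \<Rightarrow> real L2 \<Rightarrow> real L2" where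
  "atom_op (Gauss \<alpha>) = gauss_mult \<alpha>"
| "atom_op Ident = id"
| "atom_op (Hermite \<theta>) = hermite_op \<theta>"

fun atom_angle :: "atom \<Rightarrow> real" where
  "atom_angle (Gauss \<alpha>) = 0"
| "atom_angle Ident = 0"
| "atom_angle (Hermite \<theta>) = \<theta>"

definition tensor_L2 :: "('d::finite \<Rightarrow> real L2) \<Rightarrow> (real^'d) L2" where
  "tensor_L2 f = abs_L2 (\<lambda>x. \<Prod>j\<in>UNIV. rep_L2 (f j) (x $ j))"

text \<open>\<open>T\<close> is the tensor product of the operators \<open>X j\<close>; since finite sums of elementary tensors
  are dense, this determines \<open>T\<close>.\<close>

definition is_tensor_op ::
  "('d \<Rightarrow> real L2 \<Rightarrow> real L2) \<Rightarrow> ((real^'d) L2 \<Rightarrow> (real^'d) L2) \<Rightarrow> bool" where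
  "is_tensor_op X T \<longleftrightarrow>
     bounded_linear T \<and> (\<forall>c f. T (scaleC_L2 c f) = scaleC_L2 c (T f)) \<and>
     (\<forall>f. T (tensor_L2 f) = tensor_L2 (\<lambda>j. X j (f j)))"

inductive_set Mp_plus :: "((real^'d) L2 \<Rightarrow> (real^'d) L2) set" where
  real: "U \<in> Mp \<Longrightarrow> U \<in> Mp_plus"
| atomic: "(\<And>j. valid_atom (A j)) \<Longrightarrow> is_tensor_op (\<lambda>j. atom_op (A j)) T \<Longrightarrow> T \<in> Mp_plus"
| compose: "S \<in> Mp_plus \<Longrightarrow> T \<in> Mp_plus \<Longrightarrow> S \<circ> T \<in> Mp_plus"

definition positive_selfadjoint :: "('a::euclidean_space L2 \<Rightarrow> 'a L2) \<Rightarrow> bool" where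
  "positive_selfadjoint T \<longleftrightarrow>
     (\<forall>f g. cinner_L2 (T f) g = cinner_L2 f (T g)) \<and> (\<forall>f. 0 \<le> Re (cinner_L2 (T f) f))"

definition Mp_zero :: "((real^'d) L2 \<Rightarrow> (real^'d) L2) set" where
  "Mp_zero = {Z \<in> Mp_plus. positive_selfadjoint Z}"

definition mp_factorization ::
  "((real^'d) L2 \<Rightarrow> (real^'d) L2) \<Rightarrow> ((real^'d) L2 \<Rightarrow> (real^'d) L2) \<Rightarrow>
   real^('d + 'd)^('d + 'd) \<Rightarrow> ('d \<Rightarrow> atom) \<Rightarrow> bool" where
  "mp_factorization Z U V A \<longleftrightarrow>
     mp_projection U V \<and> (\<forall>j. valid_atom (A j)) \<and>
     (\<exists>X. is_tensor_op (\<lambda>j. atom_op (A j)) X \<and> Z = U \<circ> X \<circ> inv U)"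

definition diag_matrix :: "real^'n \<Rightarrow> real^'n^'n" where
  "diag_matrix v = (\<chi> i j. if i = j then v $ i else 0)"

definition sigma_diag :: "('d::finite \<Rightarrow> atom) \<Rightarrow> real^('d + 'd)" where
  "sigma_diag A = (\<chi> k. case k of
     Inl j \<Rightarrow> (case A j of Gauss \<alpha> \<Rightarrow> \<alpha> | Ident \<Rightarrow> 0 | Hermite \<theta> \<Rightarrow> 2 * tanh (\<theta> / 2))
   | Inr j \<Rightarrow> (case A j of Gauss \<alpha> \<Rightarrow> 0 | Ident \<Rightarrow> 0 | Hermite \<theta> \<Rightarrow> 2 * tanh (\<theta> / 2)))"

definition Sigma_matrix :: "('d::finite \<Rightarrow> atom) \<Rightarrow> real^('d + 'd)^('d + 'd)" where
  "Sigma_matrix A = diag_matrix (sigma_diag A)"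

definition sqrt_Sigma_matrix :: "('d::finite \<Rightarrow> atom) \<Rightarrow> real^('d + 'd)^('d + 'd)" where
  "sqrt_Sigma_matrix A = diag_matrix (\<chi> k. sqrt (sigma_diag A $ k))"

definition singular_values :: "real^'n^'m \<Rightarrow> real set" where
  "singular_values M = {sqrt \<mu> |\<mu>. \<exists>v. v \<noteq> 0 \<and> (transpose M ** M) *v v = \<mu> *\<^sub>R v}"

definition sigma_max :: "real^'n^'m \<Rightarrow> real" where
  "sigma_max M = Max (singular_values M)"


section \<open>Schwartz functions and tempered distributions\<close>

definition partial_deriv :: "'a::euclidean_space \<Rightarrow> ('a \<Rightarrow> complex) \<Rightarrow> 'a \<Rightarrow> complex" where
  "partial_deriv b f x = frechet_derivative f (at x) b"

definition iter_deriv :: "'a::euclidean_space list \<Rightarrow> ('a \<Rightarrow> complex) \<Rightarrow> 'a \<Rightarrow> complex" where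
  "iter_deriv bs f = foldr partial_deriv bs f"

definition schwartz :: "('a::euclidean_space \<Rightarrow> complex) \<Rightarrow> bool" where
  "schwartz f \<longleftrightarrow> (\<forall>bs. set bs \<subseteq> Basis \<longrightarrow>
     (\<forall>x. iter_deriv bs f differentiable at x) \<and>
     (\<forall>N::nat. bdd_above (range (\<lambda>x. (1 + norm x) ^ N * norm (iter_deriv bs f x)))))"

definition schwartz_seminorm :: "nat \<Rightarrow> ('a::euclidean_space \<Rightarrow> complex) \<Rightarrow> real" where
  "schwartz_seminorm N f = (\<Sum>bs | set bs \<subseteq> Basis \<and> length bs \<le> N.
     SUP x. (1 + norm x) ^ N * norm (iter_deriv bs f x))"

text \<open>With the sesquilinear duality \<open>\<langle>u, \<phi>\<rangle>\<close> used in time-frequency analysis, a tempered distribution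
  is a continuous \<^emph>\<open>conjugate-linear\<close> functional \<open>u \<phi> = \<langle>u, \<phi>\<rangle>\<close>; its values outside the Schwartz space
  are irrelevant.\<close>

definition tempered :: "(('a::euclidean_space \<Rightarrow> complex) \<Rightarrow> complex) \<Rightarrow> bool" where
  "tempered u \<longleftrightarrow>
     (\<forall>\<phi> \<psi>. schwartz \<phi> \<longrightarrow> schwartz \<psi> \<longrightarrow> u (\<lambda>x. \<phi> x + \<psi> x) = u \<phi> + u \<psi>) \<and>
     (\<forall>c \<phi>. schwartz \<phi> \<longrightarrow> u (\<lambda>x. c * \<phi> x) = cnj c * u \<phi>) \<and>
     (\<exists>N C. \<forall>\<phi>. schwartz \<phi> \<longrightarrow> norm (u \<phi>) \<le> C * schwartz_seminorm N \<phi>)"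

definition fun_dist :: "('a::euclidean_space \<Rightarrow> complex) \<Rightarrow> ('a \<Rightarrow> complex) \<Rightarrow> complex" where
  "fun_dist F \<phi> = (\<integral>x. F x * cnj (\<phi> x) \<partial>lborel)"

text \<open>Extension of an operator on \<open>L\<^sup>2\<close> to tempered distributions by duality,
  \<open>\<langle>Z u, \<phi>\<rangle> = \<langle>u, Z\<^sup>* \<phi>\<rangle>\<close>: the function chosen below is the Schwartz representative of
  \<open>Z\<^sup>* \<phi>\<close>.\<close>

definition extend_op ::
  "('a::euclidean_space L2 \<Rightarrow> 'a L2) \<Rightarrow> (('a \<Rightarrow> complex) \<Rightarrow> complex) \<Rightarrow> ('a \<Rightarrow> complex) \<Rightarrow> complex" where
  "extend_op Z u \<phi> = u (THE \<psi>. schwartz \<psi> \<and>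
     (\<forall>f. cinner_L2 (Z f) (abs_L2 \<phi>) = cinner_L2 f (abs_L2 \<psi>)))"


section \<open>Weyl quantization\<close>

definition pos :: "real^('d + 'd) \<Rightarrow> real^'d" where
  "pos z = (\<chi> i. z $ Inl i)"

definition freq :: "real^('d + 'd) \<Rightarrow> real^'d" where
  "freq z = (\<chi> i. z $ Inr i)"

definition wigner ::
  "(real^'d \<Rightarrow> complex) \<Rightarrow> (real^'d \<Rightarrow> complex) \<Rightarrow> real^('d + 'd) \<Rightarrow> complex" where
  "wigner f g z =
     (\<integral>y. f (pos z + y /\<^sub>R 2) * cnj (g (pos z - y /\<^sub>R 2)) * cis (- 2 * pi * (y \<bullet> freq z)) \<partial>lborel)"

definition Opw ::
  "((real^('d + 'd) \<Rightarrow> complex) \<Rightarrow> complex) \<Rightarrow>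
   (real^'d \<Rightarrow> complex) \<Rightarrow> (real^'d \<Rightarrow> complex) \<Rightarrow> complex" where
  "Opw a f = (\<lambda>g. a (wigner g f))"

text \<open>A Weyl operator maps Schwartz functions to tempered distributions, so equality with an
  operator on \<open>L\<^sup>2\<close> means equality of these distributions.\<close>

definition is_Opw ::
  "((real^'d) L2 \<Rightarrow> (real^'d) L2) \<Rightarrow> ((real^('d + 'd) \<Rightarrow> complex) \<Rightarrow> complex) \<Rightarrow> bool" where
  "is_Opw Z a \<longleftrightarrow> tempered a \<and>
     (\<forall>f g. schwartz f \<longrightarrow> schwartz g \<longrightarrow> fun_dist (rep_L2 (Z (abs_L2 f))) g = Opw a f g)"


section \<open>Modulation spaces\<close>

definition v_weight :: "real \<Rightarrow> 'a::real_normed_vector \<Rightarrow> real" where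
  "v_weight s z = (1 + (norm z)\<^sup>2) powr (s / 2)"

definition stft ::
  "('a::euclidean_space \<Rightarrow> complex) \<Rightarrow> (('a \<Rightarrow> complex) \<Rightarrow> complex) \<Rightarrow> 'a \<Rightarrow> 'a \<Rightarrow> complex" where
  "stft g u x \<xi> = u (\<lambda>y. cis (2 * pi * (\<xi> \<bullet> y)) * g (y - x))"

definition ennreal_powr :: "ennreal \<Rightarrow> real \<Rightarrow> ennreal" where
  "ennreal_powr t r = (if t = \<infinity> then \<infinity> else ennreal (enn2real t powr r))"

definition Lp_norm :: "ennreal \<Rightarrow> ('a::euclidean_space \<Rightarrow> ennreal) \<Rightarrow> ennreal" where
  "Lp_norm p F = (if p = \<infinity> then esssup lborel F
     else ennreal_powr (\<integral>\<^sup>+x. ennreal_powr (F x) (enn2real p) \<partial>lborel) (1 / enn2real p))"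

definition mixed_norm ::
  "ennreal \<Rightarrow> ennreal \<Rightarrow> ('a::euclidean_space \<Rightarrow> 'a \<Rightarrow> ennreal) \<Rightarrow> ennreal" where
  "mixed_norm p q F = Lp_norm q (\<lambda>\<xi>. Lp_norm p (\<lambda>x. F x \<xi>))"

definition mod_norm ::
  "('a::euclidean_space \<Rightarrow> complex) \<Rightarrow> ennreal \<Rightarrow> ennreal \<Rightarrow> real \<Rightarrow> (('a \<Rightarrow> complex) \<Rightarrow> complex) \<Rightarrow> ennreal" where
  "mod_norm g p q s u =
     mixed_norm p q (\<lambda>x \<xi>. ennreal (v_weight s (x, \<xi>) * norm (stft g u x \<xi>)))"

definition mod_space ::
  "('a::euclidean_space \<Rightarrow> complex) \<Rightarrow> ennreal \<Rightarrow> ennreal \<Rightarrow> real \<Rightarrow> (('a \<Rightarrow> complex) \<Rightarrow> complex) set" where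
  "mod_space g p q s = {u. tempered u \<and> mod_norm g p q s u < \<infinity>}"

end

theory Submission
  imports Defs "HOL-Probability.Characteristic_Functions" "HOL-Probability.Sinc_Integral"
begin

text \<open>
A factorised operator \<open>Z = U X U\<^sup>-\<^sup>1\<close> is a Gaussian superposition of phase-space shifts, and both assertions are
read off from that formula. Write \<open>\<rho>(x, \<xi>)\<close> for the unitary operator taking \<open>f\<close> to
\<open>y \<mapsto> exp (2 \<pi> i \<xi> (y - x/2)) f (y - x)\<close>.

In dimension one, multiplication by \<open>exp (- \<pi> \<alpha> y\<^sup>2)\<close> is the average of the modulations by \<open>\<surd>\<alpha> a\<close> with respect
to \<open>exp (- \<pi> a\<^sup>2) da\<close>, since that Gaussian is its own Fourier transform. Likewise the Hermite operator of
angle \<open>\<theta>\<close> is \<open>1 / cosh (\<theta>/2)\<close> times the average of the shifts \<open>\<rho>(- r b, r a)\<close>, \<open>r\<^sup>2 = 2 tanh (\<theta>/2)\<close>, with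
respect to \<open>exp (- \<pi> (a\<^sup>2 + b\<^sup>2)) da db\<close>; this is Mehler's formula (\<open>shift_average_Hermite\<close>). Both averages
tensorise (\<open>tensor_op_gauss_form\<close>), and conjugation by a real metaplectic operator with projection \<open>V\<close> turns
\<open>\<rho>(z)\<close> into \<open>\<rho>(V z)\<close> exactly, without a phase factor (\<open>mp_projection_covariance\<close>). With
\<open>J (x, \<xi>) = (- \<xi>, x)\<close> and \<open>c\<close> the product of the \<open>1 / cosh (\<theta>\<^sub>j/2)\<close> this gives
(\<open>mp_factorization_gauss_form\<close>)
\<open>\<langle>Z f, g\<rangle> = c \<integral> exp (- \<pi> |w|\<^sup>2) \<langle>\<rho>(V J \<Sigma>\<^sup>1\<^sup>/\<^sup>2 w) f, g\<rangle> dw\<close>.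

The Weyl symbol. The matrix coefficient \<open>\<langle>\<rho>(\<zeta>) f, g\<rangle>\<close> is the Fourier transform of the Wigner distribution
(\<open>wigner_fourier\<close>), evaluated at a frequency which for \<open>\<zeta> = V J \<Sigma>\<^sup>1\<^sup>/\<^sup>2 w\<close> pairs with \<open>z\<close> to
\<open>w \<bullet> \<Sigma>\<^sup>1\<^sup>/\<^sup>2 V\<^sup>-\<^sup>1 z\<close>, because \<open>V\<close> is symplectic. The integral over \<open>w\<close> is then the Fourier transform of a
Gaussian and produces \<open>exp (- \<pi> |\<Sigma>\<^sup>1\<^sup>/\<^sup>2 V\<^sup>-\<^sup>1 z|\<^sup>2)\<close> (\<open>weyl_symbol\<close>). Integrability of the Wigner distribution of
Schwartz functions justifies Fubini.

Modulation spaces. A Gaussian average of Schwartz functions \<open>\<rho>(L w) \<phi>\<close>, \<open>L\<close> linear, is a Schwartz function, and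
tempered distributions commute with the average (\<open>tempered_gauss_average\<close>). Hence the formula for \<open>Z\<close> persists
on tempered distributions, and the modulus of the short-time Fourier transform of \<open>Z u\<close> is at most \<open>c\<close>
times the Gaussian average of the translates of that of \<open>u\<close> (\<open>stft_extend_op\<close>). Peetre's inequality
for the weight and Minkowski's integral inequality for the mixed norm
(\<open>v_weight_peetre\<close>, \<open>mixed_norm_translates\<close>) bound the norm of \<open>Z\<close> by
\<open>2\<^sup>s\<^sup>/\<^sup>2 c \<integral> exp (- \<pi> |w|\<^sup>2) v\<^sub>s(V J \<Sigma>\<^sup>1\<^sup>/\<^sup>2 w) dw\<close>. Finally \<open>V J \<Sigma>\<^sup>1\<^sup>/\<^sup>2\<close> is, up to a sign and multiplication by
\<open>J\<close>, the transpose of \<open>\<Sigma>\<^sup>1\<^sup>/\<^sup>2 V\<^sup>-\<^sup>1\<close>, so that \<open>|V J \<Sigma>\<^sup>1\<^sup>/\<^sup>2 w| \<le> \<sigma> |w|\<close> with \<open>\<sigma>\<close> the largest singular value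
(\<open>norm_shift_of_le\<close>), and \<open>v\<^sub>s(\<zeta>) \<le> (1 + \<sigma>\<^sup>2)\<^sup>s\<^sup>/\<^sup>2 v\<^sub>s(w)\<close> whenever \<open>|\<zeta>| \<le> \<sigma> |w|\<close>.
\<close>

abbreviation gauss :: "'a::real_normed_vector \<Rightarrow> real" where
  "gauss x \<equiv> exp (- pi * (norm x)\<^sup>2)"

section \<open>Lebesgue integrals on Euclidean spaces\<close>

lemmas integrable_dominated = Bochner_Integration.integrable_bound
  and lebesgue_cong = Bochner_Integration.integral_cong

lemma cnj_borel_measurable [measurable (raw)]:
  "f \<in> borel_measurable M \<Longrightarrow> (\<lambda>x. cnj (f x)) \<in> borel_measurable M"
  by (rule borel_measurable_continuous_on[where f=cnj]) (auto intro: continuous_intros)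

lemma cis_borel_measurable [measurable (raw)]:
  "f \<in> borel_measurable M \<Longrightarrow> (\<lambda>x. cis (f x)) \<in> borel_measurable M"
  by (rule borel_measurable_continuous_on[where f=cis]) (auto intro!: continuous_intros)

lemma affine_measurable:
  fixes t :: "'a::euclidean_space"
  shows "(\<lambda>x. t + c *\<^sub>R x) \<in> borel_measurable borel"
  by (intro borel_measurable_continuous_onI continuous_intros)

lemma nn_integral_lborel_affine:
  fixes t :: "'a::euclidean_space"
  assumes [measurable]: "f \<in> borel_measurable borel" and c: "c \<noteq> 0"
  shows "(\<integral>\<^sup>+x. f x \<partial>lborel) = ennreal (\<bar>c\<bar> ^ DIM('a)) * (\<integral>\<^sup>+x. f (t + c *\<^sub>R x) \<partial>lborel)"
proof -
  have [measurable]: "(\<lambda>x. t + c *\<^sub>R x) \<in> borel_measurable borel" by (rule affine_measurable)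
  show ?thesis
    by (subst lborel_affine[OF c, of t])
       (simp add: nn_integral_density nn_integral_distr nn_integral_cmult)
qed

lemma integrable_lborel_affine:
  fixes t :: "'a::euclidean_space" and f :: "'a \<Rightarrow> 'b::{banach, second_countable_topology}"
  assumes f: "integrable lborel f" and c: "c \<noteq> 0"
  shows "integrable lborel (\<lambda>x. f (t + c *\<^sub>R x))"
proof -
  have [measurable]: "f \<in> borel_measurable borel" "(\<lambda>x. t + c *\<^sub>R x) \<in> borel_measurable borel"
    using borel_measurable_integrable[OF f] affine_measurable by auto
  show ?thesis
    using f nn_integral_lborel_affine[OF _ c, of "\<lambda>x. ennreal (norm (f x))" t] c
    unfolding integrable_iff_bounded by (auto simp: ennreal_mult_less_top)
qed

lemma integral_lborel_affine:
  fixes t :: "'a::euclidean_space" and f :: "'a \<Rightarrow> 'b::{banach, second_countable_topology}"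
  assumes f: "f \<in> borel_measurable borel" and c: "c \<noteq> 0"
  shows "(LBINT x. f x) = \<bar>c\<bar> ^ DIM('a) *\<^sub>R (LBINT x. f (t + c *\<^sub>R x))"
proof -
  have [measurable]: "f \<in> borel_measurable borel" "(\<lambda>x. t + c *\<^sub>R x) \<in> borel_measurable borel"
    using f affine_measurable by auto
  show ?thesis
    by (subst lborel_affine[OF c, of t])
       (simp add: integral_density integral_distr)
qed

lemma integrable_translate_iff:
  fixes t :: "'a::euclidean_space" and f :: "'a \<Rightarrow> 'b::{banach, second_countable_topology}"
  shows "integrable lborel (\<lambda>x. f (x + t)) \<longleftrightarrow> integrable lborel f"
  using integrable_lborel_affine[of f 1 t] integrable_lborel_affine[of "\<lambda>x. f (x + t)" 1 "-t"]
  by (auto simp: add.commute)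

lemma integral_translate:
  fixes t :: "'a::euclidean_space" and f :: "'a \<Rightarrow> 'b::{banach, second_countable_topology}"
  shows "(LBINT x. f (x + t)) = (LBINT x. f x)"
proof (cases "integrable lborel f")
  case True
  then show ?thesis
    using integral_lborel_affine[of f 1 t] borel_measurable_integrable[OF True] by (simp add: add.commute)
next
  case False
  then show ?thesis by (simp add: not_integrable_integral_eq integrable_translate_iff)
qed

lemma integral_reflect:
  fixes f :: "'a::euclidean_space \<Rightarrow> 'b::{banach, second_countable_topology}"
  shows "(LBINT x. f (- x)) = (LBINT x. f x)"
proof (cases "f \<in> borel_measurable borel")
  case True
  then show ?thesis using integral_lborel_affine[of f "-1" 0] by simp
next
  case False
  then have "f \<notin> borel_measurable lborel" by simp
  moreover have "(\<lambda>x. f (- x)) \<notin> borel_measurable lborel"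
    using False measurable_compose[of uminus borel borel "\<lambda>x. f (- x)" borel] by auto
  ultimately have "\<not> integrable lborel f" "\<not> integrable lborel (\<lambda>x. f (- x))"
    using borel_measurable_integrable by blast+
  then show ?thesis by (simp add: not_integrable_integral_eq)
qed

lemma nn_integral_translate:
  fixes t :: "'a::euclidean_space"
  assumes "f \<in> borel_measurable borel"
  shows "(\<integral>\<^sup>+x. f (x + t) \<partial>lborel) = (\<integral>\<^sup>+x. f x \<partial>lborel)"
  using nn_integral_lborel_affine[OF assms, of 1 t] by (simp add: add.commute)

lemma AE_translate:
  fixes t :: "'a::euclidean_space"
  assumes "AE x in lborel. P x"
  shows "AE x in lborel. P (x + t)"
proof -
  from assms obtain N where N: "N \<in> null_sets lborel" "{x. \<not> P x} \<subseteq> N"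
    by (auto simp: eventually_ae_filter)
  have [measurable]: "N \<in> sets borel" using N by (auto dest: null_setsD2)
  have "(\<integral>\<^sup>+x. indicator N (x + t) \<partial>lborel) = emeasure lborel N"
    by (subst nn_integral_translate) auto
  then have "(\<integral>\<^sup>+x. indicator N (x + t) \<partial>lborel) = 0" using N by auto
  then have "AE x in lborel. indicator N (x + t) = (0::ennreal)"
    by (subst (asm) nn_integral_0_iff_AE) auto
  then show ?thesis
    by eventually_elim (use N in \<open>auto split: split_indicator_asm\<close>)
qed

lemma lborel_prod_integral:
  fixes f :: "'a::euclidean_space \<Rightarrow> real \<Rightarrow> 'c::{real_normed_field,banach,second_countable_topology}"
  assumes f: "\<And>b. b \<in> Basis \<Longrightarrow> integrable lborel (f b)"
  shows "integrable lborel (\<lambda>x::'a. \<Prod>b\<in>Basis. f b (x \<bullet> b))" (is ?A)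
    and "(\<integral>x. (\<Prod>b\<in>Basis. f b (x \<bullet> b)) \<partial>(lborel :: 'a measure)) = (\<Prod>b\<in>Basis. LBINT x. f b x)" (is ?B)
proof -
  interpret P: product_sigma_finite "\<lambda>_::'a. lborel :: real measure" ..
  have fm: "f b \<in> borel_measurable borel" if "b \<in> Basis" for b
    using borel_measurable_integrable[OF f[OF that]] by simp
  have [measurable]: "(\<lambda>f. \<Sum>b\<in>Basis. f b *\<^sub>R b) \<in> (\<Pi>\<^sub>M b\<in>(Basis::'a set). lborel) \<rightarrow>\<^sub>M borel"
    by measurable
  have [measurable]: "(\<lambda>x::'a. \<Prod>b\<in>Basis. f b (x \<bullet> b)) \<in> borel_measurable borel"
  proof (rule borel_measurable_prod)
    fix b :: 'a assume b: "b \<in> Basis"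
    show "(\<lambda>x. f b (x \<bullet> b)) \<in> borel_measurable borel"
      by (rule measurable_compose[OF _ fm[OF b]]) simp
  qed
  have eq: "(\<Prod>b\<in>Basis. f b ((\<Sum>b\<in>Basis. g b *\<^sub>R b) \<bullet> b)) = (\<Prod>b\<in>Basis. f b (g b))" for g :: "'a \<Rightarrow> real"
    by (intro prod.cong) auto
  let ?h = "\<lambda>f. \<Sum>b\<in>(Basis::'a set). f b *\<^sub>R b"
  have h: "?h \<in> (\<Pi>\<^sub>M b\<in>(Basis::'a set). lborel) \<rightarrow>\<^sub>M borel" by measurable
  have F: "(\<lambda>x::'a. \<Prod>b\<in>Basis. f b (x \<bullet> b)) \<in> borel_measurable borel" by measurable
  have "integrable (\<Pi>\<^sub>M b\<in>(Basis::'a set). lborel) (\<lambda>g. \<Prod>b\<in>Basis. f b (g b))"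
    by (rule P.product_integrable_prod) (auto simp: f)
  then show ?A
    unfolding lborel_eq[where 'a='a] integrable_distr_eq[OF h F] eq .
  have "(\<integral>x. (\<Prod>b\<in>Basis. f b (x \<bullet> b)) \<partial>(lborel :: 'a measure)) =
     (\<integral>g. (\<Prod>b\<in>Basis. f b (g b)) \<partial>(\<Pi>\<^sub>M b\<in>(Basis::'a set). lborel))"
    unfolding lborel_eq[where 'a='a] integral_distr[OF h F] eq ..
  also have "\<dots> = (\<Prod>b\<in>Basis. LBINT x. f b x)"
    by (rule P.product_integral_prod) (auto simp: f)
  finally show ?B .
qed

section \<open>Gaussians\<close>

text \<open>The characteristic function of the standard normal distribution, after rescaling by \<open>\<surd>(2\<pi>)\<close>.\<close>

lemma gaussian_fourier_real:
  shows "integrable lborel (\<lambda>x::real. exp (- pi * x\<^sup>2))"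
    and "(LBINT x. complex_of_real (exp (- pi * x\<^sup>2)) * cis (2 * pi * (x * z))) =
      complex_of_real (exp (- pi * z\<^sup>2))"
proof -
  define c where "c = sqrt (2 * pi)"
  have c: "c \<noteq> 0" "c > 0" "c\<^sup>2 = 2 * pi" by (auto simp: c_def)
  have sc: "std_normal_density (0 + c * x) = exp (- pi * x\<^sup>2) / c" for x
    by (simp add: std_normal_density_def c_def power_mult_distrib)
  have "integrable lborel (\<lambda>x. std_normal_density (0 + c * x))"
    by (rule lborel_integrable_real_affine) (use c in auto)
  then have "integrable lborel (\<lambda>x. c * std_normal_density (0 + c * x))" by simp
  then show i: "integrable lborel (\<lambda>x::real. exp (- pi * x\<^sup>2))"
    unfolding sc using c by simp
  define t where "t = c * z"
  have "char std_normal_distribution t = complex_of_real (exp (- (t\<^sup>2) / 2))"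
    by (simp add: char_std_normal_distribution)
  also have "- (t\<^sup>2) / 2 = - pi * z\<^sup>2" by (simp add: t_def power_mult_distrib c)
  finally have "complex_of_real (exp (- pi * z\<^sup>2)) = char std_normal_distribution t" by simp
  also have "\<dots> = (LBINT x. std_normal_density x *\<^sub>R iexp (t * x))"
    unfolding char_def by (subst integral_density) auto
  also have "\<dots> = \<bar>c\<bar> *\<^sub>R (LBINT x. std_normal_density (0 + c * x) *\<^sub>R iexp (t * (0 + c * x)))"
    by (rule lborel_integral_real_affine) (rule c)
  also have "\<dots> = (LBINT x. c *\<^sub>R (std_normal_density (0 + c * x) *\<^sub>R iexp (t * (0 + c * x))))"
    using c by (simp only: integral_scaleR_right) simp
  also have "\<dots> = (LBINT x. complex_of_real (exp (- pi * x\<^sup>2)) * cis (2 * pi * (x * z)))"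
  proof (rule lebesgue_cong[OF refl])
    fix x
    have "t * (0 + c * x) = 2 * pi * (x * z)" using c(3) by (simp add: t_def power2_eq_square)
    then show "c *\<^sub>R (std_normal_density (0 + c * x) *\<^sub>R iexp (t * (0 + c * x))) =
       complex_of_real (exp (- pi * x\<^sup>2)) * cis (2 * pi * (x * z))"
      unfolding sc using c by (simp only: cis_conv_exp) (simp add: scaleR_conv_of_real mult_ac)
  qed
  finally show "(LBINT x. complex_of_real (exp (- pi * x\<^sup>2)) * cis (2 * pi * (x * z))) =
      complex_of_real (exp (- pi * z\<^sup>2))" by simp
qed

lemma norm_power2_Basis: "(norm (x::'a::euclidean_space))\<^sup>2 = (\<Sum>b\<in>Basis. (x \<bullet> b)\<^sup>2)"
  unfolding power2_norm_eq_inner by (subst euclidean_inner) (simp add: power2_eq_square)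

lemma cis_sum: "finite A \<Longrightarrow> cis (\<Sum>a\<in>A. f a) = (\<Prod>a\<in>A. cis (f a))"
  by (induction A rule: finite_induct) (auto simp flip: cis_mult)

lemma gaussian_integrable: "integrable lborel (\<lambda>x::'a::euclidean_space. gauss x)"
  using lborel_prod_integral(1)[of "\<lambda>(b::'a) x. exp (- pi * x\<^sup>2) :: real"] gaussian_fourier_real(1)
  by (simp add: norm_power2_Basis sum_distrib_left exp_sum flip: sum_negf)

lemma gaussian_fourier:
  "(LBINT x. complex_of_real (gauss x) * cis (2 * pi * (x \<bullet> z))) =
      complex_of_real (exp (- pi * (norm (z::'a::euclidean_space))\<^sup>2))"
proof -
  have i: "integrable lborel (\<lambda>x. complex_of_real (exp (- pi * x\<^sup>2)) * cis (2 * pi * (x * c)))" for c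
    by (rule integrable_dominated[OF gaussian_fourier_real(1)]) (auto simp: norm_mult)
  have "(LBINT x. complex_of_real (gauss x) * cis (2 * pi * (x \<bullet> z))) =
    (LBINT x. (\<Prod>b\<in>Basis. complex_of_real (exp (- pi * (x \<bullet> b)\<^sup>2)) * cis (2 * pi * ((x \<bullet> b) * (z \<bullet> b)))))"
    by (simp add: norm_power2_Basis euclidean_inner[of _ z] sum_distrib_left exp_sum cis_sum prod.distrib flip: sum_negf)
  also have "\<dots> = (\<Prod>b\<in>Basis. complex_of_real (exp (- pi * (z \<bullet> b)\<^sup>2)))"
    by (subst lborel_prod_integral(2)[OF i]) (simp only: gaussian_fourier_real(2))
  also have "\<dots> = complex_of_real (gauss z)"
    by (simp add: norm_power2_Basis sum_distrib_left exp_sum flip: sum_negf)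
  finally show ?thesis .
qed

lemma gaussian_integral: "(\<integral>x. gauss x \<partial>(lborel :: 'a::euclidean_space measure)) = 1"
proof -
  have "complex_of_real (\<integral>x. gauss x \<partial>(lborel :: 'a measure)) = 1"
    using gaussian_fourier[of "0::'a"] by (simp flip: integral_complex_of_real)
  then show ?thesis by simp
qed

section \<open>The Hilbert space of square-integrable functions\<close>

lemma square_integrable_rep_L2 [simp]: "square_integrable (rep_L2 f)"
  using Quotient_rep_reflp[OF Quotient_L2, of f] by simp

lemma abs_rep_L2 [simp]: "abs_L2 (rep_L2 f) = f"
  by (rule Quotient_abs_rep[OF Quotient_L2])

lemma rep_abs_L2: "square_integrable f \<Longrightarrow> AE x in lborel. rep_L2 (abs_L2 f) x = f x"
  using Quotient_rep_abs[OF Quotient_L2, of f] by auto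

lemma abs_L2_eqI:
  "square_integrable f \<Longrightarrow> square_integrable g \<Longrightarrow> AE x in lborel. f x = g x \<Longrightarrow> abs_L2 f = abs_L2 g"
  by (rule Quotient_rel_abs[OF Quotient_L2]) auto

lemma abs_L2_eqD:
  assumes "square_integrable f" "square_integrable g" "abs_L2 f = abs_L2 g"
  shows "AE x in lborel. f x = g x"
  using rep_abs_L2[OF assms(1)] rep_abs_L2[OF assms(2)] assms(3) by auto

lemma square_integrable_measurable: "square_integrable f \<Longrightarrow> f \<in> borel_measurable borel"
  by (simp add: square_integrable_def)

lemma rep_L2_measurable [measurable]: "rep_L2 f \<in> borel_measurable borel"
  by (simp add: square_integrable_measurable)

lemma square_integrable_bound:
  assumes "square_integrable f" "g \<in> borel_measurable borel" "\<And>x. norm (g x) \<le> norm (f x)"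
  shows "square_integrable g"
  unfolding square_integrable_def
proof
  show "g \<in> borel_measurable lborel" using assms by simp
  have [measurable]: "g \<in> borel_measurable borel" using assms by simp
  show "integrable lborel (\<lambda>x. (norm (g x))\<^sup>2)"
    by (rule integrable_dominated[of _ "\<lambda>x. (norm (f x))\<^sup>2"])
       (use assms in \<open>auto simp: square_integrable_def intro!: power_mono\<close>)
qed

lemma cinner_abs: "square_integrable f \<Longrightarrow> square_integrable g \<Longrightarrow>
    cinner_L2 (abs_L2 f) (abs_L2 g) = (LBINT x. f x * cnj (g x))"
  by (rule cinner_L2.abs_eq) auto

lemma abs_L2_add: "square_integrable f \<Longrightarrow> square_integrable g \<Longrightarrow>
    abs_L2 f + abs_L2 g = abs_L2 (\<lambda>x. f x + g x)"
  by (rule plus_L2.abs_eq) auto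

lemma abs_L2_scale: "square_integrable f \<Longrightarrow> scaleC_L2 c (abs_L2 f) = abs_L2 (\<lambda>x. c * f x)"
  by (rule scaleC_L2.abs_eq) auto

lemma square_integrable_diff: "square_integrable f \<Longrightarrow> square_integrable g \<Longrightarrow>
    square_integrable (\<lambda>x. f x - g x)"
  using square_integrable_add[of f "\<lambda>x. - 1 * g x"] square_integrable_scale[of g "-1"] by simp

lemma uminus_L2_scaleC: "- f = scaleC_L2 (-1) (f :: 'a::euclidean_space L2)" by (simp add: uminus_L2_def)

lemma abs_L2_diff: "square_integrable f \<Longrightarrow> square_integrable g \<Longrightarrow>
    abs_L2 f - abs_L2 g = abs_L2 (\<lambda>x. f x - g x)"
  using square_integrable_scale[of g "-1"]
  by (simp add: minus_L2_def uminus_L2_scaleC abs_L2_scale abs_L2_add)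

lemma abs_L2_zero: "0 = abs_L2 (\<lambda>x. 0)" by (simp add: zero_L2_def)

lemma scaleR_scaleC_L2: "r *\<^sub>R f = scaleC_L2 (complex_of_real r) f" by (simp add: scaleR_L2_def)

lemma rep_add: "AE x in lborel. rep_L2 (f + g) x = rep_L2 f x + rep_L2 g x"
  using rep_abs_L2[OF square_integrable_add[of "rep_L2 f" "rep_L2 g"]] abs_L2_add[of "rep_L2 f" "rep_L2 g"] by simp

lemma rep_scale: "AE x in lborel. rep_L2 (scaleC_L2 c f) x = c * rep_L2 f x"
  using rep_abs_L2[OF square_integrable_scale[of "rep_L2 f" c]] abs_L2_scale[of "rep_L2 f" c] by simp

lemma scaleC_L2_simps:
  "scaleC_L2 c (f + g) = scaleC_L2 c f + scaleC_L2 c g"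
  "scaleC_L2 a (scaleC_L2 b f) = scaleC_L2 (a * b) f"
  "scaleC_L2 1 f = f"
  "scaleC_L2 c (f - g) = scaleC_L2 c f - scaleC_L2 c g"
  "scaleC_L2 0 f = 0"
proof -
  show add: "scaleC_L2 c (f + g) = scaleC_L2 c f + scaleC_L2 c g" for f g
    by transfer (auto intro!: square_integrable_add square_integrable_scale simp: distrib_left)
  show mult: "scaleC_L2 a (scaleC_L2 b f) = scaleC_L2 (a * b) f" for a b f
    by transfer (auto intro!: square_integrable_scale simp: mult.assoc)
  show "scaleC_L2 1 f = f" by transfer auto
  show "scaleC_L2 c (f - g) = scaleC_L2 c f - scaleC_L2 c g"
    by (simp add: minus_L2_def uminus_L2_scaleC add mult mult.commute)
  show "scaleC_L2 0 f = 0" by transfer (auto simp: square_integrable_zero)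
qed

lemma cinner_commute: "cinner_L2 f g = cnj (cinner_L2 g f)"
  by transfer (simp add: mult.commute flip: Bochner_Integration.integral_cnj)

lemma cinner_add_left: "cinner_L2 (f + g) h = cinner_L2 f h + cinner_L2 g h"
  by transfer (simp add: distrib_right square_integrable_prod)

lemma cinner_scale_left: "cinner_L2 (scaleC_L2 c f) h = c * cinner_L2 f h"
  by transfer (simp add: mult.assoc)

lemma cinner_diff_left: "cinner_L2 (f - g) h = cinner_L2 f h - cinner_L2 g h"
  by (simp add: minus_L2_def uminus_L2_scaleC cinner_add_left cinner_scale_left)

lemma cinner_add_right: "cinner_L2 h (f + g) = cinner_L2 h f + cinner_L2 h g"
  by (metis cinner_commute cinner_add_left complex_cnj_add)

lemma cinner_scale_right: "cinner_L2 h (scaleC_L2 c f) = cnj c * cinner_L2 h f"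
  by (metis cinner_commute cinner_scale_left complex_cnj_mult)

lemma cinner_diff_right: "cinner_L2 h (f - g) = cinner_L2 h f - cinner_L2 h g"
  by (metis cinner_commute cinner_diff_left complex_cnj_diff)

lemma cinner_self: "cinner_L2 f f = complex_of_real ((norm f)\<^sup>2)"
proof -
  have "cinner_L2 f f = (LBINT x. complex_of_real ((norm (rep_L2 f x))\<^sup>2))"
    by (simp only: cinner_L2.rep_eq complex_norm_square)
  then have "Im (cinner_L2 f f) = 0" by (simp only: integral_complex_of_real Im_complex_of_real)
  moreover have "Re (cinner_L2 f f) = (norm f)\<^sup>2"
    by (simp add: power2_norm_eq_inner inner_L2_def)
  ultimately show ?thesis by (simp add: complex_eq_iff)
qed

lemma norm_L2_square: "(norm f)\<^sup>2 = (LBINT x. (norm (rep_L2 f x))\<^sup>2)"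
proof -
  have "complex_of_real ((norm f)\<^sup>2) = (LBINT x. complex_of_real ((norm (rep_L2 f x))\<^sup>2))"
    unfolding cinner_self[symmetric] by (simp only: cinner_L2.rep_eq complex_norm_square)
  then show ?thesis by (simp only: integral_complex_of_real of_real_eq_iff)
qed

lemma norm_abs_L2: "square_integrable f \<Longrightarrow> (norm (abs_L2 f))\<^sup>2 = (LBINT x. (norm (f x))\<^sup>2)"
  unfolding norm_L2_square
  by (rule integral_cong_AE) (use rep_abs_L2[of f] in \<open>auto simp: square_integrable_def\<close>)

lemma norm_scaleC_L2 [simp]: "norm (scaleC_L2 c f) = cmod c * norm f"
proof -
  have "complex_of_real ((norm (scaleC_L2 c f))\<^sup>2) = complex_of_real ((cmod c * norm f)\<^sup>2)"
    unfolding cinner_self[symmetric] cinner_scale_left cinner_scale_right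
    by (simp add: cinner_self complex_norm_square power_mult_distrib del: of_real_power)
  then show ?thesis by (simp only: of_real_eq_iff power2_eq_iff_nonneg norm_ge_zero mult_nonneg_nonneg)
qed

lemma cinner_Cauchy_Schwarz: "cmod (cinner_L2 f g) \<le> norm f * norm g"
proof (cases "cinner_L2 f g = 0")
  case False
  define c where "c = cnj (cinner_L2 f g) / cmod (cinner_L2 f g)"
  have "cmod c = 1" using False by (simp add: c_def norm_divide)
  have "cinner_L2 (scaleC_L2 c f) g = complex_of_real (cmod (cinner_L2 f g))"
    using False unfolding cinner_scale_left c_def
    by (simp add: complex_norm_square[symmetric] power2_eq_square field_simps)
  then have "cmod (cinner_L2 f g) = inner (scaleC_L2 c f) g" by (simp add: inner_L2_def)
  also have "\<dots> \<le> norm (scaleC_L2 c f) * norm g" by (rule norm_cauchy_schwarz)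
  finally show ?thesis using \<open>cmod c = 1\<close> by simp
qed auto

lemma cinner_eqI: "(\<And>h. cinner_L2 f h = cinner_L2 g h) \<Longrightarrow> f = g"
  by (metis cinner_diff_left cinner_self eq_iff_diff_eq_0 norm_eq_zero of_real_eq_0_iff power_eq_0_iff)

lemma tendsto_cinner:
  fixes a b :: "'a::euclidean_space L2"
  assumes "(f \<longlongrightarrow> a) F" "(g \<longlongrightarrow> b) F"
  shows "((\<lambda>x. cinner_L2 (f x) (g x)) \<longlongrightarrow> cinner_L2 a b) F"
proof -
  have "bounded_bilinear (cinner_L2 :: 'a L2 \<Rightarrow> _)"
    by standard
      (auto simp: cinner_add_left cinner_add_right scaleR_scaleC_L2 cinner_scale_left cinner_scale_right
         scaleR_conv_of_real intro!: exI[of _ 1] cinner_Cauchy_Schwarz)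
  from bounded_bilinear.tendsto[OF this assms] show ?thesis .
qed

lemma Cauchy_Schwarz_norm_integral:
  assumes f: "square_integrable f" and g: "square_integrable g"
  shows "(LBINT x. norm (f x) * norm (g x)) \<le> norm (abs_L2 f) * norm (abs_L2 g)"
proof -
  have [measurable]: "f \<in> borel_measurable borel" "g \<in> borel_measurable borel"
    using f g by (auto dest: square_integrable_measurable)
  have f': "square_integrable (\<lambda>x. complex_of_real (norm (f x)))"
    by (rule square_integrable_bound[OF f]) auto
  have g': "square_integrable (\<lambda>x. complex_of_real (norm (g x)))"
    by (rule square_integrable_bound[OF g]) auto
  have "(norm (abs_L2 (\<lambda>x. complex_of_real (norm (f x)))))\<^sup>2 = (norm (abs_L2 f))\<^sup>2"
    "(norm (abs_L2 (\<lambda>x. complex_of_real (norm (g x)))))\<^sup>2 = (norm (abs_L2 g))\<^sup>2"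
    by (simp_all add: norm_abs_L2 f g f' g')
  then have n: "norm (abs_L2 (\<lambda>x. complex_of_real (norm (f x)))) = norm (abs_L2 f)"
    "norm (abs_L2 (\<lambda>x. complex_of_real (norm (g x)))) = norm (abs_L2 g)"
    by simp_all
  have "complex_of_real (LBINT x. norm (f x) * norm (g x)) =
    cinner_L2 (abs_L2 (\<lambda>x. complex_of_real (norm (f x)))) (abs_L2 (\<lambda>x. complex_of_real (norm (g x))))"
    by (simp add: cinner_abs f' g' flip: integral_complex_of_real)
  then have "norm (complex_of_real (LBINT x. norm (f x) * norm (g x))) \<le> norm (abs_L2 f) * norm (abs_L2 g)"
    using cinner_Cauchy_Schwarz[of "abs_L2 (\<lambda>x. complex_of_real (norm (f x)))" "abs_L2 (\<lambda>x. complex_of_real (norm (g x)))"]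
    by (simp only: n)
  then show ?thesis by (simp only: norm_of_real)
qed

lemma square_integrable_nn:
  "square_integrable f \<longleftrightarrow> f \<in> borel_measurable borel \<and> (\<integral>\<^sup>+x. ennreal ((norm (f x))\<^sup>2) \<partial>lborel) < \<infinity>"
  by (auto simp: square_integrable_def integrable_iff_bounded)

lemma nn_norm_abs_L2:
  "square_integrable f \<Longrightarrow> (\<integral>\<^sup>+x. ennreal ((norm (f x))\<^sup>2) \<partial>lborel) = ennreal ((norm (abs_L2 f))\<^sup>2)"
  by (simp add: norm_abs_L2, rule nn_integral_eq_integral) (auto simp: square_integrable_def)

subsection \<open>Completeness\<close>

text \<open>Fatou's lemma identifies the limit in the proof of completeness and bounds its distance from the sequence.\<close>

lemma L2_Fatou:
  assumes sq: "\<And>i. square_integrable (f i)" and le: "\<And>i. norm (abs_L2 (f i)) \<le> e"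
    and lim: "AE x in lborel. (\<lambda>i. f i x) \<longlonglongrightarrow> g x" and g: "g \<in> borel_measurable borel"
  shows "square_integrable g" and "norm (abs_L2 g) \<le> e"
proof -
  have e: "e \<ge> 0" using le[of 0] norm_ge_zero order_trans by blast
  have [measurable]: "f i \<in> borel_measurable borel" for i
    using sq by (simp add: square_integrable_measurable)
  have [measurable]: "g \<in> borel_measurable borel" by (rule g)
  have "(\<integral>\<^sup>+x. ennreal ((norm (g x))\<^sup>2) \<partial>lborel) = (\<integral>\<^sup>+x. liminf (\<lambda>i. ennreal ((norm (f i x))\<^sup>2)) \<partial>lborel)"
  proof (rule nn_integral_cong_AE, use lim in eventually_elim)
    fix x assume "(\<lambda>i. f i x) \<longlonglongrightarrow> g x"
    then have "(\<lambda>i. ennreal ((norm (f i x))\<^sup>2)) \<longlonglongrightarrow> ennreal ((norm (g x))\<^sup>2)"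
      by (intro tendsto_intros)
    then show "ennreal ((norm (g x))\<^sup>2) = liminf (\<lambda>i. ennreal ((norm (f i x))\<^sup>2))"
      by (metis lim_imp_Liminf sequentially_bot)
  qed
  also have "\<dots> \<le> liminf (\<lambda>i. \<integral>\<^sup>+x. ennreal ((norm (f i x))\<^sup>2) \<partial>lborel)"
    by (rule nn_integral_liminf) measurable
  also have "\<dots> \<le> liminf (\<lambda>i::nat. ennreal (e\<^sup>2))"
    by (intro Liminf_mono always_eventually allI)
       (simp add: nn_norm_abs_L2 sq le ennreal_leI power_mono)
  also have "\<dots> = ennreal (e\<^sup>2)" by (simp add: Liminf_const)
  finally have *: "(\<integral>\<^sup>+x. ennreal ((norm (g x))\<^sup>2) \<partial>lborel) \<le> ennreal (e\<^sup>2)" .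
  show sg: "square_integrable g"
    using le_less_trans[OF *] g by (simp add: square_integrable_nn)
  have "(norm (abs_L2 g))\<^sup>2 \<le> e\<^sup>2"
    using * by (simp add: nn_norm_abs_L2[OF sg])
  then show "norm (abs_L2 g) \<le> e" using e power2_le_imp_le by blast
qed

lemma gaussian_square_integrable: "square_integrable (\<lambda>x::'a::euclidean_space. complex_of_real (gauss x))"
  unfolding square_integrable_def
proof
  show "integrable lborel (\<lambda>x::'a. (norm (complex_of_real (gauss x)))\<^sup>2)"
  proof (rule integrable_dominated[OF gaussian_integrable], measurable, rule AE_I2)
    fix x :: 'a
    have "gauss x \<le> 1" by simp
    then have "gauss x * gauss x \<le> 1 * gauss x"
      by (intro mult_right_mono) auto
    then show "norm ((norm (complex_of_real (gauss x)))\<^sup>2) \<le> norm (gauss x)"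
      by (simp add: power2_eq_square)
  qed
qed measurable

text \<open>Riesz-Fischer.  A Cauchy sequence in \<open>L\<^sup>2\<close> becomes Cauchy in \<open>L\<^sup>1\<close> after multiplication by a
  strictly positive \<open>L\<^sup>2\<close> function, so that a subsequence converges almost everywhere.\<close>

instance L2 :: (euclidean_space) banach
proof
  fix X :: "nat \<Rightarrow> 'a L2" assume X: "Cauchy X"
  define h where "h = (\<lambda>x::'a. complex_of_real (gauss x))"
  have h: "square_integrable h" unfolding h_def by (rule gaussian_square_integrable)
  have cnjh: "cnj (h x) = h x" and h0: "h x \<noteq> 0" for x by (auto simp: h_def)
  define s where "s = (\<lambda>n x. rep_L2 (X n) x * h x)"
  have si: "integrable lborel (s n)" for n
    using square_integrable_prod[OF square_integrable_rep_L2[of "X n"] h] by (simp add: s_def cnjh)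
  have sC: "\<exists>N. \<forall>i\<ge>N. \<forall>j\<ge>N. (LBINT x. norm (s i x - s j x)) < e" if e: "e > 0" for e
  proof -
    define c where "c = norm (abs_L2 h) + 1"
    have c: "c > 0" by (simp add: c_def add_pos_nonneg add.commute)
    from X e c obtain N where N: "\<And>i j. i \<ge> N \<Longrightarrow> j \<ge> N \<Longrightarrow> norm (X i - X j) < e / c"
      unfolding Cauchy_def dist_norm by (meson divide_pos_pos)
    have "(LBINT x. norm (s i x - s j x)) < e" if "i \<ge> N" "j \<ge> N" for i j
    proof -
      have "(LBINT x. norm (s i x - s j x)) = (LBINT x. norm (rep_L2 (X i) x - rep_L2 (X j) x) * norm (h x))"
        by (simp add: s_def norm_mult flip: left_diff_distrib)
      also have "\<dots> \<le> norm (abs_L2 (\<lambda>x. rep_L2 (X i) x - rep_L2 (X j) x)) * norm (abs_L2 h)"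
        by (intro Cauchy_Schwarz_norm_integral square_integrable_diff h) auto
      also have "\<dots> = norm (X i - X j) * norm (abs_L2 h)" by (simp flip: abs_L2_diff)
      also have "\<dots> \<le> norm (X i - X j) * c" by (simp add: c_def mult_left_mono)
      also have "\<dots> < e" using N[OF that] c by (simp add: field_simps)
      finally show ?thesis .
    qed
    then show ?thesis by blast
  qed
  obtain r where r: "strict_mono r" "AE x in lborel. Cauchy (\<lambda>i. s (r i) x)"
    using cauchy_L1_AE_cauchy_subseq[of lborel s] si sC by blast
  define f where "f = (\<lambda>x. lim (\<lambda>i. rep_L2 (X (r i)) x))"
  have f: "f \<in> borel_measurable borel" unfolding f_def by measurable
  have lim: "AE x in lborel. (\<lambda>i. rep_L2 (X (r i)) x) \<longlonglongrightarrow> f x"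
    using r(2)
  proof eventually_elim
    fix x assume "Cauchy (\<lambda>i. s (r i) x)"
    then have "convergent (\<lambda>i. s (r i) x)" by (simp add: Cauchy_convergent)
    then obtain l where "(\<lambda>i. s (r i) x) \<longlonglongrightarrow> l" by (auto simp: convergent_def)
    then have "(\<lambda>i. s (r i) x / h x) \<longlonglongrightarrow> l / h x" by (intro tendsto_intros h0)
    then have "convergent (\<lambda>i. rep_L2 (X (r i)) x)" by (auto simp: s_def h0 convergent_def)
    then show "(\<lambda>i. rep_L2 (X (r i)) x) \<longlonglongrightarrow> f x" by (simp add: f_def convergent_LIMSEQ_iff)
  qed
  have near: "\<exists>N. \<forall>n\<ge>N. square_integrable (\<lambda>x. rep_L2 (X n) x - f x) \<and>
      norm (abs_L2 (\<lambda>x. rep_L2 (X n) x - f x)) \<le> e" if e: "e > 0" for e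
  proof -
    from X e obtain N where N: "\<And>i j. i \<ge> N \<Longrightarrow> j \<ge> N \<Longrightarrow> norm (X i - X j) < e"
      unfolding Cauchy_def dist_norm by meson
    have "square_integrable (\<lambda>x. rep_L2 (X n) x - f x) \<and>
      norm (abs_L2 (\<lambda>x. rep_L2 (X n) x - f x)) \<le> e" if "n \<ge> N" for n
    proof -
      have 1: "square_integrable (\<lambda>x. rep_L2 (X n) x - rep_L2 (X (r (i + N))) x)" for i
        by (intro square_integrable_diff) auto
      have 2: "norm (abs_L2 (\<lambda>x. rep_L2 (X n) x - rep_L2 (X (r (i + N))) x)) \<le> e" for i
      proof -
        have "r (i + N) \<ge> N" using seq_suble[OF r(1), of "i + N"] by simp
        then show ?thesis using N[OF \<open>n \<ge> N\<close>, of "r (i + N)"] by (simp flip: abs_L2_diff)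
      qed
      have 3: "AE x in lborel. (\<lambda>i. rep_L2 (X n) x - rep_L2 (X (r (i + N))) x) \<longlonglongrightarrow> rep_L2 (X n) x - f x"
        using lim by eventually_elim (intro tendsto_intros LIMSEQ_ignore_initial_segment)
      have 4: "(\<lambda>x. rep_L2 (X n) x - f x) \<in> borel_measurable borel" using f by measurable
      show ?thesis using L2_Fatou[OF 1 2 3 4] by blast
    qed
    then show ?thesis by blast
  qed
  from near[of 1] obtain N where "square_integrable (\<lambda>x. rep_L2 (X N) x - f x)" by auto
  from square_integrable_diff[OF square_integrable_rep_L2[of "X N"] this] have sf: "square_integrable f" by simp
  have "X \<longlonglongrightarrow> abs_L2 f"
  proof (rule LIMSEQ_I)
    fix e :: real assume e: "e > 0"
    from near[of "e / 2"] e obtain N where N: "\<And>n. n \<ge> N \<Longrightarrow> norm (abs_L2 (\<lambda>x. rep_L2 (X n) x - f x)) \<le> e / 2" by auto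
    have "norm (X n - abs_L2 f) < e" if "n \<ge> N" for n
    proof -
      have "X n - abs_L2 f = abs_L2 (\<lambda>x. rep_L2 (X n) x - f x)"
        using abs_L2_diff[OF square_integrable_rep_L2[of "X n"] sf] by simp
      with N[OF that] e show ?thesis by simp
    qed
    then show "\<exists>no. \<forall>n\<ge>no. norm (X n - abs_L2 f) < e" by blast
  qed
  then show "convergent X" by (auto simp: convergent_def)
qed

lemma L2_dominated_convergence:
  assumes f: "\<And>i. f i \<in> borel_measurable borel" and g: "g \<in> borel_measurable borel"
    and h: "square_integrable h" and dom: "\<And>i x. norm (f i x) \<le> norm (h x)"
    and lim: "AE x in lborel. (\<lambda>i. f i x) \<longlonglongrightarrow> g x"
  shows "square_integrable g" and "(\<lambda>i. abs_L2 (f i)) \<longlonglongrightarrow> abs_L2 g"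
proof -
  have sf: "square_integrable (f i)" for i by (rule square_integrable_bound[OF h f dom])
  have [measurable]: "f i \<in> borel_measurable borel" "g \<in> borel_measurable borel" "h \<in> borel_measurable borel" for i
    using f g h by (auto simp: square_integrable_def)
  have gh: "AE x in lborel. norm (g x) \<le> norm (h x)"
    using lim
  proof eventually_elim
    fix x assume "(\<lambda>i. f i x) \<longlonglongrightarrow> g x"
    then have "(\<lambda>i. norm (f i x)) \<longlonglongrightarrow> norm (g x)" by (rule tendsto_norm)
    then show "norm (g x) \<le> norm (h x)" by (rule LIMSEQ_le_const2) (use dom in auto)
  qed
  have h2: "integrable lborel (\<lambda>x. (norm (h x))\<^sup>2)" using h by (simp add: square_integrable_def)
  show sg: "square_integrable g" unfolding square_integrable_def
  proof
    show "integrable lborel (\<lambda>x. (norm (g x))\<^sup>2)"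
      by (rule integrable_dominated[OF h2]) (use gh in \<open>auto intro: power_mono\<close>)
  qed simp
  have "(\<lambda>i. LBINT x. (norm (f i x - g x))\<^sup>2) \<longlonglongrightarrow> (\<integral>x. 0 \<partial>(lborel :: 'a measure))"
  proof (rule integral_dominated_convergence)
    show "integrable lborel (\<lambda>x. 4 * (norm (h x))\<^sup>2)" using h2 by simp
    show "AE x in lborel. (\<lambda>i. (norm (f i x - g x))\<^sup>2) \<longlonglongrightarrow> 0"
      using lim
    proof eventually_elim
      fix x assume "(\<lambda>i. f i x) \<longlonglongrightarrow> g x"
      then have "(\<lambda>i. (norm (f i x - g x))\<^sup>2) \<longlonglongrightarrow> (norm (g x - g x))\<^sup>2" by (intro tendsto_intros)
      then show "(\<lambda>i. (norm (f i x - g x))\<^sup>2) \<longlonglongrightarrow> 0" by simp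
    qed
    fix i
    show "AE x in lborel. norm ((norm (f i x - g x))\<^sup>2) \<le> 4 * (norm (h x))\<^sup>2"
      using gh
    proof eventually_elim
      fix x assume "norm (g x) \<le> norm (h x)"
      then have "norm (f i x - g x) \<le> 2 * norm (h x)"
        using norm_triangle_ineq4[of "f i x" "g x"] dom[of i x] by linarith
      then have "(norm (f i x - g x))\<^sup>2 \<le> (2 * norm (h x))\<^sup>2" by (intro power_mono) auto
      then show "norm ((norm (f i x - g x))\<^sup>2) \<le> 4 * (norm (h x))\<^sup>2" by (simp add: power_mult_distrib)
    qed
  qed auto
  then have "(\<lambda>i. (norm (abs_L2 (f i) - abs_L2 g))\<^sup>2) \<longlonglongrightarrow> 0"
    by (simp add: abs_L2_diff sf sg norm_abs_L2 square_integrable_diff)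
  from tendsto_real_sqrt[OF this] show "(\<lambda>i. abs_L2 (f i)) \<longlonglongrightarrow> abs_L2 g"
    by (subst tendsto_dist_iff) (simp add: dist_norm)
qed

subsection \<open>Density of box indicators\<close>

lemma square_integrable_indicator_box:
  assumes [measurable]: "A \<in> sets borel" and sub: "A \<subseteq> box a (b::'a::euclidean_space)"
  shows "square_integrable (indicator A :: 'a \<Rightarrow> complex)"
  unfolding square_integrable_def
proof
  have fin: "emeasure lborel A < \<infinity>"
    using emeasure_mono[OF sub, of lborel] emeasure_lborel_box_finite[of a b] by (simp add: le_less_trans)
  have "integrable lborel (indicator A :: 'a \<Rightarrow> real)"
    using fin by (subst integrable_indicator_iff) auto
  moreover have "(\<lambda>x. (norm (indicator A x :: complex))\<^sup>2) = (indicator A :: 'a \<Rightarrow> real)"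
    by (auto split: split_indicator)
  ultimately show "integrable lborel (\<lambda>x. (norm (indicator A x :: complex))\<^sup>2)" by simp
qed simp

definition cube :: "nat \<Rightarrow> 'a::euclidean_space set" where
  "cube n = box (- (real n *\<^sub>R One)) (real n *\<^sub>R One)"

lemma cube_borel [measurable]: "cube n \<in> sets borel"
  by (simp add: cube_def)

lemma eventually_mem_cube: "eventually (\<lambda>n. x \<in> cube n) sequentially"
proof -
  obtain n where n: "x \<in> cube n"
    using UN_box_eq_UNIV[where 'a='a] unfolding cube_def by blast
  have "x \<in> cube m" if "m \<ge> n" for m
    unfolding cube_def mem_box
  proof
    fix i :: 'a assume i: "i \<in> Basis"
    have "real n \<le> real m" using that by simp
    then show "- (real m *\<^sub>R One) \<bullet> i < x \<bullet> i \<and> x \<bullet> i < (real m *\<^sub>R One) \<bullet> i"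
      using n i by (auto simp: cube_def mem_box)
  qed
  then show ?thesis using eventually_sequentially by blast
qed

text \<open>Properties closed under linear combinations and limits hold on all of \<open>L\<^sup>2\<close> once they hold for boxes: the Borel
  sets whose truncations to cubes have the property form a Dynkin system containing the intersection-stable
  generator of boxes, and simple functions approximate.\<close>

lemma L2_induct [case_names box add scale lim]:
  fixes f :: "'a::euclidean_space L2"
  assumes box: "\<And>a b. P (abs_L2 (indicator (box a b)))"
    and add: "\<And>f g. P f \<Longrightarrow> P g \<Longrightarrow> P (f + g)"
    and scale: "\<And>c f. P f \<Longrightarrow> P (scaleC_L2 c f)"
    and lim: "\<And>X f. (\<And>n. P (X n)) \<Longrightarrow> X \<longlonglongrightarrow> f \<Longrightarrow> P f"
  shows "P f"
proof -
  have zero: "P 0" using scale[OF box, of 0] by (simp add: scaleC_L2_simps)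
  have sq: "square_integrable (indicator (A \<inter> cube k) :: 'a \<Rightarrow> complex)" if "A \<in> sets borel" for A k
    by (rule square_integrable_indicator_box[of _ "- (real k *\<^sub>R One)" "real k *\<^sub>R One"])
       (use that in \<open>auto simp: cube_def\<close>)
  have ind: "P (abs_L2 (indicator (A \<inter> cube k)))" if A: "A \<in> sets borel" for A k
  proof -
    have "Int_stable (range (\<lambda>(a, b). box a b :: 'a set))"
      by (auto simp: Int_stable_def box_Int_box)
    moreover have "range (\<lambda>(a, b). box a b :: 'a set) \<subseteq> Pow UNIV" by simp
    moreover have "A \<in> sigma_sets UNIV (range (\<lambda>(a, b). box a b))"
      using A by (simp add: borel_eq_box)
    ultimately show ?thesis
    proof (induction rule: sigma_sets_induct_disjoint)
      case (basic A)
      then show ?case using box by (auto simp: cube_def box_Int_box)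
    next
      case empty
      then show ?case using zero by (simp add: abs_L2_zero indicator_def)
    next
      case (compl A)
      have [measurable]: "A \<in> sets borel" using compl(1) by (simp add: borel_eq_box)
      have "abs_L2 (indicator ((UNIV - A) \<inter> cube k)) =
        abs_L2 (indicator (UNIV \<inter> cube k)) + scaleC_L2 (-1) (abs_L2 (indicator (A \<inter> cube k)))"
        by (subst abs_L2_scale, simp add: sq, subst abs_L2_add)
           (auto simp: sq intro!: sq[of UNIV, simplified] square_integrable_scale[of _ "-1", simplified] arg_cong[of _ _ abs_L2] split: split_indicator)
      moreover have "P (abs_L2 (indicator (UNIV \<inter> cube k)))" using box by (simp add: cube_def)
      ultimately show ?case using compl add scale by metis
    next
      case (union A)
      have Am [measurable]: "A i \<in> sets borel" for i using union(2) by (auto simp: borel_eq_box)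
      define S where "S = (\<lambda>n x. \<Sum>i<n. indicator (A i \<inter> cube k) x :: complex)"
      have Ssq: "square_integrable (S n)" for n
        unfolding S_def by (induction n) (simp_all add: square_integrable_add square_integrable_zero sq Am)
      have PS: "P (abs_L2 (S n))" for n
      proof (induction n)
        case 0
        then show ?case using zero by (simp add: S_def abs_L2_zero)
      next
        case (Suc n)
        have "abs_L2 (S (Suc n)) = abs_L2 (S n) + abs_L2 (indicator (A n \<inter> cube k))"
          using Ssq[of n] by (subst abs_L2_add) (auto simp: sq Am S_def)
        then show ?case using Suc union(3) add by metis
      qed
      have Seq: "S n x = indicator ((\<Union>i<n. A i) \<inter> cube k) x" for n x
      proof -
        have "disjoint_family_on A {..<n}" using union(1) by (rule disjoint_family_on_mono[rotated]) simp
        then have "indicator (\<Union>i<n. A i) x = (\<Sum>i<n. indicator (A i) x :: complex)"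
          by (intro indicator_UN_disjoint) auto
        then show ?thesis by (simp add: S_def indicator_inter_arith sum_distrib_right)
      qed
      have "(\<lambda>n. abs_L2 (S n)) \<longlonglongrightarrow> abs_L2 (indicator ((\<Union>i. A i) \<inter> cube k))"
      proof (rule L2_dominated_convergence(2)[where h="indicator (UNIV \<inter> cube k)"])
        show "norm (S i x) \<le> norm (indicator (UNIV \<inter> cube k) x :: complex)" for i x
          unfolding Seq by (auto split: split_indicator)
        have "(\<lambda>i. S i x) \<longlonglongrightarrow> indicator ((\<Union>i. A i) \<inter> cube k) x" for x
        proof (rule tendsto_eventually)
          show "eventually (\<lambda>i. S i x = indicator ((\<Union>i. A i) \<inter> cube k) x) sequentially"
          proof (cases "\<exists>j. x \<in> A j")
            case True
            then obtain j where "x \<in> A j" by blast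
            have "S i x = indicator ((\<Union>i. A i) \<inter> cube k) x" if "i \<ge> Suc j" for i
              using \<open>x \<in> A j\<close> that unfolding Seq by (auto split: split_indicator intro: exI[of _ j])
            then show ?thesis using eventually_sequentially by blast
          qed (auto simp: Seq)
        qed
        then show "AE x in lborel. (\<lambda>i. S i x) \<longlonglongrightarrow> indicator ((\<Union>i. A i) \<inter> cube k) x" by simp
      qed (use sq[of UNIV k] Ssq in \<open>auto dest: square_integrable_measurable\<close>)
      with PS show ?case by (rule lim)
    qed
  qed
  obtain s where s: "\<And>i. simple_function lborel (s i)" "\<And>x. (\<lambda>i. s i x) \<longlonglongrightarrow> rep_L2 f x"
    "\<And>i x. norm (s i x) \<le> 2 * norm (rep_L2 f x)"
    using borel_measurable_implies_sequence_metric[of "rep_L2 f" lborel 0] by auto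
  define g where "g = (\<lambda>i x. indicator (cube i) x * s i x)"
  have sm [measurable]: "s i \<in> borel_measurable borel" for i
    using s(1)[of i] borel_measurable_simple_function by fastforce
  have "P (abs_L2 (g i))" for i
  proof -
    have fin: "finite (range (s i))" using s(1)[of i] by (simp add: simple_function_def)
    have vm: "s i -` {c} \<in> sets borel" for c using measurable_sets[OF sm[of i], of "{c}"] by simp
    define J where "J = (\<lambda>c. indicator (s i -` {c} \<inter> cube i) :: 'a \<Rightarrow> complex)"
    have J: "square_integrable (J c)" "P (abs_L2 (J c))" for c
      unfolding J_def by (auto intro: sq ind vm)
    have "square_integrable (\<lambda>x. \<Sum>c\<in>C. c * J c x) \<and> P (abs_L2 (\<lambda>x. \<Sum>c\<in>C. c * J c x))" if "finite C" for C
      using that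
    proof (induction C)
      case empty
      then show ?case using zero by (simp add: abs_L2_zero square_integrable_zero)
    next
      case (insert c C)
      then have "abs_L2 (\<lambda>x. \<Sum>c\<in>insert c C. c * J c x) =
        scaleC_L2 c (abs_L2 (J c)) + abs_L2 (\<lambda>x. \<Sum>c\<in>C. c * J c x)"
        by (simp add: abs_L2_scale abs_L2_add square_integrable_scale J)
      with insert show ?case using J add scale
        by (simp add: square_integrable_scale square_integrable_add)
    qed
    moreover have "g i = (\<lambda>x. \<Sum>c\<in>range (s i). c * J c x)"
    proof
      fix x
      have "(\<Sum>c\<in>range (s i). c * J c x) =
        (\<Sum>c\<in>range (s i). if c = s i x then c * indicator (cube i) x else 0)"
        by (intro sum.cong) (auto simp: J_def split: split_indicator)
      also have "\<dots> = s i x * indicator (cube i) x" using fin by simp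
      finally show "g i x = (\<Sum>c\<in>range (s i). c * J c x)"
        by (simp add: g_def mult.commute)
    qed
    ultimately show ?thesis using fin by simp
  qed
  moreover have "(\<lambda>i. abs_L2 (g i)) \<longlonglongrightarrow> abs_L2 (rep_L2 f)"
  proof (rule L2_dominated_convergence(2)[where h="\<lambda>x. 2 * rep_L2 f x"])
    show "norm (g i x) \<le> norm (2 * rep_L2 f x)" for i x
      using s(3)[of i x] by (auto simp: g_def norm_mult split: split_indicator)
    have "(\<lambda>i. g i x) \<longlonglongrightarrow> rep_L2 f x" for x
    proof (rule Lim_transform_eventually[OF s(2)])
      show "eventually (\<lambda>i. s i x = g i x) sequentially"
        using eventually_mem_cube[of x] by eventually_elim (simp add: g_def)
    qed
    then show "AE x in lborel. (\<lambda>i. g i x) \<longlonglongrightarrow> rep_L2 f x" by simp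
    show "g i \<in> borel_measurable borel" for i unfolding g_def by measurable
  qed (auto intro: square_integrable_scale)
  ultimately have "P (abs_L2 (rep_L2 f))" by (rule lim)
  then show ?thesis by simp
qed

section \<open>Phase-space shifts\<close>

text \<open>The time-frequency shift with its phase taken at the midpoint \<open>x/2\<close>. This symmetric normalisation is what makes
  the covariance under metaplectic operators hold without a phase factor.\<close>

definition heis :: "'a::euclidean_space \<Rightarrow> 'a \<Rightarrow> ('a \<Rightarrow> complex) \<Rightarrow> 'a \<Rightarrow> complex" where
  "heis x \<xi> f y = cis (2 * pi * (\<xi> \<bullet> (y - x /\<^sub>R 2))) * f (y - x)"

lemma heis_measurable [measurable (raw)]:
  "f \<in> borel_measurable borel \<Longrightarrow> heis x \<xi> f \<in> borel_measurable borel"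
  unfolding heis_def[abs_def]
  by (intro borel_measurable_times cis_borel_measurable measurable_compose[of "\<lambda>y. y - x" borel borel f]) measurable

lemma norm_heis: "norm (heis x \<xi> f y) = norm (f (y - x))"
  by (simp add: heis_def norm_mult)

lemma square_integrable_heis: "square_integrable f \<Longrightarrow> square_integrable (heis x \<xi> f)"
  using integrable_translate_iff[of "\<lambda>y. (norm (f y))\<^sup>2" "- x"]
  by (auto simp: square_integrable_def norm_heis)

lift_definition heisL :: "'a::euclidean_space \<Rightarrow> 'a \<Rightarrow> 'a L2 \<Rightarrow> 'a L2" is heis
proof -
  fix x \<xi> :: 'a and f g :: "'a \<Rightarrow> complex"
  assume *: "square_integrable f \<and> square_integrable g \<and> (AE x in lborel. f x = g x)"
  then have "AE y in lborel. f (y + - x) = g (y + - x)" by (intro AE_translate) auto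
  then have "AE y in lborel. heis x \<xi> f y = heis x \<xi> g y" by eventually_elim (simp add: heis_def)
  with * show "square_integrable (heis x \<xi> f) \<and> square_integrable (heis x \<xi> g) \<and>
       (AE y in lborel. heis x \<xi> f y = heis x \<xi> g y)" by (auto intro: square_integrable_heis)
qed

lemma heisL_abs: "square_integrable f \<Longrightarrow> heisL x \<xi> (abs_L2 f) = abs_L2 (heis x \<xi> f)"
  by (rule heisL.abs_eq) auto

lemma heisL_add: "heisL x \<xi> (f + g) = heisL x \<xi> f + heisL x \<xi> g"
proof transfer
  fix x \<xi> :: 'a and f g :: "'a \<Rightarrow> complex"
  assume "square_integrable f \<and> square_integrable f \<and> (AE x in lborel. f x = f x)"
    "square_integrable g \<and> square_integrable g \<and> (AE x in lborel. g x = g x)"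
  moreover have "heis x \<xi> (\<lambda>x. f x + g x) = (\<lambda>y. heis x \<xi> f y + heis x \<xi> g y)"
    by (simp add: heis_def fun_eq_iff distrib_left)
  ultimately show "square_integrable (heis x \<xi> (\<lambda>x. f x + g x)) \<and>
    square_integrable (\<lambda>y. heis x \<xi> f y + heis x \<xi> g y) \<and>
    (AE y in lborel. heis x \<xi> (\<lambda>x. f x + g x) y = heis x \<xi> f y + heis x \<xi> g y)"
    by (simp add: square_integrable_heis square_integrable_add)
qed

lemma heisL_scale: "heisL x \<xi> (scaleC_L2 c f) = scaleC_L2 c (heisL x \<xi> f)"
proof transfer
  fix x \<xi> :: 'a and c and f :: "'a \<Rightarrow> complex"
  assume "square_integrable f \<and> square_integrable f \<and> (AE x in lborel. f x = f x)"
  moreover have "heis x \<xi> (\<lambda>x. c * f x) = (\<lambda>y. c * heis x \<xi> f y)"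
    by (simp add: heis_def fun_eq_iff)
  ultimately show "square_integrable (heis x \<xi> (\<lambda>x. c * f x)) \<and>
    square_integrable (\<lambda>y. c * heis x \<xi> f y) \<and>
    (AE y in lborel. heis x \<xi> (\<lambda>x. c * f x) y = c * heis x \<xi> f y)"
    by (simp add: square_integrable_heis square_integrable_scale)
qed

lemma norm_heisL [simp]: "norm (heisL x \<xi> f) = norm f"
proof -
  have "(norm (heisL x \<xi> f))\<^sup>2 = (LBINT y. (norm (heis x \<xi> (rep_L2 f) y))\<^sup>2)"
    using norm_abs_L2[OF square_integrable_heis[OF square_integrable_rep_L2[of f]], of x \<xi>]
    by (simp flip: heisL_abs)
  also have "\<dots> = (norm f)\<^sup>2"
    using integral_translate[of "\<lambda>y. (norm (rep_L2 f y))\<^sup>2" "- x"] by (simp add: norm_heis norm_L2_square)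
  finally show ?thesis by simp
qed

lemma bounded_linear_heisL: "bounded_linear (heisL x \<xi>)"
  by (rule bounded_linear_intro[where K=1]) (auto simp: heisL_add heisL_scale scaleR_scaleC_L2)

lemma heis_adjoint_integral:
  "(LBINT y. heis x \<xi> f y * cnj (g y)) = (LBINT y. f y * cnj (heis (- x) (- \<xi>) g y))"
proof -
  have "(LBINT y. heis x \<xi> f y * cnj (g y)) = (LBINT y. heis x \<xi> f (y + x) * cnj (g (y + x)))"
    by (rule integral_translate[symmetric])
  also have "\<dots> = (LBINT y. f y * cnj (heis (- x) (- \<xi>) g y))"
  proof (intro lebesgue_cong refl)
    fix y
    have "x - (1/2) *\<^sub>R x = (1/2) *\<^sub>R x"
      using scaleR_left_diff_distrib[of 1 "1/2" x] by simp
    then have "y + x - x /\<^sub>R 2 = y + x /\<^sub>R 2"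
      by (simp add: algebra_simps)
    then have "heis x \<xi> f (y + x) = cis (2 * pi * (\<xi> \<bullet> (y + x /\<^sub>R 2))) * f y"
      by (simp only: heis_def add_diff_cancel_right')
    then show "heis x \<xi> f (y + x) * cnj (g (y + x)) = f y * cnj (heis (- x) (- \<xi>) g y)"
      by (simp add: heis_def[of "-x"] cis_cnj)
  qed
  finally show ?thesis .
qed

lemma heisL_adjoint: "cinner_L2 (heisL x \<xi> f) g = cinner_L2 f (heisL (- x) (- \<xi>) g)"
  using heis_adjoint_integral[of x \<xi> "rep_L2 f" "rep_L2 g"]
    cinner_abs[OF square_integrable_heis[OF square_integrable_rep_L2[of f]] square_integrable_rep_L2[of g], of x \<xi>]
    cinner_abs[OF square_integrable_rep_L2[of f] square_integrable_heis[OF square_integrable_rep_L2[of g]], of "-x" "-\<xi>"]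
  by (simp flip: heisL_abs)

text \<open>Strong continuity of translations is dominated convergence for the indicator of a box, whose translates converge off
  the boundary, and extends to \<open>L\<^sup>2\<close> because translations are isometries.\<close>

lemma translation_continuous: "((\<lambda>t. heisL t 0 f) \<longlongrightarrow> f) (at 0)"
proof (induction f rule: L2_induct)
  case (box a b)
  let ?I = "indicator (box a b) :: 'a \<Rightarrow> complex"
  have sq: "square_integrable ?I" by (rule square_integrable_indicator_box[of _ a b]) auto
  have N: "AE x in lborel. x \<notin> cbox a b - box a b"
  proof (rule AE_not_in)
    have "emeasure lborel (cbox a b - box a b) = emeasure lborel (cbox a b) - emeasure lborel (box a b)"
      by (rule emeasure_Diff) (use emeasure_lborel_box_finite[of a b] in \<open>auto simp: box_subset_cbox\<close>)
    also have "\<dots> = 0" by (simp add: emeasure_lborel_box_eq emeasure_lborel_cbox_eq)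
    finally show "cbox a b - box a b \<in> null_sets lborel" by auto
  qed
  show ?case
    unfolding tendsto_at_iff_sequentially comp_def
  proof (intro allI impI)
    fix t :: "nat \<Rightarrow> 'a" assume "\<forall>i. t i \<in> UNIV - {0}" and t: "t \<longlonglongrightarrow> 0"
    from t have "Bseq t" using convergent_imp_Bseq convergentI by blast
    then obtain K where K: "\<And>i. norm (t i) \<le> K" "K > 0" by (auto simp: Bseq_def)
    let ?J = "indicator (box (a - K *\<^sub>R One) (b + K *\<^sub>R One)) :: 'a \<Rightarrow> complex"
    have "(\<lambda>i. abs_L2 (heis (t i) 0 ?I)) \<longlonglongrightarrow> abs_L2 ?I"
    proof (rule L2_dominated_convergence(2)[where h="?J"])
      show "square_integrable ?J" by (rule square_integrable_indicator_box[OF _ order_refl]) auto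
      show "norm (heis (t i) 0 ?I x) \<le> norm (?J x)" for i x
      proof -
        have "x \<in> box (a - K *\<^sub>R One) (b + K *\<^sub>R One)" if "x - t i \<in> box a b"
          unfolding mem_box
        proof
          fix j :: 'a assume j: "j \<in> Basis"
          have "\<bar>t i \<bullet> j\<bar> \<le> K" using Basis_le_norm[OF j, of "t i"] K(1)[of i] by linarith
          then show "(a - K *\<^sub>R One) \<bullet> j < x \<bullet> j \<and> x \<bullet> j < (b + K *\<^sub>R One) \<bullet> j"
            using that j by (force simp: mem_box inner_diff_left inner_add_left)
        qed
        then show ?thesis by (auto simp: norm_heis split: split_indicator)
      qed
      show "AE x in lborel. (\<lambda>i. heis (t i) 0 ?I x) \<longlonglongrightarrow> ?I x"
        using N
      proof eventually_elim
        fix x assume x: "x \<notin> cbox a b - box a b"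
        have lim: "(\<lambda>i. x - t i) \<longlonglongrightarrow> x" using tendsto_diff[OF tendsto_const t, of x] by simp
        have "eventually (\<lambda>i. heis (t i) 0 ?I x = ?I x) sequentially"
        proof (cases "x \<in> box a b")
          case True
          from topological_tendstoD[OF lim open_box True] show ?thesis
            by eventually_elim (use True in \<open>simp add: heis_def\<close>)
        next
          case False
          with x have "x \<in> - cbox a b" by auto
          from topological_tendstoD[OF lim _ this] have "eventually (\<lambda>i. x - t i \<in> - cbox a b) sequentially"
            by (simp add: open_Compl closed_cbox)
          then show ?thesis
            by eventually_elim (use False box_subset_cbox[of a b] in \<open>auto simp: heis_def split: split_indicator\<close>)
        qed
        then show "(\<lambda>i. heis (t i) 0 ?I x) \<longlonglongrightarrow> ?I x" by (rule tendsto_eventually)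
      qed
    qed auto
    then show "(\<lambda>i. heisL (t i) 0 (abs_L2 ?I)) \<longlonglongrightarrow> abs_L2 ?I" by (simp add: heisL_abs sq)
  qed
next
  case (add f g)
  then show ?case unfolding heisL_add by (rule tendsto_add)
next
  case (scale c f)
  have "bounded_linear (scaleC_L2 c :: 'a L2 \<Rightarrow> _)"
    by (rule bounded_linear_intro[where K="cmod c"])
       (auto simp: scaleC_L2_simps scaleR_scaleC_L2 mult.commute)
  from bounded_linear.tendsto[OF this scale] show ?case unfolding heisL_scale .
next
  case (lim X f)
  show ?case
  proof (rule tendstoI)
    fix e :: real assume e: "e > 0"
    from lim(2) e obtain n where n: "norm (X n - f) < e / 3"
      by (metis LIMSEQ_D divide_pos_pos le_refl zero_less_numeral)
    from tendstoD[OF lim(1)[of n], of "e / 3"] e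
    have "eventually (\<lambda>t. dist (heisL t 0 (X n)) (X n) < e / 3) (at 0)" by simp
    then show "eventually (\<lambda>t. dist (heisL t 0 f) f < e) (at 0)"
    proof eventually_elim
      fix t assume *: "dist (heisL t 0 (X n)) (X n) < e / 3"
      have "heisL t 0 f - f = (heisL t 0 (X n) - X n) - (heisL t 0 (X n - f)) + (X n - f)"
        using linear_diff[OF bounded_linear.linear[OF bounded_linear_heisL], of t 0 "X n" f] by simp
      also have "norm \<dots> \<le> norm (heisL t 0 (X n) - X n) + norm (heisL t 0 (X n - f)) + norm (X n - f)"
        by (intro norm_triangle_le add_mono norm_triangle_ineq4 order_refl)
      also have "\<dots> < e" using * n by (simp add: dist_norm)
      finally show "dist (heisL t 0 f) f < e" by (simp add: dist_norm)
    qed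
  qed
qed

section \<open>The Fourier transform\<close>

lemma integrable_pair_bound:
  fixes K :: "'a::euclidean_space \<Rightarrow> 'b::euclidean_space \<Rightarrow> 'c::{banach, second_countable_topology}"
  assumes [measurable]: "(\<lambda>(x, y). K x y) \<in> borel_measurable (borel \<Otimes>\<^sub>M borel)"
    and int: "\<And>x. integrable lborel (K x)"
    and bound: "\<And>x. (LBINT y. norm (K x y)) \<le> a x" and a: "integrable lborel a"
  shows "integrable (lborel \<Otimes>\<^sub>M lborel) (\<lambda>(x, y). K x y)"
proof (rule lborel_pair.Fubini_integrable)
  show "integrable lborel (\<lambda>x. LBINT y. norm (case (x, y) of (x, y) \<Rightarrow> K x y))"
  proof (rule integrable_dominated[OF a])
    show "AE x in lborel. norm (LBINT y. norm (case (x, y) of (x, y) \<Rightarrow> K x y)) \<le> norm (a x)"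
    proof (rule AE_I2)
      fix x
      have "0 \<le> (LBINT y. norm (K x y))" by simp
      with bound[of x] show "norm (LBINT y. norm (case (x, y) of (x, y) \<Rightarrow> K x y)) \<le> norm (a x)"
        by simp
    qed
  qed measurable
qed (use int in auto)

text \<open>Fubini in the form used throughout: the inner integrals of the norms are dominated by an integrable function of the
  outer variable.\<close>

lemma integral_swap:
  fixes K :: "'a::euclidean_space \<Rightarrow> 'b::euclidean_space \<Rightarrow> 'c::{banach, second_countable_topology}"
  assumes "(\<lambda>(x, y). K x y) \<in> borel_measurable (borel \<Otimes>\<^sub>M borel)"
    and "\<And>x. integrable lborel (K x)"
    and "\<And>x. (LBINT y. norm (K x y)) \<le> a x" and "integrable lborel a"
  shows "(LBINT x. (LBINT y. K x y)) = (LBINT y. (LBINT x. K x y))"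
  by (rule lborel_pair.Fubini_integral[symmetric]) (rule integrable_pair_bound[OF assms])

lemma fourier_integral_measurable [measurable]:
  assumes [measurable]: "f \<in> borel_measurable borel"
  shows "fourier_integral f \<in> borel_measurable borel"
  unfolding fourier_integral_def[abs_def] by measurable

lemma fourier_integrable: "integrable lborel f \<Longrightarrow> integrable lborel (\<lambda>x. f x * cis (a * (\<eta> \<bullet> x)))"
  by (rule integrable_dominated[of _ f])
     (use borel_measurable_integrable[of lborel f] in \<open>auto simp: norm_mult\<close>)

lemma norm_fourier_integral: "norm (fourier_integral f \<xi>) \<le> (LBINT x. norm (f x))"
  unfolding fourier_integral_def using integral_norm_bound[of lborel "\<lambda>x. f x * cis (- 2 * pi * (\<xi> \<bullet> x))"]
  by (simp add: norm_mult)

lemma gaussian_scaled_integrable: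
  assumes "\<epsilon> > 0"
  shows "integrable lborel (\<lambda>\<xi>::'a::euclidean_space. exp (- pi * (\<epsilon>\<^sup>2 * (norm \<xi>)\<^sup>2)))"
  using integrable_lborel_affine[OF gaussian_integrable, of \<epsilon> 0] assms by (simp add: power_mult_distrib)

lemma gaussian_scaled_fourier:
  fixes z :: "'a::euclidean_space"
  assumes e: "\<epsilon> > 0"
  shows "(LBINT \<xi>. complex_of_real (exp (- pi * (\<epsilon>\<^sup>2 * (norm \<xi>)\<^sup>2))) * cis (2 * pi * (\<xi> \<bullet> z))) =
    complex_of_real (exp (- pi * (norm (z /\<^sub>R \<epsilon>))\<^sup>2) / \<epsilon> ^ DIM('a))"
proof -
  have "(LBINT \<xi>. complex_of_real (exp (- pi * (\<epsilon>\<^sup>2 * (norm \<xi>)\<^sup>2))) * cis (2 * pi * (\<xi> \<bullet> z))) =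
    \<bar>1 / \<epsilon>\<bar> ^ DIM('a) *\<^sub>R (LBINT \<xi>. complex_of_real (exp (- pi * (\<epsilon>\<^sup>2 * (norm (0 + (1 / \<epsilon>) *\<^sub>R \<xi>))\<^sup>2))) *
      cis (2 * pi * ((0 + (1 / \<epsilon>) *\<^sub>R \<xi>) \<bullet> z)))"
    by (rule integral_lborel_affine) (use e in auto)
  also have "(LBINT \<xi>. complex_of_real (exp (- pi * (\<epsilon>\<^sup>2 * (norm (0 + (1 / \<epsilon>) *\<^sub>R \<xi>))\<^sup>2))) *
      cis (2 * pi * ((0 + (1 / \<epsilon>) *\<^sub>R \<xi>) \<bullet> z))) =
      (LBINT \<xi>. complex_of_real (gauss \<xi>) * cis (2 * pi * (\<xi> \<bullet> (z /\<^sub>R \<epsilon>))))"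
  proof -
    have "\<epsilon>\<^sup>2 * (norm (0 + (1 / \<epsilon>) *\<^sub>R \<xi>))\<^sup>2 = (norm \<xi>)\<^sup>2" for \<xi> :: 'a
      using e by (simp add: power_divide field_simps)
    then show ?thesis by (simp only:) (simp add: divide_inverse)
  qed
  also have "\<dots> = complex_of_real (exp (- pi * (norm (z /\<^sub>R \<epsilon>))\<^sup>2))"
    by (rule gaussian_fourier)
  finally show ?thesis using e by (simp add: scaleR_conv_of_real power_divide)
qed

text \<open>Gaussian regularisation of the inverse Fourier transform is convolution with an approximate identity.\<close>

lemma fourier_regularized:
  fixes k :: "'a::euclidean_space \<Rightarrow> complex"
  assumes k: "integrable lborel k" and e: "\<epsilon> > 0"
  shows "(LBINT \<xi>. fourier_integral k \<xi> * (complex_of_real (exp (- pi * (\<epsilon>\<^sup>2 * (norm \<xi>)\<^sup>2))) * cis (2 * pi * (\<xi> \<bullet> x)))) =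
    (LBINT t. k (x - \<epsilon> *\<^sub>R t) * complex_of_real (gauss t))"
proof -
  have [measurable]: "k \<in> borel_measurable borel" using borel_measurable_integrable[OF k] by simp
  define G where "G = (\<lambda>\<xi>::'a. exp (- pi * (\<epsilon>\<^sup>2 * (norm \<xi>)\<^sup>2)))"
  have [measurable]: "G \<in> borel_measurable borel" by (simp add: G_def)
  have G: "integrable lborel G" unfolding G_def by (rule gaussian_scaled_integrable[OF e])
  have Gpos: "G \<xi> > 0" for \<xi> by (simp add: G_def)
  have "(LBINT \<xi>. fourier_integral k \<xi> * (complex_of_real (G \<xi>) * cis (2 * pi * (\<xi> \<bullet> x)))) =
    (LBINT \<xi>. (LBINT y. k y * cis (- 2 * pi * (\<xi> \<bullet> y)) * (complex_of_real (G \<xi>) * cis (2 * pi * (\<xi> \<bullet> x)))))"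
    unfolding fourier_integral_def by simp
  also have "\<dots> = (LBINT y. (LBINT \<xi>. k y * cis (- 2 * pi * (\<xi> \<bullet> y)) * (complex_of_real (G \<xi>) * cis (2 * pi * (\<xi> \<bullet> x)))))"
  proof (rule integral_swap[where a="\<lambda>\<xi>. G \<xi> * (LBINT y. norm (k y))"])
    show "integrable lborel (\<lambda>\<xi>. G \<xi> * (LBINT y. norm (k y)))" using G by simp
    show "integrable lborel (\<lambda>y. k y * cis (- 2 * pi * (\<xi> \<bullet> y)) * (complex_of_real (G \<xi>) * cis (2 * pi * (\<xi> \<bullet> x))))" for \<xi>
      using fourier_integrable[OF k, of "- 2 * pi" \<xi>] by simp
    show "(LBINT y. norm (k y * cis (- 2 * pi * (\<xi> \<bullet> y)) * (complex_of_real (G \<xi>) * cis (2 * pi * (\<xi> \<bullet> x)))))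
       \<le> G \<xi> * (LBINT y. norm (k y))" for \<xi>
      using Gpos[of \<xi>] by (simp add: norm_mult mult.commute)
  qed measurable
  also have "\<dots> = (LBINT y. k y * complex_of_real (exp (- pi * (norm ((x - y) /\<^sub>R \<epsilon>))\<^sup>2) / \<epsilon> ^ DIM('a)))"
  proof (intro lebesgue_cong refl)
    fix y
    have "(LBINT \<xi>. k y * cis (- 2 * pi * (\<xi> \<bullet> y)) * (complex_of_real (G \<xi>) * cis (2 * pi * (\<xi> \<bullet> x)))) =
      (LBINT \<xi>. k y * (complex_of_real (G \<xi>) * cis (2 * pi * (\<xi> \<bullet> (x - y)))))"
    proof (intro lebesgue_cong refl)
      fix \<xi>
      have "cis (2 * pi * (\<xi> \<bullet> (x - y))) = cis (- 2 * pi * (\<xi> \<bullet> y)) * cis (2 * pi * (\<xi> \<bullet> x))"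
        by (simp add: cis_mult inner_diff_right algebra_simps)
      then show "k y * cis (- 2 * pi * (\<xi> \<bullet> y)) * (complex_of_real (G \<xi>) * cis (2 * pi * (\<xi> \<bullet> x))) =
         k y * (complex_of_real (G \<xi>) * cis (2 * pi * (\<xi> \<bullet> (x - y))))" by simp
    qed
    also have "\<dots> = k y * (LBINT \<xi>. complex_of_real (G \<xi>) * cis (2 * pi * (\<xi> \<bullet> (x - y))))" by simp
    also have "\<dots> = k y * complex_of_real (exp (- pi * (norm ((x - y) /\<^sub>R \<epsilon>))\<^sup>2) / \<epsilon> ^ DIM('a))"
      unfolding G_def by (subst gaussian_scaled_fourier[OF e]) simp
    finally show "(LBINT \<xi>. k y * cis (- 2 * pi * (\<xi> \<bullet> y)) * (complex_of_real (G \<xi>) * cis (2 * pi * (\<xi> \<bullet> x)))) =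
      k y * complex_of_real (exp (- pi * (norm ((x - y) /\<^sub>R \<epsilon>))\<^sup>2) / \<epsilon> ^ DIM('a))" .
  qed
  also have "\<dots> = \<bar>- \<epsilon>\<bar> ^ DIM('a) *\<^sub>R (LBINT t. k (x + (- \<epsilon>) *\<^sub>R t) * complex_of_real
      (exp (- pi * (norm ((x - (x + (- \<epsilon>) *\<^sub>R t)) /\<^sub>R \<epsilon>))\<^sup>2) / \<epsilon> ^ DIM('a)))"
    by (rule integral_lborel_affine) (use e in auto)
  also have "\<dots> = (LBINT t. k (x - \<epsilon> *\<^sub>R t) * complex_of_real (gauss t))"
    using e by (simp add: scaleR_conv_of_real)
  finally show ?thesis by (simp add: G_def)
qed

lemma inverse_Suc_tendsto: "(\<lambda>n. inverse (real (Suc n))) \<longlonglongrightarrow> 0"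
  by (rule LIMSEQ_inverse_real_of_nat)

lemma gaussian_scaled_tendsto:
  "(\<lambda>n. exp (- pi * ((inverse (real (Suc n)))\<^sup>2 * (norm \<xi>)\<^sup>2))) \<longlonglongrightarrow> 1"
proof -
  have "(\<lambda>n. exp (- pi * ((inverse (real (Suc n)))\<^sup>2 * (norm \<xi>)\<^sup>2))) \<longlonglongrightarrow> exp (- pi * (0\<^sup>2 * (norm \<xi>)\<^sup>2))"
    by (intro tendsto_intros inverse_Suc_tendsto)
  then show ?thesis by simp
qed

text \<open>Letting the Gaussian regularisation tend to \<open>1\<close>, the left-hand side converges because the transform is
  integrable and the approximate identity converges because \<open>h\<close> is continuous at the point in question.\<close>

theorem fourier_inversion:
  fixes h :: "'a::euclidean_space \<Rightarrow> complex"
  assumes h: "integrable lborel h" and B: "\<And>y. norm (h y) \<le> B" and cont: "isCont h x"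
    and fh: "integrable lborel (fourier_integral h)"
  shows "(LBINT \<xi>. fourier_integral h \<xi> * cis (2 * pi * (\<xi> \<bullet> x))) = h x"
proof -
  have [measurable]: "h \<in> borel_measurable borel" using borel_measurable_integrable[OF h] by simp
  define \<epsilon> where "\<epsilon> = (\<lambda>n. inverse (real (Suc n)))"
  have e: "\<epsilon> n > 0" "\<epsilon> \<longlonglongrightarrow> 0" for n using inverse_Suc_tendsto by (auto simp: \<epsilon>_def)
  have 1: "(\<lambda>n. LBINT \<xi>. fourier_integral h \<xi> * (complex_of_real (exp (- pi * ((\<epsilon> n)\<^sup>2 * (norm \<xi>)\<^sup>2))) * cis (2 * pi * (\<xi> \<bullet> x))))
    \<longlonglongrightarrow> (LBINT \<xi>. fourier_integral h \<xi> * (complex_of_real 1 * cis (2 * pi * (\<xi> \<bullet> x))))"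
  proof (rule integral_dominated_convergence[where w="\<lambda>\<xi>. norm (fourier_integral h \<xi>)"])
    show "integrable lborel (\<lambda>\<xi>. norm (fourier_integral h \<xi>))" using fh by simp
    show "AE \<xi> in lborel. (\<lambda>n. fourier_integral h \<xi> * (complex_of_real (exp (- pi * ((\<epsilon> n)\<^sup>2 * (norm \<xi>)\<^sup>2))) * cis (2 * pi * (\<xi> \<bullet> x))))
      \<longlonglongrightarrow> fourier_integral h \<xi> * (complex_of_real 1 * cis (2 * pi * (\<xi> \<bullet> x)))"
      unfolding \<epsilon>_def by (intro AE_I2 tendsto_intros gaussian_scaled_tendsto)
    fix n
    show "AE \<xi> in lborel. norm (fourier_integral h \<xi> * (complex_of_real (exp (- pi * ((\<epsilon> n)\<^sup>2 * (norm \<xi>)\<^sup>2))) * cis (2 * pi * (\<xi> \<bullet> x))))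
       \<le> norm (fourier_integral h \<xi>)"
      by (intro AE_I2) (auto simp: norm_mult intro!: mult_left_le)
  qed measurable
  have 2: "(\<lambda>n. LBINT t. h (x - \<epsilon> n *\<^sub>R t) * complex_of_real (gauss t))
     \<longlonglongrightarrow> (LBINT t. h x * complex_of_real (exp (- pi * (norm (t::'a))\<^sup>2)))"
  proof (rule integral_dominated_convergence[where w="\<lambda>t. B * exp (- pi * (norm (t::'a))\<^sup>2)"])
    show "integrable lborel (\<lambda>t. B * exp (- pi * (norm (t::'a))\<^sup>2))" using gaussian_integrable[where 'a='a] by simp
    show "AE t in lborel. (\<lambda>n. h (x - \<epsilon> n *\<^sub>R t) * complex_of_real (gauss t))
       \<longlonglongrightarrow> h x * complex_of_real (gauss t)"
    proof (rule AE_I2, intro tendsto_intros)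
      fix t :: 'a
      have "(\<lambda>n. x - \<epsilon> n *\<^sub>R t) \<longlonglongrightarrow> x - 0 *\<^sub>R t" by (intro tendsto_intros e)
      then show "(\<lambda>n. h (x - \<epsilon> n *\<^sub>R t)) \<longlonglongrightarrow> h x" using isCont_tendsto_compose[OF cont] by simp
    qed
    fix n
    show "AE t in lborel. norm (h (x - \<epsilon> n *\<^sub>R t) * complex_of_real (gauss t))
      \<le> B * exp (- pi * (norm (t::'a))\<^sup>2)"
      using B by (intro AE_I2) (simp add: norm_mult)
  qed measurable
  have "(LBINT t. h x * complex_of_real (exp (- pi * (norm (t::'a))\<^sup>2))) = h x * complex_of_real (LBINT t. exp (- pi * (norm (t::'a))\<^sup>2))"
    by (simp flip: integral_complex_of_real)
  also have "\<dots> = h x" by (simp only: gaussian_integral) simp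
  finally have 3: "(LBINT t. h x * complex_of_real (exp (- pi * (norm (t::'a))\<^sup>2))) = h x" .
  show ?thesis
    using LIMSEQ_unique[OF 1] 2 unfolding 3 fourier_regularized[OF h e(1)] by simp
qed

lemma heisL_zero: "heisL 0 0 f = f"
  using heisL_abs[OF square_integrable_rep_L2[of f], of 0 0] by (simp add: heis_def[abs_def])

text \<open>Plancherel on \<open>L\<^sup>1 \<inter> L\<^sup>2\<close>: the regularised energy of the Fourier integral is a Gaussian average
  of the autocorrelation of \<open>f\<close>, which is continuous at the origin.\<close>

theorem Plancherel:
  fixes f :: "'a::euclidean_space \<Rightarrow> complex"
  assumes f: "integrable lborel f" and sf: "square_integrable f"
  shows "square_integrable (fourier_integral f)"
    and "norm (abs_L2 (fourier_integral f)) = norm (abs_L2 f)"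
proof -
  have [measurable]: "f \<in> borel_measurable borel" using borel_measurable_integrable[OF f] by simp
  define \<epsilon> where "\<epsilon> = (\<lambda>n. inverse (real (Suc n)))"
  have e: "\<epsilon> n > 0" "\<epsilon> \<longlonglongrightarrow> 0" for n using inverse_Suc_tendsto by (auto simp: \<epsilon>_def)
  define G where "G = (\<lambda>n (\<xi>::'a). exp (- pi * ((\<epsilon> n)\<^sup>2 * (norm \<xi>)\<^sup>2)))"
  have [measurable]: "G n \<in> borel_measurable borel" for n by (simp add: G_def)
  have G: "integrable lborel (G n)" for n unfolding G_def by (rule gaussian_scaled_integrable[OF e(1)])
  have Gpos: "G n \<xi> > 0" for n \<xi> by (simp add: G_def)
  define H where "H = (\<lambda>t::'a. gauss t)"
  have [measurable]: "H \<in> borel_measurable borel" by (simp add: H_def)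
  have H: "integrable lborel H" unfolding H_def by (rule gaussian_integrable)
  have Hpos: "H t > 0" for t by (simp add: H_def)
  define F where "F = fourier_integral f"
  have [measurable]: "F \<in> borel_measurable borel" unfolding F_def by measurable
  define B where "B = (LBINT x. norm (f x))"
  have FB: "norm (F \<xi>) \<le> B" for \<xi> unfolding F_def B_def by (rule norm_fourier_integral)
  have B0: "B \<ge> 0" by (simp add: B_def)
  have A: "heis t 0 f x = f (x - t)" for t x by (simp add: heis_def)
  have int_corr: "integrable lborel (\<lambda>x. f (x - t) * cnj (f x))" for t
    using square_integrable_prod[OF square_integrable_heis[OF sf] sf, of t 0] by (simp add: A)
  have corr: "cinner_L2 (heisL t 0 (abs_L2 f)) (abs_L2 f) = (LBINT x. f (x - t) * cnj (f x))" for t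
    by (simp add: heisL_abs sf cinner_abs square_integrable_heis A)
  have key: "complex_of_real (LBINT \<xi>. G n \<xi> * (norm (F \<xi>))\<^sup>2) =
      (LBINT t. complex_of_real (H t) * cinner_L2 (heisL (\<epsilon> n *\<^sub>R t) 0 (abs_L2 f)) (abs_L2 f))" for n
  proof -
    have "complex_of_real (LBINT \<xi>. G n \<xi> * (norm (F \<xi>))\<^sup>2) = (LBINT \<xi>. F \<xi> * complex_of_real (G n \<xi>) * cnj (F \<xi>))"
      unfolding integral_complex_of_real[symmetric]
      by (intro lebesgue_cong refl) (simp add: complex_norm_square mult_ac del: of_real_power)
    also have "\<dots> = (LBINT \<xi>. (LBINT x. F \<xi> * complex_of_real (G n \<xi>) * (cnj (f x) * cis (2 * pi * (\<xi> \<bullet> x)))))"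
      unfolding F_def by (simp add: fourier_integral_def cis_cnj flip: Bochner_Integration.integral_cnj)
    also have "\<dots> = (LBINT x. (LBINT \<xi>. F \<xi> * complex_of_real (G n \<xi>) * (cnj (f x) * cis (2 * pi * (\<xi> \<bullet> x)))))"
    proof (rule integral_swap[where a="\<lambda>\<xi>. G n \<xi> * (B * B)"])
      show "integrable lborel (\<lambda>\<xi>. G n \<xi> * (B * B))" using G by simp
      show "integrable lborel (\<lambda>x. F \<xi> * complex_of_real (G n \<xi>) * (cnj (f x) * cis (2 * pi * (\<xi> \<bullet> x))))" for \<xi>
        using fourier_integrable[OF integrable_cnj[OF f], of "2 * pi" \<xi>] by simp
      show "(LBINT x. norm (F \<xi> * complex_of_real (G n \<xi>) * (cnj (f x) * cis (2 * pi * (\<xi> \<bullet> x))))) \<le> G n \<xi> * (B * B)" for \<xi>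
        using Gpos[of n \<xi>] FB[of \<xi>] B0 by (auto simp: norm_mult B_def[symmetric] intro!: mult_right_mono)
    qed measurable
    also have "\<dots> = (LBINT x. cnj (f x) * (LBINT \<xi>. F \<xi> * (complex_of_real (G n \<xi>) * cis (2 * pi * (\<xi> \<bullet> x)))))"
      by (intro lebesgue_cong refl, subst integral_mult_right_zero[symmetric])
         (simp add: mult_ac)
    also have "\<dots> = (LBINT x. cnj (f x) * (LBINT t. f (x - \<epsilon> n *\<^sub>R t) * complex_of_real (H t)))"
      unfolding F_def G_def H_def by (simp only: fourier_regularized[OF f e(1)])
    also have "\<dots> = (LBINT x. (LBINT t. complex_of_real (H t) * (f (x - \<epsilon> n *\<^sub>R t) * cnj (f x))))"
      by (simp add: mult_ac flip: integral_mult_right_zero)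
    also have "\<dots> = (LBINT t. (LBINT x. complex_of_real (H t) * (f (x - \<epsilon> n *\<^sub>R t) * cnj (f x))))"
    proof (rule integral_swap[symmetric, where a="\<lambda>t. H t * (norm (abs_L2 f) * norm (abs_L2 f))"])
      show "integrable lborel (\<lambda>t. H t * (norm (abs_L2 f) * norm (abs_L2 f)))" using H by simp
      show "integrable lborel (\<lambda>x. complex_of_real (H t) * (f (x - \<epsilon> n *\<^sub>R t) * cnj (f x)))" for t
        using int_corr by simp
      show "(LBINT x. norm (complex_of_real (H t) * (f (x - \<epsilon> n *\<^sub>R t) * cnj (f x)))) \<le> H t * (norm (abs_L2 f) * norm (abs_L2 f))" for t
      proof -
        have "(LBINT x. norm (heis (\<epsilon> n *\<^sub>R t) 0 f x) * norm (f x)) \<le> norm (abs_L2 (heis (\<epsilon> n *\<^sub>R t) 0 f)) * norm (abs_L2 f)"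
          by (intro Cauchy_Schwarz_norm_integral square_integrable_heis sf)
        also have "\<dots> = norm (abs_L2 f) * norm (abs_L2 f)" by (simp add: sf flip: heisL_abs)
        finally show ?thesis using Hpos[of t] by (simp add: norm_mult A)
      qed
    qed measurable
    also have "\<dots> = (LBINT t. complex_of_real (H t) * cinner_L2 (heisL (\<epsilon> n *\<^sub>R t) 0 (abs_L2 f)) (abs_L2 f))"
      by (simp add: corr)
    finally show ?thesis .
  qed
  have cont: "isCont (\<lambda>t. heisL t 0 (abs_L2 f)) 0"
    using translation_continuous[of "abs_L2 f"] by (simp add: isCont_def heisL_zero)
  have "(\<lambda>n. LBINT t. complex_of_real (H t) * cinner_L2 (heisL (\<epsilon> n *\<^sub>R t) 0 (abs_L2 f)) (abs_L2 f))
     \<longlonglongrightarrow> (LBINT t. complex_of_real (H t) * cinner_L2 (abs_L2 f) (abs_L2 f))"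
  proof (rule integral_dominated_convergence[where w="\<lambda>t. H t * (norm (abs_L2 f) * norm (abs_L2 f))"])
    show "integrable lborel (\<lambda>t. H t * (norm (abs_L2 f) * norm (abs_L2 f)))" using H by simp
    show "(\<lambda>t. complex_of_real (H t) * cinner_L2 (heisL (\<epsilon> n *\<^sub>R t) 0 (abs_L2 f)) (abs_L2 f)) \<in> borel_measurable lborel" for n
      unfolding corr by measurable
    show "AE t in lborel. norm (complex_of_real (H t) * cinner_L2 (heisL (\<epsilon> n *\<^sub>R t) 0 (abs_L2 f)) (abs_L2 f))
       \<le> H t * (norm (abs_L2 f) * norm (abs_L2 f))" for n
      using Hpos cinner_Cauchy_Schwarz[of "heisL (\<epsilon> n *\<^sub>R t) 0 (abs_L2 f)" "abs_L2 f" for t]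
      by (intro AE_I2) (auto simp: norm_mult less_imp_le)
    show "AE t in lborel. (\<lambda>n. complex_of_real (H t) * cinner_L2 (heisL (\<epsilon> n *\<^sub>R t) 0 (abs_L2 f)) (abs_L2 f))
       \<longlonglongrightarrow> complex_of_real (H t) * cinner_L2 (abs_L2 f) (abs_L2 f)"
    proof (rule AE_I2, intro tendsto_intros tendsto_cinner)
      fix t :: 'a
      have "(\<lambda>n. \<epsilon> n *\<^sub>R t) \<longlonglongrightarrow> 0 *\<^sub>R t" by (intro tendsto_intros e)
      then show "(\<lambda>n. heisL (\<epsilon> n *\<^sub>R t) 0 (abs_L2 f)) \<longlonglongrightarrow> abs_L2 f"
        using isCont_tendsto_compose[OF cont] by (simp add: heisL_zero)
    qed
  qed auto
  also have "(LBINT t. complex_of_real (H t) * cinner_L2 (abs_L2 f) (abs_L2 f)) = complex_of_real ((norm (abs_L2 f))\<^sup>2)"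
  proof -
    have "(LBINT t. complex_of_real (H t) * cinner_L2 (abs_L2 f) (abs_L2 f)) = complex_of_real (LBINT t. H t) * cinner_L2 (abs_L2 f) (abs_L2 f)"
      by (simp flip: integral_complex_of_real)
    then show ?thesis unfolding H_def gaussian_integral cinner_self by simp
  qed
  finally have lim: "(\<lambda>n. LBINT \<xi>. G n \<xi> * (norm (F \<xi>))\<^sup>2) \<longlonglongrightarrow> (norm (abs_L2 f))\<^sup>2"
    unfolding key[symmetric] by (simp only: tendsto_of_real_iff)
  have i: "integrable lborel (\<lambda>\<xi>. G n \<xi> * (norm (F \<xi>))\<^sup>2)" for n
  proof (rule integrable_dominated)
    show "integrable lborel (\<lambda>\<xi>. G n \<xi> * B\<^sup>2)" using G by simp
    show "AE \<xi> in lborel. norm (G n \<xi> * (norm (F \<xi>))\<^sup>2) \<le> norm (G n \<xi> * B\<^sup>2)"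
      using Gpos FB by (intro AE_I2) (auto simp: abs_mult less_imp_le intro!: mult_left_mono power_mono)
  qed measurable
  have mono: "AE \<xi> in lborel. mono (\<lambda>n. G n \<xi> * (norm (F \<xi>))\<^sup>2)"
  proof (rule AE_I2, rule monoI, rule mult_right_mono)
    fix \<xi> :: 'a and m n :: nat assume "m \<le> n"
    then have "\<epsilon> n \<le> \<epsilon> m" by (simp add: \<epsilon>_def)
    then have "(\<epsilon> n)\<^sup>2 \<le> (\<epsilon> m)\<^sup>2" using e(1)[of n] by (intro power_mono) auto
    then show "G m \<xi> \<le> G n \<xi>" by (auto simp: G_def intro!: mult_right_mono)
  qed simp
  have pw: "AE \<xi> in lborel. (\<lambda>n. G n \<xi> * (norm (F \<xi>))\<^sup>2) \<longlonglongrightarrow> (norm (F \<xi>))\<^sup>2"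
  proof (rule AE_I2)
    fix \<xi>
    have "(\<lambda>n. G n \<xi> * (norm (F \<xi>))\<^sup>2) \<longlonglongrightarrow> 1 * (norm (F \<xi>))\<^sup>2"
      unfolding G_def \<epsilon>_def by (intro tendsto_intros gaussian_scaled_tendsto)
    then show "(\<lambda>n. G n \<xi> * (norm (F \<xi>))\<^sup>2) \<longlonglongrightarrow> (norm (F \<xi>))\<^sup>2" by simp
  qed
  have meas: "(\<lambda>\<xi>. (norm (F \<xi>))\<^sup>2) \<in> borel_measurable lborel" by measurable
  show sF: "square_integrable (fourier_integral f)"
    unfolding square_integrable_def F_def[symmetric]
    using integrable_monotone_convergence[OF i mono pw lim meas] by simp
  have "(norm (abs_L2 (fourier_integral f)))\<^sup>2 = (norm (abs_L2 f))\<^sup>2"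
    unfolding norm_abs_L2[OF sF] unfolding F_def[symmetric]
    by (rule integral_monotone_convergence[OF i mono pw lim meas])
  then show "norm (abs_L2 (fourier_integral f)) = norm (abs_L2 f)" by simp
qed

section \<open>The Fourier transform as a unitary operator\<close>

definition trunc_L2 :: "nat \<Rightarrow> 'a::euclidean_space L2 \<Rightarrow> 'a \<Rightarrow> complex" where
  "trunc_L2 n f = (\<lambda>x. if norm x \<le> real n then rep_L2 f x else 0)"

lemma fourier_L2_trunc: "fourier_L2 f = lim (\<lambda>n. abs_L2 (fourier_integral (trunc_L2 n f)))"
  by (simp add: fourier_L2_def trunc_L2_def)

lemma square_integrable_indicator_cball:
  "square_integrable (indicator (cball 0 R) :: 'a::euclidean_space \<Rightarrow> complex)"
proof -
  obtain a :: 'a where "cball 0 R \<subseteq> box (- a) a"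
    using bounded_subset_box_symmetric[OF bounded_cball[of "0::'a" R]] by blast
  then show ?thesis by (intro square_integrable_indicator_box) auto
qed

lemma integrable_bounded_support:
  assumes f: "square_integrable f" and supp: "\<And>x. norm x > R \<Longrightarrow> f x = 0"
  shows "integrable lborel f"
proof -
  have "(\<lambda>x. f x * cnj (indicator (cball 0 R) x)) = f"
    using supp by (auto simp: fun_eq_iff split: split_indicator)
  with square_integrable_prod[OF f square_integrable_indicator_cball[of R]] show ?thesis by simp
qed

lemma trunc_measurable [measurable]: "trunc_L2 n f \<in> borel_measurable borel"
  unfolding trunc_L2_def by measurable

lemma trunc_square_integrable: "square_integrable (trunc_L2 n f)"
  by (rule square_integrable_bound[OF square_integrable_rep_L2[of f]]) (auto simp: trunc_L2_def)

lemma trunc_integrable: "integrable lborel (trunc_L2 n f)"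
  by (rule integrable_bounded_support[of _ "real n"]) (auto simp: trunc_square_integrable, simp add: trunc_L2_def)

lemma trunc_tendsto: "(\<lambda>n. abs_L2 (trunc_L2 n f)) \<longlonglongrightarrow> f"
proof -
  have "(\<lambda>n. abs_L2 (trunc_L2 n f)) \<longlonglongrightarrow> abs_L2 (rep_L2 f)"
  proof (rule L2_dominated_convergence(2)[where h="rep_L2 f"])
    show "AE x in lborel. (\<lambda>i. trunc_L2 i f x) \<longlonglongrightarrow> rep_L2 f x"
    proof (rule AE_I2, rule tendsto_eventually)
      fix x :: 'a
      obtain N :: nat where "norm x \<le> real N" using real_arch_simple by blast
      then have "trunc_L2 n f x = rep_L2 f x" if "n \<ge> N" for n
        using that by (auto simp: trunc_L2_def)
      then show "eventually (\<lambda>n. trunc_L2 n f x = rep_L2 f x) sequentially"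
        using eventually_sequentially by blast
    qed
  qed (auto simp: trunc_L2_def trunc_measurable[unfolded trunc_L2_def])
  then show ?thesis by simp
qed

lemma fourier_integral_add: "integrable lborel f \<Longrightarrow> integrable lborel g \<Longrightarrow>
    fourier_integral (\<lambda>x. f x + g x) = (\<lambda>\<xi>. fourier_integral f \<xi> + fourier_integral g \<xi>)"
  unfolding fourier_integral_def fun_eq_iff distrib_right
  by (intro allI Bochner_Integration.integral_add fourier_integrable)

lemma fourier_integral_diff: "integrable lborel f \<Longrightarrow> integrable lborel g \<Longrightarrow>
    fourier_integral (\<lambda>x. f x - g x) = (\<lambda>\<xi>. fourier_integral f \<xi> - fourier_integral g \<xi>)"
  unfolding fourier_integral_def fun_eq_iff left_diff_distrib
  by (intro allI Bochner_Integration.integral_diff fourier_integrable)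

lemma fourier_integral_scale: "fourier_integral (\<lambda>x. c * f x) = (\<lambda>\<xi>. c * fourier_integral f \<xi>)"
  unfolding fourier_integral_def fun_eq_iff by (simp add: mult.assoc)

lemma fourier_integral_cong_AE:
  assumes [measurable]: "f \<in> borel_measurable borel" "g \<in> borel_measurable borel"
    and eq: "AE x in lborel. f x = g x"
  shows "fourier_integral f = fourier_integral g"
  unfolding fourier_integral_def fun_eq_iff
  by (intro allI integral_cong_AE) (use eq in auto)

lemma norm_fourier_diff:
  assumes "integrable lborel f" "square_integrable f" "integrable lborel g" "square_integrable g"
  shows "norm (abs_L2 (fourier_integral f) - abs_L2 (fourier_integral g)) = norm (abs_L2 f - abs_L2 g)"
proof -
  have d: "integrable lborel (\<lambda>x. f x - g x)" "square_integrable (\<lambda>x. f x - g x)"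
    using assms by (auto intro: square_integrable_diff)
  have "abs_L2 (fourier_integral f) - abs_L2 (fourier_integral g) = abs_L2 (fourier_integral (\<lambda>x. f x - g x))"
    using assms by (simp add: abs_L2_diff Plancherel fourier_integral_diff)
  then show ?thesis using Plancherel(2)[OF d] assms by (simp add: abs_L2_diff)
qed

lemma fourier_L2_tendsto: "(\<lambda>n. abs_L2 (fourier_integral (trunc_L2 n f))) \<longlonglongrightarrow> fourier_L2 f"
proof -
  have C: "Cauchy (\<lambda>n. abs_L2 (trunc_L2 n f))"
    using trunc_tendsto by (rule LIMSEQ_imp_Cauchy)
  have "Cauchy (\<lambda>n. abs_L2 (fourier_integral (trunc_L2 n f)))"
    using C unfolding Cauchy_def dist_norm
    by (simp add: norm_fourier_diff trunc_integrable trunc_square_integrable)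
  then show ?thesis unfolding fourier_L2_trunc
    by (simp add: Cauchy_convergent_iff convergent_LIMSEQ_iff)
qed

text \<open>On functions that are integrable and square integrable the \<open>L\<^sup>2\<close> limit defining the transform is the Fourier
  integral itself, because the truncations converge to the function in \<open>L\<^sup>2\<close> and Plancherel applies to the difference.\<close>

lemma fourier_L2_abs:
  assumes "integrable lborel f" "square_integrable f"
  shows "fourier_L2 (abs_L2 f) = abs_L2 (fourier_integral f)"
proof (rule LIMSEQ_unique[OF fourier_L2_tendsto])
  have "(\<lambda>n. norm (abs_L2 (trunc_L2 n (abs_L2 f)) - abs_L2 f)) \<longlonglongrightarrow> 0"
    using trunc_tendsto[of "abs_L2 f"] by (simp add: LIM_zero_iff tendsto_norm_zero_iff)
  then have "(\<lambda>n. norm (abs_L2 (fourier_integral (trunc_L2 n (abs_L2 f))) - abs_L2 (fourier_integral f))) \<longlonglongrightarrow> 0"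
    by (simp add: norm_fourier_diff trunc_integrable trunc_square_integrable assms)
  then show "(\<lambda>n. abs_L2 (fourier_integral (trunc_L2 n (abs_L2 f)))) \<longlonglongrightarrow> abs_L2 (fourier_integral f)"
    by (simp add: LIM_zero_iff tendsto_norm_zero_iff)
qed

lemma fourier_L2_trunc_abs: "fourier_L2 (abs_L2 (trunc_L2 n f)) = abs_L2 (fourier_integral (trunc_L2 n f))"
  by (rule fourier_L2_abs[OF trunc_integrable trunc_square_integrable])

lemma norm_fourier_L2 [simp]: "norm (fourier_L2 f) = norm f"
proof (rule LIMSEQ_unique)
  show "(\<lambda>n. norm (abs_L2 (fourier_integral (trunc_L2 n f)))) \<longlonglongrightarrow> norm (fourier_L2 f)"
    by (intro tendsto_norm fourier_L2_tendsto)
  show "(\<lambda>n. norm (abs_L2 (fourier_integral (trunc_L2 n f)))) \<longlonglongrightarrow> norm f"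
    using tendsto_norm[OF trunc_tendsto[of f]]
    by (simp add: Plancherel trunc_integrable trunc_square_integrable)
qed

lemma fourier_L2_add: "fourier_L2 (f + g) = fourier_L2 f + fourier_L2 g"
proof (rule LIMSEQ_unique[OF fourier_L2_tendsto])
  have "fourier_integral (trunc_L2 n (f + g)) = fourier_integral (\<lambda>x. trunc_L2 n f x + trunc_L2 n g x)" for n
    by (rule fourier_integral_cong_AE) (use rep_add[of f g] in \<open>auto simp: trunc_L2_def\<close>)
  then have "abs_L2 (fourier_integral (trunc_L2 n (f + g))) =
    abs_L2 (fourier_integral (trunc_L2 n f)) + abs_L2 (fourier_integral (trunc_L2 n g))" for n
    by (simp add: fourier_integral_add trunc_integrable trunc_square_integrable abs_L2_add Plancherel)
  then show "(\<lambda>n. abs_L2 (fourier_integral (trunc_L2 n (f + g)))) \<longlonglongrightarrow> fourier_L2 f + fourier_L2 g"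
    by (simp add: tendsto_add fourier_L2_tendsto)
qed

lemma bounded_linear_scaleC_L2: "bounded_linear (scaleC_L2 c :: 'a::euclidean_space L2 \<Rightarrow> _)"
  by (rule bounded_linear_intro[where K="cmod c"])
     (auto simp: scaleC_L2_simps scaleR_scaleC_L2 mult.commute)

lemma fourier_L2_scale: "fourier_L2 (scaleC_L2 c f) = scaleC_L2 c (fourier_L2 f)"
proof (rule LIMSEQ_unique[OF fourier_L2_tendsto])
  have "fourier_integral (trunc_L2 n (scaleC_L2 c f)) = fourier_integral (\<lambda>x. c * trunc_L2 n f x)" for n
    by (rule fourier_integral_cong_AE) (use rep_scale[of c f] in \<open>auto simp: trunc_L2_def\<close>)
  then have "abs_L2 (fourier_integral (trunc_L2 n (scaleC_L2 c f))) =
    scaleC_L2 c (abs_L2 (fourier_integral (trunc_L2 n f)))" for n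
    by (simp add: fourier_integral_scale trunc_integrable trunc_square_integrable abs_L2_scale Plancherel)
  then show "(\<lambda>n. abs_L2 (fourier_integral (trunc_L2 n (scaleC_L2 c f)))) \<longlonglongrightarrow> scaleC_L2 c (fourier_L2 f)"
    by (simp add: bounded_linear.tendsto[OF bounded_linear_scaleC_L2] fourier_L2_tendsto)
qed

lemma bounded_linear_fourier_L2: "bounded_linear fourier_L2"
  by (rule bounded_linear_intro[where K=1]) (auto simp: fourier_L2_add fourier_L2_scale scaleR_scaleC_L2)

lemmas tendsto_fourier_L2 = bounded_linear.tendsto[OF bounded_linear_fourier_L2]

lift_definition cnj_L2 :: "'a::euclidean_space L2 \<Rightarrow> 'a L2" is "\<lambda>f x. cnj (f x)"
  by (auto simp: square_integrable_def elim: eventually_mono)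

lemma square_integrable_cnj: "square_integrable f \<Longrightarrow> square_integrable (\<lambda>x. cnj (f x))"
  by (auto simp: square_integrable_def)

lemma cnj_L2_abs: "square_integrable f \<Longrightarrow> cnj_L2 (abs_L2 f) = abs_L2 (\<lambda>x. cnj (f x))"
  by (rule cnj_L2.abs_eq) auto

lemma norm_cnj_L2 [simp]: "norm (cnj_L2 f) = norm f"
proof -
  have "(norm (cnj_L2 f))\<^sup>2 = (norm f)\<^sup>2"
    using norm_abs_L2[OF square_integrable_cnj[OF square_integrable_rep_L2[of f]]]
    by (simp add: norm_L2_square flip: cnj_L2_abs)
  then show ?thesis by simp
qed

lemma cnj_L2_add: "cnj_L2 (f + g) = cnj_L2 f + cnj_L2 g"
  by transfer (simp add: square_integrable_cnj square_integrable_add)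

lemma cnj_L2_scale: "cnj_L2 (scaleC_L2 c f) = scaleC_L2 (cnj c) (cnj_L2 f)"
  by transfer (simp add: square_integrable_cnj square_integrable_scale)

lemma bounded_linear_cnj_L2: "bounded_linear cnj_L2"
  by (rule bounded_linear_intro[where K=1]) (auto simp: cnj_L2_add cnj_L2_scale scaleR_scaleC_L2)

definition inverse_fourier_L2 :: "'a::euclidean_space L2 \<Rightarrow> 'a L2" where
  "inverse_fourier_L2 f = cnj_L2 (fourier_L2 (cnj_L2 f))"

lemma norm_inverse_fourier_L2 [simp]: "norm (inverse_fourier_L2 f) = norm f"
  by (simp add: inverse_fourier_L2_def)

lemma tendsto_inverse_fourier_L2:
  "(f \<longlongrightarrow> a) F \<Longrightarrow> ((\<lambda>x. inverse_fourier_L2 (f x)) \<longlongrightarrow> inverse_fourier_L2 a) F"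
  unfolding inverse_fourier_L2_def
  by (intro bounded_linear.tendsto[OF bounded_linear_cnj_L2] tendsto_fourier_L2)

text \<open>The multiplication formula, from which the adjoint of the \<open>L\<^sup>2\<close> transform is read off.\<close>

lemma fourier_integral_multiplication:
  fixes f g :: "'a::euclidean_space \<Rightarrow> complex"
  assumes f: "integrable lborel f" and g: "integrable lborel g"
  shows "(LBINT \<xi>. fourier_integral f \<xi> * g \<xi>) = (LBINT x. f x * fourier_integral g x)"
proof -
  have [measurable]: "f \<in> borel_measurable borel" "g \<in> borel_measurable borel"
    using borel_measurable_integrable[OF f] borel_measurable_integrable[OF g] by auto
  have "(LBINT \<xi>. fourier_integral f \<xi> * g \<xi>) = (LBINT \<xi>. (LBINT x. f x * cis (- 2 * pi * (\<xi> \<bullet> x)) * g \<xi>))"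
    by (simp add: fourier_integral_def)
  also have "\<dots> = (LBINT x. (LBINT \<xi>. f x * cis (- 2 * pi * (\<xi> \<bullet> x)) * g \<xi>))"
  proof (rule integral_swap[where a="\<lambda>\<xi>. (LBINT x. norm (f x)) * norm (g \<xi>)"])
    show "integrable lborel (\<lambda>\<xi>. (LBINT x. norm (f x)) * norm (g \<xi>))" using g by simp
    show "integrable lborel (\<lambda>x. f x * cis (- 2 * pi * (\<xi> \<bullet> x)) * g \<xi>)" for \<xi>
      using fourier_integrable[OF f, of "- 2 * pi" \<xi>] by simp
    show "(LBINT x. norm (f x * cis (- 2 * pi * (\<xi> \<bullet> x)) * g \<xi>)) \<le> (LBINT x. norm (f x)) * norm (g \<xi>)" for \<xi>
      by (simp add: norm_mult)
  qed measurable
  also have "\<dots> = (LBINT x. f x * fourier_integral g x)"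
    unfolding fourier_integral_def
    by (intro lebesgue_cong refl, subst integral_mult_right_zero[symmetric])
       (simp add: mult_ac inner_commute)
  finally show ?thesis .
qed

lemma fourier_L2_adjoint: "cinner_L2 (fourier_L2 f) g = cinner_L2 f (inverse_fourier_L2 g)"
proof (rule LIMSEQ_unique)
  let ?f = "\<lambda>n. trunc_L2 n f" and ?g = "\<lambda>n. trunc_L2 n g"
  show "(\<lambda>n. cinner_L2 (fourier_L2 (abs_L2 (?f n))) (abs_L2 (?g n))) \<longlonglongrightarrow> cinner_L2 (fourier_L2 f) g"
    by (intro tendsto_cinner tendsto_fourier_L2 trunc_tendsto)
  have "cinner_L2 (fourier_L2 (abs_L2 (?f n))) (abs_L2 (?g n)) = cinner_L2 (abs_L2 (?f n)) (inverse_fourier_L2 (abs_L2 (?g n)))" for n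
  proof -
    have gc: "integrable lborel (\<lambda>x. cnj (?g n x))" "square_integrable (\<lambda>x. cnj (?g n x))"
      using trunc_integrable[of n g] trunc_square_integrable[of n g] by (auto intro: square_integrable_cnj)
    have "cinner_L2 (fourier_L2 (abs_L2 (?f n))) (abs_L2 (?g n)) = (LBINT \<xi>. fourier_integral (?f n) \<xi> * cnj (?g n \<xi>))"
      by (simp add: fourier_L2_trunc_abs cinner_abs Plancherel trunc_integrable trunc_square_integrable)
    also have "\<dots> = (LBINT x. ?f n x * fourier_integral (\<lambda>x. cnj (?g n x)) x)"
      by (rule fourier_integral_multiplication[OF trunc_integrable gc(1)])
    also have "\<dots> = cinner_L2 (abs_L2 (?f n)) (inverse_fourier_L2 (abs_L2 (?g n)))"
      by (simp add: inverse_fourier_L2_def cnj_L2_abs trunc_square_integrable fourier_L2_abs[OF gc] Plancherel[OF gc]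
          cinner_abs square_integrable_cnj)
    finally show ?thesis .
  qed
  then show "(\<lambda>n. cinner_L2 (fourier_L2 (abs_L2 (?f n))) (abs_L2 (?g n))) \<longlonglongrightarrow> cinner_L2 f (inverse_fourier_L2 g)"
    by (simp add: tendsto_cinner trunc_tendsto tendsto_inverse_fourier_L2)
qed

lemma norm_diff_square_L2: "complex_of_real ((norm (f - g))\<^sup>2) = cinner_L2 f f - cinner_L2 f g - cinner_L2 g f + cinner_L2 g g"
  unfolding cinner_self[symmetric] cinner_diff_left cinner_diff_right by simp

text \<open>An isometry whose adjoint is again an isometry is unitary: \<open>|T T\<^sup>* g - g|\<^sup>2 = |T T\<^sup>* g|\<^sup>2 - 2 |T\<^sup>* g|\<^sup>2 + |g|\<^sup>2 = 0\<close>.\<close>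

lemma fourier_inverse_fourier_L2: "fourier_L2 (inverse_fourier_L2 g) = g"
proof -
  have 1: "cinner_L2 (fourier_L2 (inverse_fourier_L2 g)) g = complex_of_real ((norm g)\<^sup>2)"
    by (simp add: fourier_L2_adjoint cinner_self)
  then have 2: "cinner_L2 g (fourier_L2 (inverse_fourier_L2 g)) = complex_of_real ((norm g)\<^sup>2)"
    by (subst cinner_commute) (simp only: 1 complex_cnj_complex_of_real)
  have "complex_of_real ((norm (fourier_L2 (inverse_fourier_L2 g) - g))\<^sup>2) = 0"
    unfolding norm_diff_square_L2 1 2 unfolding cinner_self by simp
  then show ?thesis by simp
qed

lemma cinner_polarization:
  "cinner_L2 f g = (complex_of_real ((norm (f + g))\<^sup>2) - complex_of_real ((norm (f - g))\<^sup>2)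
     + \<i> * complex_of_real ((norm (f + scaleC_L2 \<i> g))\<^sup>2) - \<i> * complex_of_real ((norm (f - scaleC_L2 \<i> g))\<^sup>2)) / 4"
  unfolding cinner_self[symmetric] cinner_diff_left cinner_diff_right cinner_add_left cinner_add_right
    cinner_scale_left cinner_scale_right by (simp add: algebra_simps)

definition unitary_L2 :: "('a::euclidean_space L2 \<Rightarrow> 'a L2) \<Rightarrow> bool" where
  "unitary_L2 U \<longleftrightarrow> bij U \<and> (\<forall>f g. U (f + g) = U f + U g) \<and> (\<forall>c f. U (scaleC_L2 c f) = scaleC_L2 c (U f)) \<and>
     (\<forall>f. norm (U f) = norm f)"

lemma unitary_L2_I:
  assumes add: "\<And>f g. U (f + g) = U f + U g" and scale: "\<And>c f. U (scaleC_L2 c f) = scaleC_L2 c (U f)"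
    and norm: "\<And>f. norm (U f) = norm f" and surj: "\<And>g. \<exists>f. U f = g"
  shows "unitary_L2 U"
proof -
  have diff: "U (f - g) = U f - U g" for f g
    by (simp add: minus_L2_def uminus_L2_scaleC add scale)
  have "inj U"
    by (rule injI) (metis diff norm norm_eq_zero right_minus_eq)
  moreover have "surj U" using surj by (metis surjI)
  ultimately show ?thesis using assms by (simp add: unitary_L2_def bij_def)
qed

lemma unitary_cinner: assumes "unitary_L2 U" shows "cinner_L2 (U f) (U g) = cinner_L2 f g"
proof -
  have a: "U f + U g = U (f + g)" "norm (U f) = norm f" for f g using assms by (auto simp: unitary_L2_def)
  have s: "scaleC_L2 c (U f) = U (scaleC_L2 c f)" for c f using assms by (auto simp: unitary_L2_def)
  have d: "U f - U g = U (f - g)" for f g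
    by (simp add: minus_L2_def uminus_L2_scaleC a s)
  show ?thesis by (subst (1 2) cinner_polarization) (simp add: a s d)
qed

lemma unitary_comp: "unitary_L2 U \<Longrightarrow> unitary_L2 W \<Longrightarrow> unitary_L2 (U \<circ> W)"
  by (auto simp: unitary_L2_def intro: bij_comp)

lemma unitary_inv: assumes "unitary_L2 U" shows "unitary_L2 (inv U)"
proof -
  have b: "bij U" using assms by (simp add: unitary_L2_def)
  have [simp]: "U (inv U f) = f" "inv U (U f) = f" for f
    using b by (auto simp: bij_def surj_f_inv_f inv_f_f)
  have i: "inv U f = g \<longleftrightarrow> f = U g" for f g by auto
  have 1: "U (inv U f + inv U g) = f + g" "U (scaleC_L2 c (inv U f)) = scaleC_L2 c f" "norm (U f) = norm f" for f g c
    using assms by (auto simp: unitary_L2_def)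
  show ?thesis unfolding unitary_L2_def
  proof (intro conjI allI)
    show "bij (inv U)" using b by (rule bij_imp_bij_inv)
    show "norm (inv U f) = norm f" for f using 1(3)[of "inv U f"] by simp
  qed (simp_all add: i 1)
qed

lemma unitary_fourier_L2: "unitary_L2 fourier_L2"
  by (rule unitary_L2_I) (auto simp: fourier_L2_add fourier_L2_scale intro: fourier_inverse_fourier_L2)

lemma unitary_scale: assumes "cmod c = 1" shows "unitary_L2 (scaleC_L2 c)"
proof (rule unitary_L2_I)
  have "c \<noteq> 0" using assms by auto
  then show "\<exists>f. scaleC_L2 c f = g" for g :: "'a L2"
    using assms by (intro exI[of _ "scaleC_L2 (inverse c) g"]) (auto simp: scaleC_L2_simps)
qed (auto simp: scaleC_L2_simps mult.commute assms)

section \<open>Real metaplectic operators and phase-space shifts\<close>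

lemma fourier_integral_heis:
  "fourier_integral (heis x \<xi> f) = heis \<xi> (- x) (fourier_integral f)"
proof
  fix \<eta>
  have "fourier_integral (heis x \<xi> f) \<eta> = (LBINT y. heis x \<xi> f (y + x) * cis (- 2 * pi * (\<eta> \<bullet> (y + x))))"
    unfolding fourier_integral_def by (rule integral_translate[symmetric])
  also have "\<dots> = (LBINT y. cis (2 * pi * (- x \<bullet> (\<eta> - \<xi> /\<^sub>R 2))) * (f y * cis (- 2 * pi * ((\<eta> - \<xi>) \<bullet> y))))"
  proof (intro lebesgue_cong refl)
    fix y
    have "cis (2 * pi * (\<xi> \<bullet> (y + x - x /\<^sub>R 2))) * cis (- 2 * pi * (\<eta> \<bullet> (y + x))) =
      cis (2 * pi * (- x \<bullet> (\<eta> - \<xi> /\<^sub>R 2))) * cis (- 2 * pi * ((\<eta> - \<xi>) \<bullet> y))"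
      unfolding cis_mult
      by (rule arg_cong[of _ _ cis]) (simp add: inner_diff_left inner_diff_right inner_add_right inner_commute[of x] algebra_simps)
    then show "heis x \<xi> f (y + x) * cis (- 2 * pi * (\<eta> \<bullet> (y + x))) =
      cis (2 * pi * (- x \<bullet> (\<eta> - \<xi> /\<^sub>R 2))) * (f y * cis (- 2 * pi * ((\<eta> - \<xi>) \<bullet> y)))"
      by (simp only: heis_def add_diff_cancel_right' mult_ac)
  qed
  also have "\<dots> = heis \<xi> (- x) (fourier_integral f) \<eta>"
    by (simp add: heis_def fourier_integral_def)
  finally show "fourier_integral (heis x \<xi> f) \<eta> = heis \<xi> (- x) (fourier_integral f) \<eta>" .
qed

lemma integrable_heis: "integrable lborel f \<Longrightarrow> integrable lborel (heis x \<xi> f)"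
proof (rule integrable_dominated)
  assume f: "integrable lborel f"
  show "integrable lborel (\<lambda>y. f (y - x))" using f integrable_translate_iff[of f "- x"] by simp
  show "heis x \<xi> f \<in> borel_measurable lborel"
    using borel_measurable_integrable[OF f] by (simp add: heis_measurable)
qed (simp add: norm_heis)

lemmas tendsto_heisL = bounded_linear.tendsto[OF bounded_linear_heisL]

lemma fourier_L2_heisL: "fourier_L2 (heisL x \<xi> f) = heisL \<xi> (- x) (fourier_L2 f)"
proof (rule LIMSEQ_unique)
  show "(\<lambda>n. fourier_L2 (heisL x \<xi> (abs_L2 (trunc_L2 n f)))) \<longlonglongrightarrow> fourier_L2 (heisL x \<xi> f)"
    by (intro tendsto_fourier_L2 tendsto_heisL trunc_tendsto)
  have "fourier_L2 (heisL x \<xi> (abs_L2 (trunc_L2 n f))) = heisL \<xi> (- x) (fourier_L2 (abs_L2 (trunc_L2 n f)))" for n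
    by (simp add: heisL_abs trunc_square_integrable fourier_L2_abs integrable_heis trunc_integrable
        square_integrable_heis fourier_integral_heis Plancherel)
  then show "(\<lambda>n. fourier_L2 (heisL x \<xi> (abs_L2 (trunc_L2 n f)))) \<longlonglongrightarrow> heisL \<xi> (- x) (fourier_L2 f)"
    by (simp add: tendsto_fourier_L2 tendsto_heisL trunc_tendsto)
qed

definition rho :: "real^('d::finite + 'd) \<Rightarrow> (real^'d) L2 \<Rightarrow> (real^'d) L2" where
  "rho z = heisL (pos z) (freq z)"

definition omega :: "real^('d::finite + 'd) \<Rightarrow> real^('d + 'd) \<Rightarrow> real" where
  "omega z w = pos z \<bullet> freq w - freq z \<bullet> pos w"

lemma matrix_inv_right: "invertible A \<Longrightarrow> A ** matrix_inv A = mat 1"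
  and matrix_inv_left: "invertible A \<Longrightarrow> matrix_inv A ** A = mat 1"
  unfolding invertible_def matrix_inv_def by (metis (mono_tags, lifting) someI_ex)+

lemma pos_nth [simp]: "pos z $ i = z $ Inl i" and freq_nth [simp]: "freq z $ i = z $ Inr i"
  by (simp_all add: pos_def freq_def)

lemma sum_UNIV_Plus:
  fixes f :: "'a::finite + 'b::finite \<Rightarrow> 'c::comm_monoid_add"
  shows "(\<Sum>k\<in>UNIV. f k) = (\<Sum>i\<in>UNIV. f (Inl i)) + (\<Sum>j\<in>UNIV. f (Inr j))"
  by (simp add: UNIV_Plus_UNIV[symmetric] sum.Plus del: UNIV_Plus_UNIV)

lemma pos_block: "pos (block_matrix A B C D *v z) = A *v pos z + B *v freq z"
  by (simp add: vec_eq_iff matrix_vector_mult_def block_matrix_def sum_UNIV_Plus)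

lemma freq_block: "freq (block_matrix A B C D *v z) = C *v pos z + D *v freq z"
  by (simp add: vec_eq_iff matrix_vector_mult_def block_matrix_def sum_UNIV_Plus)

lemma inner_phase: "z \<bullet> w = pos z \<bullet> pos w + freq z \<bullet> freq w"
  by (simp add: inner_vec_def sum_UNIV_Plus)

lemma inner_transpose: "(transpose A *v x) \<bullet> y = x \<bullet> (A *v y)"
  for A :: "real^'n^'m"
  by (simp add: dot_lmul_matrix[symmetric])

lemma minus_matrix_vector_mult: "(- A) *v x = - (A *v x)"
  for A :: "real^'n^'m"
  by (simp add: vec_eq_iff matrix_vector_mult_def sum_negf)

lemma linear_pos: "linear pos" and linear_freq: "linear freq"
  by (auto intro!: linearI simp: vec_eq_iff)

text \<open>The generators of the metaplectic group other than the Fourier transform are given on representatives. What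
  unitarity needs from such a formula is collected once, for chirps and dilations.\<close>

lemma pointwise_op:
  fixes T :: "'a::euclidean_space L2 \<Rightarrow> 'a L2" and t :: "('a \<Rightarrow> complex) \<Rightarrow> 'a \<Rightarrow> complex"
  assumes T: "\<And>f. T f = abs_L2 (t (rep_L2 f))"
    and sq: "\<And>f. square_integrable f \<Longrightarrow> square_integrable (t f)"
    and AE: "\<And>f g. AE x in lborel. f x = g x \<Longrightarrow> AE x in lborel. t f x = t g x"
    and add: "\<And>f g x. t (\<lambda>x. f x + g x) x = t f x + t g x"
    and scale: "\<And>c f x. t (\<lambda>x. c * f x) x = c * t f x"
    and int: "\<And>f. square_integrable f \<Longrightarrow> (LBINT x. (norm (t f x))\<^sup>2) = (LBINT x. (norm (f x))\<^sup>2)"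
  shows "square_integrable f \<Longrightarrow> T (abs_L2 f) = abs_L2 (t f)"
    and "T (u + v) = T u + T v" and "T (scaleC_L2 c u) = scaleC_L2 c (T u)" and "norm (T u) = norm u"
proof -
  show abs: "T (abs_L2 f) = abs_L2 (t f)" if "square_integrable f" for f
    unfolding T by (intro abs_L2_eqI sq that AE rep_abs_L2) auto
  have add': "t (\<lambda>x. f x + g x) = (\<lambda>x. t f x + t g x)" and scale': "t (\<lambda>x. c * f x) = (\<lambda>x. c * t f x)" for f g c
    by (rule ext, rule add) (rule ext, rule scale)
  have "T (abs_L2 (rep_L2 u) + abs_L2 (rep_L2 v)) = T (abs_L2 (rep_L2 u)) + T (abs_L2 (rep_L2 v))"
    by (simp only: abs_L2_add abs square_integrable_rep_L2 square_integrable_add sq add')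
  then show "T (u + v) = T u + T v" by simp
  have "T (scaleC_L2 c (abs_L2 (rep_L2 u))) = scaleC_L2 c (T (abs_L2 (rep_L2 u)))"
    by (simp only: abs_L2_scale abs square_integrable_rep_L2 square_integrable_scale sq scale')
  then show "T (scaleC_L2 c u) = scaleC_L2 c (T u)" by simp
  have "(norm (T u))\<^sup>2 = (norm u)\<^sup>2"
    unfolding T norm_abs_L2[OF sq[OF square_integrable_rep_L2]] int[OF square_integrable_rep_L2]
    by (simp add: norm_L2_square)
  then show "norm (T u) = norm u" by simp
qed

definition chirp_fun :: "real^'d::finite^'d \<Rightarrow> (real^'d \<Rightarrow> complex) \<Rightarrow> real^'d \<Rightarrow> complex" where
  "chirp_fun Q f x = cis (pi * ((Q *v x) \<bullet> x)) * f x"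

lemma chirp_square_integrable: "square_integrable f \<Longrightarrow> square_integrable (chirp_fun Q f)"
proof (rule square_integrable_bound)
  assume f: "square_integrable f"
  have [measurable]: "f \<in> borel_measurable borel" using f by (rule square_integrable_measurable)
  have [measurable]: "(\<lambda>x. (Q *v x) \<bullet> x) \<in> borel_measurable borel"
    by (intro borel_measurable_continuous_onI continuous_intros)
  show "chirp_fun Q f \<in> borel_measurable borel" unfolding chirp_fun_def[abs_def] by measurable
qed (auto simp: chirp_fun_def norm_mult)

lemma mp_chirp_abs: "square_integrable f \<Longrightarrow> mp_chirp Q (abs_L2 f) = abs_L2 (chirp_fun Q f)"
  and mp_chirp_add: "mp_chirp Q (u + v) = mp_chirp Q u + mp_chirp Q v"
  and mp_chirp_scale: "mp_chirp Q (scaleC_L2 c u) = scaleC_L2 c (mp_chirp Q u)"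
  and mp_chirp_norm: "norm (mp_chirp Q u) = norm u"
  by (rule pointwise_op[where t="chirp_fun Q"];
      auto simp: mp_chirp_def chirp_fun_def[abs_def] distrib_left norm_mult
           intro: chirp_square_integrable[unfolded chirp_fun_def[abs_def]] elim: eventually_mono)+

lemma unitary_chirp: "unitary_L2 (mp_chirp Q)"
proof (rule unitary_L2_I)
  fix g
  have "mp_chirp Q (abs_L2 (chirp_fun (- Q) (rep_L2 g))) = abs_L2 (chirp_fun Q (chirp_fun (- Q) (rep_L2 g)))"
    by (intro mp_chirp_abs chirp_square_integrable) simp
  also have "chirp_fun Q (chirp_fun (- Q) (rep_L2 g)) = rep_L2 g"
  proof
    fix x
    show "chirp_fun Q (chirp_fun (- Q) (rep_L2 g)) x = rep_L2 g x"
      by (simp add: chirp_fun_def minus_matrix_vector_mult mult.assoc[symmetric] cis_mult)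
  qed
  finally show "\<exists>f. mp_chirp Q f = g" by auto
qed (auto simp: mp_chirp_add mp_chirp_scale mp_chirp_norm)

lemma chirp_heisL:
  assumes Q: "transpose Q = Q"
  shows "mp_chirp Q (heisL x \<xi> f) = heisL x (Q *v x + \<xi>) (mp_chirp Q f)"
proof -
  have scaled: "pi * a + 2 * pi * b = 2 * pi * c + pi * d" if "a + 2 * b = 2 * c + d" for a b c d :: real
  proof -
    have "pi * (a + 2 * b) = pi * (2 * c + d)" using that by simp
    then show ?thesis by (simp add: algebra_simps)
  qed
  have eq: "chirp_fun Q (heis x \<xi> h) = heis x (Q *v x + \<xi>) (chirp_fun Q h)" for h
  proof
    fix y
    have s: "(Q *v y) \<bullet> x = (Q *v x) \<bullet> y"
      using inner_transpose[of Q y x] Q by (simp add: inner_commute)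
    have "(Q *v y) \<bullet> y + 2 * (\<xi> \<bullet> (y - x /\<^sub>R 2)) =
      2 * ((Q *v x + \<xi>) \<bullet> (y - x /\<^sub>R 2)) + (Q *v (y - x)) \<bullet> (y - x)"
      using s by (simp add: matrix_vector_mult_diff_distrib inner_diff_left inner_diff_right inner_add_left field_simps)
    then have "pi * ((Q *v y) \<bullet> y) + 2 * pi * (\<xi> \<bullet> (y - x /\<^sub>R 2)) =
      2 * pi * ((Q *v x + \<xi>) \<bullet> (y - x /\<^sub>R 2)) + pi * ((Q *v (y - x)) \<bullet> (y - x))"
      by (rule scaled)
    then show "chirp_fun Q (heis x \<xi> h) y = heis x (Q *v x + \<xi>) (chirp_fun Q h) y"
      by (simp only: chirp_fun_def heis_def mult.assoc[symmetric] cis_mult)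
  qed
  have "mp_chirp Q (heisL x \<xi> (abs_L2 (rep_L2 f))) = heisL x (Q *v x + \<xi>) (mp_chirp Q (abs_L2 (rep_L2 f)))"
    by (simp only: heisL_abs mp_chirp_abs square_integrable_rep_L2 square_integrable_heis chirp_square_integrable eq)
  then show ?thesis by simp
qed

lemma prod_Basis_cart: "(\<Prod>b\<in>(Basis :: (real^'d) set). g b) = (\<Prod>i\<in>UNIV. g (axis i 1))"
proof -
  have B: "(Basis :: (real^'d) set) = (\<lambda>i. axis i 1) ` UNIV" by (auto simp: Basis_vec_def)
  have "inj (\<lambda>i. axis i 1 :: real^'d)" by (auto simp: inj_def axis_eq_axis)
  then show ?thesis unfolding B by (subst prod.reindex) auto
qed

lemma linear_image_measurable:
  fixes E :: "real^'d^'d" shows "(*v) E \<in> borel_measurable borel"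
  by (intro borel_measurable_continuous_onI) (rule matrix_vector_mult_linear_continuous_on)

text \<open>A shear translates one coordinate by an amount that depends on the others only, so Fubini reduces
  its effect on integrals to translation invariance on the line.\<close>

lemma nn_integral_shear:
  fixes a c :: "'a::euclidean_space"
  assumes a: "a \<in> Basis" and c: "c \<in> Basis" and ac: "a \<noteq> c" and f [measurable]: "f \<in> borel_measurable borel"
  shows "(\<integral>\<^sup>+x. f (x + (x \<bullet> c) *\<^sub>R a) \<partial>lborel) = (\<integral>\<^sup>+x. f x \<partial>lborel)"
proof -
  interpret P: product_sigma_finite "\<lambda>_::'a. lborel :: real measure" ..
  define I where "I = Basis - {a}"
  have I: "finite I" "a \<notin> I" "insert a I = Basis" "c \<in> I" using a c ac by (auto simp: I_def)
  let ?M = "\<lambda>I. \<Pi>\<^sub>M b\<in>I. (lborel :: real measure)"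
  let ?h = "\<lambda>x. \<Sum>b\<in>(Basis::'a set). x b *\<^sub>R b"
  have h: "?h \<in> ?M Basis \<rightarrow>\<^sub>M borel" by measurable
  have D: "(\<integral>\<^sup>+x. k x \<partial>lborel) = (\<integral>\<^sup>+x. k (?h x) \<partial>?M Basis)" if "k \<in> borel_measurable borel" for k :: "'a \<Rightarrow> ennreal"
    by (subst lborel_eq, subst nn_integral_distr[OF h]) (use that in simp_all)
  have upd: "?h (x(a := y)) = y *\<^sub>R a + (\<Sum>b\<in>I. x b *\<^sub>R b)" for x y
  proof -
    have "?h (x(a := y)) = y *\<^sub>R a + (\<Sum>b\<in>I. (x(a := y)) b *\<^sub>R b)"
      unfolding I(3)[symmetric] using I(1,2) by (subst sum.insert) auto
    also have "(\<Sum>b\<in>I. (x(a := y)) b *\<^sub>R b) = (\<Sum>b\<in>I. x b *\<^sub>R b)"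
      using I(2) by (intro sum.cong) auto
    finally show ?thesis .
  qed
  have hc: "?h x \<bullet> c = x c" for x using c by simp
  have "(\<integral>\<^sup>+x. f (x + (x \<bullet> c) *\<^sub>R a) \<partial>lborel) = (\<integral>\<^sup>+x. f (?h x + x c *\<^sub>R a) \<partial>?M Basis)"
    by (subst D) (simp_all only: hc, measurable)
  also have "\<dots> = (\<integral>\<^sup>+x. f (?h x + x c *\<^sub>R a) \<partial>?M (insert a I))" by (simp only: I(3))
  also have "\<dots> = (\<integral>\<^sup>+x. (\<integral>\<^sup>+y. f (?h (x(a := y)) + (x(a := y)) c *\<^sub>R a) \<partial>lborel) \<partial>?M I)"
    using c by (intro P.product_nn_integral_insert I) (simp add: I(3), measurable)
  also have "\<dots> = (\<integral>\<^sup>+x. (\<integral>\<^sup>+y. f (?h (x(a := y))) \<partial>lborel) \<partial>?M I)"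
  proof (rule nn_integral_cong)
    fix x
    have [measurable]: "(\<lambda>y. f (y *\<^sub>R a + (\<Sum>b\<in>I. x b *\<^sub>R b))) \<in> borel_measurable borel" by measurable
    have "(\<integral>\<^sup>+y. f (?h (x(a := y)) + (x(a := y)) c *\<^sub>R a) \<partial>lborel) =
      (\<integral>\<^sup>+y. f ((y + x c) *\<^sub>R a + (\<Sum>b\<in>I. x b *\<^sub>R b)) \<partial>lborel)"
      unfolding upd using ac by (simp add: algebra_simps)
    also have "\<dots> = (\<integral>\<^sup>+y. f (y *\<^sub>R a + (\<Sum>b\<in>I. x b *\<^sub>R b)) \<partial>lborel)"
      by (rule nn_integral_translate[of "\<lambda>y. f (y *\<^sub>R a + (\<Sum>b\<in>I. x b *\<^sub>R b))"]) measurable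
    finally show "(\<integral>\<^sup>+y. f (?h (x(a := y)) + (x(a := y)) c *\<^sub>R a) \<partial>lborel) = (\<integral>\<^sup>+y. f (?h (x(a := y))) \<partial>lborel)"
      unfolding upd .
  qed
  also have "\<dots> = (\<integral>\<^sup>+x. f (?h x) \<partial>?M (insert a I))"
    by (intro P.product_nn_integral_insert[symmetric] I) (simp add: I(3))
  also have "\<dots> = (\<integral>\<^sup>+x. f x \<partial>lborel)"
    by (simp only: D[OF f] I(3))
  finally show ?thesis .
qed

lemma nn_integral_coordinate_swap:
  fixes f :: "real^'d \<Rightarrow> ennreal"
  assumes f [measurable]: "f \<in> borel_measurable borel" and p: "\<And>i. p (p i) = i"
  shows "(\<integral>\<^sup>+x. f (\<chi> i. x $ p i) \<partial>lborel) = (\<integral>\<^sup>+x. f x \<partial>lborel)"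
proof -
  let ?P = "\<lambda>x::real^'d. \<chi> i. x $ p i"
  have "linear ?P" by (rule linearI) (simp_all add: vec_eq_iff)
  then have [measurable]: "?P \<in> borel_measurable borel"
    by (intro borel_measurable_continuous_onI linear_continuous_on) (simp add: linear_conv_bounded_linear)
  have bij: "bij p" using p by (rule involuntory_imp_bij)
  have "lborel = distr lborel borel ?P"
  proof (rule lborel_eqI)
    fix l u :: "real^'d" assume lu: "\<And>b. b \<in> Basis \<Longrightarrow> l \<bullet> b \<le> u \<bullet> b"
    have lu': "l $ i \<le> u $ i" for i using lu[of "axis i 1"] by (simp add: inner_axis)
    have "?P -` box l u = box (?P l) (?P u)"
      by (auto simp: mem_box_cart) (metis p)+
    then have "emeasure (distr lborel borel ?P) (box l u) = emeasure lborel (box (?P l) (?P u))"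
      by (simp add: emeasure_distr)
    also have "\<dots> = (\<Prod>b\<in>Basis. (?P u - ?P l) \<bullet> b)"
      by (rule emeasure_lborel_box) (auto simp: Basis_vec_def inner_axis lu')
    also have "\<dots> = (\<Prod>i\<in>UNIV. u $ p i - l $ p i)"
      by (simp add: prod_Basis_cart inner_axis)
    also have "\<dots> = (\<Prod>i\<in>UNIV. u $ i - l $ i)"
      using prod.reindex_bij_betw[OF bij, of "\<lambda>i. u $ i - l $ i"] by simp
    finally show "emeasure (distr lborel borel ?P) (box l u) = (\<Prod>b\<in>Basis. (u - l) \<bullet> b)"
      by (simp add: prod_Basis_cart inner_axis)
  qed simp
  then have "(\<integral>\<^sup>+x. f x \<partial>lborel) = (\<integral>\<^sup>+x. f x \<partial>distr lborel borel ?P)" by simp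
  then show ?thesis by (simp add: nn_integral_distr)
qed

text \<open>Both sides are multiplicative in the matrix, and a matrix is a product of coordinate transpositions, shears, diagonal
  matrices and matrices with a zero row; the last do not occur in an invertible one.\<close>

lemma nn_integral_linear_image:
  fixes E :: "real^'d^'d"
  assumes E: "invertible E" and f: "f \<in> borel_measurable borel"
  shows "(\<integral>\<^sup>+x. f x \<partial>lborel) = ennreal \<bar>det E\<bar> * (\<integral>\<^sup>+x. f (E *v x) \<partial>lborel)"
proof -
  define P where "P = (\<lambda>A::real^'d^'d. det A \<noteq> 0 \<longrightarrow> (\<forall>f. f \<in> borel_measurable borel \<longrightarrow>
    (\<integral>\<^sup>+x. f x \<partial>lborel) = ennreal \<bar>det A\<bar> * (\<integral>\<^sup>+x. f (A *v x) \<partial>lborel)))"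
  have "P E"
  proof (rule induct_matrix_elementary_alt)
    fix A B assume A: "P A" and B: "P B"
    show "P (A ** B)" unfolding P_def
    proof (intro impI allI)
      fix f :: "real^'d \<Rightarrow> ennreal" assume "det (A ** B) \<noteq> 0" and f: "f \<in> borel_measurable borel"
      then have d: "det A \<noteq> 0" "det B \<noteq> 0" by (auto simp: det_mul)
      have "(\<lambda>x. f (A *v x)) \<in> borel_measurable borel"
        using measurable_compose[OF linear_image_measurable f] .
      then have "(\<integral>\<^sup>+x. f (A *v x) \<partial>lborel) = ennreal \<bar>det B\<bar> * (\<integral>\<^sup>+x. f (A *v (B *v x)) \<partial>lborel)"
        using B d(2) unfolding P_def by blast
      moreover have "(\<integral>\<^sup>+x. f x \<partial>lborel) = ennreal \<bar>det A\<bar> * (\<integral>\<^sup>+x. f (A *v x) \<partial>lborel)"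
        using A d(1) f unfolding P_def by blast
      ultimately show "(\<integral>\<^sup>+x. f x \<partial>lborel) = ennreal \<bar>det (A ** B)\<bar> * (\<integral>\<^sup>+x. f ((A ** B) *v x) \<partial>lborel)"
        by (simp only: det_mul abs_mult ennreal_mult abs_ge_zero mult.assoc matrix_vector_mul_assoc[symmetric])
    qed
  next
    fix A :: "real^'d^'d" and i assume "row i A = 0"
    then have "det A = 0" by (rule det_zero_row)
    then show "P A" by (simp add: P_def)
  next
    fix A :: "real^'d^'d" assume A: "\<And>i j. i \<noteq> j \<Longrightarrow> A $ i $ j = 0"
    have d: "det A = (\<Prod>i\<in>UNIV. A $ i $ i)" using A by (intro det_diagonal) auto
    show "P A" unfolding P_def
    proof (intro impI allI)
      fix f :: "real^'d \<Rightarrow> ennreal" assume d0: "det A \<noteq> 0" and f: "f \<in> borel_measurable borel"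
      define c where "c = (\<lambda>b::real^'d. (A *v b) \<bullet> b)"
      have ca: "c (axis i 1) = A $ i $ i" for i
        by (simp add: c_def inner_axis matrix_vector_mult_basis column_def)
      have c0: "c b \<noteq> 0" if "b \<in> Basis" for b
        using that d0 unfolding d by (auto simp: Basis_vec_def ca)
      have dc: "\<bar>det A\<bar> = (\<Prod>b\<in>Basis. \<bar>c b\<bar>)" unfolding d prod_Basis_cart ca by (rule abs_prod)
      have T: "0 + (\<Sum>b\<in>Basis. (c b * (x \<bullet> b)) *\<^sub>R b) = A *v x" for x
      proof (rule euclidean_eqI)
        fix b :: "real^'d" assume b: "b \<in> Basis"
        then obtain i where i: "b = axis i 1" by (auto simp: Basis_vec_def)
        have "(A *v x) $ i = (\<Sum>j\<in>UNIV. A $ i $ j * x $ j)" by (simp add: matrix_vector_mult_def)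
        also have "\<dots> = (\<Sum>j\<in>UNIV. if j = i then A $ i $ i * x $ i else 0)"
          by (rule sum.cong) (use A in auto)
        finally have "(A *v x) \<bullet> b = c b * (x \<bullet> b)" by (simp add: i ca inner_axis)
        then show "(0 + (\<Sum>b\<in>Basis. (c b * (x \<bullet> b)) *\<^sub>R b)) \<bullet> b = (A *v x) \<bullet> b" using b by simp
      qed
      have "(lborel :: (real^'d) measure) = density (distr lborel borel ((*v) A)) (\<lambda>_. ennreal \<bar>det A\<bar>)"
        using lborel_affine_euclidean[of c 0, OF c0] unfolding T dc .
      then have "(\<integral>\<^sup>+x. f x \<partial>lborel) = (\<integral>\<^sup>+x. f x \<partial>density (distr lborel borel ((*v) A)) (\<lambda>_. ennreal \<bar>det A\<bar>))"
        by simp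
      also have "\<dots> = ennreal \<bar>det A\<bar> * (\<integral>\<^sup>+x. f (A *v x) \<partial>lborel)"
        using f linear_image_measurable[of A]
        by (simp add: nn_integral_density nn_integral_distr nn_integral_cmult)
      finally show "(\<integral>\<^sup>+x. f x \<partial>lborel) = ennreal \<bar>det A\<bar> * (\<integral>\<^sup>+x. f (A *v x) \<partial>lborel)" .
    qed
  next
    fix m n :: 'd assume "m \<noteq> n"
    let ?p = "Transposition.transpose m n"
    let ?A = "(\<chi> i j. mat 1 $ i $ ?p j) :: real^'d^'d"
    have "\<bar>det ?A\<bar> = 1" by (simp add: det_permute_columns permutes_swap_id sign_swap_id abs_mult)
    moreover have "?A *v x = (\<chi> i. x $ ?p i)" for x
    proof -
      have "mat 1 $ i $ ?p j * x $ j = (if j = ?p i then x $ j else 0)" for i j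
        by (auto simp: mat_def)
      then show ?thesis by (simp add: vec_eq_iff matrix_vector_mult_def)
    qed
    ultimately show "P ?A" unfolding P_def by (simp add: nn_integral_coordinate_swap)
  next
    fix m n :: 'd assume mn: "m \<noteq> n"
    let ?A = "(\<chi> i j. of_bool (i = m \<and> j = n \<or> i = j)) :: real^'d^'d"
    have "?A = (\<chi> k. if k = m then row m (mat 1) + 1 *s row n (mat 1) else row k (mat 1))"
      using mn by (auto simp: vec_eq_iff row_def mat_def)
    then have "det ?A = 1" using det_row_operation[OF mn, of "mat 1 :: real^'d^'d" 1] by simp
    moreover have "?A *v x = x + (x \<bullet> axis n 1) *\<^sub>R axis m 1" for x
    proof -
      have "(?A *v x) $ i = (\<Sum>j\<in>UNIV. (if j = i then x $ j else 0) + (if j = n then if i = m then x $ j else 0 else 0))" for i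
        unfolding matrix_vector_mult_def using mn by (auto intro!: sum.cong)
      moreover have "(x + (x \<bullet> axis n 1) *\<^sub>R axis m 1) $ i = x $ i + (if i = m then x $ n else 0)" for i
        unfolding vector_add_component vector_scaleR_component inner_axis by (simp add: axis_def)
      ultimately show ?thesis by (simp only: vec_eq_iff) (simp add: sum.distrib)
    qed
    ultimately show "P ?A" unfolding P_def using mn
      by (simp add: nn_integral_shear axis_in_Basis_iff axis_eq_axis)
  qed
  then show ?thesis using E f by (simp add: P_def invertible_det_nz)
qed

definition dilation_fun :: "int \<Rightarrow> real^'d::finite^'d \<Rightarrow> (real^'d \<Rightarrow> complex) \<Rightarrow> real^'d \<Rightarrow> complex" where
  "dilation_fun m E f x = \<i> powi m * complex_of_real (sqrt \<bar>det E\<bar>) * f (E *v x)"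

lemma norm_i_powi: "norm (\<i> powi m) = 1"
  by (simp add: norm_power_int)

lemma dilation_nn:
  fixes E :: "real^'d^'d"
  assumes E: "invertible E" and f: "f \<in> borel_measurable borel"
  shows "(\<integral>\<^sup>+x. ennreal ((norm (dilation_fun m E f x))\<^sup>2) \<partial>lborel) = (\<integral>\<^sup>+x. ennreal ((norm (f x))\<^sup>2) \<partial>lborel)"
proof -
  note [measurable] = f linear_image_measurable[of E]
  have "(\<integral>\<^sup>+x. ennreal ((norm (dilation_fun m E f x))\<^sup>2) \<partial>lborel) =
     (\<integral>\<^sup>+x. ennreal \<bar>det E\<bar> * ennreal ((norm (f (E *v x)))\<^sup>2) \<partial>lborel)"
    by (intro nn_integral_cong)
       (simp add: dilation_fun_def norm_mult norm_i_powi power_mult_distrib flip: ennreal_mult')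
  also have "\<dots> = (\<integral>\<^sup>+x. ennreal ((norm (f x))\<^sup>2) \<partial>lborel)"
    by (simp add: nn_integral_cmult nn_integral_linear_image[OF E, of "\<lambda>x. ennreal ((norm (f x))\<^sup>2)"])
  finally show ?thesis .
qed

lemma dilation_square_integrable:
  fixes E :: "real^'d^'d"
  assumes E: "invertible E" and f: "square_integrable f"
  shows "square_integrable (dilation_fun m E f)"
proof -
  note [measurable] = square_integrable_measurable[OF f] linear_image_measurable[of E]
  have "dilation_fun m E f \<in> borel_measurable borel" unfolding dilation_fun_def[abs_def] by measurable
  then show ?thesis using f by (simp add: square_integrable_nn dilation_nn E)
qed

lemma AE_linear_image:
  fixes E :: "real^'d^'d"
  assumes E: "invertible E" and ae: "AE x in lborel. P x"
  shows "AE x in lborel. P (E *v x)"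
proof -
  from ae obtain N where N: "N \<in> null_sets lborel" "{x. \<not> P x} \<subseteq> N"
    by (auto simp: eventually_ae_filter)
  have [measurable]: "N \<in> sets borel" using N by (auto dest: null_setsD2)
  note linear_image_measurable[of E, measurable]
  have "ennreal \<bar>det E\<bar> * (\<integral>\<^sup>+x. indicator N (E *v x) \<partial>lborel) = emeasure lborel N"
    by (subst nn_integral_linear_image[OF E, symmetric]) auto
  then have "(\<integral>\<^sup>+x. indicator N (E *v x) \<partial>lborel) = 0" using N E by (auto simp: invertible_det_nz)
  then have "AE x in lborel. indicator N (E *v x) = (0::ennreal)"
    by (subst (asm) nn_integral_0_iff_AE) auto
  then show ?thesis
    by eventually_elim (use N in \<open>auto split: split_indicator_asm\<close>)
qed

lemma
  fixes E :: "real^'d^'d"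
  assumes E: "invertible E"
  shows mp_dilation_abs: "square_integrable f \<Longrightarrow> mp_dilation m E (abs_L2 f) = abs_L2 (dilation_fun m E f)"
    and mp_dilation_add: "mp_dilation m E (u + v) = mp_dilation m E u + mp_dilation m E v"
    and mp_dilation_scale: "mp_dilation m E (scaleC_L2 c u) = scaleC_L2 c (mp_dilation m E u)"
    and mp_dilation_norm: "norm (mp_dilation m E u) = norm u"
proof -
  have 1: "mp_dilation m E f = abs_L2 (dilation_fun m E (rep_L2 f))" for f
    by (simp add: mp_dilation_def dilation_fun_def[abs_def])
  have 2: "AE x in lborel. dilation_fun m E f x = dilation_fun m E g x" if "AE x in lborel. f x = g x" for f g
    using AE_linear_image[OF E that] by eventually_elim (simp add: dilation_fun_def)
  have 3: "dilation_fun m E (\<lambda>x. f x + g x) x = dilation_fun m E f x + dilation_fun m E g x"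
    "dilation_fun m E (\<lambda>x. c * f x) x = c * dilation_fun m E f x" for f g x c
    by (simp_all add: dilation_fun_def algebra_simps)
  have 4: "(LBINT x. (norm (dilation_fun m E f x))\<^sup>2) = (LBINT x. (norm (f x))\<^sup>2)" if "square_integrable f" for f
  proof -
    have [measurable]: "f \<in> borel_measurable borel" "dilation_fun m E f \<in> borel_measurable borel"
      using that dilation_square_integrable[OF E that] by (auto dest: square_integrable_measurable)
    show ?thesis
      by (simp add: integral_eq_nn_integral dilation_nn E)
  qed
  note P = pointwise_op[of "mp_dilation m E" "dilation_fun m E", OF 1 dilation_square_integrable[OF E] 2 3 4]
  show "square_integrable f \<Longrightarrow> mp_dilation m E (abs_L2 f) = abs_L2 (dilation_fun m E f)" by (rule P(1))
  show "mp_dilation m E (u + v) = mp_dilation m E u + mp_dilation m E v" by (rule P(2))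
  show "mp_dilation m E (scaleC_L2 c u) = scaleC_L2 c (mp_dilation m E u)" by (rule P(3))
  show "norm (mp_dilation m E u) = norm u" by (rule P(4))
qed

lemma unitary_dilation:
  fixes E :: "real^'d^'d"
  assumes E: "invertible E"
  shows "unitary_L2 (mp_dilation m E)"
proof (rule unitary_L2_I)
  fix g :: "(real^'d) L2"
  define F where "F = matrix_inv E"
  have EF: "E ** F = mat 1" "F ** E = mat 1"
    using E by (auto simp: F_def matrix_inv_left matrix_inv_right)
  then have F: "invertible F" unfolding invertible_def by blast
  have dE: "\<bar>det E\<bar> * \<bar>det F\<bar> = 1"
    using det_mul[of E F] EF by (simp flip: abs_mult)
  have "mp_dilation m E (abs_L2 (dilation_fun (- m) F (rep_L2 g))) = abs_L2 (dilation_fun m E (dilation_fun (- m) F (rep_L2 g)))"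
    by (intro mp_dilation_abs dilation_square_integrable E F) simp
  also have "dilation_fun m E (dilation_fun (- m) F (rep_L2 g)) = rep_L2 g"
  proof
    fix x
    have "\<i> powi m * \<i> powi (- m) = 1" by (simp add: power_int_minus)
    moreover have "complex_of_real (sqrt \<bar>det E\<bar>) * complex_of_real (sqrt \<bar>det F\<bar>) = 1"
      using dE by (simp flip: of_real_mult real_sqrt_mult)
    moreover have "dilation_fun m E (dilation_fun (- m) F (rep_L2 g)) x =
      (\<i> powi m * \<i> powi (- m)) * (complex_of_real (sqrt \<bar>det E\<bar>) * complex_of_real (sqrt \<bar>det F\<bar>)) * rep_L2 g x"
      using EF by (simp add: dilation_fun_def matrix_vector_mul_assoc)
    ultimately show "dilation_fun m E (dilation_fun (- m) F (rep_L2 g)) x = rep_L2 g x" by simp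
  qed
  finally show "\<exists>f. mp_dilation m E f = g" by auto
qed (auto simp: mp_dilation_add mp_dilation_scale mp_dilation_norm E)

lemma dilation_heisL:
  fixes E :: "real^'d^'d"
  assumes E: "invertible E"
  shows "mp_dilation m E (heisL x \<xi> f) = heisL (matrix_inv E *v x) (transpose E *v \<xi>) (mp_dilation m E f)"
proof -
  have eq: "dilation_fun m E (heis x \<xi> h) = heis (matrix_inv E *v x) (transpose E *v \<xi>) (dilation_fun m E h)" for h
  proof
    fix y
    have Ex: "E *v (matrix_inv E *v x) = x" using E by (simp add: matrix_vector_mul_assoc matrix_inv_right)
    have "(transpose E *v \<xi>) \<bullet> (y - (matrix_inv E *v x) /\<^sub>R 2) = \<xi> \<bullet> (E *v y - x /\<^sub>R 2)"
      unfolding inner_transpose by (simp add: matrix_vector_mult_diff_distrib Ex matrix_vector_mult_scaleR)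
    moreover have "E *v (y - matrix_inv E *v x) = E *v y - x"
      by (simp add: matrix_vector_mult_diff_distrib Ex)
    ultimately show "dilation_fun m E (heis x \<xi> h) y = heis (matrix_inv E *v x) (transpose E *v \<xi>) (dilation_fun m E h) y"
      by (simp only: dilation_fun_def heis_def mult_ac)
  qed
  have "mp_dilation m E (heisL x \<xi> (abs_L2 (rep_L2 f))) =
    heisL (matrix_inv E *v x) (transpose E *v \<xi>) (mp_dilation m E (abs_L2 (rep_L2 f)))"
    by (simp only: heisL_abs mp_dilation_abs[OF E] square_integrable_rep_L2 square_integrable_heis
        dilation_square_integrable[OF E] eq)
  then show ?thesis by simp
qed

lemma omega_nondegenerate: "(\<And>w. omega z w = 0) \<Longrightarrow> z = 0"
proof -
  assume *: "\<And>w. omega z w = 0"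
  define w :: "real^('a + 'a)" where "w = (\<chi> k. case k of Inl i \<Rightarrow> - freq z $ i | Inr i \<Rightarrow> pos z $ i)"
  have "pos w = - freq z" "freq w = pos z" by (simp_all add: vec_eq_iff w_def)
  then have "omega z w = z \<bullet> z" by (simp add: omega_def inner_phase)
  with *[of w] show "z = 0" by simp
qed

text \<open>A vector in the kernel would be \<open>omega\<close>-orthogonal to everything.\<close>

lemma omega_invariant_invertible:
  fixes V :: "real^('d::finite + 'd)^('d + 'd)"
  assumes "\<And>z w. omega (V *v z) (V *v w) = omega z w"
  shows "invertible V"
proof -
  have "inj ((*v) V)"
  proof (rule injI)
    fix x y assume "V *v x = V *v y"
    then have z: "V *v (x - y) = 0" by (simp add: matrix_vector_mult_diff_distrib)
    have "omega (x - y) w = 0" for w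
      using assms[of "x - y" w] z by (simp add: omega_def vec_eq_iff inner_vec_def)
    then show "x = y" using omega_nondegenerate[of "x - y"] by simp
  qed
  then show ?thesis by (simp add: invertible_left_inverse matrix_left_invertible_injective)
qed

text \<open>Exact covariance of phase-space shifts. The midpoint normalisation of the shifts makes it true for each generator,
  and it is inherited by compositions and inverses; so is the invariance of the symplectic form.\<close>

theorem mp_projection_covariance:
  assumes "mp_projection U V"
  shows "unitary_L2 U" and "\<And>z w. omega (V *v z) (V *v w) = omega z w"
    and "\<And>z f. U (rho z f) = rho (V *v z) (U f)"
proof -
  from assms have "unitary_L2 U \<and> (\<forall>z w. omega (V *v z) (V *v w) = omega z w) \<and>
    (\<forall>z f. U (rho z f) = rho (V *v z) (U f))"
  proof induction
    case fourier
    have "cmod (\<i> powr (- of_nat CARD('a) / 2)) = 1"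
      by (simp add: powr_def norm_exp_eq_Re)
    from unitary_comp[OF unitary_scale[OF this] unitary_fourier_L2]
    have "unitary_L2 (mp_fourier :: (real^'a) L2 \<Rightarrow> _)" by (simp add: mp_fourier_def[abs_def] comp_def)
    moreover have "omega (block_matrix 0 (mat 1) (- mat 1) 0 *v z) (block_matrix 0 (mat 1) (- mat 1) 0 *v w) = omega z w"
      and "mp_fourier (rho z f) = rho (block_matrix 0 (mat 1) (- mat 1) 0 *v z) (mp_fourier f)" for z w :: "real^('a + 'a)" and f
      by (auto simp: omega_def pos_block freq_block rho_def mp_fourier_def fourier_L2_heisL heisL_scale inner_commute
          minus_matrix_vector_mult)
    ultimately show ?case by blast
  next
    case (chirp Q)
    have "(Q *v x) \<bullet> y = x \<bullet> (Q *v y)" for x y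
      using inner_transpose[of Q x y] chirp by simp
    then show ?case
      by (auto simp: unitary_chirp omega_def pos_block freq_block rho_def chirp_heisL[OF chirp] inner_add_left inner_add_right)
  next
    case (dilation E m)
    have "(matrix_inv E *v x) \<bullet> (transpose E *v y) = x \<bullet> y" "(transpose E *v y) \<bullet> (matrix_inv E *v x) = y \<bullet> x" for x y
    proof -
      show "(transpose E *v y) \<bullet> (matrix_inv E *v x) = y \<bullet> x"
        unfolding inner_transpose using dilation by (simp add: matrix_vector_mul_assoc matrix_inv_right)
      then show "(matrix_inv E *v x) \<bullet> (transpose E *v y) = x \<bullet> y" by (simp add: inner_commute)
    qed
    then show ?case
      by (auto simp: unitary_dilation dilation omega_def pos_block freq_block rho_def dilation_heisL)
  next
    case (compose U V U' V')
    then show ?case by (simp add: unitary_comp[unfolded comp_def] comp_def matrix_vector_mul_assoc[symmetric])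
  next
    case (inverse U V)
    have "invertible V" using inverse by (intro omega_invariant_invertible) auto
    then have VW: "V *v (matrix_inv V *v z) = z" for z
      by (simp add: matrix_vector_mul_assoc matrix_inv_right)
    have b: "bij U" using inverse by (simp add: unitary_L2_def)
    have [simp]: "U (inv U f) = f" "inv U (U f) = f" for f
      using b by (auto simp: bij_def surj_f_inv_f inv_f_f)
    have "omega (matrix_inv V *v z) (matrix_inv V *v w) = omega z w" for z w
    proof -
      have "omega (V *v (matrix_inv V *v z)) (V *v (matrix_inv V *v w)) = omega (matrix_inv V *v z) (matrix_inv V *v w)"
        using inverse.IH by blast
      then show ?thesis by (simp only: VW)
    qed
    moreover have "inv U (rho z f) = rho (matrix_inv V *v z) (inv U f)" for z f
    proof -
      have "U (rho (matrix_inv V *v z) (inv U f)) = rho z f" using inverse.IH by (simp add: VW)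
      then have "inv U (rho z f) = inv U (U (rho (matrix_inv V *v z) (inv U f)))" by (simp only:)
      then show ?thesis by simp
    qed
    ultimately show ?case using inverse by (auto intro: unitary_inv)
  qed
  then show "unitary_L2 U" and "\<And>z w. omega (V *v z) (V *v w) = omega z w"
    and "\<And>z f. U (rho z f) = rho (V *v z) (U f)" by blast+
qed

section \<open>Atomic contractions in dimension one\<close>

text \<open>The modulation variable \<open>a\<close> occurs only in the phase, so that integrating it out is a Gaussian Fourier integral.
  What remains is an integral over the translations \<open>b\<close> alone, with an additional Gaussian factor.\<close>

lemma phase_average_1d:
  fixes f g :: "real \<Rightarrow> complex"
  assumes f: "f \<in> borel_measurable borel" and f1: "\<And>y. norm (f y) \<le> 1" and g: "integrable lborel g"
  shows "(LBINT b. (LBINT a. complex_of_real (exp (- pi * a\<^sup>2)) * complex_of_real (exp (- pi * b\<^sup>2)) *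
        (LBINT y. heis (- (t * b)) (s * a) f y * cnj (g y)))) =
    (LBINT y. (LBINT b. complex_of_real (exp (- pi * b\<^sup>2) * exp (- pi * (s * (y + t * b / 2))\<^sup>2)) * f (y + t * b)) * cnj (g y))"
proof -
  note [measurable] = f borel_measurable_integrable[OF g]
  have gm [measurable]: "g \<in> borel_measurable borel" using borel_measurable_integrable[OF g] by simp
  define e where "e = (\<lambda>a::real. exp (- pi * a\<^sup>2))"
  have [measurable]: "e \<in> borel_measurable borel" by (simp add: e_def)
  have e: "integrable lborel e" unfolding e_def by (rule gaussian_fourier_real(1))
  have ep: "e a > 0" "e a \<le> 1" for a by (auto simp: e_def)
  have bnd: "(LBINT y. norm (k y * cnj (g y))) \<le> (LBINT y. norm (g y))"
    and int: "integrable lborel (\<lambda>y. k y * cnj (g y))"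
    if [measurable]: "k \<in> borel_measurable borel" and "\<And>y. norm (k y) \<le> 1" for k :: "real \<Rightarrow> complex"
  proof -
    show i: "integrable lborel (\<lambda>y. k y * cnj (g y))"
      by (rule integrable_dominated[OF g]) (auto simp: norm_mult that intro!: mult_left_le_one_le)
    show "(LBINT y. norm (k y * cnj (g y))) \<le> (LBINT y. norm (g y))"
      using i g by (intro integral_mono integrable_norm) (auto simp: norm_mult that intro!: mult_left_le_one_le)
  qed
  have hm: "(\<lambda>(a, y). heis (- (t * b)) (s * a) f y) \<in> borel_measurable (borel \<Otimes>\<^sub>M borel)" for b
    unfolding heis_def by measurable
  have h1: "norm (heis x \<xi> f y) \<le> 1" for x \<xi> y by (simp add: norm_heis f1)
  have inner: "(LBINT a. complex_of_real (e a) * heis (- (t * b)) (s * a) f y) =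
    complex_of_real (exp (- pi * (s * (y + t * b / 2))\<^sup>2)) * f (y + t * b)" for b y
  proof -
    have "(LBINT a. complex_of_real (e a) * heis (- (t * b)) (s * a) f y) =
      (LBINT a. (complex_of_real (e a) * cis (2 * pi * (a * (s * (y + t * b / 2))))) * f (y + t * b))"
      by (intro lebesgue_cong refl) (simp add: heis_def mult_ac)
    then show ?thesis unfolding e_def by (simp only: integral_mult_left_zero gaussian_fourier_real(2))
  qed
  have "(LBINT b. (LBINT a. complex_of_real (e a) * complex_of_real (e b) * (LBINT y. heis (- (t * b)) (s * a) f y * cnj (g y)))) =
    (LBINT b. (LBINT y. complex_of_real (e b) * (complex_of_real (exp (- pi * (s * (y + t * b / 2))\<^sup>2)) * f (y + t * b)) * cnj (g y)))"
  proof (rule lebesgue_cong[OF refl])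
    fix b
    have "(LBINT a. complex_of_real (e a) * complex_of_real (e b) * (LBINT y. heis (- (t * b)) (s * a) f y * cnj (g y))) =
      (LBINT a. (LBINT y. complex_of_real (e a) * complex_of_real (e b) * (heis (- (t * b)) (s * a) f y * cnj (g y))))"
      by simp
    also have "\<dots> = (LBINT y. (LBINT a. complex_of_real (e a) * complex_of_real (e b) * (heis (- (t * b)) (s * a) f y * cnj (g y))))"
    proof (rule integral_swap[where a="\<lambda>a. e a * (LBINT y. norm (g y))"])
      show "integrable lborel (\<lambda>a. e a * (LBINT y. norm (g y)))" using e by simp
      show "integrable lborel (\<lambda>y. complex_of_real (e a) * complex_of_real (e b) * (heis (- (t * b)) (s * a) f y * cnj (g y)))" for a
        using int[OF heis_measurable[OF f] h1] by simp
      have "(LBINT y. norm (heis (- (t * b)) (s * a) f y * cnj (g y))) \<le> (LBINT y. norm (g y))" for a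
        by (rule bnd[OF heis_measurable[OF f] h1])
      then have "e a * (e b * (LBINT y. norm (heis (- (t * b)) (s * a) f y * cnj (g y)))) \<le> e a * (1 * (LBINT y. norm (g y)))" for a
        using ep by (intro mult_left_mono mult_mono) (auto simp: less_imp_le)
      then show "(LBINT y. norm (complex_of_real (e a) * complex_of_real (e b) * (heis (- (t * b)) (s * a) f y * cnj (g y))))
         \<le> e a * (LBINT y. norm (g y))" for a
        using ep by (simp add: norm_mult less_imp_le mult.assoc)
      show "(\<lambda>(a, y). complex_of_real (e a) * complex_of_real (e b) * (heis (- (t * b)) (s * a) f y * cnj (g y))) \<in> borel_measurable (borel \<Otimes>\<^sub>M borel)"
        using hm[of b] unfolding split_beta' by measurable
    qed
    also have "\<dots> = (LBINT y. complex_of_real (e b) * (LBINT a. complex_of_real (e a) * heis (- (t * b)) (s * a) f y) * cnj (g y))"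
      by (simp add: mult_ac flip: integral_mult_right_zero)
    finally show "(LBINT a. complex_of_real (e a) * complex_of_real (e b) * (LBINT y. heis (- (t * b)) (s * a) f y * cnj (g y))) =
      (LBINT y. complex_of_real (e b) * (complex_of_real (exp (- pi * (s * (y + t * b / 2))\<^sup>2)) * f (y + t * b)) * cnj (g y))"
      by (simp only: inner)
  qed
  also have "\<dots> = (LBINT y. (LBINT b. complex_of_real (e b) * (complex_of_real (exp (- pi * (s * (y + t * b / 2))\<^sup>2)) * f (y + t * b)) * cnj (g y)))"
  proof (rule integral_swap[where a="\<lambda>b. e b * (LBINT y. norm (g y))"])
    show "integrable lborel (\<lambda>b. e b * (LBINT y. norm (g y)))" using e by simp
    define k where "k = (\<lambda>b y. complex_of_real (exp (- pi * (s * (y + t * b / 2))\<^sup>2)) * f (y + t * b))"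
    have k [measurable]: "k b \<in> borel_measurable borel" for b unfolding k_def by measurable
    have k1: "norm (k b y) \<le> 1" for b y
      unfolding k_def norm_mult by (intro mult_le_one f1) auto
    show "integrable lborel (\<lambda>y. complex_of_real (e b) * (complex_of_real (exp (- pi * (s * (y + t * b / 2))\<^sup>2)) * f (y + t * b)) * cnj (g y))" for b
      using int[OF k k1, of b] by (simp add: k_def mult.assoc)
    have "e b * (LBINT y. norm (k b y * cnj (g y))) \<le> e b * (LBINT y. norm (g y))" for b
      using ep bnd[OF k k1] by (intro mult_left_mono) (auto simp: less_imp_le)
    then show "(LBINT y. norm (complex_of_real (e b) * (complex_of_real (exp (- pi * (s * (y + t * b / 2))\<^sup>2)) * f (y + t * b)) * cnj (g y)))
       \<le> e b * (LBINT y. norm (g y))" for b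
      using ep by (simp add: norm_mult less_imp_le mult.assoc k_def)
  qed measurable
  also have "\<dots> = (LBINT y. (LBINT b. complex_of_real (e b * exp (- pi * (s * (y + t * b / 2))\<^sup>2)) * f (y + t * b)) * cnj (g y))"
    by (intro lebesgue_cong refl, subst integral_mult_left_zero[symmetric]) (simp add: mult.assoc)
  finally show ?thesis by (simp only: e_def)
qed

text \<open>The average of \<open>heis (- t b) (s a) f\<close> with respect to \<open>exp (- \<pi> (a\<^sup>2 + b\<^sup>2)) da db\<close>, with the integral over \<open>a\<close>
  already carried out.\<close>

definition shift_average :: "real \<Rightarrow> real \<Rightarrow> (real \<Rightarrow> complex) \<Rightarrow> real \<Rightarrow> complex" where
  "shift_average s t f y =
     (LBINT b. complex_of_real (exp (- pi * b\<^sup>2) * exp (- pi * (s * (y + t * b / 2))\<^sup>2)) * f (y + t * b))"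

lemma gaussian_integral_real: "(LBINT b. exp (- pi * b\<^sup>2)) = (1::real)"
  using gaussian_integral[where 'a=real] by simp

lemma shift_average_Gauss:
  assumes "\<alpha> \<ge> 0"
  shows "shift_average (sqrt \<alpha>) 0 f y = complex_of_real (exp (- pi * \<alpha> * y\<^sup>2)) * f y"
proof -
  have "shift_average (sqrt \<alpha>) 0 f y = (LBINT b. complex_of_real (exp (- pi * b\<^sup>2)) * (complex_of_real (exp (- pi * (\<alpha> * y\<^sup>2))) * f y))"
    unfolding shift_average_def using assms by (simp add: power_mult_distrib mult.assoc)
  also have "\<dots> = complex_of_real (LBINT b. exp (- pi * b\<^sup>2)) * (complex_of_real (exp (- pi * (\<alpha> * y\<^sup>2))) * f y)"
    by (simp flip: integral_complex_of_real)
  also have "\<dots> = complex_of_real (exp (- pi * \<alpha> * y\<^sup>2)) * f y"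
    unfolding gaussian_integral_real by (simp add: mult.assoc)
  finally show ?thesis .
qed

text \<open>The quadratic forms in the two integral kernels for the Hermite operator, the one from the average of shifts and the
  one from its definition, agree; here \<open>h = \<theta>/2\<close>, and the reason is the duplication formulas for \<open>sinh\<close> and \<open>cosh\<close>.\<close>

lemma Mehler_exponent:
  fixes h x y :: real
  assumes h: "h > 0"
  shows "(y - x)\<^sup>2 / (2 * tanh h) + 2 * tanh h * ((x + y) / 2)\<^sup>2 =
    tanh (2 * h) * x\<^sup>2 + (x / cosh (2 * h) - y)\<^sup>2 / tanh (2 * h)"
proof -
  define c where "c = cosh h"
  define s where "s = sinh h"
  have c: "c > 0" and s: "s > 0" using h by (auto simp: c_def s_def)
  have cs: "c\<^sup>2 = s\<^sup>2 + 1" unfolding c_def s_def using cosh_square_eq[of h] by simp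
  have t: "tanh h = s / c" by (simp add: tanh_def c_def s_def)
  define C where "C = c\<^sup>2 + s\<^sup>2"
  have C: "cosh (2 * h) = C" by (simp add: cosh_double C_def c_def s_def)
  have S: "sinh (2 * h) = 2 * s * c" by (simp add: sinh_double c_def s_def)
  have T: "tanh (2 * h) = 2 * s * c / C" by (simp add: tanh_def C S)
  have Cp: "C > 0" using c by (simp add: C_def add_pos_nonneg)
  have C2: "C\<^sup>2 = 4 * s\<^sup>2 * c\<^sup>2 + 1"
  proof -
    have C': "C = 2 * s\<^sup>2 + 1" by (simp add: C_def cs)
    show ?thesis unfolding C' cs by (simp add: power2_eq_square algebra_simps)
  qed
  have "(y - x)\<^sup>2 / (2 * (s / c)) + 2 * (s / c) * ((x + y) / 2)\<^sup>2 = (c\<^sup>2 * (y - x)\<^sup>2 + s\<^sup>2 * (x + y)\<^sup>2) / (2 * s * c)"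
    using c s by (simp add: field_simps power2_eq_square)
  also have "c\<^sup>2 * (y - x)\<^sup>2 + s\<^sup>2 * (x + y)\<^sup>2 = C * (x\<^sup>2 + y\<^sup>2) - 2 * x * y"
    unfolding C_def cs by (simp add: power2_eq_square algebra_simps)
  finally have L: "(y - x)\<^sup>2 / (2 * (s / c)) + 2 * (s / c) * ((x + y) / 2)\<^sup>2 = (C * (x\<^sup>2 + y\<^sup>2) - 2 * x * y) / (2 * s * c)" .
  have "2 * s * c / C * x\<^sup>2 + (x / C - y)\<^sup>2 / (2 * s * c / C) =
    ((4 * s\<^sup>2 * c\<^sup>2 + 1) * x\<^sup>2 + C\<^sup>2 * y\<^sup>2 - 2 * C * x * y) / (C * (2 * s * c))"
    using c s Cp by (simp add: field_simps power2_eq_square)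
  also have "(4 * s\<^sup>2 * c\<^sup>2 + 1) * x\<^sup>2 + C\<^sup>2 * y\<^sup>2 - 2 * C * x * y = C * (C * (x\<^sup>2 + y\<^sup>2) - 2 * x * y)"
    unfolding C2[symmetric] by (simp add: power2_eq_square algebra_simps)
  also have "C * (C * (x\<^sup>2 + y\<^sup>2) - 2 * x * y) / (C * (2 * s * c)) = (C * (x\<^sup>2 + y\<^sup>2) - 2 * x * y) / (2 * s * c)"
    using Cp by simp
  finally show ?thesis unfolding t C T L by simp
qed

text \<open>Mehler's formula: an affine change of variables turns the average of shifts into the Gaussian convolution that the
  defining formula of the Hermite operator reduces to.\<close>

lemma shift_average_Hermite:
  fixes f :: "real \<Rightarrow> complex"
  assumes \<theta>: "\<theta> > 0" and f: "integrable lborel f"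
  shows "complex_of_real (inverse (cosh (\<theta> / 2))) * shift_average (sqrt (2 * tanh (\<theta> / 2))) (sqrt (2 * tanh (\<theta> / 2))) f x =
    complex_of_real (cosh \<theta> powr (- 1 / 2)) * (complex_of_real (exp (- pi * (tanh \<theta> * x\<^sup>2))) *
      (LBINT u. f (x / cosh \<theta> - sqrt (tanh \<theta>) * u) * complex_of_real (exp (- pi * u\<^sup>2))))"
proof -
  have fm [measurable]: "f \<in> borel_measurable borel" using borel_measurable_integrable[OF f] by simp
  define h where "h = \<theta> / 2"
  have h: "h > 0" "\<theta> = 2 * h" using \<theta> by (auto simp: h_def)
  define r where "r = sqrt (2 * tanh h)"
  have r: "r > 0" "r\<^sup>2 = 2 * tanh h" using h by (auto simp: r_def)
  define \<epsilon> where "\<epsilon> = sqrt (tanh \<theta>)"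
  have e: "\<epsilon> > 0" "\<epsilon>\<^sup>2 = tanh \<theta>" using \<theta> by (auto simp: \<epsilon>_def)
  let ?M = "\<lambda>y. complex_of_real (exp (- pi * ((y - x)\<^sup>2 / (2 * tanh h) + 2 * tanh h * ((x + y) / 2)\<^sup>2))) * f y"
  have "(LBINT y. ?M y) = \<bar>r\<bar> *\<^sub>R (LBINT b. ?M (x + r * b))"
    by (rule lborel_integral_real_affine) (use r in auto)
  also have "(LBINT b. ?M (x + r * b)) = shift_average r r f x"
    unfolding shift_average_def
  proof (intro lebesgue_cong refl)
    fix b
    have "(x + r * b - x)\<^sup>2 / (2 * tanh h) + 2 * tanh h * ((x + (x + r * b)) / 2)\<^sup>2 = b\<^sup>2 + (r * (x + r * b / 2))\<^sup>2"
      unfolding r(2)[symmetric] using r(1) by (simp add: power2_eq_square field_simps)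
    then have "- pi * ((x + r * b - x)\<^sup>2 / (2 * tanh h) + 2 * tanh h * ((x + (x + r * b)) / 2)\<^sup>2) = - pi * b\<^sup>2 + - pi * (r * (x + r * b / 2))\<^sup>2"
      by (simp only: distrib_left)
    then show "?M (x + r * b) = complex_of_real (exp (- pi * b\<^sup>2) * exp (- pi * (r * (x + r * b / 2))\<^sup>2)) * f (x + r * b)"
      by (simp only: exp_add)
  qed
  finally have A: "shift_average r r f x = complex_of_real (inverse r) * (LBINT y. ?M y)"
    using r by (simp add: scaleR_conv_of_real field_simps)
  let ?N = "\<lambda>y. complex_of_real (exp (- pi * (tanh \<theta> * x\<^sup>2 + (x / cosh \<theta> - y)\<^sup>2 / tanh \<theta>))) * f y"
  have MN: "(LBINT y. ?M y) = (LBINT y. ?N y)"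
    using Mehler_exponent[OF h(1), of _ x] by (simp add: h(2))
  have "(LBINT y. ?N y) = \<bar>- \<epsilon>\<bar> *\<^sub>R (LBINT u. ?N (x / cosh \<theta> + (- \<epsilon>) * u))"
    by (rule lborel_integral_real_affine) (use e in auto)
  also have "(LBINT u. ?N (x / cosh \<theta> + (- \<epsilon>) * u)) =
    (LBINT u. complex_of_real (exp (- pi * (tanh \<theta> * x\<^sup>2))) * (f (x / cosh \<theta> - \<epsilon> * u) * complex_of_real (exp (- pi * u\<^sup>2))))"
  proof (intro lebesgue_cong refl)
    fix u
    have "- pi * (tanh \<theta> * x\<^sup>2 + (x / cosh \<theta> - (x / cosh \<theta> + (- \<epsilon>) * u))\<^sup>2 / tanh \<theta>) = - pi * (tanh \<theta> * x\<^sup>2) + - pi * u\<^sup>2"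
      unfolding e(2)[symmetric] using e(1) by (simp add: power_mult_distrib algebra_simps)
    then show "?N (x / cosh \<theta> + (- \<epsilon>) * u) =
      complex_of_real (exp (- pi * (tanh \<theta> * x\<^sup>2))) * (f (x / cosh \<theta> - \<epsilon> * u) * complex_of_real (exp (- pi * u\<^sup>2)))"
      by (simp only: exp_add) simp
  qed
  finally have B: "(LBINT y. ?N y) = complex_of_real \<epsilon> * (complex_of_real (exp (- pi * (tanh \<theta> * x\<^sup>2))) *
      (LBINT u. f (x / cosh \<theta> - \<epsilon> * u) * complex_of_real (exp (- pi * u\<^sup>2))))"
    using e by (simp add: scaleR_conv_of_real)
  have const: "inverse (cosh h) * inverse r * \<epsilon> = cosh \<theta> powr (- 1 / 2)"
  proof (rule power2_eq_imp_eq)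
    have ch: "cosh h > 0" "cosh \<theta> > 0" "sinh h > 0" using h by auto
    have "(inverse (cosh h) * inverse r * \<epsilon>)\<^sup>2 = tanh \<theta> / ((cosh h)\<^sup>2 * (2 * tanh h))"
      by (simp add: power_mult_distrib power_inverse r e field_simps)
    also have "(cosh h)\<^sup>2 * (2 * tanh h) = sinh \<theta>"
      unfolding h(2) sinh_double tanh_def using ch by (simp add: power2_eq_square field_simps)
    also have "tanh \<theta> / sinh \<theta> = inverse (cosh \<theta>)"
      using \<theta> by (simp add: tanh_def field_simps)
    also have "\<dots> = (cosh \<theta> powr (- 1 / 2))\<^sup>2"
      using ch by (simp add: powr_minus powr_half_sqrt power_inverse)
    finally show "(inverse (cosh h) * inverse r * \<epsilon>)\<^sup>2 = (cosh \<theta> powr (- 1 / 2))\<^sup>2" .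
  qed (use h r e in auto)
  have "complex_of_real (inverse (cosh h)) * shift_average r r f x =
    complex_of_real (inverse (cosh h) * inverse r * \<epsilon>) * (complex_of_real (exp (- pi * (tanh \<theta> * x\<^sup>2))) *
      (LBINT u. f (x / cosh \<theta> - \<epsilon> * u) * complex_of_real (exp (- pi * u\<^sup>2))))"
    unfolding A MN B by simp
  then show ?thesis unfolding const by (simp only: r_def h_def \<epsilon>_def)
qed

lemma sinh_complex_of_real: "sinh (complex_of_real x) = complex_of_real (sinh x)"
  and cosh_complex_of_real: "cosh (complex_of_real x) = complex_of_real (cosh x)"
  by (simp_all add: sinh_def cosh_def exp_of_real scaleR_conv_of_real flip: of_real_minus)

text \<open>The kernel in the definition acts on the Fourier transform of \<open>f\<close>. Carrying out the \<open>\<eta>\<close>-integral, which is the Fourier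
  integral of a Gaussian, gives an operator acting on \<open>f\<close> itself.\<close>

lemma hermite_op_explicit:
  fixes f :: "real \<Rightarrow> complex"
  assumes \<theta>: "\<theta> > 0" and f: "integrable lborel f" and sf: "square_integrable f"
  shows "hermite_op \<theta> (abs_L2 f) = abs_L2 (\<lambda>x. complex_of_real (cosh \<theta> powr (- 1 / 2)) * (complex_of_real (exp (- pi * (tanh \<theta> * x\<^sup>2))) *
      (LBINT u. f (x / cosh \<theta> - sqrt (tanh \<theta>) * u) * complex_of_real (exp (- pi * u\<^sup>2)))))"
proof -
  have fm [measurable]: "f \<in> borel_measurable borel" using borel_measurable_integrable[OF f] by simp
  have e: "sqrt (tanh \<theta>) > 0" using \<theta> by simp
  have "(LBINT \<eta>. exp (\<i> * pi * (2 * x * \<eta> + \<i> * (x\<^sup>2 + \<eta>\<^sup>2) * sinh \<theta>) / cosh \<theta>) * rep_L2 (fourier_L2 (abs_L2 f)) \<eta>) =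
    complex_of_real (exp (- pi * (tanh \<theta> * x\<^sup>2))) *
      (LBINT u. f (x / cosh \<theta> - sqrt (tanh \<theta>) * u) * complex_of_real (exp (- pi * u\<^sup>2)))" for x
  proof -
    have "exp (\<i> * pi * (2 * x * \<eta> + \<i> * (x\<^sup>2 + \<eta>\<^sup>2) * sinh \<theta>) / cosh \<theta>) =
      complex_of_real (exp (- pi * (tanh \<theta> * x\<^sup>2))) * (complex_of_real (exp (- pi * ((sqrt (tanh \<theta>))\<^sup>2 * (norm \<eta>)\<^sup>2))) *
        cis (2 * pi * (\<eta> \<bullet> (x / cosh \<theta>))))" for \<eta>
    proof -
      have eq: "\<i> * pi * (2 * x * \<eta> + \<i> * (x\<^sup>2 + \<eta>\<^sup>2) * sinh \<theta>) / cosh \<theta> =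
        complex_of_real (- pi * (tanh \<theta> * x\<^sup>2)) + complex_of_real (- pi * (tanh \<theta> * \<eta>\<^sup>2)) + \<i> * complex_of_real (2 * pi * (\<eta> * (x / cosh \<theta>)))"
        by (simp add: complex_eq_iff tanh_def field_simps)
      show ?thesis unfolding eq exp_add exp_of_real using \<theta> by (simp add: cis_conv_exp mult.assoc)
    qed
    then have "(LBINT \<eta>. exp (\<i> * pi * (2 * x * \<eta> + \<i> * (x\<^sup>2 + \<eta>\<^sup>2) * sinh \<theta>) / cosh \<theta>) * rep_L2 (fourier_L2 (abs_L2 f)) \<eta>) =
      (LBINT \<eta>. complex_of_real (exp (- pi * (tanh \<theta> * x\<^sup>2))) * (rep_L2 (abs_L2 (fourier_integral f)) \<eta> *
         (complex_of_real (exp (- pi * ((sqrt (tanh \<theta>))\<^sup>2 * (norm \<eta>)\<^sup>2))) * cis (2 * pi * (\<eta> \<bullet> (x / cosh \<theta>))))))"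
      by (simp only: fourier_L2_abs[OF f sf] mult_ac)
    also have "\<dots> = complex_of_real (exp (- pi * (tanh \<theta> * x\<^sup>2))) * (LBINT \<eta>. rep_L2 (abs_L2 (fourier_integral f)) \<eta> *
         (complex_of_real (exp (- pi * ((sqrt (tanh \<theta>))\<^sup>2 * (norm \<eta>)\<^sup>2))) * cis (2 * pi * (\<eta> \<bullet> (x / cosh \<theta>)))))"
      by (rule integral_mult_right_zero)
    also have "(LBINT \<eta>. rep_L2 (abs_L2 (fourier_integral f)) \<eta> *
         (complex_of_real (exp (- pi * ((sqrt (tanh \<theta>))\<^sup>2 * (norm \<eta>)\<^sup>2))) * cis (2 * pi * (\<eta> \<bullet> (x / cosh \<theta>))))) =
       (LBINT \<eta>. fourier_integral f \<eta> *
         (complex_of_real (exp (- pi * ((sqrt (tanh \<theta>))\<^sup>2 * (norm \<eta>)\<^sup>2))) * cis (2 * pi * (\<eta> \<bullet> (x / cosh \<theta>)))))"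
      by (rule integral_cong_AE) (use rep_abs_L2[OF Plancherel(1)[OF f sf]] in auto)
    also have "\<dots> = (LBINT u. f (x / cosh \<theta> - sqrt (tanh \<theta>) *\<^sub>R u) * complex_of_real (gauss u))"
      by (rule fourier_regularized[OF f e])
    finally show ?thesis by simp
  qed
  then show ?thesis using \<theta> by (simp add: hermite_op_def sinh_complex_of_real cosh_complex_of_real)
qed

text \<open>The squares of the scales of the modulations and of the translations over which an atom averages; they are the diagonal
  entries of \<open>\<Sigma>\<close>.\<close>

fun atom_scales :: "atom \<Rightarrow> real \<times> real" where
  "atom_scales (Gauss \<alpha>) = (\<alpha>, 0)"
| "atom_scales Ident = (0, 0)"
| "atom_scales (Hermite \<theta>) = (2 * tanh (\<theta> / 2), 2 * tanh (\<theta> / 2))"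

text \<open>The three kinds of atoms in a common form. The class of functions is restricted so that all integrals converge
  absolutely; it contains the indicators of intervals, which suffice for density arguments.\<close>

lemma atom_op_shift_average:
  fixes f :: "real \<Rightarrow> complex"
  assumes v: "valid_atom A" and f: "integrable lborel f" and sf: "square_integrable f" and f1: "\<And>x. norm (f x) \<le> 1"
  defines "F \<equiv> \<lambda>x. complex_of_real (inverse (cosh (atom_angle A / 2))) *
      shift_average (sqrt (fst (atom_scales A))) (sqrt (snd (atom_scales A))) f x"
  shows "square_integrable F" and "atom_op A (abs_L2 f) = abs_L2 F"
proof -
  have fm [measurable]: "f \<in> borel_measurable borel" using borel_measurable_integrable[OF f] by simp
  have "square_integrable F \<and> atom_op A (abs_L2 f) = abs_L2 F"
  proof (cases A)
    case (Gauss \<alpha>)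
    with v have a: "\<alpha> > 0" by simp
    have F: "F = (\<lambda>x. complex_of_real (exp (- pi * \<alpha> * x\<^sup>2)) * f x)"
      unfolding F_def using Gauss shift_average_Gauss[of \<alpha> f] a by (simp add: fun_eq_iff)
    have sF: "square_integrable (\<lambda>x. complex_of_real (exp (- pi * \<alpha> * x\<^sup>2)) * h x)" if h: "square_integrable h" for h
    proof (rule square_integrable_bound[OF h])
      have [measurable]: "h \<in> borel_measurable borel" using h by (rule square_integrable_measurable)
      show "(\<lambda>x. complex_of_real (exp (- pi * \<alpha> * x\<^sup>2)) * h x) \<in> borel_measurable borel" by measurable
      show "norm (complex_of_real (exp (- pi * \<alpha> * x\<^sup>2)) * h x) \<le> norm (h x)" for x
        using a by (auto simp: norm_mult intro!: mult_left_le_one_le)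
    qed
    have "atom_op A (abs_L2 f) = abs_L2 (\<lambda>x. complex_of_real (exp (- pi * \<alpha> * x\<^sup>2)) * rep_L2 (abs_L2 f) x)"
      by (simp add: Gauss gauss_mult_def exp_of_real[symmetric])
    also have "\<dots> = abs_L2 (\<lambda>x. complex_of_real (exp (- pi * \<alpha> * x\<^sup>2)) * f x)"
      by (intro abs_L2_eqI sF square_integrable_rep_L2 sf) (use rep_abs_L2[OF sf] in eventually_elim, simp)
    finally show ?thesis unfolding F using sF[OF sf] by simp
  next
    case Ident
    have "F = f" unfolding F_def using Ident shift_average_Gauss[of 0 f] by (simp add: fun_eq_iff)
    then show ?thesis using sf Ident by simp
  next
    case (Hermite \<theta>)
    with v have t: "\<theta> > 0" by simp
    define H where "H = (\<lambda>x. complex_of_real (cosh \<theta> powr (- 1 / 2)) * (complex_of_real (exp (- pi * (tanh \<theta> * x\<^sup>2))) *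
      (LBINT u. f (x / cosh \<theta> - sqrt (tanh \<theta>) * u) * complex_of_real (exp (- pi * u\<^sup>2)))))"
    have F: "F = H" unfolding F_def H_def using Hermite shift_average_Hermite[OF t f] by (simp add: fun_eq_iff)
    have Hm: "H \<in> borel_measurable borel" unfolding H_def by measurable
    define G where "G = (\<lambda>x::real. complex_of_real (cosh \<theta> powr (- 1 / 2)) * complex_of_real (exp (- pi * (tanh \<theta> * x\<^sup>2))))"
    have "square_integrable G"
    proof -
      have "integrable lborel (\<lambda>x. exp (- pi * ((sqrt (2 * tanh \<theta>))\<^sup>2 * (norm (x::real))\<^sup>2)))"
        by (rule gaussian_scaled_integrable) (use t in simp)
      moreover have "(\<lambda>x::real. (norm (complex_of_real (exp (- pi * (tanh \<theta> * x\<^sup>2)))))\<^sup>2) = (\<lambda>x. exp (- pi * ((sqrt (2 * tanh \<theta>))\<^sup>2 * (norm (x::real))\<^sup>2)))"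
        using t by (simp add: fun_eq_iff power2_eq_square flip: exp_add)
      ultimately have "square_integrable (\<lambda>x::real. complex_of_real (exp (- pi * (tanh \<theta> * x\<^sup>2))))"
        unfolding square_integrable_def by simp
      then show ?thesis unfolding G_def by (rule square_integrable_scale)
    qed
    moreover have "norm (H x) \<le> norm (G x)" for x
    proof -
      have i: "integrable lborel (\<lambda>u::real. exp (- pi * u\<^sup>2))" by (rule gaussian_fourier_real(1))
      have "norm (LBINT u. f (x / cosh \<theta> - sqrt (tanh \<theta>) * u) * complex_of_real (exp (- pi * u\<^sup>2))) \<le> (LBINT u. exp (- pi * u\<^sup>2))"
        by (rule Bochner_Integration.integral_norm_bound_integral[OF integrable_dominated[OF i] i])
           (auto simp: norm_mult f1 intro!: mult_left_le_one_le)
      then have "norm (LBINT u. f (x / cosh \<theta> - sqrt (tanh \<theta>) * u) * complex_of_real (exp (- pi * u\<^sup>2))) \<le> 1"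
        by (simp only: gaussian_integral_real)
      from mult_left_mono[OF this, of "norm (G x)"] show ?thesis
        unfolding H_def G_def norm_mult by (simp add: mult.assoc)
    qed
    ultimately have "square_integrable H" by (rule square_integrable_bound[OF _ Hm])
    moreover have "atom_op A (abs_L2 f) = abs_L2 H" unfolding H_def using Hermite hermite_op_explicit[OF t f sf] by simp
    ultimately show ?thesis unfolding F by simp
  qed
  then show "square_integrable F" and "atom_op A (abs_L2 f) = abs_L2 F" by auto
qed

section \<open>Gaussian averages of phase-space shifts\<close>

lemma heisL_cinner_integral:
  "cinner_L2 (heisL x \<xi> f) g = (LBINT y. heis x \<xi> (rep_L2 f) y * cnj (rep_L2 g y))"
  using cinner_abs[OF square_integrable_heis[OF square_integrable_rep_L2[of f]] square_integrable_rep_L2[of g], of x \<xi>]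
  by (simp flip: heisL_abs)

lemma heisL_cinner_measurable:
  assumes [measurable]: "A \<in> borel_measurable borel" "B \<in> borel_measurable borel"
  shows "(\<lambda>w. cinner_L2 (heisL (A w) (B w) f) g) \<in> borel_measurable borel"
  unfolding heisL_cinner_integral heis_def by measurable

definition gauss_form :: "('w::euclidean_space \<Rightarrow> 'a::euclidean_space) \<Rightarrow> ('w \<Rightarrow> 'a) \<Rightarrow> 'a L2 \<Rightarrow> 'a L2 \<Rightarrow> complex" where
  "gauss_form A B f g = (LBINT w. complex_of_real (gauss w) * cinner_L2 (heisL (A w) (B w) f) g)"

context
  fixes A B :: "'w::euclidean_space \<Rightarrow> 'a::euclidean_space"
  assumes A: "A \<in> borel_measurable borel" and B: "B \<in> borel_measurable borel"
begin

lemma gauss_form_bound: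
  "norm (complex_of_real (gauss w) * cinner_L2 (heisL (A w) (B w) f) g) \<le> gauss w * (norm f * norm g)"
  using cinner_Cauchy_Schwarz[of "heisL (A w) (B w) f" g] by (simp add: norm_mult)

lemma gauss_form_integrable:
  "integrable lborel (\<lambda>w. complex_of_real (gauss w) * cinner_L2 (heisL (A w) (B w) f) g)"
proof (rule integrable_dominated)
  show "integrable lborel (\<lambda>w::'w. gauss w * (norm f * norm g))" using gaussian_integrable[where 'a='w] by simp
  show "(\<lambda>w. complex_of_real (gauss w) * cinner_L2 (heisL (A w) (B w) f) g) \<in> borel_measurable lborel"
    using heisL_cinner_measurable[OF A B, of f g] by simp
  show "AE w in lborel. norm (complex_of_real (gauss w) * cinner_L2 (heisL (A w) (B w) f) g)
      \<le> norm (gauss w * (norm f * norm g))"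
    by (intro AE_I2 order_trans[OF gauss_form_bound]) (simp only: real_norm_def abs_ge_self)
qed

lemma norm_gauss_form: "norm (gauss_form A B f g) \<le> norm f * norm g"
proof -
  have "norm (gauss_form A B f g) \<le> (\<integral>w. gauss w * (norm f * norm g) \<partial>(lborel :: 'w measure))"
    unfolding gauss_form_def
    by (rule Bochner_Integration.integral_norm_bound_integral[OF gauss_form_integrable])
       (use gaussian_integrable[where 'a='w] gauss_form_bound in auto)
  then show ?thesis by (simp add: gaussian_integral[simplified])
qed

lemma gauss_form_add_left: "gauss_form A B (f + h) g = gauss_form A B f g + gauss_form A B h g"
  unfolding gauss_form_def heisL_add cinner_add_left distrib_left
  by (rule Bochner_Integration.integral_add[OF gauss_form_integrable gauss_form_integrable])

lemma gauss_form_add_right: "gauss_form A B f (g + h) = gauss_form A B f g + gauss_form A B f h"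
  unfolding gauss_form_def cinner_add_right distrib_left
  by (rule Bochner_Integration.integral_add[OF gauss_form_integrable gauss_form_integrable])

lemma gauss_form_scale_left: "gauss_form A B (scaleC_L2 c f) g = c * gauss_form A B f g"
  unfolding gauss_form_def heisL_scale cinner_scale_left
  by (simp add: mult.left_commute)

lemma gauss_form_scale_right: "gauss_form A B f (scaleC_L2 c g) = cnj c * gauss_form A B f g"
  unfolding gauss_form_def cinner_scale_right
  by (simp add: mult.left_commute)

lemma bounded_bilinear_gauss_form: "bounded_bilinear (gauss_form A B)"
  by standard
     (auto simp: gauss_form_add_left gauss_form_add_right scaleR_scaleC_L2 gauss_form_scale_left gauss_form_scale_right
       scaleR_conv_of_real intro!: exI[of _ 1] norm_gauss_form)

lemmas tendsto_gauss_form = bounded_bilinear.tendsto[OF bounded_bilinear_gauss_form]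

end

section \<open>Coordinates of phase space\<close>

definition phase_join :: "real^'d::finite \<Rightarrow> real^'d \<Rightarrow> real^('d + 'd)" where
  "phase_join a b = (\<chi> k. case k of Inl i \<Rightarrow> a $ i | Inr i \<Rightarrow> b $ i)"

lemma pos_join [simp]: "pos (phase_join a b) = a" and freq_join [simp]: "freq (phase_join a b) = b"
  by (simp_all add: vec_eq_iff phase_join_def)

lemma phase_join_nth [simp]: "phase_join a b $ Inl i = a $ i" "phase_join a b $ Inr i = b $ i"
  by (simp_all add: phase_join_def)

lemma norm_join: "(norm (phase_join a b))\<^sup>2 = (norm a)\<^sup>2 + (norm b)\<^sup>2"
  by (simp add: power2_norm_eq_inner inner_phase)

lemma norm_cart_square: "(norm (a::real^'d))\<^sup>2 = (\<Sum>i\<in>UNIV. (a $ i)\<^sup>2)"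
  unfolding power2_norm_eq_inner inner_vec_def by (simp add: power2_eq_square)

lemma prod_UNIV_Plus:
  fixes f :: "'a::finite + 'b::finite \<Rightarrow> 'c::comm_monoid_mult"
  shows "(\<Prod>k\<in>UNIV. f k) = (\<Prod>i\<in>UNIV. f (Inl i)) * (\<Prod>j\<in>UNIV. f (Inr j))"
  by (simp add: UNIV_Plus_UNIV[symmetric] prod.Plus del: UNIV_Plus_UNIV)

lemma join_measurable: "(\<lambda>p. phase_join (snd p) (fst p)) \<in> borel \<Otimes>\<^sub>M borel \<rightarrow>\<^sub>M borel"
proof -
  have "linear (\<lambda>p::(real^'d) \<times> (real^'d). phase_join (snd p) (fst p))"
    by (rule linearI) (auto simp: vec_eq_iff phase_join_def split: sum.split)
  then have "(\<lambda>p::(real^'d) \<times> (real^'d). phase_join (snd p) (fst p)) \<in> borel_measurable borel"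
    by (intro borel_measurable_continuous_onI linear_continuous_on) (simp add: linear_conv_bounded_linear)
  then show ?thesis by (simp add: borel_prod)
qed

lemma lborel_join:
  "(lborel :: (real^('d::finite + 'd)) measure) = distr (lborel \<Otimes>\<^sub>M lborel) borel (\<lambda>p. phase_join (snd p) (fst p))"
proof (rule lborel_eqI)
  have m: "(\<lambda>p. phase_join (snd p) (fst p)) \<in> (lborel \<Otimes>\<^sub>M lborel) \<rightarrow>\<^sub>M (borel :: (real^('d + 'd)) measure)"
    using join_measurable by (simp cong: measurable_cong_sets)
  fix l u :: "real^('d + 'd)" assume lu: "\<And>b. b \<in> Basis \<Longrightarrow> l \<bullet> b \<le> u \<bullet> b"
  have lu': "l $ i \<le> u $ i" for i using lu[of "axis i 1"] by (simp add: inner_axis)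
  have "(\<lambda>p. phase_join (snd p) (fst p)) -` box l u = box (freq l) (freq u) \<times> box (pos l) (pos u)"
  proof (rule set_eqI)
    fix p :: "(real^'d) \<times> (real^'d)"
    have "(\<forall>k. P k) \<longleftrightarrow> (\<forall>i. P (Inl i)) \<and> (\<forall>i. P (Inr i))" for P :: "'d + 'd \<Rightarrow> bool"
      by (metis sum.exhaust)
    then show "p \<in> (\<lambda>p. phase_join (snd p) (fst p)) -` box l u \<longleftrightarrow> p \<in> box (freq l) (freq u) \<times> box (pos l) (pos u)"
      by (cases p) (auto simp: mem_box_cart phase_join_def)
  qed
  then have "emeasure (distr (lborel \<Otimes>\<^sub>M lborel) borel (\<lambda>p. phase_join (snd p) (fst p))) (box l u) =
    emeasure (lborel \<Otimes>\<^sub>M lborel) (box (freq l) (freq u) \<times> box (pos l) (pos u))"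
    by (simp add: emeasure_distr[OF m] space_pair_measure)
  also have "\<dots> = emeasure lborel (box (freq l) (freq u)) * emeasure lborel (box (pos l) (pos u))"
    by (rule lborel.emeasure_pair_measure_Times) auto
  also have "emeasure lborel (box (freq l) (freq u)) = ennreal (\<Prod>b\<in>Basis. (freq u - freq l) \<bullet> b)"
    by (rule emeasure_lborel_box) (auto simp: Basis_vec_def inner_axis lu')
  also have "emeasure lborel (box (pos l) (pos u)) = ennreal (\<Prod>b\<in>Basis. (pos u - pos l) \<bullet> b)"
    by (rule emeasure_lborel_box) (auto simp: Basis_vec_def inner_axis lu')
  also have "ennreal (\<Prod>b\<in>Basis. (freq u - freq l) \<bullet> b) * ennreal (\<Prod>b\<in>Basis. (pos u - pos l) \<bullet> b) =
    ennreal (\<Prod>b\<in>Basis. (u - l) \<bullet> b)"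
    using lu' by (simp add: prod_Basis_cart inner_axis prod_UNIV_Plus mult.commute prod_nonneg flip: ennreal_mult)
  finally show "emeasure (distr (lborel \<Otimes>\<^sub>M lborel) borel (\<lambda>p. phase_join (snd p) (fst p))) (box l u) = (\<Prod>b\<in>Basis. (u - l) \<bullet> b)" .
qed simp

lemma
  fixes F :: "real^('d::finite + 'd) \<Rightarrow> 'b::{banach, second_countable_topology}"
  assumes F: "F \<in> borel_measurable borel"
  shows integrable_join: "integrable lborel F \<longleftrightarrow> integrable (lborel \<Otimes>\<^sub>M lborel) (\<lambda>(b, a). F (phase_join a b))"
    and integral_join: "integrable lborel F \<Longrightarrow> (LBINT w. F w) = (LBINT b. (LBINT a. F (phase_join a b)))"
proof -
  have m: "(\<lambda>p. phase_join (snd p) (fst p)) \<in> (lborel \<Otimes>\<^sub>M lborel) \<rightarrow>\<^sub>M (borel :: (real^('d + 'd)) measure)"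
    using join_measurable by (simp cong: measurable_cong_sets)
  show i: "integrable lborel F \<longleftrightarrow> integrable (lborel \<Otimes>\<^sub>M lborel) (\<lambda>(b, a). F (phase_join a b))"
    unfolding split_beta' by (subst lborel_join) (simp add: integrable_distr_eq[OF m F])
  assume "integrable lborel F"
  then have i': "integrable (lborel \<Otimes>\<^sub>M lborel) (\<lambda>(b, a). F (phase_join a b))" using i by simp
  have "(LBINT w. F w) = (\<integral>p. F (phase_join (snd p) (fst p)) \<partial>(lborel \<Otimes>\<^sub>M lborel))"
    by (subst lborel_join) (simp add: integral_distr[OF m F])
  also have "\<dots> = (LBINT b. (LBINT a. F (phase_join a b)))"
    using lborel_pair.integral_fst'[OF i'] by (simp add: split_beta')
  finally show "(LBINT w. F w) = (LBINT b. (LBINT a. F (phase_join a b)))" .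
qed

lemma
  fixes F :: "'d::finite \<Rightarrow> real \<Rightarrow> complex"
  assumes F: "\<And>i. integrable lborel (F i)"
  shows cart_prod_integrable: "integrable lborel (\<lambda>x::real^'d. \<Prod>i\<in>UNIV. F i (x $ i))"
    and cart_prod_integral: "(\<integral>x. (\<Prod>i\<in>UNIV. F i (x $ i)) \<partial>(lborel :: (real^'d) measure)) = (\<Prod>i\<in>UNIV. LBINT x. F i x)"
proof -
  have eq: "(\<Prod>i\<in>UNIV. F i (x $ i)) = (\<Prod>b\<in>Basis. F (axis_index b) (x \<bullet> b))" for x :: "real^'d"
    by (simp add: prod_Basis_cart inner_axis)
  show "integrable lborel (\<lambda>x::real^'d. \<Prod>i\<in>UNIV. F i (x $ i))"
    unfolding eq by (rule lborel_prod_integral(1)) (rule F)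
  have "(\<integral>x. (\<Prod>i\<in>UNIV. F i (x $ i)) \<partial>(lborel :: (real^'d) measure)) = (\<Prod>b\<in>(Basis :: (real^'d) set). LBINT x. F (axis_index b) x)"
    unfolding eq by (rule lborel_prod_integral(2)) (rule F)
  then show "(\<integral>x. (\<Prod>i\<in>UNIV. F i (x $ i)) \<partial>(lborel :: (real^'d) measure)) = (\<Prod>i\<in>UNIV. LBINT x. F i x)"
    by (simp add: prod_Basis_cart)
qed

section \<open>Tensor products\<close>

lemma AE_coordinate:
  assumes "AE t in lborel. P t"
  shows "AE x in (lborel :: (real^'d) measure). P (x $ j)"
proof -
  from assms obtain N where N: "N \<in> null_sets lborel" "{t. \<not> P t} \<subseteq> N"
    by (auto simp: eventually_ae_filter)
  have [measurable]: "N \<in> sets borel" using N by (auto dest: null_setsD2)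
  define F where "F = (\<lambda>b::real^'d. if b = axis j 1 then indicator N else (\<lambda>_. 1 :: ennreal))"
  have Fm: "F b \<in> borel_measurable borel" for b by (simp add: F_def)
  have "(\<integral>\<^sup>+x. (\<Prod>b\<in>Basis. F b (x \<bullet> b)) \<partial>(lborel :: (real^'d) measure)) = (\<Prod>b\<in>Basis. \<integral>\<^sup>+x. F b x \<partial>lborel)"
    by (rule nn_integral_lborel_prod[OF Fm]) simp
  also have "\<dots> = 0"
  proof (rule prod_zero)
    have "(\<integral>\<^sup>+x. F (axis j 1) x \<partial>lborel) = 0" using N by (simp add: F_def null_setsD1)
    then show "\<exists>b\<in>Basis. (\<integral>\<^sup>+x. F b x \<partial>lborel) = 0"
      by (intro bexI[of _ "axis j 1"]) auto
  qed simp
  also have "(\<lambda>x. \<Prod>b\<in>Basis. F b (x \<bullet> b)) = (\<lambda>x. indicator N (x $ j))"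
  proof
    fix x :: "real^'d"
    have "(\<Prod>b\<in>Basis. F b (x \<bullet> b)) = (\<Prod>i\<in>UNIV. if i = j then indicator N (x $ j) else 1)"
      unfolding prod_Basis_cart by (intro prod.cong) (auto simp: F_def axis_eq_axis inner_axis)
    then show "(\<Prod>b\<in>Basis. F b (x \<bullet> b)) = indicator N (x $ j)" by simp
  qed
  finally have "(\<integral>\<^sup>+x. indicator N (x $ j) \<partial>(lborel :: (real^'d) measure)) = 0" .
  then have "AE x in (lborel :: (real^'d) measure). indicator N (x $ j) = (0::ennreal)"
    by (subst (asm) nn_integral_0_iff_AE) auto
  then show ?thesis
    by eventually_elim (use N in \<open>auto split: split_indicator_asm\<close>)
qed

lemma tensor_square_integrable:
  fixes f :: "'d::finite \<Rightarrow> real \<Rightarrow> complex"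
  assumes f: "\<And>j. square_integrable (f j)"
  shows "square_integrable (\<lambda>x::real^'d. \<Prod>j\<in>UNIV. f j (x $ j))"
  unfolding square_integrable_def
proof
  have fm [measurable]: "f j \<in> borel_measurable borel" for j using f by (rule square_integrable_measurable)
  show "(\<lambda>x::real^'d. \<Prod>j\<in>UNIV. f j (x $ j)) \<in> borel_measurable lborel" by measurable
  have "integrable lborel (\<lambda>x::real^'d. \<Prod>j\<in>UNIV. complex_of_real ((norm (f j (x $ j)))\<^sup>2))"
    by (rule cart_prod_integrable, rule integrable_of_real) (use f in \<open>simp add: square_integrable_def\<close>)
  from integrable_Re[OF this] show "integrable lborel (\<lambda>x::real^'d. (norm (\<Prod>j\<in>UNIV. f j (x $ j)))\<^sup>2)"
    by (simp add: prod_norm[symmetric] prod_power_distrib del: of_real_power flip: of_real_prod)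
qed

lemma tensor_abs:
  fixes f :: "'d::finite \<Rightarrow> real \<Rightarrow> complex"
  assumes f: "\<And>j. square_integrable (f j)"
  shows "tensor_L2 (\<lambda>j. abs_L2 (f j)) = abs_L2 (\<lambda>x. \<Prod>j\<in>UNIV. f j (x $ j))"
  unfolding tensor_L2_def
proof (intro abs_L2_eqI tensor_square_integrable square_integrable_rep_L2 f)
  have "AE x in (lborel :: (real^'d) measure). \<forall>j\<in>UNIV. rep_L2 (abs_L2 (f j)) (x $ j) = f j (x $ j)"
    by (subst AE_finite_all) (auto intro: AE_coordinate[OF rep_abs_L2[OF f]])
  then show "AE x in lborel. (\<Prod>j\<in>UNIV. rep_L2 (abs_L2 (f j)) (x $ j)) = (\<Prod>j\<in>UNIV. f j (x $ j))"
    by eventually_elim simp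
qed

lemma cinner_tensor:
  fixes f g :: "'d::finite \<Rightarrow> real \<Rightarrow> complex"
  assumes f: "\<And>j. square_integrable (f j)" and g: "\<And>j. square_integrable (g j)"
  shows "cinner_L2 (abs_L2 (\<lambda>x::real^'d. \<Prod>j\<in>UNIV. f j (x $ j))) (abs_L2 (\<lambda>x. \<Prod>j\<in>UNIV. g j (x $ j))) =
    (\<Prod>j\<in>UNIV. LBINT y. f j y * cnj (g j y))"
  using cart_prod_integral[of "\<lambda>j y. f j y * cnj (g j y)"] f g
  by (simp add: cinner_abs tensor_square_integrable square_integrable_prod prod.distrib)

lemma heis_tensor:
  "heis x \<xi> (\<lambda>y. \<Prod>j\<in>UNIV. f j (y $ j)) y = (\<Prod>j\<in>UNIV. heis (x $ j) (\<xi> $ j) (f j) (y $ j))"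
  by (simp add: heis_def inner_vec_def sum_distrib_left cis_sum prod.distrib)

lemma heisL_tensor_cinner:
  fixes f g :: "'d::finite \<Rightarrow> real \<Rightarrow> complex"
  assumes f: "\<And>j. square_integrable (f j)" and g: "\<And>j. square_integrable (g j)"
  shows "cinner_L2 (heisL x \<xi> (tensor_L2 (\<lambda>j. abs_L2 (f j)))) (tensor_L2 (\<lambda>j. abs_L2 (g j))) =
    (\<Prod>j\<in>UNIV. LBINT y. heis (x $ j) (\<xi> $ j) (f j) y * cnj (g j y))"
proof -
  have "heisL x \<xi> (tensor_L2 (\<lambda>j. abs_L2 (f j))) = abs_L2 (\<lambda>y. \<Prod>j\<in>UNIV. heis (x $ j) (\<xi> $ j) (f j) (y $ j))"
    by (simp add: tensor_abs f heisL_abs tensor_square_integrable heis_tensor[abs_def])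
  then show ?thesis
    using cinner_tensor[OF square_integrable_heis[OF f] g, of "\<lambda>j. x $ j" "\<lambda>j. \<xi> $ j"] by (simp add: tensor_abs g)
qed

lemma indicator_box_tensor:
  "(indicator (box a b) :: real^'d \<Rightarrow> complex) = (\<lambda>x. \<Prod>j\<in>UNIV. indicator (box (a $ j) (b $ j)) (x $ j))"
proof
  fix x :: "real^'d"
  show "(indicator (box a b) x :: complex) = (\<Prod>j\<in>UNIV. indicator (box (a $ j) (b $ j)) (x $ j))"
  proof (cases "x \<in> box a b")
    case False
    then obtain j where "\<not> (a $ j < x $ j \<and> x $ j < b $ j)" by (auto simp: mem_box_cart)
    then have "indicator (box (a $ j) (b $ j)) (x $ j) = (0::complex)" by (auto simp: mem_box)
    then show ?thesis using False by (metis (no_types, lifting) UNIV_I finite indicator_simps(2) prod_zero)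
  qed (auto simp: mem_box_cart mem_box)
qed

definition sympl_rot :: "real^('d::finite + 'd) \<Rightarrow> real^('d + 'd)" where
  "sympl_rot u = phase_join (- freq u) (pos u)"

text \<open>For tensors the integrand factorises over the coordinates \<open>j\<close>, each factor involving only the pair
  \<open>(w\<^sub>j, w\<^sub>j\<^sub>+\<^sub>d)\<close>; hence the integral over phase space is a product of planar integrals.\<close>

lemma gauss_form_tensor:
  fixes f g :: "'d::finite \<Rightarrow> real \<Rightarrow> complex" and s t :: "'d \<Rightarrow> real"
  assumes f: "\<And>j. square_integrable (f j)" and f1: "\<And>j y. norm (f j y) \<le> 1"
    and g: "\<And>j. square_integrable (g j)" and gi: "\<And>j. integrable lborel (g j)"
  defines "A \<equiv> \<lambda>w::real^('d + 'd). \<chi> j. - (t j * freq w $ j)" and "B \<equiv> \<lambda>w::real^('d + 'd). \<chi> j. s j * pos w $ j"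
  shows "gauss_form A B (tensor_L2 (\<lambda>j. abs_L2 (f j))) (tensor_L2 (\<lambda>j. abs_L2 (g j))) =
    (\<Prod>j\<in>UNIV. LBINT y. shift_average (s j) (t j) (f j) y * cnj (g j y))"
proof -
  note fm [measurable] = square_integrable_measurable[OF f] and gm [measurable] = square_integrable_measurable[OF g]
  have "linear A" "linear B" unfolding A_def B_def by (auto intro!: linearI simp: vec_eq_iff algebra_simps)
  then have AB: "A \<in> borel_measurable borel" "B \<in> borel_measurable borel"
    by (auto intro!: borel_measurable_continuous_onI linear_continuous_on simp: linear_conv_bounded_linear)
  define e where "e = (\<lambda>a::real. exp (- pi * a\<^sup>2))"
  have [measurable]: "e \<in> borel_measurable borel" by (simp add: e_def)
  have e: "integrable lborel e" unfolding e_def by (rule gaussian_fourier_real(1))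
  have ep: "e a > 0" for a by (auto simp: e_def)
  define I where "I = (\<lambda>j a b. LBINT y. heis (- (t j * b)) (s j * a) (f j) y * cnj (g j y))"
  define N where "N = (\<lambda>j. LBINT y. norm (g j y))"
  have IN: "norm (I j a b) \<le> N j" for j a b
    unfolding I_def N_def
  proof (rule Bochner_Integration.integral_norm_bound_integral)
    show "integrable lborel (\<lambda>y. heis (- (t j * b)) (s j * a) (f j) y * cnj (g j y))"
      by (intro square_integrable_prod square_integrable_heis f g)
  qed (use gi in \<open>auto simp: norm_mult norm_heis f1 intro!: mult_left_le_one_le\<close>)
  have Im: "(\<lambda>(b, a). I j a b) \<in> borel_measurable (borel \<Otimes>\<^sub>M borel)" for j
    unfolding I_def heis_def split_beta' by measurable
  have Ima [measurable]: "(\<lambda>a. I j a b) \<in> borel_measurable borel" for j b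
    unfolding I_def heis_def by measurable
  define G where "G = (\<lambda>j a b. complex_of_real (e a) * complex_of_real (e b) * I j a b)"
  have Gbound: "norm (G j a b) \<le> e a * (e b * N j)" for j a b
    unfolding G_def using IN[of j a b] ep by (simp add: norm_mult less_imp_le)
  have Ga: "integrable lborel (\<lambda>a. G j a b)" for j b
  proof (rule integrable_dominated)
    show "integrable lborel (\<lambda>a. e a * (e b * N j))" using e by simp
    show "(\<lambda>a. G j a b) \<in> borel_measurable lborel" unfolding G_def by measurable
    show "AE a in lborel. norm (G j a b) \<le> norm (e a * (e b * N j))"
      by (intro AE_I2 order_trans[OF Gbound]) (simp only: real_norm_def abs_ge_self)
  qed
  have Gb: "integrable lborel (\<lambda>b. LBINT a. G j a b)" for j
  proof (rule integrable_dominated)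
    show "integrable lborel (\<lambda>b. e b * (N j * (LBINT a. e a)))" using e by simp
    have [measurable]: "(\<lambda>p. I j (snd p) (fst p)) \<in> borel_measurable (borel \<Otimes>\<^sub>M borel)"
      using Im[of j] by (simp add: split_beta')
    show "(\<lambda>b. LBINT a. G j a b) \<in> borel_measurable lborel"
      unfolding G_def using Im[of j] by measurable
    have "norm (LBINT a. G j a b) \<le> (LBINT a. e a * (e b * N j))" for b
      by (rule Bochner_Integration.integral_norm_bound_integral[OF Ga]) (use e Gbound in auto)
    also have "(LBINT a. e a * (e b * N j)) = e b * (N j * (LBINT a. e a))" for b
      by (simp add: mult_ac)
    finally show "AE b in lborel. norm (LBINT a. G j a b) \<le> norm (e b * (N j * (LBINT a. e a)))"
      by (intro AE_I2) (rule order_trans, assumption, simp only: real_norm_def abs_ge_self)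
  qed
  define F where "F = (\<lambda>w. complex_of_real (gauss w) *
      cinner_L2 (heisL (A w) (B w) (tensor_L2 (\<lambda>j. abs_L2 (f j)))) (tensor_L2 (\<lambda>j. abs_L2 (g j))))"
  have F: "integrable lborel F" unfolding F_def by (rule gauss_form_integrable[OF AB])
  have FG: "F (phase_join a b) = (\<Prod>j\<in>UNIV. G j (a $ j) (b $ j))" for a b
  proof -
    have "- pi * (norm (phase_join a b))\<^sup>2 = (\<Sum>j\<in>UNIV. - pi * (a $ j)\<^sup>2) + (\<Sum>j\<in>UNIV. - pi * (b $ j)\<^sup>2)"
      unfolding norm_join unfolding norm_cart_square sum_distrib_left[symmetric] by (simp add: algebra_simps)
    then have "exp (- pi * (norm (phase_join a b))\<^sup>2) = (\<Prod>j\<in>UNIV. e (a $ j)) * (\<Prod>j\<in>UNIV. e (b $ j))"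
      by (simp only: exp_add exp_sum finite e_def)
    then show ?thesis
      unfolding F_def G_def I_def heisL_tensor_cinner[OF f g]
      by (simp add: A_def B_def prod.distrib)
  qed
  have "gauss_form A B (tensor_L2 (\<lambda>j. abs_L2 (f j))) (tensor_L2 (\<lambda>j. abs_L2 (g j))) = (LBINT w. F w)"
    unfolding gauss_form_def F_def ..
  also have "\<dots> = (LBINT b. (LBINT a. F (phase_join a b)))"
    using integral_join[OF _ F] borel_measurable_integrable[OF F] by simp
  also have "\<dots> = (\<integral>b. (\<Prod>j\<in>UNIV. LBINT a. G j a (b $ j)) \<partial>(lborel :: (real^'d) measure))"
    unfolding FG by (simp only: cart_prod_integral[OF Ga])
  also have "\<dots> = (\<Prod>j\<in>UNIV. LBINT b. (LBINT a. G j a b))"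
    by (rule cart_prod_integral[OF Gb])
  also have "\<dots> = (\<Prod>j\<in>UNIV. LBINT y. shift_average (s j) (t j) (f j) y * cnj (g j y))"
    unfolding G_def I_def e_def shift_average_def by (simp only: phase_average_1d[OF fm f1 gi])
  finally show ?thesis .
qed

text \<open>Box indicators are tensor products of functions for which the atoms are explicit, and they span a
  dense subspace; this determines the tensor product operator.\<close>

theorem tensor_op_gauss_form:
  fixes X :: "(real^'d::finite) L2 \<Rightarrow> (real^'d) L2"
  assumes v: "\<And>j. valid_atom (A j)" and X: "is_tensor_op (\<lambda>j. atom_op (A j)) X"
  shows "cinner_L2 (X f) g = (\<Prod>j\<in>UNIV. complex_of_real (inverse (cosh (atom_angle (A j) / 2)))) *
    gauss_form (\<lambda>w. \<chi> j. - (sqrt (snd (atom_scales (A j))) * freq w $ j)) (\<lambda>w. \<chi> j. sqrt (fst (atom_scales (A j))) * pos w $ j) f g"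
    (is "_ = ?c * gauss_form ?A ?B f g")
proof -
  have "linear ?A" "linear ?B" by (auto intro!: linearI simp: vec_eq_iff algebra_simps)
  then have AB: "?A \<in> borel_measurable borel" "?B \<in> borel_measurable borel"
    by (auto intro!: borel_measurable_continuous_onI linear_continuous_on simp: linear_conv_bounded_linear)
  have bl: "bounded_linear X" and sc: "\<And>c f. X (scaleC_L2 c f) = scaleC_L2 c (X f)"
    and ten: "\<And>f. X (tensor_L2 f) = tensor_L2 (\<lambda>j. atom_op (A j) (f j))"
    using X by (auto simp: is_tensor_op_def)
  have lin: "X (f + g) = X f + X g" for f g using bl by (simp add: bounded_linear.linear linear_add)
  define PA where "PA = ?A"
  define PB where "PB = ?B"
  define c0 where "c0 = ?c"
  note AB = AB[folded PA_def PB_def]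
  have "cinner_L2 (X f) g = c0 * gauss_form PA PB f g"
  proof (induction g arbitrary: f rule: L2_induct)
    case (box a' b')
    show ?case
    proof (induction f rule: L2_induct)
      case (box a b)
      define f where "f = (\<lambda>j. indicator (box (a $ j) (b $ j)) :: real \<Rightarrow> complex)"
      define g where "g = (\<lambda>j. indicator (box (a' $ j) (b' $ j)) :: real \<Rightarrow> complex)"
      have fg: "square_integrable (f j)" "square_integrable (g j)" for j
        unfolding f_def g_def by (auto intro: square_integrable_indicator_box)
      have fgi: "integrable lborel (f j)" "integrable lborel (g j)" for j
      proof -
        have *: "integrable lborel (\<lambda>x. complex_of_real (indicator (box l u) x))" for l u :: real
          using emeasure_lborel_box_finite[of l u] by (intro integrable_of_real) (simp add: integrable_indicator_iff)
        have "indicator S x = complex_of_real (indicator S x)" for S and x :: real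
          by (auto split: split_indicator)
        then have "(indicator S :: real \<Rightarrow> complex) = (\<lambda>x. complex_of_real (indicator S x))" for S by auto
        then show "integrable lborel (f j)" "integrable lborel (g j)" unfolding f_def g_def using * by simp_all
      qed
      have f1: "norm (f j x) \<le> 1" for j x by (auto simp: f_def split: split_indicator)
      define F where "F = (\<lambda>j x. complex_of_real (inverse (cosh (atom_angle (A j) / 2))) *
        shift_average (sqrt (fst (atom_scales (A j)))) (sqrt (snd (atom_scales (A j)))) (f j) x)"
      have F: "square_integrable (F j)" "atom_op (A j) (abs_L2 (f j)) = abs_L2 (F j)" for j
        using atom_op_shift_average[OF v[of j] fgi(1)[of j] fg(1)[of j] f1] unfolding F_def by auto
      have tf: "abs_L2 (indicator (box a b)) = tensor_L2 (\<lambda>j. abs_L2 (f j))"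
        and tg: "abs_L2 (indicator (box a' b')) = tensor_L2 (\<lambda>j. abs_L2 (g j))"
        by (simp_all add: tensor_abs fg) (simp_all add: indicator_box_tensor f_def g_def)
      have "cinner_L2 (X (tensor_L2 (\<lambda>j. abs_L2 (f j)))) (tensor_L2 (\<lambda>j. abs_L2 (g j))) =
        (\<Prod>j\<in>UNIV. LBINT y. F j y * cnj (g j y))"
        unfolding ten F(2) by (simp add: tensor_abs F(1) fg cinner_tensor)
      also have "\<dots> = c0 * (\<Prod>j\<in>UNIV. LBINT y. shift_average (sqrt (fst (atom_scales (A j)))) (sqrt (snd (atom_scales (A j)))) (f j) y * cnj (g j y))"
        unfolding F_def c0_def by (simp add: prod.distrib mult.assoc)
      also have "\<dots> = c0 * gauss_form PA PB (tensor_L2 (\<lambda>j. abs_L2 (f j))) (tensor_L2 (\<lambda>j. abs_L2 (g j)))"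
        using gauss_form_tensor[OF fg(1) f1 fg(2) fgi(2), of "\<lambda>j. sqrt (snd (atom_scales (A j)))" "\<lambda>j. sqrt (fst (atom_scales (A j)))"] by (simp add: PA_def PB_def)
      finally show ?case unfolding tf tg .
    next
      case (add f h)
      then show ?case by (simp add: lin cinner_add_left gauss_form_add_left[OF AB] algebra_simps)
    next
      case (scale c f)
      then show ?case by (simp add: sc cinner_scale_left gauss_form_scale_left[OF AB])
    next
      case (lim Y f)
      show ?case
      proof (rule LIMSEQ_unique)
        show "(\<lambda>n. cinner_L2 (X (Y n)) (abs_L2 (indicator (box a' b')))) \<longlonglongrightarrow> cinner_L2 (X f) (abs_L2 (indicator (box a' b')))"
          by (intro tendsto_cinner bounded_linear.tendsto[OF bl] lim tendsto_const)
        show "(\<lambda>n. cinner_L2 (X (Y n)) (abs_L2 (indicator (box a' b')))) \<longlonglongrightarrow> c0 * gauss_form PA PB f (abs_L2 (indicator (box a' b')))"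
          unfolding lim(1) by (intro tendsto_mult tendsto_gauss_form[OF AB] lim tendsto_const)
      qed
    qed
  next
    case (add g h)
    then show ?case by (simp add: cinner_add_right gauss_form_add_right[OF AB] algebra_simps)
  next
    case (scale c g)
    then show ?case by (simp add: cinner_scale_right gauss_form_scale_right[OF AB])
  next
    case (lim Y g)
    show ?case
    proof (rule LIMSEQ_unique)
      show "(\<lambda>n. cinner_L2 (X f) (Y n)) \<longlonglongrightarrow> cinner_L2 (X f) g" by (intro tendsto_cinner lim tendsto_const)
      show "(\<lambda>n. cinner_L2 (X f) (Y n)) \<longlonglongrightarrow> c0 * gauss_form PA PB f g"
        unfolding lim(1) by (intro tendsto_mult tendsto_gauss_form[OF AB] lim tendsto_const)
    qed
  qed
  then show ?thesis unfolding PA_def PB_def c0_def .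
qed

text \<open>The linear map \<open>V J \<Sigma>\<^sup>1\<^sup>/\<^sup>2\<close>, with \<open>J\<close> given by \<open>sympl_rot\<close>: \<open>J\<close> makes the positions of \<open>w\<close> modulate and its
  frequencies translate.\<close>

definition shift_of :: "real^('d::finite + 'd)^('d + 'd) \<Rightarrow> ('d \<Rightarrow> atom) \<Rightarrow> real^('d + 'd) \<Rightarrow> real^('d + 'd)" where
  "shift_of V A w = V *v sympl_rot (sqrt_Sigma_matrix A *v w)"

lemma sigma_diag_scales:
  "sigma_diag A $ Inl j = fst (atom_scales (A j))" "sigma_diag A $ Inr j = snd (atom_scales (A j))"
  by (cases "A j"; simp add: sigma_diag_def)+

lemma diag_matrix_mult: "(diag_matrix v *v w) $ k = v $ k * w $ k"
proof -
  have "(diag_matrix v *v w) $ k = (\<Sum>j\<in>UNIV. (if k = j then v $ k else 0) * w $ j)"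
    by (simp add: matrix_vector_mult_def diag_matrix_def)
  also have "\<dots> = (\<Sum>j\<in>UNIV. if j = k then v $ k * w $ k else 0)"
    by (rule sum.cong) auto
  finally show ?thesis by simp
qed

lemma linear_shift_of: "linear (shift_of V A)"
proof -
  have "linear (sympl_rot :: real^('a + 'a) \<Rightarrow> _)"
    by (rule linearI) (auto simp: vec_eq_iff sympl_rot_def phase_join_def split: sum.split)
  then have "linear ((*v) V \<circ> (sympl_rot \<circ> (*v) (sqrt_Sigma_matrix A)))"
    by (rule linear_compose[OF linear_compose[OF matrix_vector_mul_linear] matrix_vector_mul_linear])
  then show ?thesis by (simp add: shift_of_def[abs_def] comp_def)
qed

text \<open>Conjugation by \<open>U\<close> is absorbed into the shifts by covariance.\<close>

theorem mp_factorization_gauss_form: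
  assumes "mp_factorization Z U V A"
  shows "cinner_L2 (Z f) g = (\<Prod>j\<in>UNIV. complex_of_real (inverse (cosh (atom_angle (A j) / 2)))) *
    gauss_form (\<lambda>w. pos (shift_of V A w)) (\<lambda>w. freq (shift_of V A w)) f g"
proof -
  from assms obtain X where U: "mp_projection U V" and v: "\<And>j. valid_atom (A j)"
    and X: "is_tensor_op (\<lambda>j. atom_op (A j)) X" and Z: "Z = U \<circ> X \<circ> inv U"
    by (auto simp: mp_factorization_def)
  note C = mp_projection_covariance[OF U]
  have b: "U (inv U h) = h" for h
    using C(1) by (simp add: unitary_L2_def bij_is_surj surj_f_inv_f)
  have 1: "cinner_L2 (U h) g = cinner_L2 h (inv U g)" for h g
    using unitary_cinner[OF C(1), of h "inv U g"] by (simp add: b)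
  have "cinner_L2 (Z f) g = cinner_L2 (X (inv U f)) (inv U g)" by (simp add: Z 1)
  also have "\<dots> = (\<Prod>j\<in>UNIV. complex_of_real (inverse (cosh (atom_angle (A j) / 2)))) *
    gauss_form (\<lambda>w. \<chi> j. - (sqrt (snd (atom_scales (A j))) * freq w $ j)) (\<lambda>w. \<chi> j. sqrt (fst (atom_scales (A j))) * pos w $ j) (inv U f) (inv U g)"
    by (rule tensor_op_gauss_form[OF v X])
  also have "gauss_form (\<lambda>w. \<chi> j. - (sqrt (snd (atom_scales (A j))) * freq w $ j)) (\<lambda>w. \<chi> j. sqrt (fst (atom_scales (A j))) * pos w $ j) (inv U f) (inv U g) =
    gauss_form (\<lambda>w. pos (shift_of V A w)) (\<lambda>w. freq (shift_of V A w)) f g"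
    unfolding gauss_form_def
  proof (intro lebesgue_cong refl arg_cong2[of _ _ _ _ "(*)"])
    fix w
    have "heisL (\<chi> j. - (sqrt (snd (atom_scales (A j))) * freq w $ j)) (\<chi> j. sqrt (fst (atom_scales (A j))) * pos w $ j) h =
      rho (sympl_rot (sqrt_Sigma_matrix A *v w)) h" for h
    proof -
      have "(\<chi> j. - (sqrt (snd (atom_scales (A j))) * freq w $ j)) = pos (sympl_rot (sqrt_Sigma_matrix A *v w))"
        "(\<chi> j. sqrt (fst (atom_scales (A j))) * pos w $ j) = freq (sympl_rot (sqrt_Sigma_matrix A *v w))"
        by (simp_all add: vec_eq_iff sympl_rot_def sqrt_Sigma_matrix_def diag_matrix_mult sigma_diag_scales)
      then show ?thesis by (simp add: rho_def)
    qed
    then show "cinner_L2 (heisL (\<chi> j. - (sqrt (snd (atom_scales (A j))) * freq w $ j)) (\<chi> j. sqrt (fst (atom_scales (A j))) * pos w $ j) (inv U f)) (inv U g) =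
      cinner_L2 (heisL (pos (shift_of V A w)) (freq (shift_of V A w)) f) g"
      using C(3)[of "sympl_rot (sqrt_Sigma_matrix A *v w)" "inv U f"]
      by (simp add: 1[symmetric] b shift_of_def rho_def)
  qed
  finally show ?thesis .
qed

section \<open>Schwartz functions\<close>

lemma iter_deriv_Nil [simp]: "iter_deriv [] f = f"
  and iter_deriv_Cons [simp]: "iter_deriv (b # bs) f = partial_deriv b (iter_deriv bs f)"
  and iter_deriv_append: "iter_deriv (bs @ cs) f = iter_deriv bs (iter_deriv cs f)"
  by (simp_all add: iter_deriv_def)

lemma partial_deriv_eq: "(f has_derivative D) (at x) \<Longrightarrow> partial_deriv b f x = D b"
  unfolding partial_deriv_def by (simp flip: frechet_derivative_at)

lemma differentiable_has_partials:
  fixes f :: "'a::euclidean_space \<Rightarrow> complex"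
  assumes "f differentiable at x"
  shows "(f has_derivative (\<lambda>h. \<Sum>b\<in>Basis. (h \<bullet> b) *\<^sub>R partial_deriv b f x)) (at x)"
proof -
  have d: "(f has_derivative frechet_derivative f (at x)) (at x)"
    using assms frechet_derivative_works by blast
  then have lin: "linear (frechet_derivative f (at x))" by (rule has_derivative_linear)
  have "frechet_derivative f (at x) h = (\<Sum>b\<in>Basis. (h \<bullet> b) *\<^sub>R partial_deriv b f x)" for h
  proof -
    have "frechet_derivative f (at x) h = frechet_derivative f (at x) (\<Sum>b\<in>Basis. (h \<bullet> b) *\<^sub>R b)"
      by (simp add: euclidean_representation)
    also have "\<dots> = (\<Sum>b\<in>Basis. (h \<bullet> b) *\<^sub>R partial_deriv b f x)"
      using lin by (simp add: linear_sum linear_scale partial_deriv_def)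
    finally show ?thesis .
  qed
  then have "frechet_derivative f (at x) = (\<lambda>h. \<Sum>b\<in>Basis. (h \<bullet> b) *\<^sub>R partial_deriv b f x)" by auto
  with d show ?thesis by simp
qed

lemma schwartz_iter_differentiable:
  "schwartz f \<Longrightarrow> set bs \<subseteq> Basis \<Longrightarrow> iter_deriv bs f differentiable at x"
  by (simp add: schwartz_def)

lemma schwartz_differentiable: "schwartz f \<Longrightarrow> f differentiable at x"
  using schwartz_iter_differentiable[of f "[]" x] by simp

lemma schwartz_iter_deriv: "schwartz f \<Longrightarrow> set bs \<subseteq> Basis \<Longrightarrow> schwartz (iter_deriv bs f)"
  unfolding schwartz_def iter_deriv_append[symmetric] by simp

lemma schwartz_partial_deriv: "schwartz f \<Longrightarrow> b \<in> Basis \<Longrightarrow> schwartz (partial_deriv b f)"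
  using schwartz_iter_deriv[of f "[b]"] by simp

lemma schwartz_continuous: "schwartz f \<Longrightarrow> continuous_on UNIV f"
  by (meson continuous_at_imp_continuous_on differentiable_imp_continuous_within schwartz_differentiable)

lemma schwartz_measurable: "schwartz f \<Longrightarrow> f \<in> borel_measurable borel"
  by (rule borel_measurable_continuous_onI) (rule schwartz_continuous)

definition schwartz_sup :: "nat \<Rightarrow> 'a::euclidean_space list \<Rightarrow> ('a \<Rightarrow> complex) \<Rightarrow> real" where
  "schwartz_sup N bs f = (SUP x. (1 + norm x) ^ N * norm (iter_deriv bs f x))"

lemma schwartz_bdd: "schwartz f \<Longrightarrow> set bs \<subseteq> Basis \<Longrightarrow>
    bdd_above (range (\<lambda>x. (1 + norm x) ^ N * norm (iter_deriv bs f x)))"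
  by (simp add: schwartz_def)

lemma schwartz_sup_upper: "schwartz f \<Longrightarrow> set bs \<subseteq> Basis \<Longrightarrow>
    (1 + norm x) ^ N * norm (iter_deriv bs f x) \<le> schwartz_sup N bs f"
  unfolding schwartz_sup_def by (intro cSUP_upper schwartz_bdd) auto

lemma schwartz_sup_le: "(\<And>x. (1 + norm x) ^ N * norm (iter_deriv bs f x) \<le> C) \<Longrightarrow> schwartz_sup N bs f \<le> C"
  unfolding schwartz_sup_def by (intro cSUP_least) auto

lemma schwartz_sup_nonneg: "schwartz f \<Longrightarrow> set bs \<subseteq> Basis \<Longrightarrow> 0 \<le> schwartz_sup N bs f"
  by (rule order_trans[OF _ schwartz_sup_upper[of f bs 0]]) auto

lemma schwartz_seminorm_sup:
  "schwartz_seminorm N f = (\<Sum>bs | set bs \<subseteq> Basis \<and> length bs \<le> N. schwartz_sup N bs f)"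
  by (simp add: schwartz_seminorm_def schwartz_sup_def)

lemma finite_multiindices: "finite {bs. set bs \<subseteq> (Basis :: 'a::euclidean_space set) \<and> length bs \<le> N}"
  by (rule finite_lists_length_le) simp

lemma schwartz_sup_le_seminorm:
  assumes f: "schwartz f" and bs: "set bs \<subseteq> Basis" "length bs \<le> N"
  shows "schwartz_sup N bs f \<le> schwartz_seminorm N f"
  unfolding schwartz_seminorm_sup
  by (rule member_le_sum) (use assms in \<open>auto simp: schwartz_sup_nonneg finite_multiindices\<close>)

lemma schwartz_seminorm_nonneg: "schwartz f \<Longrightarrow> 0 \<le> schwartz_seminorm N f"
  unfolding schwartz_seminorm_sup by (intro sum_nonneg) (auto simp: schwartz_sup_nonneg)

lemma schwartz_seminorm_upper:
  assumes f: "schwartz f" and bs: "set bs \<subseteq> Basis" "length bs \<le> M" and N: "N \<le> M"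
  shows "(1 + norm x) ^ N * norm (iter_deriv bs f x) \<le> schwartz_seminorm M f"
proof -
  have "(1 + norm x) ^ N * norm (iter_deriv bs f x) \<le> (1 + norm x) ^ M * norm (iter_deriv bs f x)"
    using N by (intro mult_right_mono power_increasing) auto
  also have "\<dots> \<le> schwartz_sup M bs f" by (rule schwartz_sup_upper[OF f bs(1)])
  also have "\<dots> \<le> schwartz_seminorm M f" by (rule schwartz_sup_le_seminorm[OF f bs])
  finally show ?thesis .
qed

lemma schwartz_seminorm_le:
  fixes f :: "'a::euclidean_space \<Rightarrow> complex"
  assumes "\<And>bs x. set bs \<subseteq> Basis \<Longrightarrow> length bs \<le> N \<Longrightarrow> (1 + norm x) ^ N * norm (iter_deriv bs f x) \<le> C"
  shows "schwartz_seminorm N f \<le> real (card {bs. set bs \<subseteq> (Basis :: 'a::euclidean_space set) \<and> length bs \<le> N}) * C"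
  unfolding schwartz_seminorm_sup
  by (rule sum_bounded_above) (use assms in \<open>auto intro!: schwartz_sup_le\<close>)

lemma schwartzI:
  assumes "\<And>bs x. set bs \<subseteq> Basis \<Longrightarrow> iter_deriv bs f differentiable at x"
    and "\<And>bs N. set bs \<subseteq> Basis \<Longrightarrow> \<exists>C. \<forall>x. (1 + norm x) ^ N * norm (iter_deriv bs f x) \<le> C"
  shows "schwartz f"
  unfolding schwartz_def bdd_above_def using assms by auto

lemma iter_deriv_add:
  assumes "schwartz f" "schwartz g" "set bs \<subseteq> Basis"
  shows "iter_deriv bs (\<lambda>x. f x + g x) = (\<lambda>x. iter_deriv bs f x + iter_deriv bs g x)"
  using assms(3)
proof (induction bs)
  case (Cons b bs)
  show ?case
  proof
    fix x
    have "(iter_deriv bs f has_derivative frechet_derivative (iter_deriv bs f) (at x)) (at x)"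
      "(iter_deriv bs g has_derivative frechet_derivative (iter_deriv bs g) (at x)) (at x)"
      using assms Cons.prems schwartz_iter_differentiable frechet_derivative_works by (metis set_subset_Cons subset_trans)+
    from partial_deriv_eq[OF has_derivative_add[OF this]] Cons
    show "iter_deriv (b # bs) (\<lambda>x. f x + g x) x = iter_deriv (b # bs) f x + iter_deriv (b # bs) g x"
      by (simp add: partial_deriv_def)
  qed
qed simp

lemma iter_deriv_scale:
  assumes "schwartz f" "set bs \<subseteq> Basis"
  shows "iter_deriv bs (\<lambda>x. c * f x) = (\<lambda>x. c * iter_deriv bs f x)"
  using assms(2)
proof (induction bs)
  case (Cons b bs)
  show ?case
  proof
    fix x
    have "(iter_deriv bs f has_derivative frechet_derivative (iter_deriv bs f) (at x)) (at x)"
      using assms Cons.prems schwartz_iter_differentiable frechet_derivative_works by (metis set_subset_Cons subset_trans)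
    from partial_deriv_eq[OF has_derivative_mult_right[OF this, of c]] Cons
    show "iter_deriv (b # bs) (\<lambda>x. c * f x) x = c * iter_deriv (b # bs) f x"
      by (simp add: partial_deriv_def)
  qed
qed simp

lemma schwartz_add:
  assumes f: "schwartz f" and g: "schwartz g"
  shows "schwartz (\<lambda>x. f x + g x)"
proof (rule schwartzI)
  fix bs :: "'a list" assume bs: "set bs \<subseteq> Basis"
  show "iter_deriv bs (\<lambda>x. f x + g x) differentiable at x" for x
    unfolding iter_deriv_add[OF f g bs] by (intro differentiable_add schwartz_iter_differentiable f g bs)
  show "\<exists>C. \<forall>x. (1 + norm x) ^ N * norm (iter_deriv bs (\<lambda>x. f x + g x) x) \<le> C" for N
  proof (intro exI allI)
    fix x
    have "(1 + norm x) ^ N * norm (iter_deriv bs f x + iter_deriv bs g x) \<le>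
      (1 + norm x) ^ N * norm (iter_deriv bs f x) + (1 + norm x) ^ N * norm (iter_deriv bs g x)"
      unfolding distrib_left[symmetric] by (intro mult_left_mono norm_triangle_ineq) auto
    also have "\<dots> \<le> schwartz_sup N bs f + schwartz_sup N bs g"
      by (intro add_mono schwartz_sup_upper f g bs)
    finally show "(1 + norm x) ^ N * norm (iter_deriv bs (\<lambda>x. f x + g x) x) \<le> schwartz_sup N bs f + schwartz_sup N bs g"
      unfolding iter_deriv_add[OF f g bs] .
  qed
qed

lemma schwartz_scale:
  assumes f: "schwartz f"
  shows "schwartz (\<lambda>x. c * f x)"
proof (rule schwartzI)
  fix bs :: "'a list" assume bs: "set bs \<subseteq> Basis"
  show "iter_deriv bs (\<lambda>x. c * f x) differentiable at x" for x
    unfolding iter_deriv_scale[OF f bs] by (intro differentiable_mult differentiable_const schwartz_iter_differentiable f bs)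
  show "\<exists>C. \<forall>x. (1 + norm x) ^ N * norm (iter_deriv bs (\<lambda>x. c * f x) x) \<le> C" for N
  proof (intro exI allI)
    fix x
    have "(1 + norm x) ^ N * norm (c * iter_deriv bs f x) = norm c * ((1 + norm x) ^ N * norm (iter_deriv bs f x))"
      by (simp add: norm_mult)
    also have "\<dots> \<le> norm c * schwartz_sup N bs f"
      by (intro mult_left_mono schwartz_sup_upper f bs) auto
    finally show "(1 + norm x) ^ N * norm (iter_deriv bs (\<lambda>x. c * f x) x) \<le> norm c * schwartz_sup N bs f"
      unfolding iter_deriv_scale[OF f bs] .
  qed
qed

lemma schwartz_diff:
  assumes f: "schwartz f" and g: "schwartz g"
  shows "schwartz (\<lambda>x. f x - g x)"
    and "set bs \<subseteq> Basis \<Longrightarrow> iter_deriv bs (\<lambda>x. f x - g x) = (\<lambda>x. iter_deriv bs f x - iter_deriv bs g x)"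
  using schwartz_add[OF f schwartz_scale[OF g, of "-1"]]
    iter_deriv_add[OF f schwartz_scale[OF g, of "-1"]] iter_deriv_scale[OF g, of bs "-1"] by simp_all

lemma schwartz_seminorm_scale:
  assumes f: "schwartz f"
  shows "schwartz_seminorm N (\<lambda>x. c * f x) \<le> norm c * schwartz_seminorm N f"
  unfolding schwartz_seminorm_sup sum_distrib_left
proof (intro sum_mono schwartz_sup_le)
  fix bs :: "'a list" and x assume "bs \<in> {bs. set bs \<subseteq> Basis \<and> length bs \<le> N}"
  then have bs: "set bs \<subseteq> Basis" by simp
  have "norm c * ((1 + norm x) ^ N * norm (iter_deriv bs f x)) \<le> norm c * schwartz_sup N bs f"
    by (intro mult_left_mono schwartz_sup_upper f bs) auto
  then show "(1 + norm x) ^ N * norm (iter_deriv bs (\<lambda>x. c * f x) x) \<le> norm c * schwartz_sup N bs f"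
    unfolding iter_deriv_scale[OF f bs] by (simp add: norm_mult mult_ac)
qed

lemma schwartz_seminorm_add:
  assumes f: "schwartz f" and g: "schwartz g"
  shows "schwartz_seminorm N (\<lambda>x. f x + g x) \<le> schwartz_seminorm N f + schwartz_seminorm N g"
  unfolding schwartz_seminorm_sup sum.distrib[symmetric]
proof (intro sum_mono schwartz_sup_le)
  fix bs :: "'a list" and x assume "bs \<in> {bs. set bs \<subseteq> Basis \<and> length bs \<le> N}"
  then have bs: "set bs \<subseteq> Basis" by simp
  have "(1 + norm x) ^ N * norm (iter_deriv bs f x + iter_deriv bs g x) \<le>
      (1 + norm x) ^ N * norm (iter_deriv bs f x) + (1 + norm x) ^ N * norm (iter_deriv bs g x)"
    unfolding distrib_left[symmetric] by (intro mult_left_mono norm_triangle_ineq) auto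
  also have "\<dots> \<le> schwartz_sup N bs f + schwartz_sup N bs g"
    by (intro add_mono schwartz_sup_upper f g bs)
  finally show "(1 + norm x) ^ N * norm (iter_deriv bs (\<lambda>x. f x + g x) x) \<le> schwartz_sup N bs f + schwartz_sup N bs g"
    unfolding iter_deriv_add[OF f g bs] .
qed

subsection \<open>Integrability\<close>

lemma integrable_inverse_1_plus_square_real: "integrable lborel (\<lambda>x::real. inverse (1 + x\<^sup>2))"
  using integrable_inverse_1_plus_square by (simp add: set_integrable_def einterval_def)

lemma integrable_inverse_power:
  "integrable lborel (\<lambda>x::'a::euclidean_space. inverse ((1 + norm x) ^ (2 * DIM('a))))"
proof (rule integrable_dominated)
  show "integrable lborel (\<lambda>x::'a. \<Prod>b\<in>Basis. inverse (1 + (x \<bullet> b)\<^sup>2) :: real)"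
    by (rule lborel_prod_integral(1)) (rule integrable_inverse_1_plus_square_real)
  show "AE x in (lborel :: 'a measure). norm (inverse ((1 + norm x) ^ (2 * DIM('a)))) \<le> norm (\<Prod>b\<in>Basis. inverse (1 + (x \<bullet> b)\<^sup>2) :: real)"
  proof (rule AE_I2)
    fix x :: 'a
    have "(\<Prod>b\<in>Basis. 1 + (x \<bullet> b)\<^sup>2) \<le> (\<Prod>b\<in>(Basis::'a set). (1 + norm x)\<^sup>2)"
    proof (intro prod_mono conjI)
      fix b :: 'a assume "b \<in> Basis"
      then have "\<bar>x \<bullet> b\<bar> \<le> norm x" by (rule Basis_le_norm)
      then have "\<bar>x \<bullet> b\<bar>\<^sup>2 \<le> (norm x)\<^sup>2" by (intro power_mono) auto
      then show "1 + (x \<bullet> b)\<^sup>2 \<le> (1 + norm x)\<^sup>2" by (simp add: power2_sum add_increasing2)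
    qed simp
    also have "\<dots> = (1 + norm x) ^ (2 * DIM('a))" by (simp add: power_mult)
    finally have *: "(\<Prod>b\<in>Basis. 1 + (x \<bullet> b)\<^sup>2) \<le> (1 + norm x) ^ (2 * DIM('a))" .
    have pos: "(\<Prod>b\<in>Basis. 1 + (x \<bullet> b)\<^sup>2) > 0" by (intro prod_pos) (simp add: add_pos_nonneg)
    have "(\<Prod>b\<in>Basis. inverse (1 + (x \<bullet> b)\<^sup>2)) = inverse (\<Prod>b\<in>Basis. 1 + (x \<bullet> b)\<^sup>2)"
      by (simp add: prod_inversef[symmetric] comp_def)
    then show "norm (inverse ((1 + norm x) ^ (2 * DIM('a)))) \<le> norm (\<Prod>b\<in>Basis. inverse (1 + (x \<bullet> b)\<^sup>2) :: real)"
      using le_imp_inverse_le[OF * pos] pos by (simp add: less_imp_le)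
  qed
qed measurable

lemma decay_bound:
  assumes "(1 + norm x) ^ N * r \<le> C"
  shows "r \<le> C * inverse ((1 + norm x) ^ N)"
  using assms by (simp add: field_simps add_pos_nonneg)

lemma schwartz_bounded: assumes "schwartz f" shows "\<exists>C. \<forall>x. norm (f x) \<le> C"
  using schwartz_sup_upper[OF assms, of "[]" _ 0] by (intro exI[of _ "schwartz_sup 0 [] f"]) simp

lemma schwartz_integrable_norm_le:
  fixes f :: "'a::euclidean_space \<Rightarrow> complex"
  assumes f: "schwartz f"
  shows "integrable lborel f"
    and "(LBINT x. norm (f x)) \<le> schwartz_seminorm (2 * DIM('a)) f * (\<integral>x. inverse ((1 + norm x) ^ (2 * DIM('a))) \<partial>(lborel :: 'a measure))"
proof -
  have b: "norm (f x) \<le> schwartz_seminorm (2 * DIM('a)) f * inverse ((1 + norm x) ^ (2 * DIM('a)))" for x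
    using schwartz_seminorm_upper[OF f, of "[]" "2 * DIM('a)" "2 * DIM('a)" x] by (intro decay_bound) simp
  have i: "integrable lborel (\<lambda>x::'a. schwartz_seminorm (2 * DIM('a)) f * inverse ((1 + norm x) ^ (2 * DIM('a))))"
    using integrable_inverse_power[where 'a='a] by simp
  show fi: "integrable lborel f"
  proof (rule integrable_dominated[OF i])
    show "f \<in> borel_measurable lborel" using schwartz_measurable[OF f] by simp
    show "AE x in lborel. norm (f x) \<le> norm (schwartz_seminorm (2 * DIM('a)) f * inverse ((1 + norm x) ^ (2 * DIM('a))))"
      by (intro AE_I2 order_trans[OF b]) (simp only: real_norm_def abs_ge_self)
  qed
  have "(LBINT x. norm (f x)) \<le> (\<integral>x. schwartz_seminorm (2 * DIM('a)) f * inverse ((1 + norm x) ^ (2 * DIM('a))) \<partial>(lborel :: 'a measure))"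
    by (rule Bochner_Integration.integral_mono[OF integrable_norm[OF fi] i b])
  then show "(LBINT x. norm (f x)) \<le> schwartz_seminorm (2 * DIM('a)) f * (\<integral>x. inverse ((1 + norm x) ^ (2 * DIM('a))) \<partial>(lborel :: 'a measure))"
    by simp
qed

lemmas schwartz_integrable = schwartz_integrable_norm_le(1)

lemma schwartz_square_integrable:
  assumes f: "schwartz f"
  shows "square_integrable f"
  unfolding square_integrable_def
proof
  show m: "f \<in> borel_measurable lborel" using schwartz_measurable[OF f] by simp
  obtain C where C: "\<And>x. norm (f x) \<le> C" using schwartz_bounded[OF f] by blast
  then have C0: "C \<ge> 0" using norm_ge_zero order_trans by blast
  show "integrable lborel (\<lambda>x. (norm (f x))\<^sup>2)"
  proof (rule integrable_dominated)
    show "integrable lborel (\<lambda>x. C * norm (f x))" using schwartz_integrable[OF f] by simp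
    show "(\<lambda>x. (norm (f x))\<^sup>2) \<in> borel_measurable lborel" using m by measurable
    show "AE x in lborel. norm ((norm (f x))\<^sup>2) \<le> norm (C * norm (f x))"
      using C C0 by (intro AE_I2) (simp add: power2_eq_square mult_right_mono)
  qed
qed

subsection \<open>Phase-space shifts of Schwartz functions\<close>

lemma heis_has_derivative:
  assumes "\<phi> differentiable at (y - x)"
  shows "partial_deriv b (heis x \<xi> \<phi>) y = 2 * pi * \<i> * (\<xi> \<bullet> b) * heis x \<xi> \<phi> y + heis x \<xi> (partial_deriv b \<phi>) y"
    and "heis x \<xi> \<phi> differentiable at y"
proof -
  have d: "(\<phi> has_derivative frechet_derivative \<phi> (at (y - x))) (at (y - x))"
    using assms frechet_derivative_works by blast
  have "((\<lambda>y. \<phi> (y - x)) has_derivative (\<lambda>h. frechet_derivative \<phi> (at (y - x)) h)) (at y)"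
    by (rule has_derivative_compose[of "\<lambda>y. y - x" "\<lambda>h. h", OF _ d]) (auto intro!: derivative_eq_intros)
  then have "(heis x \<xi> \<phi> has_derivative (\<lambda>h. cis (2 * pi * (\<xi> \<bullet> (y - x /\<^sub>R 2))) * frechet_derivative \<phi> (at (y - x)) h +
      (2 * pi * (\<xi> \<bullet> h)) *\<^sub>R (\<i> * cis (2 * pi * (\<xi> \<bullet> (y - x /\<^sub>R 2)))) * \<phi> (y - x))) (at y)"
    unfolding heis_def[abs_def] by (intro derivative_eq_intros | assumption | simp)+
  from partial_deriv_eq[OF this, of b] differentiableI[OF this]
  show "partial_deriv b (heis x \<xi> \<phi>) y = 2 * pi * \<i> * (\<xi> \<bullet> b) * heis x \<xi> \<phi> y + heis x \<xi> (partial_deriv b \<phi>) y"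
    "heis x \<xi> \<phi> differentiable at y"
    by (simp_all add: heis_def partial_deriv_def scaleR_conv_of_real mult_ac)
qed

text \<open>The Leibniz rule for the derivatives of a shift: each derivative falls either on the phase (first list of a pair) or on
  the function (second list). An explicit list of terms keeps the number of terms and the polynomial growth of the
  coefficients visible.\<close>

fun heis_terms :: "'a list \<Rightarrow> ('a list \<times> 'a list) list" where
  "heis_terms [] = [([], [])]"
| "heis_terms (b # bs) = map (\<lambda>(us, vs). (b # us, vs)) (heis_terms bs) @ map (\<lambda>(us, vs). (us, b # vs)) (heis_terms bs)"

definition heis_coeff :: "'a::euclidean_space \<Rightarrow> 'a list \<Rightarrow> complex" where
  "heis_coeff \<xi> us = (\<Prod>u\<leftarrow>us. 2 * pi * \<i> * (\<xi> \<bullet> u))"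

lemma heis_terms_subset: "(us, vs) \<in> set (heis_terms bs) \<Longrightarrow> set us \<subseteq> set bs \<and> set vs \<subseteq> set bs \<and> length us + length vs = length bs"
  by (induction bs arbitrary: us vs) (force)+

lemma length_heis_terms: "length (heis_terms bs) = 2 ^ length bs"
  by (induction bs) auto

lemma partial_deriv_sum_list:
  assumes "\<And>p. p \<in> set ps \<Longrightarrow> F p differentiable at y"
  shows "partial_deriv b (\<lambda>y. \<Sum>p\<leftarrow>ps. F p y) y = (\<Sum>p\<leftarrow>ps. partial_deriv b (F p) y) \<and>
    (\<lambda>y. \<Sum>p\<leftarrow>ps. F p y) differentiable at y"
  using assms
proof (induction ps)
  case Nil
  have "((\<lambda>y. 0) has_derivative (\<lambda>h. 0)) (at y)" by simp
  from partial_deriv_eq[OF this] show ?case by simp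
next
  case (Cons p ps)
  then have IH: "partial_deriv b (\<lambda>y. \<Sum>p\<leftarrow>ps. F p y) y = (\<Sum>p\<leftarrow>ps. partial_deriv b (F p) y)"
    and d: "(\<lambda>y. \<Sum>p\<leftarrow>ps. F p y) differentiable at y" "F p differentiable at y" by auto
  have "((\<lambda>y. F p y + (\<Sum>p\<leftarrow>ps. F p y)) has_derivative (\<lambda>h. frechet_derivative (F p) (at y) h + frechet_derivative (\<lambda>y. \<Sum>p\<leftarrow>ps. F p y) (at y) h)) (at y)"
    using d by (intro has_derivative_add) (simp_all add: frechet_derivative_works[symmetric])
  from partial_deriv_eq[OF this, of b] differentiableI[OF this] show ?case
    using IH by (simp add: partial_deriv_def)
qed

lemma partial_deriv_cmult:
  fixes f :: "'a::euclidean_space \<Rightarrow> complex"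
  assumes "f differentiable at y"
  shows "partial_deriv b (\<lambda>y. c * f y) y = c * partial_deriv b f y" and "(\<lambda>y. c * f y) differentiable at y"
proof -
  have "(f has_derivative frechet_derivative f (at y)) (at y)" using assms frechet_derivative_works by blast
  note d = has_derivative_mult_right[OF this, of c]
  from partial_deriv_eq[OF d, of b] differentiableI[OF d]
  show "partial_deriv b (\<lambda>y. c * f y) y = c * partial_deriv b f y" and "(\<lambda>y. c * f y) differentiable at y"
    by (simp_all add: partial_deriv_def)
qed

lemma iter_deriv_heis:
  assumes \<phi>: "schwartz \<phi>" and bs: "set bs \<subseteq> Basis"
  shows "iter_deriv bs (heis x \<xi> \<phi>) = (\<lambda>y. \<Sum>(us, vs)\<leftarrow>heis_terms bs. heis_coeff \<xi> us * heis x \<xi> (iter_deriv vs \<phi>) y)"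
  using bs
proof (induction bs)
  case Nil
  then show ?case by (simp add: heis_coeff_def)
next
  case (Cons b bs)
  show ?case
  proof
    fix y
    have vs: "iter_deriv (snd p) \<phi> differentiable at z" if "p \<in> set (heis_terms bs)" for p z
      using heis_terms_subset[of "fst p" "snd p" bs] that Cons.prems by (intro schwartz_iter_differentiable[OF \<phi>]) auto
    have "iter_deriv (b # bs) (heis x \<xi> \<phi>) y =
      partial_deriv b (\<lambda>y. \<Sum>p\<leftarrow>heis_terms bs. heis_coeff \<xi> (fst p) * heis x \<xi> (iter_deriv (snd p) \<phi>) y) y"
      using Cons by (simp add: split_beta')
    also have "\<dots> = (\<Sum>p\<leftarrow>heis_terms bs. partial_deriv b (\<lambda>y. heis_coeff \<xi> (fst p) * heis x \<xi> (iter_deriv (snd p) \<phi>) y) y)"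
      using partial_deriv_sum_list[of "heis_terms bs" "\<lambda>p y. heis_coeff \<xi> (fst p) * heis x \<xi> (iter_deriv (snd p) \<phi>) y" y b]
        vs partial_deriv_cmult(2) heis_has_derivative(2) by blast
    also have "\<dots> = (\<Sum>p\<leftarrow>heis_terms bs. heis_coeff \<xi> (b # fst p) * heis x \<xi> (iter_deriv (snd p) \<phi>) y
        + heis_coeff \<xi> (fst p) * heis x \<xi> (iter_deriv (b # snd p) \<phi>) y)"
    proof (intro arg_cong[of _ _ sum_list] map_cong refl)
      fix p assume p: "p \<in> set (heis_terms bs)"
      show "partial_deriv b (\<lambda>y. heis_coeff \<xi> (fst p) * heis x \<xi> (iter_deriv (snd p) \<phi>) y) y =
        heis_coeff \<xi> (b # fst p) * heis x \<xi> (iter_deriv (snd p) \<phi>) y + heis_coeff \<xi> (fst p) * heis x \<xi> (iter_deriv (b # snd p) \<phi>) y"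
        unfolding partial_deriv_cmult(1)[OF heis_has_derivative(2)[OF vs[OF p]]] heis_has_derivative(1)[OF vs[OF p]]
        by (simp add: heis_coeff_def algebra_simps)
    qed
    also have "\<dots> = (\<Sum>(us, vs)\<leftarrow>heis_terms (b # bs). heis_coeff \<xi> us * heis x \<xi> (iter_deriv vs \<phi>) y)"
      by (simp add: sum_list_addf comp_def split_beta')
    finally show "iter_deriv (b # bs) (heis x \<xi> \<phi>) y = (\<Sum>(us, vs)\<leftarrow>heis_terms (b # bs). heis_coeff \<xi> us * heis x \<xi> (iter_deriv vs \<phi>) y)" .
  qed
qed

lemma norm_heis_coeff_le:
  assumes "set us \<subseteq> Basis" "length us \<le> n"
  shows "norm (heis_coeff \<xi> us) \<le> (1 + 2 * pi * norm \<xi>) ^ n"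
proof -
  have "norm (heis_coeff \<xi> us) \<le> (1 + 2 * pi * norm \<xi>) ^ length us"
    using assms(1)
  proof (induction us)
    case (Cons u us)
    have "\<bar>\<xi> \<bullet> u\<bar> \<le> norm \<xi>" using Cons.prems by (intro Basis_le_norm) auto
    then have "norm (2 * pi * \<i> * (\<xi> \<bullet> u)) \<le> 1 + 2 * pi * norm \<xi>"
      by (simp add: norm_mult add_increasing)
    moreover have "norm (heis_coeff \<xi> (u # us)) = norm (2 * pi * \<i> * (\<xi> \<bullet> u)) * norm (heis_coeff \<xi> us)"
      by (simp add: heis_coeff_def norm_mult)
    ultimately show ?case using Cons by (auto intro!: mult_mono)
  qed (simp add: heis_coeff_def)
  also have "\<dots> \<le> (1 + 2 * pi * norm \<xi>) ^ n" using assms(2) by (intro power_increasing) auto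
  finally show ?thesis .
qed

lemma sum_list_norm_bound:
  fixes F :: "'b \<Rightarrow> complex" and C :: real
  assumes "\<And>p. p \<in> set ps \<Longrightarrow> norm (F p) \<le> C"
  shows "norm (\<Sum>p\<leftarrow>ps. F p) \<le> real (length ps) * C"
  using assms
proof (induction ps)
  case (Cons p ps)
  have "norm (\<Sum>p\<leftarrow>p # ps. F p) \<le> norm (F p) + norm (\<Sum>p\<leftarrow>ps. F p)" by (simp add: norm_triangle_ineq)
  also have "\<dots> \<le> C + real (length ps) * C" using Cons by (intro add_mono) auto
  finally show ?case by (simp add: algebra_simps)
qed simp

text \<open>Shifts act on the Schwartz space with seminorms that grow polynomially in the shift. This is what makes Gaussian
  averages converge.\<close>

lemma heis_seminorm_bound:
  assumes \<phi>: "schwartz \<phi>" and bs: "set bs \<subseteq> Basis" and NM: "N \<le> M" "length bs \<le> M"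
  shows "(1 + norm y) ^ N * norm (iter_deriv bs (heis x \<xi> \<phi>) y) \<le>
    2 ^ length bs * ((1 + 2 * pi * norm \<xi>) ^ length bs * (1 + norm x) ^ N * schwartz_seminorm M \<phi>)"
proof -
  have "norm (\<Sum>p\<leftarrow>heis_terms bs. (1 + norm y) ^ N * (heis_coeff \<xi> (fst p) * heis x \<xi> (iter_deriv (snd p) \<phi>) y)) \<le>
    real (length (heis_terms bs)) * ((1 + 2 * pi * norm \<xi>) ^ length bs * (1 + norm x) ^ N * schwartz_seminorm M \<phi>)"
  proof (rule sum_list_norm_bound)
    fix p assume p: "p \<in> set (heis_terms bs)"
    have sub: "set (fst p) \<subseteq> Basis" "length (fst p) \<le> length bs" "set (snd p) \<subseteq> Basis" "length (snd p) \<le> M"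
      using heis_terms_subset[of "fst p" "snd p" bs] p bs NM by auto
    have "1 + norm y \<le> (1 + norm x) * (1 + norm (y - x))"
    proof -
      have "norm y \<le> norm x + norm (y - x)" using norm_triangle_ineq[of x "y - x"] by simp
      moreover have "0 \<le> norm x * norm (y - x)" by simp
      moreover have "(1 + norm x) * (1 + norm (y - x)) = 1 + norm x + norm (y - x) + norm x * norm (y - x)"
        by (simp add: algebra_simps)
      ultimately show ?thesis by linarith
    qed
    then have "(1 + norm y) ^ N \<le> ((1 + norm x) * (1 + norm (y - x))) ^ N" by (intro power_mono) auto
    then have "(1 + norm y) ^ N * norm (iter_deriv (snd p) \<phi> (y - x)) \<le>
      ((1 + norm x) * (1 + norm (y - x))) ^ N * norm (iter_deriv (snd p) \<phi> (y - x))" by (intro mult_right_mono) auto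
    also have "\<dots> = (1 + norm x) ^ N * ((1 + norm (y - x)) ^ N * norm (iter_deriv (snd p) \<phi> (y - x)))"
      by (simp add: power_mult_distrib)
    also have "\<dots> \<le> (1 + norm x) ^ N * schwartz_seminorm M \<phi>"
      by (intro mult_left_mono schwartz_seminorm_upper \<phi> sub NM) auto
    finally have "(1 + norm y) ^ N * norm (heis x \<xi> (iter_deriv (snd p) \<phi>) y) \<le> (1 + norm x) ^ N * schwartz_seminorm M \<phi>"
      by (simp add: norm_heis)
    then have "norm (heis_coeff \<xi> (fst p)) * ((1 + norm y) ^ N * norm (heis x \<xi> (iter_deriv (snd p) \<phi>) y)) \<le>
      (1 + 2 * pi * norm \<xi>) ^ length bs * ((1 + norm x) ^ N * schwartz_seminorm M \<phi>)"
      by (rule mult_mono[OF norm_heis_coeff_le[OF sub(1,2)]]) auto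
    moreover have "norm ((1 + norm y) ^ N * (heis_coeff \<xi> (fst p) * heis x \<xi> (iter_deriv (snd p) \<phi>) y)) =
      norm (heis_coeff \<xi> (fst p)) * ((1 + norm y) ^ N * norm (heis x \<xi> (iter_deriv (snd p) \<phi>) y))"
    proof -
      have "norm (1 + complex_of_real (norm y)) = 1 + norm y"
        using norm_of_real[of "1 + norm y", where 'a=complex] by simp
      then show ?thesis by (simp add: norm_mult norm_power)
    qed
    ultimately show "norm ((1 + norm y) ^ N * (heis_coeff \<xi> (fst p) * heis x \<xi> (iter_deriv (snd p) \<phi>) y)) \<le>
      (1 + 2 * pi * norm \<xi>) ^ length bs * (1 + norm x) ^ N * schwartz_seminorm M \<phi>" by (simp add: mult.assoc)
  qed
  moreover have "norm (\<Sum>p\<leftarrow>heis_terms bs. (1 + norm y) ^ N * (heis_coeff \<xi> (fst p) * heis x \<xi> (iter_deriv (snd p) \<phi>) y)) =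
    (1 + norm y) ^ N * norm (iter_deriv bs (heis x \<xi> \<phi>) y)"
  proof -
    have "norm (1 + complex_of_real (norm y)) = 1 + norm y"
      using norm_of_real[of "1 + norm y", where 'a=complex] by simp
    then show ?thesis
      unfolding iter_deriv_heis[OF \<phi> bs] split_beta' by (simp add: sum_list_const_mult norm_mult norm_power)
  qed
  ultimately show ?thesis by (simp add: length_heis_terms)
qed

lemma heis_continuous:
  assumes A: "continuous_on UNIV A" and B: "continuous_on UNIV B" and h: "continuous_on UNIV h"
  shows "continuous_on UNIV (\<lambda>(w, y). heis (A w) (B w) h y)"
  unfolding heis_def split_beta' cis_conv_exp
  by (intro continuous_intros continuous_on_compose2[OF A] continuous_on_compose2[OF B] continuous_on_compose2[OF h]) auto

lemma continuous_on_sum_list: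
  fixes F :: "'b \<Rightarrow> 'x::topological_space \<Rightarrow> complex"
  assumes "\<And>p. p \<in> set ps \<Longrightarrow> continuous_on S (F p)"
  shows "continuous_on S (\<lambda>x. \<Sum>p\<leftarrow>ps. F p x)"
  using assms by (induction ps) (auto intro!: continuous_intros)

lemma iter_deriv_heis_continuous:
  assumes \<phi>: "schwartz \<phi>" and bs: "set bs \<subseteq> Basis" and A: "continuous_on UNIV A" and B: "continuous_on UNIV B"
  shows "continuous_on UNIV (\<lambda>(w, y). iter_deriv bs (heis (A w) (B w) \<phi>) y)"
proof -
  have "continuous_on UNIV (\<lambda>q. heis_coeff (B (fst q)) us)" for us and q :: "'b \<times> 'a"
    unfolding heis_coeff_def
  proof (induction us)
    case (Cons u us)
    then show ?case by (auto intro!: continuous_intros continuous_on_compose2[OF B])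
  qed auto
  then have c: "continuous_on UNIV (\<lambda>q::'b \<times> 'a. heis_coeff (B (fst q)) us)" for us .
  have "continuous_on UNIV (\<lambda>q. \<Sum>p\<leftarrow>heis_terms bs. heis_coeff (B (fst q)) (fst p) * heis (A (fst q)) (B (fst q)) (iter_deriv (snd p) \<phi>) (snd q))"
  proof (intro continuous_on_sum_list continuous_on_mult c)
    fix p assume "p \<in> set (heis_terms bs)"
    then have "set (snd p) \<subseteq> Basis" using heis_terms_subset[of "fst p" "snd p" bs] bs by auto
    then have "continuous_on UNIV (iter_deriv (snd p) \<phi>)" by (intro schwartz_continuous schwartz_iter_deriv \<phi>)
    from heis_continuous[OF A B this]
    show "continuous_on UNIV (\<lambda>q. heis (A (fst q)) (B (fst q)) (iter_deriv (snd p) \<phi>) (snd q))" by (simp add: split_beta')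
  qed
  then show ?thesis by (simp add: split_beta' iter_deriv_heis[OF \<phi> bs])
qed

lemma schwartz_heis:
  assumes \<phi>: "schwartz \<phi>"
  shows "schwartz (heis x \<xi> \<phi>)"
proof (rule schwartzI)
  fix bs :: "'a list" assume bs: "set bs \<subseteq> Basis"
  show "\<exists>C. \<forall>y. (1 + norm y) ^ N * norm (iter_deriv bs (heis x \<xi> \<phi>) y) \<le> C" for N
    using heis_seminorm_bound[OF \<phi> bs, of N "max N (length bs)"] by (meson max.cobounded1 max.cobounded2)
  show "iter_deriv bs (heis x \<xi> \<phi>) differentiable at y" for y
    unfolding iter_deriv_heis[OF \<phi> bs] split_beta'
  proof (rule conjunct2[OF partial_deriv_sum_list])
    fix p assume "p \<in> set (heis_terms bs)"
    then have "set (snd p) \<subseteq> Basis" using heis_terms_subset[of "fst p" "snd p" bs] bs by auto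
    then show "(\<lambda>y. heis_coeff \<xi> (fst p) * heis x \<xi> (iter_deriv (snd p) \<phi>) y) differentiable at y"
      by (intro partial_deriv_cmult(2) heis_has_derivative(2) schwartz_iter_differentiable \<phi>)
  qed
qed

section \<open>Gaussian averages of Schwartz functions\<close>

text \<open>The polynomial is absorbed by \<open>exp (2 + \<pi> |w|\<^sup>2 / 2)\<close>, up to a factor \<open>K!\<close>, which leaves half of the Gaussian.\<close>

lemma gaussian_poly_integrable:
  "integrable lborel (\<lambda>w::'w::euclidean_space. gauss w * (1 + norm w) ^ K)"
proof (rule integrable_dominated)
  have "integrable lborel (\<lambda>w::'w. exp (- pi * ((1 / sqrt 2)\<^sup>2 * (norm w)\<^sup>2)))"
    by (rule gaussian_scaled_integrable) simp
  then have "integrable lborel (\<lambda>w::'w. exp (- pi * ((norm w)\<^sup>2 / 2)))" by (simp add: power_divide)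
  then show "integrable lborel (\<lambda>w::'w. (fact K * exp 2) * exp (- pi * ((norm w)\<^sup>2 / 2)))" by simp
  show "AE w::'w in lborel. norm (gauss w * (1 + norm w) ^ K) \<le> norm ((fact K * exp 2) * exp (- pi * ((norm w)\<^sup>2 / 2)))"
  proof (rule AE_I2)
    fix w :: 'w
    define t where "t = norm w"
    have t: "t \<ge> 0" by (simp add: t_def)
    have "(1 + t) ^ K / fact K \<le> exp (1 + t)"
      using exp_ge_one_plus_x_over_n_power_n summable_exp[of "1 + t"] sum_le_suminf[OF summable_exp[of "1 + t"], of "{K}"] t
      by (simp add: exp_def divide_inverse mult.commute)
    then have 1: "(1 + t) ^ K \<le> fact K * exp (1 + t)" by (simp add: field_simps)
    have "t \<le> 1 + t\<^sup>2 / 4" using zero_le_power2[of "t / 2 - 1"] by (simp add: power2_diff power_divide)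
    also have "\<dots> \<le> 1 + pi * (t\<^sup>2 / 2)"
      using mult_right_mono[of "1 / 2" pi "t\<^sup>2 / 2"] pi_ge_two by simp
    finally have "exp (1 + t) \<le> exp (2 + pi * (t\<^sup>2 / 2))" by simp
    with 1 have 2: "(1 + t) ^ K \<le> fact K * exp (2 + pi * (t\<^sup>2 / 2))"
      by (meson fact_ge_zero mult_left_mono order_trans)
    have "exp (- pi * t\<^sup>2) * (1 + t) ^ K \<le> exp (- pi * t\<^sup>2) * (fact K * exp (2 + pi * (t\<^sup>2 / 2)))"
      by (intro mult_left_mono 2) simp
    also have "\<dots> = (fact K * exp 2) * exp (- pi * (t\<^sup>2 / 2))"
      by (simp add: exp_add[symmetric] mult.left_commute[of "exp _" "fact K"] mult.assoc)
    finally show "norm (gauss w * (1 + norm w) ^ K) \<le> norm ((fact K * exp 2) * exp (- pi * ((norm w)\<^sup>2 / 2)))"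
      using t by (simp add: t_def abs_mult)
  qed
qed measurable

text \<open>Differentiation under the integral sign for total derivatives, by dominated convergence of the difference quotients along
  sequences; the mean value inequality dominates them.\<close>

lemma has_derivative_integral:
  fixes k :: "'w::euclidean_space \<Rightarrow> 'a::euclidean_space \<Rightarrow> complex" and d :: "'a \<Rightarrow> 'w \<Rightarrow> 'a \<Rightarrow> complex"
  assumes der: "\<And>w y. (k w has_derivative (\<lambda>h. \<Sum>b\<in>Basis. (h \<bullet> b) *\<^sub>R d b w y)) (at y)"
    and bound: "\<And>b w y. b \<in> Basis \<Longrightarrow> norm (d b w y) \<le> H w" and H: "integrable lborel H"
    and dm: "\<And>b y. b \<in> Basis \<Longrightarrow> (\<lambda>w. d b w y) \<in> borel_measurable borel"
    and k: "\<And>y. integrable lborel (\<lambda>w. k w y)"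
  shows "((\<lambda>y. LBINT w. k w y) has_derivative (\<lambda>h. \<Sum>b\<in>Basis. (h \<bullet> b) *\<^sub>R (LBINT w. d b w y))) (at y)"
proof -
  have H0: "H w \<ge> 0" for w
    using bound[of "SOME b. b \<in> Basis" w] some_in_eq[of "Basis :: 'a set"] norm_ge_zero order_trans by (metis nonempty_Basis)
  have di: "integrable lborel (\<lambda>w. d b w y)" if "b \<in> Basis" for b y
    by (rule integrable_dominated[OF H])
       (use that dm bound H0 in \<open>auto simp: abs_of_nonneg\<close>)
  define D where "D = (\<lambda>w y h. \<Sum>b\<in>Basis. (h \<bullet> b) *\<^sub>R d b w y)"
  have Dbound: "norm (D w y h) \<le> (DIM('a) * H w) * norm h" for w y h
  proof -
    have "norm (D w y h) \<le> (\<Sum>b\<in>(Basis::'a set). norm h * H w)"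
      unfolding D_def
    proof (rule sum_norm_le)
      fix b :: 'a assume b: "b \<in> Basis"
      show "norm ((h \<bullet> b) *\<^sub>R d b w y) \<le> norm h * H w"
        using Basis_le_norm[OF b, of h] bound[OF b, of w y] by (auto intro!: mult_mono)
    qed
    then show ?thesis by (simp add: mult_ac)
  qed
  have diff: "norm (k w (y + h) - k w y) \<le> (DIM('a) * H w) * norm h" for w y h
  proof -
    have "norm (k w (y + h) - k w y) \<le> (DIM('a) * H w) * norm ((y + h) - y)"
    proof (rule differentiable_bound[where f'="\<lambda>y h. D w y h" and S=UNIV])
      show "(k w has_derivative D w x) (at x within UNIV)" for x
        using der[of w x] by (simp add: D_def)
      show "onorm (D w x) \<le> DIM('a) * H w" for x
        by (rule onorm_le) (rule Dbound)
    qed auto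
    then show ?thesis by simp
  qed
  have Di: "integrable lborel (\<lambda>w. D w y h)" for h
    unfolding D_def by (intro Bochner_Integration.integrable_sum integrable_scaleR_right di)
  have Dint: "(\<Sum>b\<in>Basis. (h \<bullet> b) *\<^sub>R (LBINT w. d b w y)) = (LBINT w. D w y h)" for h
    unfolding D_def by (subst Bochner_Integration.integral_sum) (auto intro: di)
  show ?thesis
    unfolding has_derivative_at
  proof
    show "bounded_linear (\<lambda>h. \<Sum>b\<in>Basis. (h \<bullet> b) *\<^sub>R (LBINT w. d b w y))"
      by (intro bounded_linear_sum bounded_linear_scaleR_const bounded_linear_inner_left)
    show "(\<lambda>h. norm ((LBINT w. k w (y + h)) - (LBINT w. k w y) - (\<Sum>b\<in>Basis. (h \<bullet> b) *\<^sub>R (LBINT w. d b w y))) / norm h) \<midarrow>0\<rightarrow> 0"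
      unfolding tendsto_at_iff_sequentially comp_def
    proof (intro allI impI)
      fix h :: "nat \<Rightarrow> 'a" assume h: "\<forall>i. h i \<in> UNIV - {0}" "h \<longlonglongrightarrow> 0"
      define e where "e = (\<lambda>i w. norm (k w (y + h i) - k w y - D w y (h i)) / norm (h i))"
      have "(\<lambda>i. LBINT w. e i w) \<longlonglongrightarrow> (\<integral>w. 0 \<partial>(lborel :: 'w measure))"
      proof (rule integral_dominated_convergence)
        show "integrable lborel (\<lambda>w. 2 * (DIM('a) * H w))" using H by simp
        show "AE w in lborel. (\<lambda>i. e i w) \<longlonglongrightarrow> 0"
        proof (rule AE_I2)
          fix w
          have "(\<lambda>h. norm (k w (y + h) - k w y - D w y h) / norm h) \<midarrow>0\<rightarrow> 0"
            using der[of w y] by (simp add: has_derivative_at D_def)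
          then show "(\<lambda>i. e i w) \<longlonglongrightarrow> 0"
            using h unfolding e_def tendsto_at_iff_sequentially comp_def by blast
        qed
        fix i
        show "AE w in lborel. norm (e i w) \<le> 2 * (DIM('a) * H w)"
        proof (rule AE_I2)
          fix w
          have "norm (k w (y + h i) - k w y - D w y (h i)) \<le> norm (k w (y + h i) - k w y) + norm (D w y (h i))"
            by (rule norm_triangle_ineq4)
          also have "\<dots> \<le> (2 * (DIM('a) * H w)) * norm (h i)"
            using diff[of w y "h i"] Dbound[of w y "h i"] by (simp add: algebra_simps)
          finally show "norm (e i w) \<le> 2 * (DIM('a) * H w)"
            using h(1) by (simp add: e_def pos_divide_le_eq)
        qed
        show "e i \<in> borel_measurable lborel" unfolding e_def
          using borel_measurable_integrable[OF k[of y]] borel_measurable_integrable[OF k[of "y + h i"]] borel_measurable_integrable[OF Di[of "h i"]]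
          by measurable
      qed simp
      then have lim: "(\<lambda>i. LBINT w. e i w) \<longlonglongrightarrow> 0" by simp
      show "(\<lambda>i. norm ((LBINT w. k w (y + h i)) - (LBINT w. k w y) - (\<Sum>b\<in>Basis. (h i \<bullet> b) *\<^sub>R (LBINT w. d b w y))) / norm (h i)) \<longlonglongrightarrow> 0"
      proof (rule tendsto_sandwich[OF _ _ tendsto_const lim])
        show "eventually (\<lambda>i. norm ((LBINT w. k w (y + h i)) - (LBINT w. k w y) - (\<Sum>b\<in>Basis. (h i \<bullet> b) *\<^sub>R (LBINT w. d b w y))) / norm (h i)
          \<le> (LBINT w. e i w)) sequentially"
        proof (intro always_eventually allI)
          fix i
          have "(LBINT w. k w (y + h i)) - (LBINT w. k w y) - (\<Sum>b\<in>Basis. (h i \<bullet> b) *\<^sub>R (LBINT w. d b w y)) =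
            (LBINT w. k w (y + h i) - k w y - D w y (h i))"
            unfolding Dint using k Di by simp
          also have "norm \<dots> \<le> (LBINT w. norm (k w (y + h i) - k w y - D w y (h i)))"
            by (rule integral_norm_bound)
          finally show "norm ((LBINT w. k w (y + h i)) - (LBINT w. k w y) - (\<Sum>b\<in>Basis. (h i \<bullet> b) *\<^sub>R (LBINT w. d b w y))) / norm (h i)
          \<le> (LBINT w. e i w)"
            unfolding e_def by (simp add: divide_right_mono)
        qed
      qed (simp add: always_eventually)
    qed
  qed
qed

text \<open>Families of Schwartz functions of polynomial growth: exactly what is needed to integrate them against a Gaussian in the
  Schwartz space.\<close>

definition schwartz_family :: "('w::euclidean_space \<Rightarrow> 'a::euclidean_space \<Rightarrow> complex) \<Rightarrow> bool" where
  "schwartz_family \<Phi> \<longleftrightarrow> (\<forall>w. schwartz (\<Phi> w)) \<and>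
     (\<forall>bs. set bs \<subseteq> Basis \<longrightarrow> continuous_on UNIV (\<lambda>(w, y). iter_deriv bs (\<Phi> w) y)) \<and>
     (\<forall>bs N. set bs \<subseteq> Basis \<longrightarrow> (\<exists>C K. \<forall>w y. (1 + norm y) ^ N * norm (iter_deriv bs (\<Phi> w) y) \<le> C * (1 + norm w) ^ K))"

definition gauss_average :: "('w::euclidean_space \<Rightarrow> 'a::euclidean_space \<Rightarrow> complex) \<Rightarrow> 'a \<Rightarrow> complex" where
  "gauss_average \<Phi> y = (LBINT w. complex_of_real (gauss w) * \<Phi> w y)"

lemma one_plus_mult_le:
  fixes x c n :: real
  assumes "x \<le> c * n" "0 \<le> c" "0 \<le> n"
  shows "1 + x \<le> (1 + c) * (1 + n)"
proof -
  have "(1 + c) * (1 + n) = 1 + c + n + c * n" by (simp add: algebra_simps)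
  with assms show ?thesis by linarith
qed

lemma heis_linear_bound:
  fixes A B :: "'w::euclidean_space \<Rightarrow> 'a::euclidean_space"
  assumes A: "linear A" and B: "linear B" and bs: "set bs \<subseteq> Basis"
  obtains C where "C \<ge> 0"
    "\<And>\<phi> w y. schwartz \<phi> \<Longrightarrow> (1 + norm y) ^ N * norm (iter_deriv bs (heis (A w) (B w) \<phi>) y) \<le>
       C * schwartz_seminorm (max N (length bs)) \<phi> * (1 + norm w) ^ (length bs + N)"
proof -
  obtain a where a: "a > 0" "\<And>w. norm (A w) \<le> a * norm w" using linear_bounded_pos[OF A] by blast
  obtain b where b: "b > 0" "\<And>w. norm (B w) \<le> b * norm w" using linear_bounded_pos[OF B] by blast
  define C where "C = 2 ^ length bs * ((1 + 2 * pi * b) ^ length bs * (1 + a) ^ N)"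
  show thesis
  proof (rule that[of C])
    show "C \<ge> 0" using a b by (simp add: C_def)
    fix \<phi> :: "'a \<Rightarrow> complex" and w y assume \<phi>: "schwartz \<phi>"
    let ?p = "schwartz_seminorm (max N (length bs)) \<phi>"
    have "1 + norm (A w) \<le> (1 + a) * (1 + norm w)"
      using a(2)[of w] a(1) by (intro one_plus_mult_le) auto
    then have A': "(1 + norm (A w)) ^ N \<le> ((1 + a) * (1 + norm w)) ^ N" by (intro power_mono) auto
    have "2 * pi * norm (B w) \<le> 2 * pi * b * norm w" using b(2)[of w] by (simp add: mult_left_mono)
    then have "1 + 2 * pi * norm (B w) \<le> (1 + 2 * pi * b) * (1 + norm w)"
      using b(1) by (intro one_plus_mult_le) auto
    then have B': "(1 + 2 * pi * norm (B w)) ^ length bs \<le> ((1 + 2 * pi * b) * (1 + norm w)) ^ length bs"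
      by (intro power_mono) auto
    have "(1 + norm y) ^ N * norm (iter_deriv bs (heis (A w) (B w) \<phi>) y) \<le>
      2 ^ length bs * ((1 + 2 * pi * norm (B w)) ^ length bs * (1 + norm (A w)) ^ N * ?p)"
      by (rule heis_seminorm_bound[OF \<phi> bs]) auto
    also have "\<dots> \<le> 2 ^ length bs * (((1 + 2 * pi * b) * (1 + norm w)) ^ length bs * ((1 + a) * (1 + norm w)) ^ N * ?p)"
      using A' B' a b schwartz_seminorm_nonneg[OF \<phi>] by (intro mult_left_mono mult_right_mono mult_mono) auto
    also have "\<dots> = C * ?p * (1 + norm w) ^ (length bs + N)"
      by (simp add: C_def power_mult_distrib power_add mult_ac)
    finally show "(1 + norm y) ^ N * norm (iter_deriv bs (heis (A w) (B w) \<phi>) y) \<le> C * ?p * (1 + norm w) ^ (length bs + N)" .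
  qed
qed

lemma heis_family:
  fixes A B :: "'w::euclidean_space \<Rightarrow> 'a::euclidean_space"
  assumes A: "linear A" and B: "linear B" and \<phi>: "schwartz \<phi>"
  shows "schwartz_family (\<lambda>w. heis (A w) (B w) \<phi>)"
  unfolding schwartz_family_def
proof (intro conjI allI impI)
  show "schwartz (heis (A w) (B w) \<phi>)" for w by (rule schwartz_heis[OF \<phi>])
  fix bs :: "'a list" assume bs: "set bs \<subseteq> Basis"
  show "continuous_on UNIV (\<lambda>(w, y). iter_deriv bs (heis (A w) (B w) \<phi>) y)"
    using A B by (intro iter_deriv_heis_continuous[OF \<phi> bs] linear_continuous_on) (simp_all add: linear_conv_bounded_linear)
  show "\<exists>C K. \<forall>w y. (1 + norm y) ^ N * norm (iter_deriv bs (heis (A w) (B w) \<phi>) y) \<le> C * (1 + norm w) ^ K" for N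
    using heis_linear_bound[OF A B bs, of N] \<phi> by metis
qed

context
  fixes \<Phi> :: "'w::euclidean_space \<Rightarrow> 'a::euclidean_space \<Rightarrow> complex"
  assumes fam: "schwartz_family \<Phi>"
begin

lemma family_schwartz: "schwartz (\<Phi> w)"
  using fam by (simp add: schwartz_family_def)

lemma family_continuous: "set bs \<subseteq> Basis \<Longrightarrow> continuous_on UNIV (\<lambda>(w, y). iter_deriv bs (\<Phi> w) y)"
  using fam by (simp add: schwartz_family_def)

lemma family_bound:
  assumes "set bs \<subseteq> Basis"
  obtains C K where "C \<ge> 0" "\<And>w y. (1 + norm y) ^ N * norm (iter_deriv bs (\<Phi> w) y) \<le> C * (1 + norm w) ^ K"
proof -
  from fam assms obtain C K where *: "\<And>w y. (1 + norm y) ^ N * norm (iter_deriv bs (\<Phi> w) y) \<le> C * (1 + norm w) ^ K"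
    unfolding schwartz_family_def by meson
  have "0 \<le> (1 + norm (0::'a)) ^ N * norm (iter_deriv bs (\<Phi> 0) 0)" by simp
  also have "\<dots> \<le> C" using *[of 0 0] by simp
  finally show thesis using that * by blast
qed

lemma family_measurable:
  assumes "set bs \<subseteq> Basis"
  shows "(\<lambda>w. iter_deriv bs (\<Phi> w) y) \<in> borel_measurable borel"
proof (rule borel_measurable_continuous_onI)
  have "continuous_on UNIV (\<lambda>w::'w. (w, y))" by (intro continuous_intros)
  from continuous_on_compose2[OF family_continuous[OF assms] this]
  show "continuous_on UNIV (\<lambda>w. iter_deriv bs (\<Phi> w) y)" by simp
qed

lemma family_integrable:
  assumes bs: "set bs \<subseteq> Basis"
  shows "integrable lborel (\<lambda>w. complex_of_real (gauss w) * iter_deriv bs (\<Phi> w) y)"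
proof -
  obtain C K where C: "C \<ge> 0" "\<And>w y. (1 + norm y) ^ 0 * norm (iter_deriv bs (\<Phi> w) y) \<le> C * (1 + norm w) ^ K"
    using family_bound[OF bs, of 0] by blast
  show ?thesis
  proof (rule integrable_dominated)
    show "integrable lborel (\<lambda>w::'w. C * (gauss w * (1 + norm w) ^ K))"
      using gaussian_poly_integrable[of K, where 'w='w] by simp
    show "(\<lambda>w. complex_of_real (gauss w) * iter_deriv bs (\<Phi> w) y) \<in> borel_measurable lborel"
      using family_measurable[OF bs, of y] by simp
    show "AE w in lborel. norm (complex_of_real (gauss w) * iter_deriv bs (\<Phi> w) y) \<le> norm (C * (gauss w * (1 + norm w) ^ K))"
      using C by (intro AE_I2) (simp add: norm_mult abs_mult mult.left_commute[of C] mult_left_mono)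
  qed
qed

lemma iter_deriv_gauss_average:
  assumes bs: "set bs \<subseteq> Basis"
  shows "iter_deriv bs (gauss_average \<Phi>) = (\<lambda>y. LBINT w. complex_of_real (gauss w) * iter_deriv bs (\<Phi> w) y)"
    and "iter_deriv bs (gauss_average \<Phi>) differentiable at y"
proof -
  define G where "G = (\<lambda>w::'w. complex_of_real (gauss w))"
  have der: "((\<lambda>y. LBINT w. G w * iter_deriv bs (\<Phi> w) y) has_derivative
      (\<lambda>h. \<Sum>b\<in>Basis. (h \<bullet> b) *\<^sub>R (LBINT w. G w * iter_deriv (b # bs) (\<Phi> w) y))) (at y)"
    if bs: "set bs \<subseteq> Basis" for bs and y :: 'a
  proof -
    have sub: "set (b # bs) \<subseteq> Basis" if "b \<in> Basis" for b using that bs by simp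
    define Q where "Q = (\<lambda>b p. fst p \<ge> 0 \<and> (\<forall>w y. norm (iter_deriv (b # bs) (\<Phi> w) y) \<le> fst p * (1 + norm w) ^ snd p))"
    have "\<forall>b\<in>Basis. \<exists>p. Q b p"
    proof
      fix b :: 'a assume "b \<in> Basis"
      from family_bound[OF sub[OF this], of 0] obtain C K where "C \<ge> 0" "\<And>w y. (1 + norm y) ^ 0 * norm (iter_deriv (b # bs) (\<Phi> w) y) \<le> C * (1 + norm w) ^ K"
        by blast
      then have "Q b (C, K)" by (simp add: Q_def)
      then show "\<exists>p. Q b p" ..
    qed
    from bchoice[OF this] obtain q where q: "\<forall>b\<in>Basis. Q b (q b)" ..
    define C where "C = (\<lambda>b. fst (q b))"
    define K where "K = (\<lambda>b. snd (q b))"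
    have CK: "C b \<ge> 0" "norm (iter_deriv (b # bs) (\<Phi> w) y) \<le> C b * (1 + norm w) ^ K b" if "b \<in> Basis" for b w y
      using q that unfolding Q_def C_def K_def by blast+
    define H where "H = (\<lambda>w::'w. \<Sum>b\<in>Basis. C b * (gauss w * (1 + norm w) ^ K b))"
    have H: "integrable lborel H" unfolding H_def
      by (intro Bochner_Integration.integrable_sum integrable_mult_right gaussian_poly_integrable)
    show ?thesis
    proof (rule has_derivative_integral[OF _ _ H])
      fix w y
      have d: "iter_deriv bs (\<Phi> w) differentiable at y" by (rule schwartz_iter_differentiable[OF family_schwartz bs])
      have "((\<lambda>y. G w * iter_deriv bs (\<Phi> w) y) has_derivative (\<lambda>h. \<Sum>b\<in>Basis. (h \<bullet> b) *\<^sub>R partial_deriv b (\<lambda>y. G w * iter_deriv bs (\<Phi> w) y) y)) (at y)"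
        by (intro differentiable_has_partials partial_deriv_cmult d)
      then show "((\<lambda>y. G w * iter_deriv bs (\<Phi> w) y) has_derivative (\<lambda>h. \<Sum>b\<in>Basis. (h \<bullet> b) *\<^sub>R (G w * iter_deriv (b # bs) (\<Phi> w) y))) (at y)"
        by (simp add: partial_deriv_cmult d)
    next
      fix b :: 'a and w y assume b: "b \<in> Basis"
      have "norm (G w * iter_deriv (b # bs) (\<Phi> w) y) \<le> gauss w * (C b * (1 + norm w) ^ K b)"
        unfolding G_def norm_mult using CK(2)[OF b, of w y] by (simp del: iter_deriv_Cons)
      also have "\<dots> = C b * (gauss w * (1 + norm w) ^ K b)" by simp
      also have "\<dots> \<le> H w" unfolding H_def
        by (rule member_le_sum[OF b]) (auto simp: CK)
      finally show "norm (G w * iter_deriv (b # bs) (\<Phi> w) y) \<le> H w" .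
    next
      fix b y :: 'a assume "b \<in> Basis"
      from borel_measurable_integrable[OF family_integrable[OF sub[OF this], of y]]
      show "(\<lambda>w. G w * iter_deriv (b # bs) (\<Phi> w) y) \<in> borel_measurable borel" by (simp add: G_def)
    next
      show "integrable lborel (\<lambda>w. G w * iter_deriv bs (\<Phi> w) y)" for y
        unfolding G_def by (rule family_integrable[OF bs])
    qed
  qed
  have main: "iter_deriv bs (gauss_average \<Phi>) = (\<lambda>y. LBINT w. G w * iter_deriv bs (\<Phi> w) y)"
    using bs
  proof (induction bs)
    case Nil
    then show ?case by (simp add: gauss_average_def[abs_def] G_def)
  next
    case (Cons b bs)
    then have bs: "set bs \<subseteq> Basis" and b: "b \<in> Basis" by auto
    show ?case
    proof
      fix y
      have "iter_deriv (b # bs) (gauss_average \<Phi>) y = partial_deriv b (\<lambda>y. LBINT w. G w * iter_deriv bs (\<Phi> w) y) y"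
        using Cons.IH[OF bs] by simp
      also have "\<dots> = (\<Sum>c\<in>Basis. (b \<bullet> c) *\<^sub>R (LBINT w. G w * iter_deriv (c # bs) (\<Phi> w) y))"
        by (rule partial_deriv_eq[OF der[OF bs]])
      also have "\<dots> = (\<Sum>c\<in>Basis. if c = b then (LBINT w. G w * iter_deriv (c # bs) (\<Phi> w) y) else 0)"
        using b by (intro sum.cong) (auto simp: inner_Basis)
      also have "\<dots> = (LBINT w. G w * iter_deriv (b # bs) (\<Phi> w) y)" using b by simp
      finally show "iter_deriv (b # bs) (gauss_average \<Phi>) y = (LBINT w. G w * iter_deriv (b # bs) (\<Phi> w) y)" .
    qed
  qed
  then show "iter_deriv bs (gauss_average \<Phi>) = (\<lambda>y. LBINT w. complex_of_real (gauss w) * iter_deriv bs (\<Phi> w) y)"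
    by (simp add: G_def)
  show "iter_deriv bs (gauss_average \<Phi>) differentiable at y"
    unfolding main using der[OF bs] by (rule differentiableI)
qed

lemma gauss_average_norm_le:
  assumes bs: "set bs \<subseteq> Basis" and bnd: "\<And>w. (1 + norm y) ^ N * norm (iter_deriv bs (\<Phi> w) y) \<le> C * (1 + norm w) ^ K"
  shows "(1 + norm y) ^ N * norm (iter_deriv bs (gauss_average \<Phi>) y) \<le> C * (\<integral>w. gauss w * (1 + norm w) ^ K \<partial>(lborel :: 'w measure))"
proof -
  have "(1 + norm y) ^ N * norm (iter_deriv bs (gauss_average \<Phi>) y) =
    norm (LBINT w. complex_of_real ((1 + norm y) ^ N) * (complex_of_real (gauss w) * iter_deriv bs (\<Phi> w) y))"
    unfolding iter_deriv_gauss_average(1)[OF bs] integral_mult_right_zero norm_mult norm_of_real by simp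
  also have "\<dots> \<le> (\<integral>w. C * (gauss w * (1 + norm w) ^ K) \<partial>(lborel :: 'w measure))"
  proof (rule Bochner_Integration.integral_norm_bound_integral)
    show "integrable lborel (\<lambda>w. complex_of_real ((1 + norm y) ^ N) * (complex_of_real (gauss w) * iter_deriv bs (\<Phi> w) y))"
      by (intro integrable_mult_right family_integrable bs)
    show "integrable lborel (\<lambda>w::'w. C * (gauss w * (1 + norm w) ^ K))"
      by (intro integrable_mult_right gaussian_poly_integrable)
    fix w :: 'w
    have "gauss w * ((1 + norm y) ^ N * norm (iter_deriv bs (\<Phi> w) y)) \<le> gauss w * (C * (1 + norm w) ^ K)"
      by (intro mult_left_mono bnd) simp
    then show "norm (complex_of_real ((1 + norm y) ^ N) * (complex_of_real (gauss w) * iter_deriv bs (\<Phi> w) y))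
        \<le> C * (gauss w * (1 + norm w) ^ K)"
      unfolding norm_mult norm_of_real by (simp add: mult_ac)
  qed
  finally show ?thesis by simp
qed

lemma schwartz_gauss_average: "schwartz (gauss_average \<Phi>)"
proof (rule schwartzI)
  fix bs :: "'a list" assume bs: "set bs \<subseteq> Basis"
  show "iter_deriv bs (gauss_average \<Phi>) differentiable at y" for y by (rule iter_deriv_gauss_average(2)[OF bs])
  show "\<exists>C. \<forall>y. (1 + norm y) ^ N * norm (iter_deriv bs (gauss_average \<Phi>) y) \<le> C" for N
  proof -
    obtain C K where "C \<ge> 0" "\<And>w y. (1 + norm y) ^ N * norm (iter_deriv bs (\<Phi> w) y) \<le> C * (1 + norm w) ^ K"
      using family_bound[OF bs, of N] by blast
    then show ?thesis using gauss_average_norm_le[OF bs, of _ N C K] by blast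
  qed
qed

lemma family_seminorm_bound:
  obtains C K where "C \<ge> 0" "\<And>w. schwartz_seminorm N (\<Phi> w) \<le> C * (1 + norm w) ^ K"
proof -
  let ?B = "{bs. set bs \<subseteq> (Basis :: 'a set) \<and> length bs \<le> N}"
  define Q where "Q = (\<lambda>bs p. fst p \<ge> 0 \<and> (\<forall>w y. (1 + norm y) ^ N * norm (iter_deriv bs (\<Phi> w) y) \<le> fst p * (1 + norm w) ^ snd p))"
  have "\<forall>bs\<in>?B. \<exists>p. Q bs p"
  proof
    fix bs assume "bs \<in> ?B"
    then have "set bs \<subseteq> Basis" by simp
    from family_bound[OF this, of N] obtain C K where "C \<ge> 0" "\<And>w y. (1 + norm y) ^ N * norm (iter_deriv bs (\<Phi> w) y) \<le> C * (1 + norm w) ^ K"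
      by blast
    then have "Q bs (C, K)" by (simp add: Q_def)
    then show "\<exists>p. Q bs p" ..
  qed
  from bchoice[OF this] obtain q where q: "\<forall>bs\<in>?B. Q bs (q bs)" ..
  define C where "C = (\<lambda>bs. fst (q bs))"
  define K where "K = (\<lambda>bs. snd (q bs))"
  have CK: "C bs \<ge> 0" "(1 + norm y) ^ N * norm (iter_deriv bs (\<Phi> w) y) \<le> C bs * (1 + norm w) ^ K bs" if "bs \<in> ?B" for bs w y
    using q that by (auto simp: Q_def C_def K_def)
  have fin: "finite ?B" by (rule finite_multiindices)
  show thesis
  proof (rule that[of "\<Sum>bs\<in>?B. C bs" "\<Sum>bs\<in>?B. K bs"])
    show "(\<Sum>bs\<in>?B. C bs) \<ge> 0" using CK by (intro sum_nonneg) auto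
    fix w
    show "schwartz_seminorm N (\<Phi> w) \<le> (\<Sum>bs\<in>?B. C bs) * (1 + norm w) ^ (\<Sum>bs\<in>?B. K bs)"
      unfolding schwartz_seminorm_sup sum_distrib_right
    proof (intro sum_mono schwartz_sup_le)
      fix bs and y :: 'a assume bs: "bs \<in> ?B"
      have "(1 + norm y) ^ N * norm (iter_deriv bs (\<Phi> w) y) \<le> C bs * (1 + norm w) ^ K bs" by (rule CK(2)[OF bs])
      also have "\<dots> \<le> C bs * (1 + norm w) ^ (\<Sum>bs\<in>?B. K bs)"
        using CK(1)[OF bs] member_le_sum[OF bs, of K] fin by (intro mult_left_mono power_increasing) auto
      finally show "(1 + norm y) ^ N * norm (iter_deriv bs (\<Phi> w) y) \<le> C bs * (1 + norm w) ^ (\<Sum>bs\<in>?B. K bs)" .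
    qed
  qed
qed

text \<open>Continuity in the parameter, uniformly in \<open>y\<close>: for large \<open>y\<close> the extra power of \<open>1 + |y|\<close> makes both terms small, and on
  the remaining ball continuity is uniform by compactness.\<close>

lemma family_uniform:
  assumes bs: "set bs \<subseteq> Basis" and e: "e > 0"
  shows "\<exists>\<delta>>0. \<forall>v. dist v w < \<delta> \<longrightarrow> (\<forall>y. (1 + norm y) ^ N * norm (iter_deriv bs (\<Phi> v) y - iter_deriv bs (\<Phi> w) y) \<le> e)"
proof -
  let ?F = "\<lambda>v y. iter_deriv bs (\<Phi> v) y"
  obtain C K where C: "C \<ge> 0" "\<And>w y. (1 + norm y) ^ Suc N * norm (?F w y) \<le> C * (1 + norm w) ^ K"
    using family_bound[OF bs, of "Suc N"] by blast
  define B where "B = C * (2 + norm w) ^ K"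
  have B: "(1 + norm y) ^ Suc N * norm (?F v y) \<le> B" if "dist v w < 1" for v y
  proof -
    have "norm v \<le> 1 + norm w" using that norm_triangle_ineq2[of v w] by (simp add: dist_norm)
    then have "C * (1 + norm v) ^ K \<le> B" unfolding B_def using C(1) by (intro mult_left_mono power_mono) auto
    with C(2)[of y v] show ?thesis by linarith
  qed
  have B0: "B \<ge> 0" using C(1) by (simp add: B_def)
  define R where "R = 2 * B / e"
  have R: "R \<ge> 0" using B0 e by (simp add: R_def)
  define e' where "e' = e / (1 + R) ^ N"
  have e': "e' > 0" using e R by (simp add: e'_def)
  have "uniformly_continuous_on (cball w 1 \<times> cball 0 R) (\<lambda>(v, y). ?F v y)"
    by (intro compact_uniformly_continuous compact_Times compact_cball continuous_on_subset[OF family_continuous[OF bs]]) auto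
  then obtain \<delta> where \<delta>: "\<delta> > 0" "\<And>p q. p \<in> cball w 1 \<times> cball 0 R \<Longrightarrow> q \<in> cball w 1 \<times> cball 0 R \<Longrightarrow> dist q p < \<delta> \<Longrightarrow>
      dist ((\<lambda>(v, y). ?F v y) q) ((\<lambda>(v, y). ?F v y) p) < e'"
    unfolding uniformly_continuous_on_def using e' by metis
  show ?thesis
  proof (intro exI[of _ "min 1 \<delta>"] conjI allI impI)
    show "min 1 \<delta> > 0" using \<delta> by simp
    fix v y assume v: "dist v w < min 1 \<delta>"
    show "(1 + norm y) ^ N * norm (?F v y - ?F w y) \<le> e"
    proof (cases "norm y \<le> R")
      case True
      have "dist (v, y) (w, y) < \<delta>" using v by (simp add: dist_Pair_Pair)
      then have "norm (?F v y - ?F w y) < e'"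
        using \<delta>(2)[of "(w, y)" "(v, y)"] v True by (simp add: dist_norm norm_minus_commute)
      moreover have "(1 + norm y) ^ N \<le> (1 + R) ^ N" using True by (intro power_mono) auto
      ultimately have "(1 + norm y) ^ N * norm (?F v y - ?F w y) \<le> (1 + R) ^ N * e'"
        using R by (intro mult_mono) auto
      then show ?thesis using R by (simp add: e'_def)
    next
      case False
      have "(1 + norm y) ^ Suc N * norm (?F v y - ?F w y) \<le> (1 + norm y) ^ Suc N * (norm (?F v y) + norm (?F w y))"
        by (intro mult_left_mono norm_triangle_ineq4) auto
      also have "\<dots> \<le> 2 * B" using B[of v y] B[of w y] v by (simp add: distrib_left)
      finally have *: "(1 + norm y) * ((1 + norm y) ^ N * norm (?F v y - ?F w y)) \<le> 2 * B" by (simp add: mult.assoc)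
      have "2 * B \<le> e * (1 + norm y)"
      proof -
        have "2 * B = e * R" using e by (simp add: R_def)
        also have "\<dots> \<le> e * (1 + norm y)" using False e by (intro mult_left_mono) auto
        finally show ?thesis .
      qed
      with * have "(1 + norm y) * ((1 + norm y) ^ N * norm (?F v y - ?F w y)) \<le> (1 + norm y) * e"
        by (simp add: mult.commute)
      then show ?thesis by (simp add: add_pos_nonneg)
    qed
  qed
qed

definition fam_dist :: "nat \<Rightarrow> 'w \<Rightarrow> 'w \<Rightarrow> real" where
  "fam_dist N v w = schwartz_seminorm N (\<lambda>y. \<Phi> v y - \<Phi> w y)"

lemma fam_dist_tendsto: "((\<lambda>v. fam_dist N v w) \<longlongrightarrow> 0) (at w)"
proof (rule tendstoI)
  fix e :: real assume e: "e > 0"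
  let ?B = "{bs. set bs \<subseteq> (Basis :: 'a set) \<and> length bs \<le> N}"
  define e' where "e' = e / (card ?B + 1)"
  have e': "e' > 0" "card ?B * e' < e" using e by (auto simp: e'_def field_simps)
  have "eventually (\<lambda>v. \<forall>bs\<in>?B. \<forall>y. (1 + norm y) ^ N * norm (iter_deriv bs (\<Phi> v) y - iter_deriv bs (\<Phi> w) y) \<le> e') (at w)"
  proof (rule eventually_ball_finite[OF finite_multiindices], rule ballI)
    fix bs assume "bs \<in> ?B"
    then obtain \<delta> where "\<delta> > 0" "\<And>v. dist v w < \<delta> \<Longrightarrow> (\<forall>y. (1 + norm y) ^ N * norm (iter_deriv bs (\<Phi> v) y - iter_deriv bs (\<Phi> w) y) \<le> e')"
      using family_uniform[of bs e' w N] e' by auto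
    then show "eventually (\<lambda>v. \<forall>y. (1 + norm y) ^ N * norm (iter_deriv bs (\<Phi> v) y - iter_deriv bs (\<Phi> w) y) \<le> e') (at w)"
      unfolding eventually_at by blast
  qed
  then show "eventually (\<lambda>v. dist (fam_dist N v w) 0 < e) (at w)"
  proof eventually_elim
    fix v assume *: "\<forall>bs\<in>?B. \<forall>y. (1 + norm y) ^ N * norm (iter_deriv bs (\<Phi> v) y - iter_deriv bs (\<Phi> w) y) \<le> e'"
    have "fam_dist N v w \<le> card ?B * e'"
      unfolding fam_dist_def
    proof (rule schwartz_seminorm_le)
      fix bs :: "'a list" and y assume bs: "set bs \<subseteq> Basis" "length bs \<le> N"
      show "(1 + norm y) ^ N * norm (iter_deriv bs (\<lambda>y. \<Phi> v y - \<Phi> w y) y) \<le> e'"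
        using * bs by (simp add: schwartz_diff(2)[OF family_schwartz family_schwartz bs(1)])
    qed
    moreover have "fam_dist N v w \<ge> 0"
      unfolding fam_dist_def by (intro schwartz_seminorm_nonneg schwartz_diff family_schwartz)
    ultimately show "dist (fam_dist N v w) 0 < e" using e' by simp
  qed
qed

lemma fam_dist_nonneg: "fam_dist N v w \<ge> 0"
  unfolding fam_dist_def by (intro schwartz_seminorm_nonneg schwartz_diff family_schwartz)

lemma fam_dist_commute: "fam_dist N v w = fam_dist N w v"
proof -
  have "fam_dist N v w \<le> fam_dist N w v" for v w
  proof -
    have "fam_dist N v w = schwartz_seminorm N (\<lambda>y. (-1) * (\<Phi> w y - \<Phi> v y))" by (simp add: fam_dist_def)
    also have "\<dots> \<le> norm (-1::complex) * schwartz_seminorm N (\<lambda>y. \<Phi> w y - \<Phi> v y)"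
      by (intro schwartz_seminorm_scale schwartz_diff family_schwartz)
    finally show ?thesis by (simp add: fam_dist_def)
  qed
  then show ?thesis by (intro antisym)
qed

lemma fam_dist_triangle: "fam_dist N v w \<le> fam_dist N v x + fam_dist N x w"
proof -
  have "fam_dist N v w = schwartz_seminorm N (\<lambda>y. (\<Phi> v y - \<Phi> x y) + (\<Phi> x y - \<Phi> w y))" by (simp add: fam_dist_def)
  also have "\<dots> \<le> fam_dist N v x + fam_dist N x w"
    unfolding fam_dist_def by (intro schwartz_seminorm_add schwartz_diff family_schwartz)
  finally show ?thesis .
qed

lemma fam_dist_self: "fam_dist N w w = 0"
proof -
  have "schwartz_sup N bs (\<lambda>y. \<Phi> w y - \<Phi> w y) = 0" if "set bs \<subseteq> Basis" for bs
    unfolding schwartz_sup_def schwartz_diff(2)[OF family_schwartz family_schwartz that] by simp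
  then show ?thesis unfolding fam_dist_def schwartz_seminorm_sup by (intro sum.neutral) auto
qed

lemma fam_dist_le: "fam_dist N v w \<le> schwartz_seminorm N (\<Phi> v) + schwartz_seminorm N (\<Phi> w)"
proof -
  have "fam_dist N v w = schwartz_seminorm N (\<lambda>y. \<Phi> v y + (-1) * \<Phi> w y)" by (simp add: fam_dist_def)
  also have "\<dots> \<le> schwartz_seminorm N (\<Phi> v) + schwartz_seminorm N (\<lambda>y. (-1) * \<Phi> w y)"
    by (intro schwartz_seminorm_add schwartz_scale family_schwartz)
  also have "\<dots> \<le> schwartz_seminorm N (\<Phi> v) + norm (-1::complex) * schwartz_seminorm N (\<Phi> w)"
    by (intro add_left_mono schwartz_seminorm_scale family_schwartz)
  finally show ?thesis by simp
qed

lemma fam_dist_isCont: "isCont (\<lambda>v. fam_dist N v w) w"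
  unfolding isCont_def fam_dist_self by (rule fam_dist_tendsto)

lemma fam_dist_continuous: "continuous_on UNIV (\<lambda>p. fam_dist N (fst p) (snd p))"
proof (rule continuous_at_imp_continuous_on, rule ballI)
  fix p :: "'w \<times> 'w"
  have 1: "((\<lambda>q. fam_dist N (fst q) (fst p)) \<longlongrightarrow> 0) (at p)"
    using isCont_tendsto_compose[OF fam_dist_isCont[where N=N and w="fst p"], of fst "at p"] by (simp add: fam_dist_self tendsto_fst)
  have 2: "((\<lambda>q. fam_dist N (snd q) (snd p)) \<longlongrightarrow> 0) (at p)"
    using isCont_tendsto_compose[OF fam_dist_isCont[where N=N and w="snd p"], of snd "at p"] by (simp add: fam_dist_self tendsto_snd)
  have "((\<lambda>q. fam_dist N (fst q) (snd q) - fam_dist N (fst p) (snd p)) \<longlongrightarrow> 0) (at p)"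
  proof (rule tendsto_rabs_zero_cancel, rule tendsto_sandwich[OF _ _ tendsto_const])
    show "((\<lambda>q. fam_dist N (fst q) (fst p) + fam_dist N (snd q) (snd p)) \<longlongrightarrow> 0) (at p)"
      using tendsto_add[OF 1 2] by simp
    show "eventually (\<lambda>q. \<bar>fam_dist N (fst q) (snd q) - fam_dist N (fst p) (snd p)\<bar> \<le> fam_dist N (fst q) (fst p) + fam_dist N (snd q) (snd p)) (at p)"
    proof (intro always_eventually allI)
      fix q
      have "fam_dist N (fst q) (snd q) \<le> fam_dist N (fst q) (fst p) + fam_dist N (fst p) (snd p) + fam_dist N (snd p) (snd q)"
        using fam_dist_triangle[where N=N and v="fst q" and w="snd q" and x="fst p"] fam_dist_triangle[where N=N and v="fst p" and w="snd q" and x="snd p"] by linarith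
      moreover have "fam_dist N (fst p) (snd p) \<le> fam_dist N (fst p) (fst q) + fam_dist N (fst q) (snd q) + fam_dist N (snd q) (snd p)"
        using fam_dist_triangle[where N=N and v="fst p" and w="snd p" and x="fst q"] fam_dist_triangle[where N=N and v="fst q" and w="snd p" and x="snd q"] by linarith
      ultimately show "\<bar>fam_dist N (fst q) (snd q) - fam_dist N (fst p) (snd p)\<bar> \<le> fam_dist N (fst q) (fst p) + fam_dist N (snd q) (snd p)"
        using fam_dist_commute[where N=N and v="fst q" and w="fst p"] fam_dist_commute[where N=N and v="snd q" and w="snd p"] by linarith
    qed
  qed (simp add: always_eventually)
  then show "isCont (\<lambda>p. fam_dist N (fst p) (snd p)) p"
    unfolding isCont_def using Lim_null by blast
qed

end

section \<open>Tempered distributions and Gaussian averages\<close>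

lemma tempered_add: "tempered u \<Longrightarrow> schwartz \<phi> \<Longrightarrow> schwartz \<psi> \<Longrightarrow> u (\<lambda>x. \<phi> x + \<psi> x) = u \<phi> + u \<psi>"
  by (simp add: tempered_def)

lemma tempered_scale: "tempered u \<Longrightarrow> schwartz \<phi> \<Longrightarrow> u (\<lambda>x. c * \<phi> x) = cnj c * u \<phi>"
  by (simp add: tempered_def)

lemma tempered_diff:
  assumes "tempered u" "schwartz \<phi>" "schwartz \<psi>"
  shows "u (\<lambda>x. \<phi> x - \<psi> x) = u \<phi> - u \<psi>"
  using tempered_add[OF assms(1,2) schwartz_scale[OF assms(3), of "-1"]] tempered_scale[OF assms(1,3), of "-1"] by simp

lemma tempered_bound:
  assumes "tempered u"
  obtains C N where "C \<ge> 0" "\<And>\<phi>. schwartz \<phi> \<Longrightarrow> norm (u \<phi>) \<le> C * schwartz_seminorm N \<phi>"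
proof -
  from assms obtain N C where *: "\<And>\<phi>. schwartz \<phi> \<Longrightarrow> norm (u \<phi>) \<le> C * schwartz_seminorm N \<phi>"
    unfolding tempered_def by blast
  have "norm (u \<phi>) \<le> \<bar>C\<bar> * schwartz_seminorm N \<phi>" if "schwartz \<phi>" for \<phi>
    using *[OF that] mult_right_mono[OF abs_ge_self schwartz_seminorm_nonneg[OF that], of C N] by linarith
  then show thesis using that[of "\<bar>C\<bar>" N] by simp
qed

lemma schwartz_zero: "schwartz (\<lambda>x. 0)"
proof (rule schwartzI)
  fix bs :: "'a list"
  have z: "iter_deriv bs (\<lambda>x. 0) = (\<lambda>x. 0)"
  proof (induction bs)
    case (Cons b bs)
    have "((\<lambda>y::'a. 0::complex) has_derivative (\<lambda>h. 0)) (at y)" for y by simp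
    from partial_deriv_eq[OF this] Cons show ?case by auto
  qed simp
  show "iter_deriv bs (\<lambda>x. 0) differentiable at x" for x unfolding z by simp
  show "\<exists>C. \<forall>x. (1 + norm x) ^ N * norm (iter_deriv bs (\<lambda>x. 0) x) \<le> C" for N unfolding z by auto
qed

lemma schwartz_finite_sum:
  assumes fin: "finite R" and \<Phi>: "\<And>v. schwartz (\<Phi> v)"
  shows "schwartz (\<lambda>y. \<Sum>v\<in>R. m v * \<Phi> v y)"
    and "set bs \<subseteq> Basis \<Longrightarrow> iter_deriv bs (\<lambda>y. \<Sum>v\<in>R. m v * \<Phi> v y) y = (\<Sum>v\<in>R. m v * iter_deriv bs (\<Phi> v) y)"
    and "tempered u \<Longrightarrow> u (\<lambda>y. \<Sum>v\<in>R. m v * \<Phi> v y) = (\<Sum>v\<in>R. cnj (m v) * u (\<Phi> v))"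
proof -
  have 1: "schwartz (\<lambda>y. \<Sum>v\<in>R. m v * \<Phi> v y)" if "finite R" for R
    using that by (induction R) (simp_all add: schwartz_zero schwartz_add schwartz_scale \<Phi>)
  then show "schwartz (\<lambda>y. \<Sum>v\<in>R. m v * \<Phi> v y)" using fin .
  show "iter_deriv bs (\<lambda>y. \<Sum>v\<in>R. m v * \<Phi> v y) y = (\<Sum>v\<in>R. m v * iter_deriv bs (\<Phi> v) y)" if bs: "set bs \<subseteq> Basis"
    using fin
  proof (induction R)
    case empty
    then show ?case using iter_deriv_scale[OF schwartz_zero bs, of 0] by (simp add: fun_eq_iff)
  next
    case (insert v R)
    then show ?case
      by (simp add: iter_deriv_add[OF schwartz_scale[OF \<Phi>] 1 bs] iter_deriv_scale[OF \<Phi> bs])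
  qed
  show "u (\<lambda>y. \<Sum>v\<in>R. m v * \<Phi> v y) = (\<Sum>v\<in>R. cnj (m v) * u (\<Phi> v))" if u: "tempered u"
    using fin
  proof (induction R)
    case empty
    then show ?case using tempered_scale[OF u schwartz_zero, of 0] by simp
  next
    case (insert v R)
    then show ?case
      by (simp add: tempered_add[OF u schwartz_scale[OF \<Phi>] 1] tempered_scale[OF u \<Phi>])
  qed
qed

lemma tempered_family_continuous:
  assumes u: "tempered u" and fam: "schwartz_family \<Phi>"
  shows "continuous_on UNIV (\<lambda>w. u (\<Phi> w))"
proof (rule continuous_at_imp_continuous_on, rule ballI)
  fix w
  obtain C N where C: "C \<ge> 0" "\<And>\<phi>. schwartz \<phi> \<Longrightarrow> norm (u \<phi>) \<le> C * schwartz_seminorm N \<phi>"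
    by (rule tempered_bound[OF u]) (rule that)
  have "((\<lambda>v. u (\<Phi> v) - u (\<Phi> w)) \<longlongrightarrow> 0) (at w)"
  proof (rule Lim_null_comparison)
    show "eventually (\<lambda>v. norm (u (\<Phi> v) - u (\<Phi> w)) \<le> C * fam_dist \<Phi> N v w) (at w)"
    proof (intro always_eventually allI)
      fix v
      have "u (\<Phi> v) - u (\<Phi> w) = u (\<lambda>y. \<Phi> v y - \<Phi> w y)"
        by (simp add: tempered_diff[OF u] family_schwartz[OF fam])
      also have "norm \<dots> \<le> C * fam_dist \<Phi> N v w"
        unfolding fam_dist_def[OF fam] by (intro C schwartz_diff family_schwartz[OF fam])
      finally show "norm (u (\<Phi> v) - u (\<Phi> w)) \<le> C * fam_dist \<Phi> N v w" .
    qed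
    show "((\<lambda>v. C * fam_dist \<Phi> N v w) \<longlongrightarrow> 0) (at w)"
      using tendsto_mult[OF tendsto_const fam_dist_tendsto[OF fam], of C] by simp
  qed
  then show "isCont (\<lambda>w. u (\<Phi> w)) w" unfolding isCont_def using Lim_null by blast
qed

lemma gaussian_weight_integrable:
  fixes h :: "'w::euclidean_space \<Rightarrow> complex"
  assumes hm: "h \<in> borel_measurable borel" and hb: "\<And>w. norm (h w) \<le> C * (1 + norm w) ^ K"
  shows "integrable lborel (\<lambda>w. complex_of_real (gauss w) * h w)"
proof (rule integrable_dominated)
  show "integrable lborel (\<lambda>w::'w. C * (gauss w * (1 + norm w) ^ K))"
    by (intro integrable_mult_right gaussian_poly_integrable)
  show "(\<lambda>w. complex_of_real (gauss w) * h w) \<in> borel_measurable lborel"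
    using hm by measurable
  show "AE w in lborel. norm (complex_of_real (gauss w) * h w) \<le> norm (C * (gauss w * (1 + norm w) ^ K))"
  proof (rule AE_I2)
    fix w
    have "gauss w * norm (h w) \<le> gauss w * (C * (1 + norm w) ^ K)"
      by (intro mult_left_mono hb) simp
    also have "\<dots> = C * (gauss w * (1 + norm w) ^ K)" by (rule mult.left_commute)
    finally have "norm (complex_of_real (gauss w) * h w) \<le> C * (gauss w * (1 + norm w) ^ K)"
      unfolding norm_mult norm_of_real abs_exp_cancel .
    then show "norm (complex_of_real (gauss w) * h w) \<le> norm (C * (gauss w * (1 + norm w) ^ K))"
      unfolding real_norm_def by (rule order_trans[OF _ abs_ge_self])
  qed
qed

text \<open>A tempered distribution commutes with Gaussian averages of Schwartz families.  Evaluating the family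
  along simple functions \<open>s\<^sub>k w \<rightarrow> w\<close> turns the average into finite sums, for which this is linearity;
  the error is controlled in the relevant Schwartz seminorm by dominated convergence.\<close>

theorem tempered_gauss_average:
  fixes \<Phi> :: "'w::euclidean_space \<Rightarrow> 'a::euclidean_space \<Rightarrow> complex"
  assumes u: "tempered u" and fam: "schwartz_family \<Phi>"
  shows "integrable lborel (\<lambda>w. complex_of_real (gauss w) * u (\<Phi> w))"
    and "u (gauss_average \<Phi>) = (LBINT w. complex_of_real (gauss w) * u (\<Phi> w))"
proof -
  obtain C N where C: "C \<ge> 0" "\<And>\<phi>. schwartz \<phi> \<Longrightarrow> norm (u \<phi>) \<le> C * schwartz_seminorm N \<phi>"
    by (rule tempered_bound[OF u]) (rule that)
  obtain D K where D: "D \<ge> 0" "\<And>w. schwartz_seminorm N (\<Phi> w) \<le> D * (1 + norm w) ^ K"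
    by (rule family_seminorm_bound[OF fam, of N]) (rule that)
  note sch = family_schwartz[OF fam]
  define G where "G = (\<lambda>w::'w. gauss w)"
  have Gpos: "G w > 0" for w by (simp add: G_def)
  have Gm [measurable]: "G \<in> borel_measurable borel" by (simp add: G_def)
  have Gi: "integrable lborel G" unfolding G_def by (rule gaussian_integrable)
  have um [measurable]: "(\<lambda>w. u (\<Phi> w)) \<in> borel_measurable borel"
    by (rule borel_measurable_continuous_onI) (rule tempered_family_continuous[OF u fam])
  have ub: "norm (u (\<Phi> w)) \<le> C * D * (1 + norm w) ^ K" for w
    using C(2)[OF sch, of w] mult_left_mono[OF D(2)[of w] C(1)] by (simp add: mult.assoc)
  show ui: "integrable lborel (\<lambda>w. complex_of_real (gauss w) * u (\<Phi> w))"
    by (rule gaussian_weight_integrable[OF um ub])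
  obtain s :: "nat \<Rightarrow> 'w \<Rightarrow> 'w" where s: "\<And>i. simple_function lborel (s i)" "\<And>w. (\<lambda>i. s i w) \<longlonglongrightarrow> w"
    "\<And>i w. norm (s i w) \<le> 2 * norm w"
    using borel_measurable_implies_sequence_metric[of "\<lambda>w::'w. w" lborel 0]
    by (simp add: dist_norm) blast
  have sm [measurable]: "s i \<in> borel_measurable borel" for i
    using s(1)[of i] borel_measurable_simple_function by fastforce
  have fin: "finite (range (s i))" for i using s(1)[of i] by (simp add: simple_function_def)
  have s_poly: "(1 + norm (s i w)) ^ K \<le> 2 ^ K * (1 + norm w) ^ K" for i w
  proof -
    have "(1 + norm (s i w)) ^ K \<le> (2 * (1 + norm w)) ^ K" using s(3)[of i w] by (intro power_mono) auto
    then show ?thesis by (simp only: power_mult_distrib)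
  qed
  define m where "m = (\<lambda>i v. LBINT w. G w * indicator (s i -` {v}) w)"
  have simple_sum: "(LBINT w. complex_of_real (G w) * h (s i w)) = (\<Sum>v\<in>range (s i). complex_of_real (m i v) * h v)"
    for i and h :: "'w \<Rightarrow> complex"
  proof -
    have vi: "integrable lborel (\<lambda>w. complex_of_real (G w * indicator (s i -` {v}) w))" for v
    proof (intro integrable_of_real integrable_dominated[OF Gi])
      have "s i -` {v} \<in> sets borel" using measurable_sets[OF sm[of i], of "{v}"] by simp
      then show "(\<lambda>w. G w * indicator (s i -` {v}) w) \<in> borel_measurable lborel" by measurable
    qed (auto split: split_indicator)
    have "complex_of_real (G w) * h (s i w) = (\<Sum>v\<in>range (s i). complex_of_real (G w * indicator (s i -` {v}) w) * h v)" for w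
    proof -
      have "(\<Sum>v\<in>range (s i). complex_of_real (G w * indicator (s i -` {v}) w) * h v) =
        (\<Sum>v\<in>range (s i). if v = s i w then complex_of_real (G w) * h v else 0)"
        by (intro sum.cong) (auto split: split_indicator)
      then show ?thesis using fin[of i] by simp
    qed
    then have "(LBINT w. complex_of_real (G w) * h (s i w)) =
      (LBINT w. (\<Sum>v\<in>range (s i). complex_of_real (G w * indicator (s i -` {v}) w) * h v))" by simp
    also have "\<dots> = (\<Sum>v\<in>range (s i). LBINT w. complex_of_real (G w * indicator (s i -` {v}) w) * h v)"
      by (intro Bochner_Integration.integral_sum integrable_mult_left vi)
    also have "\<dots> = (\<Sum>v\<in>range (s i). complex_of_real (m i v) * h v)"
      unfolding integral_mult_left_zero m_def integral_complex_of_real ..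
    finally show ?thesis .
  qed
  define S where "S = (\<lambda>i y. \<Sum>v\<in>range (s i). complex_of_real (m i v) * \<Phi> v y)"
  have Ssch: "schwartz (S i)" for i unfolding S_def by (rule schwartz_finite_sum(1)[OF fin sch])
  have Sit: "iter_deriv bs (S i) y = (LBINT w. complex_of_real (G w) * iter_deriv bs (\<Phi> (s i w)) y)" if "set bs \<subseteq> Basis" for i bs y
    unfolding S_def schwartz_finite_sum(2)[OF fin sch that] using simple_sum[where i=i and h="\<lambda>v. iter_deriv bs (\<Phi> v) y"] by simp
  have uS: "u (S i) = (LBINT w. complex_of_real (G w) * u (\<Phi> (s i w)))" for i
    unfolding S_def schwartz_finite_sum(3)[OF fin sch u] using simple_sum[where i=i and h="\<lambda>v. u (\<Phi> v)"] by simp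
  have usm [measurable]: "(\<lambda>w. u (\<Phi> (s i w))) \<in> borel_measurable borel" for i
    by (rule measurable_compose[OF sm um])
  have lim1: "(\<lambda>i. u (S i)) \<longlonglongrightarrow> (LBINT w. complex_of_real (G w) * u (\<Phi> w))"
    unfolding uS
  proof (rule integral_dominated_convergence[where w="\<lambda>w. (C * D * 2 ^ K) * (gauss w * (1 + norm w) ^ K)"])
    show "integrable lborel (\<lambda>w::'w. (C * D * 2 ^ K) * (gauss w * (1 + norm w) ^ K))"
      by (intro integrable_mult_right gaussian_poly_integrable)
    show "AE w in lborel. (\<lambda>i. complex_of_real (G w) * u (\<Phi> (s i w))) \<longlonglongrightarrow> complex_of_real (G w) * u (\<Phi> w)"
    proof (rule AE_I2, intro tendsto_mult tendsto_const)
      fix w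
      have "isCont (\<lambda>w. u (\<Phi> w)) w"
        using tempered_family_continuous[OF u fam] by (simp add: continuous_on_eq_continuous_at)
      from isCont_tendsto_compose[OF this s(2)] show "(\<lambda>i. u (\<Phi> (s i w))) \<longlonglongrightarrow> u (\<Phi> w)" .
    qed
    fix i
    show "AE w in lborel. norm (complex_of_real (G w) * u (\<Phi> (s i w))) \<le> (C * D * 2 ^ K) * (gauss w * (1 + norm w) ^ K)"
    proof (rule AE_I2)
      fix w
      have "norm (u (\<Phi> (s i w))) \<le> C * D * (2 ^ K * (1 + norm w) ^ K)"
        using ub[of "s i w"] mult_left_mono[OF s_poly[of i w], of "C * D"] C(1) D(1) by simp
      then have "G w * norm (u (\<Phi> (s i w))) \<le> G w * (C * D * (2 ^ K * (1 + norm w) ^ K))"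
        using Gpos[of w] by (intro mult_left_mono) auto
      then show "norm (complex_of_real (G w) * u (\<Phi> (s i w))) \<le> (C * D * 2 ^ K) * (gauss w * (1 + norm w) ^ K)"
        using Gpos[of w] by (simp add: norm_mult G_def mult_ac)
    qed
  qed measurable
  have dm: "(\<lambda>w. fam_dist \<Phi> N w (s i w)) \<in> borel_measurable borel" for i
  proof -
    have d: "(\<lambda>p. fam_dist \<Phi> N (fst p) (snd p)) \<in> borel_measurable borel"
      by (rule borel_measurable_continuous_onI) (rule fam_dist_continuous[OF fam])
    have p: "(\<lambda>w. (w, s i w)) \<in> borel_measurable borel" by (intro borel_measurable_Pair sm) simp
    from measurable_compose[OF p d] show ?thesis by simp
  qed
  have db: "fam_dist \<Phi> N w (s i w) \<le> D * (1 + 2 ^ K) * (1 + norm w) ^ K" for i w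
  proof -
    have "fam_dist \<Phi> N w (s i w) \<le> D * (1 + norm w) ^ K + D * (1 + norm (s i w)) ^ K"
      using fam_dist_le[OF fam, of N w "s i w"] D(2)[of w] D(2)[of "s i w"] by linarith
    also have "\<dots> \<le> D * (1 + norm w) ^ K + D * (2 ^ K * (1 + norm w) ^ K)"
      by (intro add_left_mono mult_left_mono s_poly D)
    finally show ?thesis by (simp add: algebra_simps)
  qed
  have dpoly: "G w * fam_dist \<Phi> N w (s i w) \<le> (D * (1 + 2 ^ K)) * (gauss w * (1 + norm w) ^ K)" for i w
    using mult_left_mono[OF db[of w i], of "G w"] Gpos[of w] by (simp add: G_def mult_ac)
  have dabs: "\<bar>G w * fam_dist \<Phi> N w (s i w)\<bar> = G w * fam_dist \<Phi> N w (s i w)" for i w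
    by (intro abs_of_nonneg mult_nonneg_nonneg less_imp_le[OF Gpos] fam_dist_nonneg[OF fam])
  have di: "integrable lborel (\<lambda>w. G w * fam_dist \<Phi> N w (s i w))" for i
  proof (rule integrable_dominated)
    show "integrable lborel (\<lambda>w::'w. (D * (1 + 2 ^ K)) * (gauss w * (1 + norm w) ^ K))"
      by (intro integrable_mult_right gaussian_poly_integrable)
    show "(\<lambda>w. G w * fam_dist \<Phi> N w (s i w)) \<in> borel_measurable lborel" using dm[of i] by measurable
    show "AE w in lborel. norm (G w * fam_dist \<Phi> N w (s i w)) \<le> norm ((D * (1 + 2 ^ K)) * (gauss w * (1 + norm w) ^ K))"
      unfolding real_norm_def dabs by (intro AE_I2 order_trans[OF dpoly] abs_ge_self)
  qed
  have lim2: "(\<lambda>i. LBINT w. G w * fam_dist \<Phi> N w (s i w)) \<longlonglongrightarrow> (\<integral>w. 0 \<partial>(lborel :: 'w measure))"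
  proof (rule integral_dominated_convergence[where w="\<lambda>w. (D * (1 + 2 ^ K)) * (gauss w * (1 + norm w) ^ K)"])
    show "integrable lborel (\<lambda>w::'w. (D * (1 + 2 ^ K)) * (gauss w * (1 + norm w) ^ K))"
      by (intro integrable_mult_right gaussian_poly_integrable)
    show "AE w in lborel. (\<lambda>i. G w * fam_dist \<Phi> N w (s i w)) \<longlonglongrightarrow> 0"
    proof (rule AE_I2)
      fix w
      have "(\<lambda>i. fam_dist \<Phi> N (s i w) w) \<longlonglongrightarrow> fam_dist \<Phi> N w w"
        using isCont_tendsto_compose[OF fam_dist_isCont[OF fam] s(2)] .
      then have "(\<lambda>i. G w * fam_dist \<Phi> N w (s i w)) \<longlonglongrightarrow> G w * 0"
        by (intro tendsto_mult tendsto_const) (simp add: fam_dist_self[OF fam] fam_dist_commute[OF fam, of N w])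
      then show "(\<lambda>i. G w * fam_dist \<Phi> N w (s i w)) \<longlonglongrightarrow> 0" by simp
    qed
    show "(\<lambda>w. G w * fam_dist \<Phi> N w (s i w)) \<in> borel_measurable lborel" for i using dm[of i] by measurable
    show "AE w in lborel. norm (G w * fam_dist \<Phi> N w (s i w)) \<le> (D * (1 + 2 ^ K)) * (gauss w * (1 + norm w) ^ K)" for i
      unfolding real_norm_def dabs by (intro AE_I2 dpoly)
  qed simp
  define c where "c = real (card {bs. set bs \<subseteq> (Basis :: 'a set) \<and> length bs \<le> N})"
  have err: "norm (u (gauss_average \<Phi>) - u (S i)) \<le> C * (c * (LBINT w. G w * fam_dist \<Phi> N w (s i w)))" for i
  proof -
    have "u (gauss_average \<Phi>) - u (S i) = u (\<lambda>y. gauss_average \<Phi> y - S i y)"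
      by (simp add: tempered_diff[OF u schwartz_gauss_average[OF fam] Ssch])
    also have "norm \<dots> \<le> C * schwartz_seminorm N (\<lambda>y. gauss_average \<Phi> y - S i y)"
      by (intro C schwartz_diff schwartz_gauss_average[OF fam] Ssch)
    also have "\<dots> \<le> C * (c * (LBINT w. G w * fam_dist \<Phi> N w (s i w)))"
      unfolding c_def
    proof (intro mult_left_mono C schwartz_seminorm_le)
      fix bs :: "'a list" and y assume bs: "set bs \<subseteq> Basis" "length bs \<le> N"
      obtain E L where E: "E \<ge> 0" "\<And>w y. (1 + norm y) ^ 0 * norm (iter_deriv bs (\<Phi> w) y) \<le> E * (1 + norm w) ^ L"
        by (rule family_bound[OF fam bs(1), where N=0]) (rule that)
      have i1: "integrable lborel (\<lambda>w. complex_of_real (G w) * iter_deriv bs (\<Phi> w) y)"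
        unfolding G_def by (rule family_integrable[OF fam bs(1)])
      have i2: "integrable lborel (\<lambda>w. complex_of_real (G w) * iter_deriv bs (\<Phi> (s i w)) y)"
        unfolding G_def
      proof (rule gaussian_weight_integrable)
        show "(\<lambda>w. iter_deriv bs (\<Phi> (s i w)) y) \<in> borel_measurable borel"
          using measurable_compose[OF sm family_measurable[OF fam bs(1)]] .
        fix w
        have "norm (iter_deriv bs (\<Phi> (s i w)) y) \<le> E * (1 + norm (s i w)) ^ L" using E(2)[where w="s i w"] by simp
        also have "\<dots> \<le> E * (2 * (1 + norm w)) ^ L" using s(3)[of i w] E(1) by (intro mult_left_mono power_mono) auto
        finally show "norm (iter_deriv bs (\<Phi> (s i w)) y) \<le> (E * 2 ^ L) * (1 + norm w) ^ L"
          unfolding power_mult_distrib by (simp only: mult.assoc)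
      qed
      have "iter_deriv bs (\<lambda>y. gauss_average \<Phi> y - S i y) y =
        (LBINT w. complex_of_real (G w) * iter_deriv bs (\<Phi> w) y) - (LBINT w. complex_of_real (G w) * iter_deriv bs (\<Phi> (s i w)) y)"
        unfolding schwartz_diff(2)[OF schwartz_gauss_average[OF fam] Ssch bs(1)] Sit[OF bs(1)]
          iter_deriv_gauss_average(1)[OF fam bs(1)] G_def ..
      also have "\<dots> = (LBINT w. complex_of_real (G w) * iter_deriv bs (\<lambda>y. \<Phi> w y - \<Phi> (s i w) y) y)"
        unfolding schwartz_diff(2)[OF sch sch bs(1)] right_diff_distrib
        by (rule Bochner_Integration.integral_diff[OF i1 i2, symmetric])
      finally have eq: "iter_deriv bs (\<lambda>y. gauss_average \<Phi> y - S i y) y =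
        (LBINT w. complex_of_real (G w) * iter_deriv bs (\<lambda>y. \<Phi> w y - \<Phi> (s i w) y) y)" .
      have "(1 + norm y) ^ N * norm (iter_deriv bs (\<lambda>y. gauss_average \<Phi> y - S i y) y) =
        norm (LBINT w. complex_of_real ((1 + norm y) ^ N) * (complex_of_real (G w) * iter_deriv bs (\<lambda>y. \<Phi> w y - \<Phi> (s i w) y) y))"
        unfolding eq integral_mult_right_zero norm_mult norm_of_real by simp
      also have "\<dots> \<le> (LBINT w. G w * fam_dist \<Phi> N w (s i w))"
      proof (rule Bochner_Integration.integral_norm_bound_integral[OF _ di])
        show "integrable lborel (\<lambda>w. complex_of_real ((1 + norm y) ^ N) * (complex_of_real (G w) * iter_deriv bs (\<lambda>y. \<Phi> w y - \<Phi> (s i w) y) y))"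
          unfolding schwartz_diff(2)[OF sch sch bs(1)] right_diff_distrib
          using integrable_mult_right[OF Bochner_Integration.integrable_diff[OF i1 i2], of "complex_of_real ((1 + norm y) ^ N)"]
          by (simp add: right_diff_distrib)
        fix w
        have "(1 + norm y) ^ N * norm (iter_deriv bs (\<lambda>y. \<Phi> w y - \<Phi> (s i w) y) y) \<le> fam_dist \<Phi> N w (s i w)"
          unfolding fam_dist_def[OF fam] by (intro schwartz_seminorm_upper schwartz_diff sch bs) simp
        then have "G w * ((1 + norm y) ^ N * norm (iter_deriv bs (\<lambda>y. \<Phi> w y - \<Phi> (s i w) y) y)) \<le> G w * fam_dist \<Phi> N w (s i w)"
          using Gpos[of w] by (intro mult_left_mono) auto
        then show "norm (complex_of_real ((1 + norm y) ^ N) * (complex_of_real (G w) * iter_deriv bs (\<lambda>y. \<Phi> w y - \<Phi> (s i w) y) y)) \<le> G w * fam_dist \<Phi> N w (s i w)"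
          unfolding norm_mult norm_of_real using Gpos[of w] by (simp add: mult_ac)
      qed
      finally show "(1 + norm y) ^ N * norm (iter_deriv bs (\<lambda>y. gauss_average \<Phi> y - S i y) y) \<le> (LBINT w. G w * fam_dist \<Phi> N w (s i w))" .
    qed
    finally show ?thesis .
  qed
  have "(\<lambda>i. u (gauss_average \<Phi>) - u (S i)) \<longlonglongrightarrow> 0"
  proof (rule Lim_null_comparison)
    show "eventually (\<lambda>i. norm (u (gauss_average \<Phi>) - u (S i)) \<le> C * (c * (LBINT w. G w * fam_dist \<Phi> N w (s i w)))) sequentially"
      using err by (intro always_eventually allI)
    have "(\<lambda>i. C * (c * (LBINT w. G w * fam_dist \<Phi> N w (s i w)))) \<longlonglongrightarrow> C * (c * 0)"
      using lim2 by (intro tendsto_mult tendsto_const) simp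
    then show "(\<lambda>i. C * (c * (LBINT w. G w * fam_dist \<Phi> N w (s i w)))) \<longlonglongrightarrow> 0" by simp
  qed
  then have "(\<lambda>i. u (gauss_average \<Phi>) - (u (gauss_average \<Phi>) - u (S i))) \<longlonglongrightarrow> u (gauss_average \<Phi>) - 0"
    by (intro tendsto_diff tendsto_const)
  then have "(\<lambda>i. u (S i)) \<longlonglongrightarrow> u (gauss_average \<Phi>)" by simp
  from LIMSEQ_unique[OF this lim1]
  show "u (gauss_average \<Phi>) = (LBINT w. complex_of_real (gauss w) * u (\<Phi> w))"
    by (simp add: G_def)
qed

section \<open>Extension to tempered distributions\<close>

lemma continuous_AE_eq:
  fixes f g :: "'a::euclidean_space \<Rightarrow> complex"
  assumes f: "continuous_on UNIV f" and g: "continuous_on UNIV g" and ae: "AE x in lborel. f x = g x"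
  shows "f = g"
proof (rule ccontr)
  assume "f \<noteq> g"
  define S where "S = {x. f x - g x \<noteq> 0}"
  have "S \<noteq> {}" using \<open>f \<noteq> g\<close> by (auto simp: S_def)
  have "S = (\<lambda>x. f x - g x) -` (- {0})" by (auto simp: S_def)
  moreover have "open ((\<lambda>x. f x - g x) -` (- {0}))"
    by (intro open_vimage) (auto intro!: continuous_intros f g)
  ultimately have "open S" by simp
  have "S \<in> null_sets lborel"
    using ae \<open>open S\<close> by (subst AE_iff_null_sets) (auto simp: S_def elim: eventually_mono)
  then have "negligible S" by (simp add: negligible_iff_null_sets null_sets_completionI)
  with open_not_negligible[OF \<open>open S\<close> \<open>S \<noteq> {}\<close>] show False by simp
qed

text \<open>The adjoint of the average is the average of the adjoint shifts. The adjoint of a shift by \<open>\<zeta>\<close> is the shift by \<open>- \<zeta>\<close>,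
  and the Gaussian is even.\<close>

lemma gauss_form_adjoint:
  fixes A B :: "'w::euclidean_space \<Rightarrow> 'a::euclidean_space"
  assumes A: "linear A" and B: "linear B" and \<phi>: "schwartz \<phi>"
  shows "gauss_form A B f (abs_L2 \<phi>) = cinner_L2 f (abs_L2 (gauss_average (\<lambda>w. heis (A w) (B w) \<phi>)))"
proof -
  have [measurable]: "A \<in> borel_measurable borel" "B \<in> borel_measurable borel"
    using A B by (auto intro!: borel_measurable_continuous_onI linear_continuous_on simp: linear_conv_bounded_linear)
  note s\<phi> = schwartz_square_integrable[OF \<phi>]
  have [measurable]: "\<phi> \<in> borel_measurable borel" using \<phi> by (rule schwartz_measurable)
  define G where "G = (\<lambda>w::'w. gauss w)"
  have [measurable]: "G \<in> borel_measurable borel" by (simp add: G_def)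
  have Gpos: "G w > 0" for w by (simp add: G_def)
  have fam: "schwartz_family (\<lambda>w. heis (A w) (B w) \<phi>)" by (rule heis_family[OF A B \<phi>])
  have "gauss_form A B f (abs_L2 \<phi>) = (LBINT w. complex_of_real (G w) * cinner_L2 f (heisL (A (- w)) (B (- w)) (abs_L2 \<phi>)))"
    unfolding gauss_form_def heisL_adjoint G_def by (simp add: linear_neg[OF A] linear_neg[OF B])
  also have "\<dots> = (LBINT w. complex_of_real (G w) * cinner_L2 f (heisL (A w) (B w) (abs_L2 \<phi>)))"
    using integral_reflect[of "\<lambda>w. complex_of_real (G w) * cinner_L2 f (heisL (A w) (B w) (abs_L2 \<phi>))"]
    by (simp add: G_def)
  also have "\<dots> = (LBINT w. (LBINT y. complex_of_real (G w) * (rep_L2 f y * cnj (heis (A w) (B w) \<phi> y))))"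
  proof (intro lebesgue_cong refl)
    fix w
    have "cinner_L2 (abs_L2 (rep_L2 f)) (heisL (A w) (B w) (abs_L2 \<phi>)) = (LBINT y. rep_L2 f y * cnj (heis (A w) (B w) \<phi> y))"
      by (simp only: heisL_abs[OF s\<phi>] cinner_abs[OF square_integrable_rep_L2 square_integrable_heis[OF s\<phi>]])
    then show "complex_of_real (G w) * cinner_L2 f (heisL (A w) (B w) (abs_L2 \<phi>)) =
      (LBINT y. complex_of_real (G w) * (rep_L2 f y * cnj (heis (A w) (B w) \<phi> y)))" by simp
  qed
  also have "\<dots> = (LBINT y. (LBINT w. complex_of_real (G w) * (rep_L2 f y * cnj (heis (A w) (B w) \<phi> y))))"
  proof (rule integral_swap[where a="\<lambda>w. G w * (norm f * norm (abs_L2 \<phi>))"])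
    show "(\<lambda>(w, y). complex_of_real (G w) * (rep_L2 f y * cnj (heis (A w) (B w) \<phi> y))) \<in> borel_measurable (borel \<Otimes>\<^sub>M borel)"
      unfolding heis_def by measurable
    show "integrable lborel (\<lambda>w. G w * (norm f * norm (abs_L2 \<phi>)))"
      unfolding G_def using gaussian_integrable[where 'a='w] by simp
    fix w
    show "integrable lborel (\<lambda>y. complex_of_real (G w) * (rep_L2 f y * cnj (heis (A w) (B w) \<phi> y)))"
      by (intro integrable_mult_right square_integrable_prod square_integrable_heis s\<phi>) simp
    have "(LBINT y. norm (rep_L2 f y) * norm (heis (A w) (B w) \<phi> y)) \<le> norm (abs_L2 (rep_L2 f)) * norm (abs_L2 (heis (A w) (B w) \<phi>))"
      by (intro Cauchy_Schwarz_norm_integral square_integrable_heis s\<phi>) simp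
    also have "\<dots> = norm f * norm (abs_L2 \<phi>)" by (simp flip: heisL_abs[OF s\<phi>])
    finally show "(LBINT y. norm (complex_of_real (G w) * (rep_L2 f y * cnj (heis (A w) (B w) \<phi> y)))) \<le> G w * (norm f * norm (abs_L2 \<phi>))"
      using Gpos[of w] by (simp add: norm_mult)
  qed
  also have "\<dots> = (LBINT y. rep_L2 f y * cnj (gauss_average (\<lambda>w. heis (A w) (B w) \<phi>) y))"
  proof (intro lebesgue_cong refl)
    fix y
    have "cnj (gauss_average (\<lambda>w. heis (A w) (B w) \<phi>) y) = (LBINT w. complex_of_real (G w) * cnj (heis (A w) (B w) \<phi> y))"
      unfolding gauss_average_def G_def by (simp flip: Bochner_Integration.integral_cnj)
    then show "(LBINT w. complex_of_real (G w) * (rep_L2 f y * cnj (heis (A w) (B w) \<phi> y))) =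
      rep_L2 f y * cnj (gauss_average (\<lambda>w. heis (A w) (B w) \<phi>) y)"
      by (simp add: mult.left_commute flip: integral_mult_right_zero)
  qed
  also have "\<dots> = cinner_L2 (abs_L2 (rep_L2 f)) (abs_L2 (gauss_average (\<lambda>w. heis (A w) (B w) \<phi>)))"
    by (simp only: cinner_abs[OF square_integrable_rep_L2 schwartz_square_integrable[OF schwartz_gauss_average[OF fam]]])
  finally show ?thesis by simp
qed

lemma stft_heis:
  fixes x \<xi> :: "'a::euclidean_space"
  shows "(\<lambda>y. cis (2 * pi * (\<xi> \<bullet> y)) * g (y - x)) = (\<lambda>y. cis (pi * (\<xi> \<bullet> x)) * heis x \<xi> g y)"
proof
  fix y
  have "2 * pi * (\<xi> \<bullet> y) = pi * (\<xi> \<bullet> x) + 2 * pi * (\<xi> \<bullet> (y - x /\<^sub>R 2))" by (simp add: inner_diff_right algebra_simps)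
  then show "cis (2 * pi * (\<xi> \<bullet> y)) * g (y - x) = cis (pi * (\<xi> \<bullet> x)) * heis x \<xi> g y"
    by (simp only: heis_def cis_mult[symmetric] mult.assoc)
qed

lemma heis_stft_window:
  fixes a b x \<xi> :: "'a::euclidean_space"
  shows "heis a b (\<lambda>y. cis (2 * pi * (\<xi> \<bullet> y)) * g (y - x)) =
   (\<lambda>y. cis (- pi * (b \<bullet> a) - 2 * pi * (\<xi> \<bullet> a)) * (cis (2 * pi * ((\<xi> + b) \<bullet> y)) * g (y - (x + a))))"
proof
  fix y
  have "2 * pi * (b \<bullet> (y - a /\<^sub>R 2)) + 2 * pi * (\<xi> \<bullet> (y - a)) = (- pi * (b \<bullet> a) - 2 * pi * (\<xi> \<bullet> a)) + 2 * pi * ((\<xi> + b) \<bullet> y)"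
    by (simp add: inner_diff_right inner_add_left algebra_simps)
  then have "cis (2 * pi * (b \<bullet> (y - a /\<^sub>R 2))) * cis (2 * pi * (\<xi> \<bullet> (y - a))) =
    cis (- pi * (b \<bullet> a) - 2 * pi * (\<xi> \<bullet> a)) * cis (2 * pi * ((\<xi> + b) \<bullet> y))"
    by (simp only: cis_mult)
  moreover have "y - a - x = y - (x + a)" by simp
  ultimately show "heis a b (\<lambda>y. cis (2 * pi * (\<xi> \<bullet> y)) * g (y - x)) y =
    cis (- pi * (b \<bullet> a) - 2 * pi * (\<xi> \<bullet> a)) * (cis (2 * pi * ((\<xi> + b) \<bullet> y)) * g (y - (x + a)))"
    by (simp only: heis_def mult.assoc[symmetric])
qed

lemma schwartz_stft_window: "schwartz g \<Longrightarrow> schwartz (\<lambda>y. cis (2 * pi * (\<xi> \<bullet> y)) * g (y - x))"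
  unfolding stft_heis by (intro schwartz_scale schwartz_heis)

lemma norm_stft_heis:
  assumes u: "tempered u" and g: "schwartz g"
  shows "norm (stft g u x \<xi>) = norm (u (heis x \<xi> g))"
  unfolding stft_def stft_heis by (simp add: tempered_scale[OF u schwartz_heis[OF g]] norm_mult)

context
  fixes Z :: "'a::euclidean_space L2 \<Rightarrow> 'a L2" and A B :: "'w::euclidean_space \<Rightarrow> 'a" and c :: real
  assumes Z: "\<And>f g. cinner_L2 (Z f) g = complex_of_real c * gauss_form A B f g"
    and A: "linear A" and B: "linear B"
begin

text \<open>The definite description in the extension is resolved by the average of the shifts: it is a Schwartz function representing
  the adjoint, and continuous functions that agree almost everywhere are equal.\<close>

lemma extend_op_eq:
  assumes \<phi>: "schwartz \<phi>"
  shows "extend_op Z u \<phi> = u (\<lambda>y. complex_of_real c * gauss_average (\<lambda>w. heis (A w) (B w) \<phi>) y)"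
proof -
  define \<psi> where "\<psi> = (\<lambda>y. complex_of_real c * gauss_average (\<lambda>w. heis (A w) (B w) \<phi>) y)"
  have av: "schwartz (gauss_average (\<lambda>w. heis (A w) (B w) \<phi>))"
    by (intro schwartz_gauss_average heis_family A B \<phi>)
  then have \<psi>: "schwartz \<psi>" unfolding \<psi>_def by (rule schwartz_scale)
  have adj: "cinner_L2 (Z f) (abs_L2 \<phi>) = cinner_L2 f (abs_L2 \<psi>)" for f
  proof -
    have "abs_L2 \<psi> = scaleC_L2 (complex_of_real c) (abs_L2 (gauss_average (\<lambda>w. heis (A w) (B w) \<phi>)))"
      unfolding \<psi>_def by (simp add: abs_L2_scale schwartz_square_integrable[OF av])
    then show ?thesis by (simp add: Z gauss_form_adjoint[OF A B \<phi>] cinner_scale_right)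
  qed
  have "(THE \<psi>. schwartz \<psi> \<and> (\<forall>f. cinner_L2 (Z f) (abs_L2 \<phi>) = cinner_L2 f (abs_L2 \<psi>))) = \<psi>"
  proof (rule the_equality)
    show "schwartz \<psi> \<and> (\<forall>f. cinner_L2 (Z f) (abs_L2 \<phi>) = cinner_L2 f (abs_L2 \<psi>))" using \<psi> adj by simp
    fix \<psi>' assume "schwartz \<psi>' \<and> (\<forall>f. cinner_L2 (Z f) (abs_L2 \<phi>) = cinner_L2 f (abs_L2 \<psi>'))"
    then have \<psi>': "schwartz \<psi>'" and "cinner_L2 f (abs_L2 \<psi>') = cinner_L2 f (abs_L2 \<psi>)" for f by (simp_all add: adj)
    then have "abs_L2 \<psi>' = abs_L2 \<psi>"
      by (intro cinner_eqI) (metis cinner_commute)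
    then have "AE x in lborel. \<psi>' x = \<psi> x"
      using \<psi> \<psi>' by (intro abs_L2_eqD schwartz_square_integrable)
    then show "\<psi>' = \<psi>" using \<psi> \<psi>' by (intro continuous_AE_eq schwartz_continuous)
  qed
  then show ?thesis by (simp add: extend_op_def \<psi>_def)
qed

lemma extend_op_integral:
  assumes u: "tempered u" and \<phi>: "schwartz \<phi>"
  shows "extend_op Z u \<phi> = complex_of_real c * (LBINT w. complex_of_real (gauss w) * u (heis (A w) (B w) \<phi>))"
  unfolding extend_op_eq[OF \<phi>]
  by (simp add: tempered_scale[OF u schwartz_gauss_average[OF heis_family[OF A B \<phi>]]] tempered_gauss_average(2)[OF u heis_family[OF A B \<phi>]])

text \<open>Linearity is inherited under the integral. Continuity comes from the bound of the seminorms of a shift, integrated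
  against the Gaussian.\<close>

lemma tempered_extend_op:
  assumes u: "tempered u"
  shows "tempered (extend_op Z u)"
  unfolding tempered_def
proof (intro conjI allI impI)
  fix \<phi> \<psi> :: "'a \<Rightarrow> complex" assume \<phi>: "schwartz \<phi>" and \<psi>: "schwartz \<psi>"
  have "heis x \<xi> (\<lambda>y. \<phi> y + \<psi> y) = (\<lambda>y. heis x \<xi> \<phi> y + heis x \<xi> \<psi> y)" for x \<xi>
    by (simp add: heis_def fun_eq_iff distrib_left)
  then show "extend_op Z u (\<lambda>x. \<phi> x + \<psi> x) = extend_op Z u \<phi> + extend_op Z u \<psi>"
    using tempered_gauss_average(1)[OF u heis_family[OF A B \<phi>]] tempered_gauss_average(1)[OF u heis_family[OF A B \<psi>]]
    by (simp add: extend_op_integral[OF u] \<phi> \<psi> schwartz_add tempered_add[OF u] schwartz_heis distrib_left)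
next
  fix a and \<phi> :: "'a \<Rightarrow> complex" assume \<phi>: "schwartz \<phi>"
  have "heis x \<xi> (\<lambda>y. a * \<phi> y) = (\<lambda>y. a * heis x \<xi> \<phi> y)" for x \<xi>
    by (simp add: heis_def fun_eq_iff)
  then show "extend_op Z u (\<lambda>x. a * \<phi> x) = cnj a * extend_op Z u \<phi>"
    by (simp add: extend_op_integral[OF u] \<phi> schwartz_scale tempered_scale[OF u] schwartz_heis mult.left_commute)
next
  obtain C N where C: "C \<ge> 0" "\<And>\<phi>. schwartz \<phi> \<Longrightarrow> norm (u \<phi>) \<le> C * schwartz_seminorm N \<phi>"
    by (rule tempered_bound[OF u]) (rule that)
  let ?B = "{bs. set bs \<subseteq> (Basis :: 'a set) \<and> length bs \<le> N}"
  define E where "E = (\<lambda>bs D. D \<ge> 0 \<and> (\<forall>\<phi> w y. schwartz \<phi> \<longrightarrow> (1 + norm y) ^ N * norm (iter_deriv bs (heis (A w) (B w) \<phi>) y) \<le>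
       D * schwartz_seminorm N \<phi> * (1 + norm w) ^ (length bs + N)))"
  have "\<forall>bs\<in>?B. \<exists>D. E bs D"
  proof
    fix bs assume "bs \<in> ?B"
    then have bs: "set bs \<subseteq> Basis" "max N (length bs) = N" by auto
    from heis_linear_bound[OF A B bs(1), of N] obtain D where "D \<ge> 0"
      "\<And>\<phi> w y. schwartz \<phi> \<Longrightarrow> (1 + norm y) ^ N * norm (iter_deriv bs (heis (A w) (B w) \<phi>) y) \<le>
       D * schwartz_seminorm (max N (length bs)) \<phi> * (1 + norm w) ^ (length bs + N)" by blast
    then have "E bs D" by (simp add: E_def bs(2))
    then show "\<exists>D. E bs D" ..
  qed
  from bchoice[OF this] obtain D where D: "\<forall>bs\<in>?B. E bs (D bs)" ..
  define I where "I = (\<lambda>K. \<integral>w. gauss w * (1 + norm w) ^ K \<partial>(lborel :: 'w measure))"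
  have I: "I K \<ge> 0" for K unfolding I_def by (intro Bochner_Integration.integral_nonneg) simp
  define T where "T = (\<Sum>bs\<in>?B. D bs * I (length bs + N))"
  show "\<exists>N C. \<forall>\<phi>. schwartz \<phi> \<longrightarrow> norm (extend_op Z u \<phi>) \<le> C * schwartz_seminorm N \<phi>"
  proof (intro exI allI impI)
    fix \<phi> :: "'a \<Rightarrow> complex" assume \<phi>: "schwartz \<phi>"
    note fam = heis_family[OF A B \<phi>]
    have "schwartz_seminorm N (gauss_average (\<lambda>w. heis (A w) (B w) \<phi>)) \<le> (\<Sum>bs\<in>?B. D bs * I (length bs + N) * schwartz_seminorm N \<phi>)"
      unfolding schwartz_seminorm_sup[of N "gauss_average _"]
    proof (intro sum_mono schwartz_sup_le)
      fix bs and y :: 'a assume bs: "bs \<in> ?B"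
      have "(1 + norm y) ^ N * norm (iter_deriv bs (heis (A w) (B w) \<phi>) y) \<le> (D bs * schwartz_seminorm N \<phi>) * (1 + norm w) ^ (length bs + N)" for w
        using D bs \<phi> unfolding E_def by blast
      from gauss_average_norm_le[OF fam _ this] bs
      show "(1 + norm y) ^ N * norm (iter_deriv bs (gauss_average (\<lambda>w. heis (A w) (B w) \<phi>)) y) \<le> D bs * I (length bs + N) * schwartz_seminorm N \<phi>"
        by (simp add: I_def mult_ac)
    qed
    then have p: "schwartz_seminorm N (gauss_average (\<lambda>w. heis (A w) (B w) \<phi>)) \<le> T * schwartz_seminorm N \<phi>"
      by (simp add: T_def sum_distrib_right)
    have "norm (extend_op Z u \<phi>) \<le> C * schwartz_seminorm N (\<lambda>y. complex_of_real c * gauss_average (\<lambda>w. heis (A w) (B w) \<phi>) y)"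
      unfolding extend_op_eq[OF \<phi>] by (intro C schwartz_scale schwartz_gauss_average fam)
    also have "\<dots> \<le> C * (\<bar>c\<bar> * schwartz_seminorm N (gauss_average (\<lambda>w. heis (A w) (B w) \<phi>)))"
      using schwartz_seminorm_scale[OF schwartz_gauss_average[OF fam], of N "complex_of_real c"]
      by (intro mult_left_mono C) simp
    also have "\<dots> \<le> C * (\<bar>c\<bar> * (T * schwartz_seminorm N \<phi>))"
      by (intro mult_left_mono C p) simp
    finally show "norm (extend_op Z u \<phi>) \<le> (C * \<bar>c\<bar> * T) * schwartz_seminorm N \<phi>" by (simp add: mult.assoc)
  qed
qed

text \<open>A shift of a shifted window is again a shifted window up to a phase, so that the extended operator averages the
  translates of the short-time Fourier transform.\<close>

lemma stft_extend_op:
  assumes u: "tempered u" and g: "schwartz g"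
  shows "norm (stft g (extend_op Z u) x \<xi>) \<le>
    \<bar>c\<bar> * (LBINT w. gauss w * norm (stft g u (x + A w) (\<xi> + B w)))"
    and "integrable lborel (\<lambda>w. gauss w * norm (stft g u (x + A w) (\<xi> + B w)))"
proof -
  define \<phi> where "\<phi> = (\<lambda>y. cis (2 * pi * (\<xi> \<bullet> y)) * g (y - x))"
  have \<phi>: "schwartz \<phi>" unfolding \<phi>_def by (rule schwartz_stft_window[OF g])
  have n: "norm (u (heis (A w) (B w) \<phi>)) = norm (stft g u (x + A w) (\<xi> + B w))" for w
    unfolding \<phi>_def heis_stft_window stft_def
    by (simp add: tempered_scale[OF u schwartz_stft_window[OF g]] norm_mult)
  note i = tempered_gauss_average(1)[OF u heis_family[OF A B \<phi>]]
  have "stft g (extend_op Z u) x \<xi> = complex_of_real c * (LBINT w. complex_of_real (gauss w) * u (heis (A w) (B w) \<phi>))"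
    unfolding stft_def \<phi>_def[symmetric] by (rule extend_op_integral[OF u \<phi>])
  then have "norm (stft g (extend_op Z u) x \<xi>) = \<bar>c\<bar> * norm (LBINT w. complex_of_real (gauss w) * u (heis (A w) (B w) \<phi>))"
    by (simp add: norm_mult)
  also have "\<dots> \<le> \<bar>c\<bar> * (LBINT w. norm (complex_of_real (gauss w) * u (heis (A w) (B w) \<phi>)))"
    by (intro mult_left_mono integral_norm_bound) simp
  finally show "norm (stft g (extend_op Z u) x \<xi>) \<le>
    \<bar>c\<bar> * (LBINT w. gauss w * norm (stft g u (x + A w) (\<xi> + B w)))"
    by (simp add: norm_mult n)
  show "integrable lborel (\<lambda>w. gauss w * norm (stft g u (x + A w) (\<xi> + B w)))"
    using integrable_norm[OF i] by (simp add: norm_mult n)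
qed

end

lemma stft_norm_measurable:
  assumes u: "tempered u" and g: "schwartz (g :: 'a::euclidean_space \<Rightarrow> complex)"
  shows "(\<lambda>p. norm (stft g u (fst p) (snd p))) \<in> borel_measurable borel"
proof -
  have "schwartz_family (\<lambda>p::'a \<times> 'a. heis (fst p) (snd p) g)"
    by (intro heis_family g) (auto intro!: linearI)
  from tempered_family_continuous[OF u this]
  have "continuous_on UNIV (\<lambda>p. norm (u (heis (fst p) (snd p) g)))" by (intro continuous_on_norm)
  then have "(\<lambda>p. norm (u (heis (fst p) (snd p) g))) \<in> borel_measurable borel" by (rule borel_measurable_continuous_onI)
  then show ?thesis by (simp add: norm_stft_heis[OF u g])
qed

section \<open>The Wigner distribution of Schwartz functions\<close>

text \<open>Translating by \<open>t b\<close> does not change the integral of the derivative, so that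
  \<open>\<integral> \<partial>\<^sub>b f = \<integral>\<^sub>0\<^sup>1 \<integral> \<partial>\<^sub>b f (y + t b) dy dt = \<integral> (f (y + b) - f y) dy = 0\<close>.\<close>

lemma integral_partial_deriv_eq_0:
  fixes f :: "'a::euclidean_space \<Rightarrow> complex"
  assumes f: "integrable lborel f" and D: "integrable lborel D" and cont: "continuous_on UNIV D"
    and deriv: "\<And>y t. ((\<lambda>t. f (y + t *\<^sub>R b)) has_vector_derivative D (y + t *\<^sub>R b)) (at t)"
  shows "(LBINT y. D y) = 0"
proof -
  have Dm [measurable]: "D \<in> borel_measurable borel" using cont by (rule borel_measurable_continuous_onI)
  define K where "K = (\<lambda>t y. indicator {0..1} (t::real) *\<^sub>R D (y + t *\<^sub>R b))"
  have "(LBINT t. (LBINT y. K t y)) = (LBINT y. (LBINT t. K t y))"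
  proof (rule integral_swap[where a="\<lambda>t. indicator {0..1} t * (LBINT y. norm (D y))"])
    show "(\<lambda>(t, y). K t y) \<in> borel_measurable (borel \<Otimes>\<^sub>M borel)" unfolding K_def by measurable
    show "integrable lborel (\<lambda>t::real. indicator {0..1} t * (LBINT y. norm (D y)))"
      by (intro integrable_mult_left) (simp add: integrable_indicator_iff)
    fix t :: real
    show "integrable lborel (K t)"
      unfolding K_def using D by (intro integrable_scaleR_right) (simp add: integrable_translate_iff)
    show "(LBINT y. norm (K t y)) \<le> indicator {0..1} t * (LBINT y. norm (D y))"
      by (simp add: K_def integral_translate[of "\<lambda>y. norm (D y)"])
  qed
  moreover have "(LBINT y. K t y) = indicator {0..1} t *\<^sub>R (LBINT y. D y)" for t
    by (simp add: K_def integral_translate[of D])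
  moreover have "(LBINT t. K t y) = f (y + b) - f y" for y
  proof -
    have "(LBINT t. indicator {0..1} t *\<^sub>R D (y + t *\<^sub>R b)) = f (y + 1 *\<^sub>R b) - f (y + 0 *\<^sub>R b)"
      by (rule integral_FTC_Icc)
         (auto intro!: has_vector_derivative_at_within[OF deriv] continuous_on_compose2[OF cont] continuous_intros)
    then show ?thesis by (simp add: K_def)
  qed
  moreover have "(LBINT y. f (y + b) - f y) = 0"
    using f by (simp add: integrable_translate_iff integral_translate[of f])
  ultimately show ?thesis by simp
qed

definition wigner_kernel :: "('a::euclidean_space \<Rightarrow> complex) \<Rightarrow> ('a \<Rightarrow> complex) \<Rightarrow> 'a \<Rightarrow> 'a \<Rightarrow> complex" where
  "wigner_kernel f g x y = f (x + y /\<^sub>R 2) * cnj (g (x - y /\<^sub>R 2))"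

lemma wigner_eq_fourier: "wigner f g z = fourier_integral (wigner_kernel f g (pos z)) (freq z)"
  by (simp add: wigner_def fourier_integral_def wigner_kernel_def inner_commute)

text \<open>With \<open>u = x + y/2\<close> and \<open>v = x - y/2\<close> both \<open>x\<close> and \<open>y\<close> are controlled by \<open>(1 + |u|) (1 + |v|)\<close>, so that the decay of the
  two factors passes to decay in \<open>x\<close> and \<open>y\<close>.\<close>

lemma wigner_kernel_decay:
  fixes f g :: "'a::euclidean_space \<Rightarrow> complex"
  assumes f: "schwartz f" and g: "schwartz g"
  shows "\<exists>C. \<forall>x y. (1 + norm x) ^ m * (1 + norm y) ^ n * norm (wigner_kernel f g x y) \<le> C"
proof (intro exI allI)
  fix x y :: 'a
  define u where "u = x + y /\<^sub>R 2"
  define v where "v = x - y /\<^sub>R 2"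
  have x: "x = (u + v) /\<^sub>R 2" and y: "y = u - v"
    by (simp_all add: u_def v_def algebra_simps flip: scaleR_add_left)
  have p: "0 \<le> norm u * norm v" by simp
  have e: "(1 + norm u) * (1 + norm v) = 1 + norm u + norm v + norm u * norm v" by (simp add: algebra_simps)
  have nx: "1 + norm x \<le> (1 + norm u) * (1 + norm v)"
  proof -
    have "norm x = norm (u + v) / 2" unfolding x by simp
    then have "norm x \<le> norm u + norm v" using norm_triangle_ineq[of u v] norm_ge_zero[of "u + v"] by linarith
    then show ?thesis unfolding e using p by linarith
  qed
  have ny: "1 + norm y \<le> (1 + norm u) * (1 + norm v)"
    unfolding y e using norm_triangle_ineq4[of u v] p by linarith
  have "(1 + norm x) ^ m * (1 + norm y) ^ n \<le> ((1 + norm u) * (1 + norm v)) ^ m * ((1 + norm u) * (1 + norm v)) ^ n"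
    by (intro mult_mono power_mono nx ny) auto
  also have "\<dots> = (1 + norm u) ^ (m + n) * (1 + norm v) ^ (m + n)"
    by (simp add: power_add power_mult_distrib mult_ac)
  finally have "(1 + norm x) ^ m * (1 + norm y) ^ n * norm (wigner_kernel f g x y) \<le>
    (1 + norm u) ^ (m + n) * (1 + norm v) ^ (m + n) * norm (wigner_kernel f g x y)"
    by (rule mult_right_mono) simp
  also have "\<dots> = ((1 + norm u) ^ (m + n) * norm (iter_deriv [] f u)) * ((1 + norm v) ^ (m + n) * norm (iter_deriv [] g v))"
    by (simp add: wigner_kernel_def u_def v_def norm_mult mult_ac)
  also have "\<dots> \<le> schwartz_sup (m + n) [] f * schwartz_sup (m + n) [] g"
    by (intro mult_mono schwartz_sup_upper f g schwartz_sup_nonneg) auto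
  finally show "(1 + norm x) ^ m * (1 + norm y) ^ n * norm (wigner_kernel f g x y) \<le> schwartz_sup (m + n) [] f * schwartz_sup (m + n) [] g" .
qed

lemma wigner_kernel_measurable:
  assumes "f \<in> borel_measurable borel" "g \<in> borel_measurable borel"
  shows "(\<lambda>(x, y). wigner_kernel f g x y) \<in> borel_measurable (borel \<Otimes>\<^sub>M borel)"
proof -
  note [measurable] = assms
  have [measurable]: "cnj \<in> borel_measurable borel"
    by (intro borel_measurable_continuous_onI continuous_intros)
  show ?thesis unfolding wigner_kernel_def by measurable
qed

lemma wigner_kernel_integrable:
  fixes f g :: "'a::euclidean_space \<Rightarrow> complex"
  assumes f: "schwartz f" and g: "schwartz g"
  shows "integrable lborel (wigner_kernel f g x)"
    and "\<exists>C. \<forall>x. (1 + norm x) ^ m * (LBINT y. norm (wigner_kernel f g x y)) \<le> C"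
proof -
  define I where "I = (\<lambda>y::'a. inverse ((1 + norm y) ^ (2 * DIM('a))))"
  have Ii: "integrable lborel I" unfolding I_def by (rule integrable_inverse_power)
  have m: "wigner_kernel f g x \<in> borel_measurable borel" for x
    using measurable_Pair2[OF wigner_kernel_measurable[OF schwartz_measurable[OF f] schwartz_measurable[OF g]], of x] by simp
  have b: "\<exists>C. \<forall>x y. (1 + norm x) ^ m * norm (wigner_kernel f g x y) \<le> C * I y" for m
  proof -
    obtain C where C: "\<forall>x y. (1 + norm x) ^ m * (1 + norm y) ^ (2 * DIM('a)) * norm (wigner_kernel f g x y) \<le> C"
      using wigner_kernel_decay[OF f g] by blast
    have "(1 + norm x) ^ m * norm (wigner_kernel f g x y) \<le> C * I y" for x y
      unfolding I_def using C by (intro decay_bound) (simp add: mult_ac)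
    then show ?thesis by blast
  qed
  have i: "integrable lborel (wigner_kernel f g x)" for x
  proof -
    obtain C where C: "\<forall>x y. (1 + norm x) ^ 0 * norm (wigner_kernel f g x y) \<le> C * I y" using b by blast
    show ?thesis
    proof (rule integrable_dominated)
      show "integrable lborel (\<lambda>y. C * I y)" by (intro integrable_mult_right Ii)
      have "norm (wigner_kernel f g x y) \<le> C * I y" for y using C[rule_format, of x y] by simp
      then show "AE y in lborel. norm (wigner_kernel f g x y) \<le> norm (C * I y)"
        unfolding real_norm_def by (intro AE_I2 order_trans[OF _ abs_ge_self])
    qed (use m[of x] in simp)
  qed
  then show "integrable lborel (wigner_kernel f g x)" .
  obtain C where C: "\<forall>x y. (1 + norm x) ^ m * norm (wigner_kernel f g x y) \<le> C * I y" using b by blast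
  have "(1 + norm x) ^ m * (LBINT y. norm (wigner_kernel f g x y)) \<le> C * (LBINT y. I y)" for x
  proof -
    have "(1 + norm x) ^ m * (LBINT y. norm (wigner_kernel f g x y)) = (LBINT y. (1 + norm x) ^ m * norm (wigner_kernel f g x y))"
      by simp
    also have "\<dots> \<le> (LBINT y. C * I y)"
      by (rule Bochner_Integration.integral_mono) (use i C Ii in auto)
    finally show ?thesis by simp
  qed
  then show "\<exists>C. \<forall>x. (1 + norm x) ^ m * (LBINT y. norm (wigner_kernel f g x y)) \<le> C" by blast
qed

lemma schwartz_line_derivative:
  assumes f: "schwartz f"
  shows "((\<lambda>t. f (x + t *\<^sub>R b)) has_vector_derivative partial_deriv b f (x + t *\<^sub>R b)) (at t)"
proof -
  have d: "(f has_derivative frechet_derivative f (at (x + t *\<^sub>R b))) (at (x + t *\<^sub>R b))"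
    using schwartz_differentiable[OF f] frechet_derivative_works by blast
  have "((\<lambda>t. f (x + t *\<^sub>R b)) has_derivative (\<lambda>h. frechet_derivative f (at (x + t *\<^sub>R b)) (h *\<^sub>R b))) (at t)"
    by (rule has_derivative_compose[of "\<lambda>t. x + t *\<^sub>R b", OF _ d]) (auto intro!: derivative_eq_intros)
  moreover have "frechet_derivative f (at (x + t *\<^sub>R b)) (h *\<^sub>R b) = h *\<^sub>R partial_deriv b f (x + t *\<^sub>R b)" for h
    unfolding partial_deriv_def using has_derivative_linear[OF d] by (rule linear_scale)
  ultimately show ?thesis by (simp add: has_vector_derivative_def)
qed

text \<open>Frequency decay comes from integration by parts: multiplying a Wigner distribution by a frequency
  coordinate differentiates one of its two arguments.\<close>

lemma wigner_freq_mult: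
  fixes f g :: "real^'d::finite \<Rightarrow> complex"
  assumes f: "schwartz f" and g: "schwartz g" and b: "b \<in> Basis"
  shows "complex_of_real (4 * pi * (freq z \<bullet> b)) * (\<i> * wigner f g z) = wigner (partial_deriv b f) g z - wigner f (partial_deriv b g) z"
proof -
  define x where "x = pos z"
  define \<xi> where "\<xi> = freq z"
  define e where "e = (\<lambda>y. cis (- 2 * pi * (\<xi> \<bullet> y)))"
  define h where "h = wigner_kernel f g x"
  define h1 where "h1 = wigner_kernel (partial_deriv b f) g x"
  define h2 where "h2 = wigner_kernel f (partial_deriv b g) x"
  define D where "D = (\<lambda>y. (1/2) * (h1 y * e y) - (1/2) * (h2 y * e y) - complex_of_real (2 * pi * (\<xi> \<bullet> b)) * (\<i> * (h y * e y)))"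
  note pf = schwartz_partial_deriv[OF f b] and pg = schwartz_partial_deriv[OF g b]
  have i: "integrable lborel (\<lambda>y. h y * e y)" "integrable lborel (\<lambda>y. h1 y * e y)" "integrable lborel (\<lambda>y. h2 y * e y)"
    unfolding h_def h1_def h2_def e_def by (intro fourier_integrable wigner_kernel_integrable f g pf pg)+
  have c: "continuous_on UNIV h" "continuous_on UNIV h1" "continuous_on UNIV h2" "continuous_on UNIV e"
    unfolding h_def h1_def h2_def e_def wigner_kernel_def[abs_def]
    by (intro continuous_intros continuous_on_compose2[OF schwartz_continuous[OF f]] continuous_on_compose2[OF schwartz_continuous[OF g]]
        continuous_on_compose2[OF schwartz_continuous[OF pf]] continuous_on_compose2[OF schwartz_continuous[OF pg]] subset_UNIV)+
  have "(LBINT y. D y) = 0"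
  proof (rule integral_partial_deriv_eq_0[OF i(1)])
    show "integrable lborel D"
      unfolding D_def by (intro Bochner_Integration.integrable_diff integrable_mult_right i)
    show "continuous_on UNIV D" unfolding D_def by (intro continuous_intros c)
    fix y t
    have 1: "((\<lambda>t. f ((x + y /\<^sub>R 2) + (t / 2) *\<^sub>R b)) has_vector_derivative (1/2) *\<^sub>R partial_deriv b f ((x + y /\<^sub>R 2) + (t / 2) *\<^sub>R b)) (at t)"
      using vector_diff_chain_at[of "\<lambda>t. t / 2" "1/2" t, OF _ schwartz_line_derivative[OF f, of "x + y /\<^sub>R 2" b "t / 2"]]
      by (simp add: comp_def has_real_derivative_iff_has_vector_derivative[symmetric] DERIV_cdivide)
    have 2: "((\<lambda>t. cnj (g ((x - y /\<^sub>R 2) + (- t / 2) *\<^sub>R b))) has_vector_derivative cnj ((- 1/2) *\<^sub>R partial_deriv b g ((x - y /\<^sub>R 2) + (- t / 2) *\<^sub>R b))) (at t)"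
    proof -
      have d: "((\<lambda>t. - t / 2) has_real_derivative - 1/2) (at t)" by (auto intro!: derivative_eq_intros)
      have "((\<lambda>t. g ((x - y /\<^sub>R 2) + (- t / 2) *\<^sub>R b)) has_vector_derivative ((- 1/2) *\<^sub>R partial_deriv b g ((x - y /\<^sub>R 2) + (- t / 2) *\<^sub>R b))) (at t)"
        using vector_diff_chain_at[OF d[unfolded has_real_derivative_iff_has_vector_derivative] schwartz_line_derivative[OF g, of "x - y /\<^sub>R 2" b "- t / 2"]]
        by (simp add: comp_def)
      then show ?thesis by (rule has_vector_derivative_cnj)
    qed
    have 3: "((\<lambda>t. e (y + t *\<^sub>R b)) has_vector_derivative - complex_of_real (2 * pi * (\<xi> \<bullet> b)) * (\<i> * e (y + t *\<^sub>R b))) (at t)"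
    proof -
      have d: "((\<lambda>t. - 2 * pi * (\<xi> \<bullet> (y + t *\<^sub>R b))) has_real_derivative - 2 * pi * (\<xi> \<bullet> b)) (at t)"
        unfolding inner_add_right inner_scaleR_right by (auto intro!: derivative_eq_intros)
      have "(cis has_vector_derivative \<i> * cis s) (at s)" for s
        unfolding has_vector_derivative_def by (auto intro!: derivative_eq_intros)
      from vector_diff_chain_at[OF d[unfolded has_real_derivative_iff_has_vector_derivative] this]
      show ?thesis by (simp add: comp_def e_def scaleR_conv_of_real)
    qed
    have a: "x + (y + t *\<^sub>R b) /\<^sub>R 2 = (x + y /\<^sub>R 2) + (t / 2) *\<^sub>R b" "x - (y + t *\<^sub>R b) /\<^sub>R 2 = (x - y /\<^sub>R 2) + (- t / 2) *\<^sub>R b" for t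
      by (simp_all add: scaleR_add_right)
    show "((\<lambda>t. h (y + t *\<^sub>R b) * e (y + t *\<^sub>R b)) has_vector_derivative D (y + t *\<^sub>R b)) (at t)"
      unfolding D_def h_def h1_def h2_def wigner_kernel_def a
      by (rule has_vector_derivative_eq_rhs[OF has_vector_derivative_mult[OF has_vector_derivative_mult[OF 1 2] 3]])
         (simp add: algebra_simps scaleR_conv_of_real)
  qed
  moreover have "(LBINT y. D y) = (1/2) * wigner (partial_deriv b f) g z - (1/2) * wigner f (partial_deriv b g) z -
      complex_of_real (2 * pi * (\<xi> \<bullet> b)) * (\<i> * wigner f g z)"
    unfolding D_def wigner_eq_fourier fourier_integral_def
    using i by (simp add: h_def h1_def h2_def e_def x_def \<xi>_def integrable_mult_right)
  ultimately show ?thesis by (simp add: \<xi>_def algebra_simps)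
qed

text \<open>Induction on the power of the frequency, over all pairs of Schwartz functions at once, since integration by parts replaces
  the functions by their derivatives.\<close>

lemma wigner_decay:
  fixes f g :: "real^'d::finite \<Rightarrow> complex"
  assumes "schwartz f" "schwartz g"
  shows "\<exists>C. \<forall>z. (1 + norm (pos z)) ^ n * (1 + norm (freq z)) ^ m * norm (wigner f g z) \<le> C"
  using assms
proof (induction m arbitrary: f g)
  case 0
  obtain C where C: "\<forall>x. (1 + norm x) ^ n * (LBINT y. norm (wigner_kernel f g x y)) \<le> C"
    using wigner_kernel_integrable(2)[OF 0] by blast
  have "(1 + norm (pos z)) ^ n * norm (wigner f g z) \<le> C" for z
  proof -
    have "(1 + norm (pos z)) ^ n * norm (wigner f g z) \<le> (1 + norm (pos z)) ^ n * (LBINT y. norm (wigner_kernel f g (pos z) y))"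
      unfolding wigner_eq_fourier by (intro mult_left_mono norm_fourier_integral) simp
    with C show ?thesis by (meson order_trans)
  qed
  then show ?case by auto
next
  case (Suc m)
  define T where "T = (\<lambda>(z::real^('d + 'd)) r. (1 + norm (pos z)) ^ n * (1 + norm (freq z)) ^ m * (r::real))"
  have Tmono: "r \<le> r' \<Longrightarrow> T z r \<le> T z r'" for z r r' unfolding T_def by (intro mult_left_mono) auto
  obtain C where C: "\<forall>z. T z (norm (wigner f g z)) \<le> C" using Suc.IH[OF Suc.prems] unfolding T_def by blast
  have "\<forall>b\<in>Basis. \<exists>E. \<forall>z. T z (\<bar>freq z \<bullet> b\<bar> * norm (wigner f g z)) \<le> E"
  proof
    fix b :: "real^'d" assume b: "b \<in> Basis"
    note p = schwartz_partial_deriv[OF Suc.prems(1) b] schwartz_partial_deriv[OF Suc.prems(2) b]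
    obtain E1 where E1: "\<forall>z. T z (norm (wigner (partial_deriv b f) g z)) \<le> E1" using Suc.IH[OF p(1) Suc.prems(2)] unfolding T_def by blast
    obtain E2 where E2: "\<forall>z. T z (norm (wigner f (partial_deriv b g) z)) \<le> E2" using Suc.IH[OF Suc.prems(1) p(2)] unfolding T_def by blast
    have "T z (\<bar>freq z \<bullet> b\<bar> * norm (wigner f g z)) \<le> E1 + E2" for z
    proof -
      have "4 * pi * (\<bar>freq z \<bullet> b\<bar> * norm (wigner f g z)) = norm (complex_of_real (4 * pi * (freq z \<bullet> b)) * (\<i> * wigner f g z))"
        unfolding norm_mult norm_of_real by (simp add: abs_mult)
      also have "\<dots> \<le> norm (wigner (partial_deriv b f) g z) + norm (wigner f (partial_deriv b g) z)"
        unfolding wigner_freq_mult[OF Suc.prems b] by (rule norm_triangle_ineq4)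
      also have "1 * (\<bar>freq z \<bullet> b\<bar> * norm (wigner f g z)) \<le> 4 * pi * (\<bar>freq z \<bullet> b\<bar> * norm (wigner f g z))"
        using pi_gt3 by (intro mult_right_mono) auto
      finally have "T z (\<bar>freq z \<bullet> b\<bar> * norm (wigner f g z)) \<le>
        T z (norm (wigner (partial_deriv b f) g z) + norm (wigner f (partial_deriv b g) z))" by (intro Tmono) simp
      also have "\<dots> = T z (norm (wigner (partial_deriv b f) g z)) + T z (norm (wigner f (partial_deriv b g) z))"
        by (simp add: T_def distrib_left)
      finally show ?thesis using E1[rule_format, of z] E2[rule_format, of z] by linarith
    qed
    then show "\<exists>E. \<forall>z. T z (\<bar>freq z \<bullet> b\<bar> * norm (wigner f g z)) \<le> E" by blast
  qed
  from bchoice[OF this] obtain E where E: "\<forall>b\<in>Basis. \<forall>z. T z (\<bar>freq z \<bullet> b\<bar> * norm (wigner f g z)) \<le> E b" ..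
  have "(1 + norm (pos z)) ^ n * (1 + norm (freq z)) ^ Suc m * norm (wigner f g z) \<le> C + (\<Sum>b\<in>Basis. E b)" for z
  proof -
    have "(1 + norm (pos z)) ^ n * (1 + norm (freq z)) ^ Suc m * norm (wigner f g z) = T z ((1 + norm (freq z)) * norm (wigner f g z))"
      by (simp add: T_def mult_ac)
    also have "\<dots> \<le> T z ((1 + (\<Sum>b\<in>Basis. \<bar>freq z \<bullet> b\<bar>)) * norm (wigner f g z))"
      by (intro Tmono mult_right_mono add_left_mono norm_le_l1) simp
    also have "\<dots> = T z (norm (wigner f g z)) + (\<Sum>b\<in>Basis. T z (\<bar>freq z \<bullet> b\<bar> * norm (wigner f g z)))"
      by (simp add: T_def distrib_left distrib_right sum_distrib_left sum_distrib_right)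
    also have "\<dots> \<le> C + (\<Sum>b\<in>Basis. E b)"
      using C E by (intro add_mono sum_mono) auto
    finally show ?thesis .
  qed
  then show ?case by blast
qed

lemma measurable_pos [measurable]: "pos \<in> borel_measurable borel"
  and measurable_freq [measurable]: "freq \<in> borel_measurable borel"
  by (intro borel_measurable_continuous_onI linear_continuous_on linear_linear[THEN iffD2] linear_pos linear_freq)+

lemma wigner_measurable:
  assumes f: "f \<in> borel_measurable borel" and g: "g \<in> borel_measurable borel"
  shows "wigner f g \<in> borel_measurable borel"
proof -
  have [measurable]: "(\<lambda>(x, y). wigner_kernel f g x y) \<in> borel_measurable (borel \<Otimes>\<^sub>M borel)"
    by (rule wigner_kernel_measurable[OF f g])
  have "(\<lambda>z. fourier_integral (wigner_kernel f g (pos z)) (freq z)) \<in> borel_measurable borel"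
    unfolding fourier_integral_def by measurable
  then show ?thesis by (simp add: wigner_eq_fourier[abs_def])
qed

lemma wigner_decay_integrable:
  fixes f g :: "real^'d::finite \<Rightarrow> complex"
  assumes f: "schwartz f" and g: "schwartz g"
  shows "\<exists>C. \<forall>z. norm (wigner f g z) \<le> C * (inverse ((1 + norm (pos z)) ^ (2 * DIM(real^'d))) * inverse ((1 + norm (freq z)) ^ (2 * DIM(real^'d))))"
proof -
  define N where "N = 2 * DIM(real^'d)"
  obtain C where C: "\<forall>z. (1 + norm (pos z)) ^ N * (1 + norm (freq z)) ^ N * norm (wigner f g z) \<le> C"
    using wigner_decay[OF f g] by blast
  have "norm (wigner f g z) \<le> C * (inverse ((1 + norm (pos z)) ^ N) * inverse ((1 + norm (freq z)) ^ N))" for z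
  proof -
    have "(1 + norm (freq z)) ^ N * norm (wigner f g z) \<le> C * inverse ((1 + norm (pos z)) ^ N)"
      using C by (intro decay_bound) (simp add: mult.assoc)
    from decay_bound[OF this] show ?thesis by (simp only: mult.assoc)
  qed
  then show ?thesis unfolding N_def by blast
qed

lemma wigner_integrable:
  fixes f g :: "real^'d::finite \<Rightarrow> complex"
  assumes f: "schwartz f" and g: "schwartz g"
  shows "integrable lborel (wigner f g)"
proof -
  note fm = schwartz_measurable[OF f] and gm = schwartz_measurable[OF g]
  define I where "I = (\<lambda>x::real^'d. inverse ((1 + norm x) ^ (2 * DIM(real^'d))))"
  have Ii: "integrable lborel I" unfolding I_def by (rule integrable_inverse_power)
  have Ip: "I x \<ge> 0" for x by (simp add: I_def)
  obtain C where C: "\<forall>z. norm (wigner f g z) \<le> C * (I (pos z) * I (freq z))"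
    using wigner_decay_integrable[OF f g] unfolding I_def by blast
  have "integrable lborel (\<lambda>z. I (pos z) * I (freq z))"
  proof (subst integrable_join)
    show "(\<lambda>z. I (pos z) * I (freq z)) \<in> borel_measurable borel" unfolding I_def by measurable
    show "integrable (lborel \<Otimes>\<^sub>M lborel) (\<lambda>(b, a). I (pos (phase_join a b)) * I (freq (phase_join a b)))"
    proof (rule integrable_pair_bound[where a="\<lambda>b. (LBINT a. I a) * I b"])
      show "(\<lambda>(b, a). I (pos (phase_join a b)) * I (freq (phase_join a b))) \<in> borel_measurable (borel \<Otimes>\<^sub>M borel)"
        unfolding I_def pos_join freq_join by measurable
    qed (auto simp: pos_join freq_join Ii Ip)
  qed
  from integrable_mult_right[OF this, of C] show ?thesis
  proof (rule integrable_dominated)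
    show "wigner f g \<in> borel_measurable lborel" using wigner_measurable[OF fm gm] by simp
    have "norm (wigner f g z) \<le> C * (I (pos z) * I (freq z))" for z using C by blast
    then show "AE z in lborel. norm (wigner f g z) \<le> norm (C * (I (pos z) * I (freq z)))"
      unfolding real_norm_def by (intro AE_I2 order_trans[OF _ abs_ge_self])
  qed
qed

text \<open>The Fourier transform of the Wigner distribution is the ambiguity function: inverting the Fourier
  transform in the frequency variable recovers the kernel \<open>f (x + y/2) cnj (g (x - y/2))\<close>, and the remaining
  integral over positions is a matrix coefficient of a Heisenberg operator.\<close>

theorem wigner_fourier:
  fixes f g :: "real^'d::finite \<Rightarrow> complex"
  assumes f: "schwartz f" and g: "schwartz g"
  shows "(LBINT z. wigner f g z * cis (2 * pi * (b \<bullet> z))) =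
    (LBINT y. heis (- freq b) (pos b) f y * cnj (g y))"
proof -
  define F where "F = (\<lambda>z. wigner f g z * cis (2 * pi * (b \<bullet> z)))"
  have Fi: "integrable lborel F"
    unfolding F_def using fourier_integrable[OF wigner_integrable[OF f g], of "2 * pi" b] by simp
  then have Fm: "F \<in> borel_measurable borel" using borel_measurable_integrable[of lborel F] by simp
  have pi2: "integrable (lborel \<Otimes>\<^sub>M lborel) (\<lambda>(\<xi>, x). F (phase_join x \<xi>))"
    using Fi integrable_join[OF Fm] by simp
  have hb: "\<exists>B. \<forall>y. norm (wigner_kernel f g x y) \<le> B" for x
    using wigner_kernel_decay[OF f g, of 0 0] by auto
  have "(LBINT z. F z) = (LBINT \<xi>. (LBINT x. F (phase_join x \<xi>)))"
    by (rule integral_join[OF Fm Fi])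
  also have "\<dots> = (LBINT x. (LBINT \<xi>. F (phase_join x \<xi>)))"
    using lborel_pair.Fubini_integral[OF pi2] by simp
  also have "\<dots> = (LBINT x. cis (2 * pi * (pos b \<bullet> x)) * wigner_kernel f g x (freq b))"
  proof (intro lebesgue_cong refl)
    fix x :: "real^'d"
    define h where "h = wigner_kernel f g x"
    obtain B where B: "\<And>y. norm (h y) \<le> B" using hb[of x] unfolding h_def by blast
    have hi: "integrable lborel h" unfolding h_def by (rule wigner_kernel_integrable[OF f g])
    have hc: "continuous_on UNIV h" unfolding h_def wigner_kernel_def[abs_def]
      by (intro continuous_intros continuous_on_compose2[OF schwartz_continuous[OF f]] continuous_on_compose2[OF schwartz_continuous[OF g]] subset_UNIV)
    have fi: "integrable lborel (fourier_integral h)"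
    proof -
      obtain C where C: "\<forall>z. norm (wigner f g z) \<le> C * (inverse ((1 + norm (pos z)) ^ (2 * DIM(real^'d))) * inverse ((1 + norm (freq z)) ^ (2 * DIM(real^'d))))"
        using wigner_decay_integrable[OF f g] by blast
      show ?thesis
      proof (rule integrable_dominated)
        show "integrable lborel (\<lambda>\<xi>::real^'d. C * (inverse ((1 + norm x) ^ (2 * DIM(real^'d))) * inverse ((1 + norm \<xi>) ^ (2 * DIM(real^'d)))))"
          by (intro integrable_mult_right integrable_inverse_power)
        have "norm (fourier_integral h \<xi>) \<le> C * (inverse ((1 + norm x) ^ (2 * DIM(real^'d))) * inverse ((1 + norm \<xi>) ^ (2 * DIM(real^'d))))" for \<xi>
          using C[rule_format, of "phase_join x \<xi>"] by (simp only: wigner_eq_fourier pos_join freq_join h_def)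
        then show "AE \<xi> in lborel. norm (fourier_integral h \<xi>) \<le> norm (C * (inverse ((1 + norm x) ^ (2 * DIM(real^'d))) * inverse ((1 + norm \<xi>) ^ (2 * DIM(real^'d)))))"
          unfolding real_norm_def by (intro AE_I2 order_trans[OF _ abs_ge_self])
        show "fourier_integral h \<in> borel_measurable lborel"
          using fourier_integral_measurable[OF borel_measurable_continuous_onI[OF hc]] by simp
      qed
    qed
    have "(LBINT \<xi>. F (phase_join x \<xi>)) = (LBINT \<xi>. cis (2 * pi * (pos b \<bullet> x)) * (fourier_integral h \<xi> * cis (2 * pi * (\<xi> \<bullet> freq b))))"
      unfolding F_def wigner_eq_fourier inner_phase pos_join freq_join h_def distrib_left cis_mult[symmetric] inner_commute[of "freq b"]
      by (simp add: mult_ac)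
    also have "\<dots> = cis (2 * pi * (pos b \<bullet> x)) * h (freq b)"
      using fourier_inversion[OF hi B _ fi, of "freq b"] hc by (simp add: continuous_on_eq_continuous_at)
    finally show "(LBINT \<xi>. F (phase_join x \<xi>)) = cis (2 * pi * (pos b \<bullet> x)) * wigner_kernel f g x (freq b)"
      by (simp add: h_def)
  qed
  also have "\<dots> = (LBINT y. cis (2 * pi * (pos b \<bullet> (y + freq b /\<^sub>R 2))) * wigner_kernel f g (y + freq b /\<^sub>R 2) (freq b))"
    by (rule integral_translate[symmetric])
  also have "\<dots> = (LBINT y. heis (- freq b) (pos b) f y * cnj (g y))"
  proof (intro lebesgue_cong refl)
    fix y
    have "y + freq b /\<^sub>R 2 + freq b /\<^sub>R 2 = y - - freq b" by (simp add: add.assoc flip: scaleR_add_left)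
    then show "cis (2 * pi * (pos b \<bullet> (y + freq b /\<^sub>R 2))) * wigner_kernel f g (y + freq b /\<^sub>R 2) (freq b) =
      heis (- freq b) (pos b) f y * cnj (g y)"
      unfolding heis_def wigner_kernel_def by (simp add: add.commute)
  qed
  finally show ?thesis unfolding F_def .
qed

lemma cnj_wigner: "cnj (wigner g f z) = wigner f g z"
proof -
  have "cnj (wigner g f z) = (LBINT y. cnj (wigner_kernel g f (pos z) y * cis (- 2 * pi * (freq z \<bullet> y))))"
    unfolding wigner_eq_fourier fourier_integral_def by (simp flip: Bochner_Integration.integral_cnj)
  also have "\<dots> = (LBINT y. (\<lambda>y. wigner_kernel f g (pos z) y * cis (- 2 * pi * (freq z \<bullet> y))) (- y))"
    by (intro lebesgue_cong refl) (simp add: wigner_kernel_def cis_cnj mult_ac)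
  also have "\<dots> = wigner f g z"
    unfolding wigner_eq_fourier fourier_integral_def by (rule integral_reflect)
  finally show ?thesis .
qed

section \<open>The Weyl symbol\<close>

lemma inner_diag_matrix: "(diag_matrix v *v w) \<bullet> z = w \<bullet> (diag_matrix v *v z)"
  by (simp add: inner_vec_def diag_matrix_mult mult_ac)

lemma omega_sympl_rot: "omega (sympl_rot u) z = - (u \<bullet> z)"
  by (simp add: omega_def sympl_rot_def pos_join freq_join inner_phase)

text \<open>The shifts occurring in the Gaussian average are dual, under the symplectic form, to the matrix
  \<open>\<Sigma>\<^sup>1\<^sup>/\<^sup>2 V\<^sup>-\<^sup>1\<close> in the Weyl symbol.\<close>

lemma omega_shift_of:
  fixes V :: "real^('d::finite + 'd)^('d + 'd)"
  assumes V: "\<And>z w. omega (V *v z) (V *v w) = omega z w"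
  shows "omega (shift_of V A w) z = - (w \<bullet> ((sqrt_Sigma_matrix A ** matrix_inv V) *v z))"
proof -
  have "invertible V" using V by (rule omega_invariant_invertible)
  then have VW: "V *v (matrix_inv V *v z) = z"
    by (simp add: matrix_vector_mul_assoc matrix_inv_right)
  have "omega (shift_of V A w) z = omega (V *v sympl_rot (sqrt_Sigma_matrix A *v w)) (V *v (matrix_inv V *v z))"
    by (simp add: shift_of_def VW)
  also have "\<dots> = - ((sqrt_Sigma_matrix A *v w) \<bullet> (matrix_inv V *v z))"
    by (simp only: V omega_sympl_rot)
  also have "\<dots> = - (w \<bullet> ((sqrt_Sigma_matrix A ** matrix_inv V) *v z))"
    by (simp add: sqrt_Sigma_matrix_def inner_diag_matrix flip: matrix_vector_mul_assoc)
  finally show ?thesis .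
qed

lemma Sigma_quadratic_form:
  assumes "\<And>j. valid_atom (A j)"
  shows "((transpose W ** Sigma_matrix A ** W) *v z) \<bullet> z = (norm ((sqrt_Sigma_matrix A ** W) *v z))\<^sup>2"
proof -
  define y where "y = W *v z"
  have s: "sigma_diag A $ k \<ge> 0" for k
  proof (cases k)
    case (Inl j)
    then show ?thesis using assms[of j] by (cases "A j") (auto simp: sigma_diag_def)
  next
    case (Inr j)
    then show ?thesis using assms[of j] by (cases "A j") (auto simp: sigma_diag_def)
  qed
  have "((transpose W ** Sigma_matrix A ** W) *v z) \<bullet> z = (Sigma_matrix A *v y) \<bullet> y"
    unfolding matrix_vector_mul_assoc[symmetric] inner_transpose y_def ..
  also have "\<dots> = (sqrt_Sigma_matrix A *v y) \<bullet> (sqrt_Sigma_matrix A *v y)"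
    unfolding inner_vec_def Sigma_matrix_def sqrt_Sigma_matrix_def diag_matrix_mult inner_real_def
  proof (intro sum.cong refl)
    fix k
    have "sigma_diag A $ k = sqrt (sigma_diag A $ k) * sqrt (sigma_diag A $ k)" using s[of k] by simp
    then show "sigma_diag A $ k * y $ k * y $ k = (\<chi> k. sqrt (sigma_diag A $ k)) $ k * y $ k * ((\<chi> k. sqrt (sigma_diag A $ k)) $ k * y $ k)"
      by (simp add: mult.assoc mult.left_commute)
  qed
  finally show ?thesis by (simp add: y_def power2_norm_eq_inner flip: matrix_vector_mul_assoc)
qed

lemma cinner_rho_wigner:
  fixes f g :: "real^'d::finite \<Rightarrow> complex"
  assumes f: "schwartz f" and g: "schwartz g"
  shows "cinner_L2 (rho \<zeta> (abs_L2 f)) (abs_L2 g) = (LBINT z. wigner f g z * cis (2 * pi * - omega \<zeta> z))"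
proof -
  \<comment> \<open>the frequency at which the transform of the Wigner distribution is the coefficient of the shift by \<open>\<zeta>\<close>\<close>
  define b where "b = phase_join (freq \<zeta>) (- pos \<zeta>)"
  have "cinner_L2 (rho \<zeta> (abs_L2 f)) (abs_L2 g) = (LBINT y. heis (pos \<zeta>) (freq \<zeta>) f y * cnj (g y))"
    unfolding rho_def heisL_abs[OF schwartz_square_integrable[OF f]]
    by (rule cinner_abs) (intro square_integrable_heis schwartz_square_integrable f g)+
  also have "\<dots> = (LBINT z. wigner f g z * cis (2 * pi * (b \<bullet> z)))"
    unfolding wigner_fourier[OF f g] by (simp add: b_def pos_join freq_join)
  also have "\<dots> = (LBINT z. wigner f g z * cis (2 * pi * - omega \<zeta> z))"
    by (simp add: b_def inner_phase omega_def pos_join freq_join)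
  finally show ?thesis .
qed

text \<open>Bounded functions are tempered because the \<open>L\<^sup>1\<close> norm is bounded by a Schwartz seminorm.\<close>

lemma tempered_fun_dist:
  fixes a :: "'a::euclidean_space \<Rightarrow> complex"
  assumes a [measurable]: "a \<in> borel_measurable borel" and B: "\<And>z. norm (a z) \<le> B"
  shows "tempered (fun_dist a)"
proof -
  have B0: "B \<ge> 0" using B[of 0] norm_ge_zero order_trans by blast
  have cm [measurable]: "cnj \<in> borel_measurable borel"
    by (intro borel_measurable_continuous_onI continuous_intros)
  have ab: "norm (a z * cnj (\<phi> z)) \<le> B * norm (\<phi> z)" for \<phi> z
    unfolding norm_mult complex_mod_cnj by (intro mult_right_mono B) simp
  have i: "integrable lborel (\<lambda>z. a z * cnj (\<phi> z))" if \<phi>: "schwartz \<phi>" for \<phi>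
  proof (rule integrable_dominated)
    show "integrable lborel (\<lambda>z. B * norm (\<phi> z))" using schwartz_integrable[OF \<phi>] by simp
    have [measurable]: "\<phi> \<in> borel_measurable borel" using \<phi> by (rule schwartz_measurable)
    show "(\<lambda>z. a z * cnj (\<phi> z)) \<in> borel_measurable lborel" by measurable
    show "AE z in lborel. norm (a z * cnj (\<phi> z)) \<le> norm (B * norm (\<phi> z))"
      using order_trans[OF ab abs_ge_self] by (simp only: real_norm_def AE_I2)
  qed
  define I where "I = (\<integral>x. inverse ((1 + norm x) ^ (2 * DIM('a))) \<partial>(lborel :: 'a measure))"
  show ?thesis
    unfolding tempered_def
  proof (intro conjI allI impI exI)
    fix \<phi> \<psi> :: "'a \<Rightarrow> complex" assume "schwartz \<phi>" "schwartz \<psi>"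
    then show "fun_dist a (\<lambda>x. \<phi> x + \<psi> x) = fun_dist a \<phi> + fun_dist a \<psi>"
      by (simp add: fun_dist_def distrib_left i)
  next
    fix c and \<phi> :: "'a \<Rightarrow> complex"
    show "fun_dist a (\<lambda>x. c * \<phi> x) = cnj c * fun_dist a \<phi>"
      by (simp add: fun_dist_def mult.left_commute[of _ "cnj c"])
  next
    fix \<phi> :: "'a \<Rightarrow> complex" assume \<phi>: "schwartz \<phi>"
    have "norm (fun_dist a \<phi>) \<le> (LBINT z. B * norm (\<phi> z))"
      unfolding fun_dist_def
    proof (rule Bochner_Integration.integral_norm_bound_integral[OF i[OF \<phi>]])
      show "integrable lborel (\<lambda>z. B * norm (\<phi> z))" using schwartz_integrable[OF \<phi>] by simp
    qed (rule ab)
    also have "\<dots> = B * (LBINT z. norm (\<phi> z))" by simp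
    also have "\<dots> \<le> B * (schwartz_seminorm (2 * DIM('a)) \<phi> * I)"
      unfolding I_def by (intro mult_left_mono schwartz_integrable_norm_le B0 \<phi>)
    finally show "norm (fun_dist a \<phi>) \<le> (B * I) * schwartz_seminorm (2 * DIM('a)) \<phi>" by (simp add: mult_ac)
  qed
qed

lemma fun_dist_rep:
  assumes "square_integrable \<phi>"
  shows "fun_dist (rep_L2 f) \<phi> = cinner_L2 f (abs_L2 \<phi>)"
  using cinner_abs[OF square_integrable_rep_L2 assms, of f] by (simp add: fun_dist_def)

text \<open>Writing each matrix coefficient of a shift as an integral against the Wigner distribution, the Gaussian
  average over the shifts becomes the Fourier transform of a Gaussian, evaluated at \<open>\<Sigma>\<^sup>1\<^sup>/\<^sup>2 V\<^sup>-\<^sup>1 z\<close>.\<close>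

theorem weyl_symbol:
  fixes Z :: "(real^'d::finite) L2 \<Rightarrow> (real^'d) L2"
  assumes Z: "mp_factorization Z U V A"
  shows "is_Opw Z (fun_dist (\<lambda>z. complex_of_real ((\<Prod>j\<in>UNIV. inverse (cosh (atom_angle (A j) / 2))) *
        exp (- pi * (((transpose (matrix_inv V) ** Sigma_matrix A ** matrix_inv V) *v z) \<bullet> z)))))"
proof -
  from Z have v: "\<And>j. valid_atom (A j)" and U: "mp_projection U V" by (auto simp: mp_factorization_def)
  define M where "M = sqrt_Sigma_matrix A ** matrix_inv V"
  define c where "c = (\<Prod>j\<in>UNIV. inverse (cosh (atom_angle (A j) / 2)))"
  define a where "a = (\<lambda>z. complex_of_real (c * exp (- pi * (norm (M *v z))\<^sup>2)))"
  have a: "(\<lambda>z. complex_of_real (c * exp (- pi * (((transpose (matrix_inv V) ** Sigma_matrix A ** matrix_inv V) *v z) \<bullet> z)))) = a"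
    unfolding a_def M_def Sigma_quadratic_form[OF v] ..
  note [measurable] = linear_image_measurable[of M]
  have am: "a \<in> borel_measurable borel" unfolding a_def by measurable
  have ab: "norm (a z) \<le> \<bar>c\<bar>" for z
    unfolding a_def norm_of_real abs_mult abs_exp_cancel by (rule mult_left_le) auto
  have "fun_dist (rep_L2 (Z (abs_L2 f))) g = fun_dist a (wigner g f)" if f: "schwartz f" and g: "schwartz g" for f g
  proof -
    define G where "G = (\<lambda>w::real^('d + 'd). gauss w)"
    have Gpos: "G w > 0" for w by (simp add: G_def)
    have Gi: "integrable lborel G" unfolding G_def by (rule gaussian_integrable)
    have [measurable]: "wigner f g \<in> borel_measurable borel"
      by (intro wigner_measurable schwartz_measurable f g)
    have Wi: "integrable lborel (wigner f g)" by (rule wigner_integrable[OF f g])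
    define K where "K = (\<lambda>w z. complex_of_real (G w) * (wigner f g z * cis (2 * pi * (w \<bullet> (M *v z)))))"
    have Kw: "(LBINT w. K w z) = wigner f g z * complex_of_real (exp (- pi * (norm (M *v z))\<^sup>2))" for z
    proof -
      have "(LBINT w. K w z) = (LBINT w. wigner f g z * (complex_of_real (gauss w) * cis (2 * pi * (w \<bullet> (M *v z)))))"
        unfolding K_def G_def by (simp only: mult.left_commute)
      then show ?thesis by (simp only: integral_mult_right_zero gaussian_fourier)
    qed
    have "fun_dist (rep_L2 (Z (abs_L2 f))) g = cinner_L2 (Z (abs_L2 f)) (abs_L2 g)"
      by (rule fun_dist_rep[OF schwartz_square_integrable[OF g]])
    also have "\<dots> = complex_of_real c * gauss_form (\<lambda>w. pos (shift_of V A w)) (\<lambda>w. freq (shift_of V A w)) (abs_L2 f) (abs_L2 g)"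
      unfolding mp_factorization_gauss_form[OF Z] c_def of_real_prod ..
    also have "gauss_form (\<lambda>w. pos (shift_of V A w)) (\<lambda>w. freq (shift_of V A w)) (abs_L2 f) (abs_L2 g) = (LBINT w. (LBINT z. K w z))"
      unfolding gauss_form_def
    proof (intro lebesgue_cong refl)
      fix w
      have "cinner_L2 (heisL (pos (shift_of V A w)) (freq (shift_of V A w)) (abs_L2 f)) (abs_L2 g) =
        (LBINT z. wigner f g z * cis (2 * pi * (w \<bullet> (M *v z))))"
        using cinner_rho_wigner[OF f g, of "shift_of V A w"]
        unfolding rho_def omega_shift_of[OF mp_projection_covariance(2)[OF U]] M_def minus_minus .
      then show "complex_of_real (gauss w) * cinner_L2 (heisL (pos (shift_of V A w)) (freq (shift_of V A w)) (abs_L2 f)) (abs_L2 g) =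
        (LBINT z. K w z)" by (simp add: K_def G_def)
    qed
    also have "\<dots> = (LBINT z. (LBINT w. K w z))"
    proof (rule integral_swap[where a="\<lambda>w. G w * (LBINT z. norm (wigner f g z))"])
      show "(\<lambda>(w, z). K w z) \<in> borel_measurable (borel \<Otimes>\<^sub>M borel)" unfolding K_def G_def by measurable
      show "integrable lborel (\<lambda>w. G w * (LBINT z. norm (wigner f g z)))" using Gi by simp
      fix w
      show "integrable lborel (K w)"
        unfolding K_def
      proof (intro integrable_mult_right integrable_dominated[OF Wi])
        show "(\<lambda>z. wigner f g z * cis (2 * pi * (w \<bullet> (M *v z)))) \<in> borel_measurable lborel" by measurable
      qed (simp add: norm_mult)
      show "(LBINT z. norm (K w z)) \<le> G w * (LBINT z. norm (wigner f g z))"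
        using Gpos[of w] by (simp add: K_def norm_mult)
    qed
    also have "\<dots> = (LBINT z. wigner f g z * complex_of_real (exp (- pi * (norm (M *v z))\<^sup>2)))"
      by (simp only: Kw)
    also have "complex_of_real c * (LBINT z. wigner f g z * complex_of_real (exp (- pi * (norm (M *v z))\<^sup>2))) =
      (LBINT z. complex_of_real c * (wigner f g z * complex_of_real (exp (- pi * (norm (M *v z))\<^sup>2))))"
      by (rule integral_mult_right_zero[symmetric])
    also have "\<dots> = fun_dist a (wigner g f)"
      unfolding fun_dist_def cnj_wigner a_def of_real_mult by (simp only: mult_ac)
    finally show ?thesis .
  qed
  then have "is_Opw Z (fun_dist a)"
    unfolding is_Opw_def Opw_def using tempered_fun_dist[OF am ab] by blast
  then show ?thesis unfolding a[symmetric] c_def .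
qed

section \<open>Singular values and weights\<close>

lemma gram_inner: "((transpose M ** M) *v v) \<bullet> w = (M *v v) \<bullet> (M *v w)"
  for M :: "real^'n^'m"
  unfolding matrix_vector_mul_assoc[symmetric] by (rule inner_transpose)

text \<open>Eigenvectors of the symmetric matrix \<open>M\<^sup>T M\<close> for distinct eigenvalues are orthogonal, hence independent. Finiteness is
  what gives meaning to the maximum in the definition of the largest singular value.\<close>

lemma finite_singular_values:
  fixes M :: "real^'n^'m"
  shows "finite (singular_values M)"
proof -
  define N where "N = transpose M ** M"
  have sym: "(N *v v) \<bullet> w = (N *v w) \<bullet> v" for v w unfolding N_def gram_inner by (rule inner_commute)
  define E where "E = {\<mu>. \<exists>v. v \<noteq> 0 \<and> N *v v = \<mu> *\<^sub>R v}"
  have "\<forall>\<mu>\<in>E. \<exists>v. v \<noteq> 0 \<and> N *v v = \<mu> *\<^sub>R v" by (simp add: E_def)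
  from bchoice[OF this] obtain e where e: "\<And>\<mu>. \<mu> \<in> E \<Longrightarrow> e \<mu> \<noteq> 0" "\<And>\<mu>. \<mu> \<in> E \<Longrightarrow> N *v e \<mu> = \<mu> *\<^sub>R e \<mu>" by blast
  have orth: "e \<mu> \<bullet> e \<nu> = 0" if "\<mu> \<in> E" "\<nu> \<in> E" "\<mu> \<noteq> \<nu>" for \<mu> \<nu>
  proof -
    have "\<mu> * (e \<mu> \<bullet> e \<nu>) = \<nu> * (e \<mu> \<bullet> e \<nu>)"
      using sym[of "e \<mu>" "e \<nu>"] e(2) that by (simp add: inner_commute)
    then show ?thesis using that(3) by simp
  qed
  have inj: "inj_on e E"
  proof (rule inj_onI, rule ccontr)
    fix \<mu> \<nu> assume h: "\<mu> \<in> E" "\<nu> \<in> E" "e \<mu> = e \<nu>" "\<mu> \<noteq> \<nu>"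
    then show False using orth[of \<mu> \<nu>] e(1)[of \<mu>] by simp
  qed
  have "independent (e ` E)"
    using orth e(1) by (intro pairwise_orthogonal_independent) (force simp: pairwise_def orthogonal_def)+
  then have "finite (e ` E)" using independent_bound by blast
  then have "finite E" using inj by (rule finite_imageD)
  moreover have "singular_values M = sqrt ` E" by (auto simp: singular_values_def E_def N_def)
  ultimately show ?thesis by simp
qed

text \<open>A maximiser of \<open>|M v|\<^sup>2\<close> on the unit sphere is an eigenvector of \<open>M\<^sup>T M\<close>: the quadratic polynomial
  \<open>t \<mapsto> \<mu> |v + t w|\<^sup>2 - |M (v + t w)|\<^sup>2\<close> is non-negative and vanishes at \<open>0\<close>, so its linear coefficient is zero.\<close>

theorem sigma_max_bound:
  fixes M :: "real^'n^'m"
  shows "0 \<le> sigma_max M" and "norm (M *v x) \<le> sigma_max M * norm x"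
proof -
  have "\<exists>v\<in>sphere (0::real^'n) 1. \<forall>w\<in>sphere 0 1. norm (M *v w) \<le> norm (M *v v)"
  proof (rule continuous_attains_sup)
    show "sphere (0::real^'n) 1 \<noteq> {}"
    proof -
      obtain b :: "real^'n" where "b \<in> Basis" using nonempty_Basis by blast
      then have "b \<in> sphere 0 1" by (simp add: norm_Basis)
      then show ?thesis by blast
    qed
    show "continuous_on (sphere 0 1) (\<lambda>v. norm (M *v v))"
      by (intro continuous_intros matrix_vector_mult_linear_continuous_on)
  qed simp
  then obtain v where v: "norm v = 1" and max: "\<And>w. norm w = 1 \<Longrightarrow> norm (M *v w) \<le> norm (M *v v)" by auto
  define m where "m = norm (M *v v)"
  have bound: "norm (M *v w) \<le> m * norm w" for w
  proof (cases "w = 0")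
    case False
    then have "norm (M *v (w /\<^sub>R norm w)) \<le> m" unfolding m_def by (intro max) simp
    then show ?thesis using False by (simp add: matrix_vector_mult_scaleR field_simps)
  qed simp
  have "(M *v v) \<bullet> (M *v w) = m\<^sup>2 * (v \<bullet> w)" for w
  proof -
    define a where "a = m\<^sup>2 * (v \<bullet> w) - (M *v v) \<bullet> (M *v w)"
    define b where "b = m\<^sup>2 * (w \<bullet> w) - (M *v w) \<bullet> (M *v w)"
    have q: "0 \<le> 2 * t * a + t\<^sup>2 * b" for t
    proof -
      have "(norm (M *v (v + t *\<^sub>R w)))\<^sup>2 \<le> (m * norm (v + t *\<^sub>R w))\<^sup>2"
        by (intro power_mono bound) simp
      then have "(M *v (v + t *\<^sub>R w)) \<bullet> (M *v (v + t *\<^sub>R w)) \<le> m\<^sup>2 * ((v + t *\<^sub>R w) \<bullet> (v + t *\<^sub>R w))"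
        by (simp only: power_mult_distrib power2_norm_eq_inner)
      moreover have "v \<bullet> v = 1" "(M *v v) \<bullet> (M *v v) = m\<^sup>2"
        using v by (simp_all add: m_def flip: power2_norm_eq_inner)
      ultimately show ?thesis
        by (simp add: a_def b_def matrix_vector_mult_add_rdistrib matrix_vector_right_distrib matrix_vector_mult_scaleR inner_add_left inner_add_right
            inner_commute[of w v] inner_commute[of "M *v w" "M *v v"] algebra_simps power2_eq_square)
    qed
    have "a = 0"
    proof (rule ccontr)
      assume a: "a \<noteq> 0"
      \<comment> \<open>at \<open>t = - a / B\<close> the polynomial is negative\<close>
      define B where "B = 1 + \<bar>b\<bar>"
      have B: "B > 0" "b < 2 * B" by (auto simp: B_def)
      have "2 * (- a / B) * a + (- a / B)\<^sup>2 * b = (a\<^sup>2 / B\<^sup>2) * (b - 2 * B)"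
        using B(1) by (simp add: field_simps power2_eq_square)
      moreover have "(a\<^sup>2 / B\<^sup>2) * (b - 2 * B) < 0"
        using a B by (intro mult_pos_neg) auto
      ultimately show False using q[of "- a / B"] by linarith
    qed
    then show ?thesis by (simp add: a_def)
  qed
  then have "((transpose M ** M) *v v) \<bullet> w = (m\<^sup>2 *\<^sub>R v) \<bullet> w" for w by (simp add: gram_inner)
  then have "(transpose M ** M) *v v = m\<^sup>2 *\<^sub>R v" using vector_eq_rdot by blast
  moreover have "v \<noteq> 0" using v by auto
  ultimately have "sqrt (m\<^sup>2) \<in> singular_values M" unfolding singular_values_def by blast
  then have "m \<le> sigma_max M"
    unfolding sigma_max_def m_def by (intro Max_ge finite_singular_values) simp
  then show "0 \<le> sigma_max M" "norm (M *v x) \<le> sigma_max M * norm x"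
    using bound[of x] order_trans[OF bound mult_right_mono[of m "sigma_max M" "norm x"]] by (auto simp: m_def intro: order_trans[OF norm_ge_zero])
qed

text \<open>Duality: \<open>|\<zeta>|\<^sup>2 = omega \<zeta> (J \<zeta>)\<close>, and the right-hand side is, up to sign, the inner product of \<open>w\<close> with
  \<open>\<Sigma>\<^sup>1\<^sup>/\<^sup>2 V\<^sup>-\<^sup>1 J \<zeta>\<close>.\<close>

lemma norm_shift_of_le:
  fixes V :: "real^('d::finite + 'd)^('d + 'd)"
  assumes V: "\<And>z w. omega (V *v z) (V *v w) = omega z w"
  shows "norm (shift_of V A w) \<le> sigma_max (sqrt_Sigma_matrix A ** matrix_inv V) * norm w"
proof -
  define \<zeta> where "\<zeta> = shift_of V A w"
  define \<sigma> where "\<sigma> = sigma_max (sqrt_Sigma_matrix A ** matrix_inv V)"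
  have n: "norm (sympl_rot \<zeta>) = norm \<zeta>"
    by (simp add: norm_eq_sqrt_inner inner_phase sympl_rot_def pos_join freq_join)
  have "norm \<zeta> * norm \<zeta> = omega \<zeta> (sympl_rot \<zeta>)"
    unfolding power2_eq_square[symmetric] power2_norm_eq_inner inner_phase
    by (simp add: omega_def sympl_rot_def pos_join freq_join)
  also have "\<dots> = - (w \<bullet> ((sqrt_Sigma_matrix A ** matrix_inv V) *v sympl_rot \<zeta>))"
    unfolding \<zeta>_def by (rule omega_shift_of[OF V])
  also have "\<dots> \<le> norm w * norm ((sqrt_Sigma_matrix A ** matrix_inv V) *v sympl_rot \<zeta>)"
    using Cauchy_Schwarz_ineq2[of w "(sqrt_Sigma_matrix A ** matrix_inv V) *v sympl_rot \<zeta>"] by linarith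
  also have "\<dots> \<le> norm w * (\<sigma> * norm (sympl_rot \<zeta>))"
    unfolding \<sigma>_def by (intro mult_left_mono sigma_max_bound) simp
  finally have "norm \<zeta> * norm \<zeta> \<le> (\<sigma> * norm w) * norm \<zeta>" by (simp add: n mult_ac)
  moreover have "0 \<le> \<sigma> * norm w" unfolding \<sigma>_def by (intro mult_nonneg_nonneg sigma_max_bound) simp
  ultimately show ?thesis
    unfolding \<zeta>_def[symmetric] \<sigma>_def[symmetric]
    using mult_le_cancel_right_pos[of "norm \<zeta>" "norm \<zeta>" "\<sigma> * norm w"] by (cases "\<zeta> = 0") auto
qed

lemma v_weight_pos: "v_weight s z > 0"
  using add_pos_nonneg[OF zero_less_one zero_le_power2[of "norm z"]] by (simp add: v_weight_def)

lemma v_weight_measurable [measurable]: "v_weight s \<in> borel_measurable borel"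
  unfolding v_weight_def[abs_def] by measurable

lemma v_weight_peetre:
  assumes "0 \<le> s"
  shows "v_weight s z \<le> 2 powr (s / 2) * (v_weight s (z + \<zeta>) * v_weight s \<zeta>)"
proof -
  have "norm z \<le> norm (z + \<zeta>) + norm \<zeta>" using norm_triangle_ineq4[of "z + \<zeta>" \<zeta>] by simp
  then have "(norm z)\<^sup>2 \<le> (norm (z + \<zeta>) + norm \<zeta>)\<^sup>2" by (rule power_mono) simp
  also have "\<dots> \<le> 2 * (norm (z + \<zeta>))\<^sup>2 + 2 * (norm \<zeta>)\<^sup>2"
    using sum_squares_bound[of "norm (z + \<zeta>)" "norm \<zeta>"] by (simp add: power2_sum)
  finally have zb: "(norm z)\<^sup>2 \<le> 2 * (norm (z + \<zeta>))\<^sup>2 + 2 * (norm \<zeta>)\<^sup>2" .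
  have "1 + (norm z)\<^sup>2 \<le> 2 * ((1 + (norm (z + \<zeta>))\<^sup>2) * (1 + (norm \<zeta>)\<^sup>2))"
  proof -
    have "2 * ((1 + (norm (z + \<zeta>))\<^sup>2) * (1 + (norm \<zeta>)\<^sup>2)) =
      2 + 2 * (norm (z + \<zeta>))\<^sup>2 + 2 * (norm \<zeta>)\<^sup>2 + 2 * ((norm (z + \<zeta>))\<^sup>2 * (norm \<zeta>)\<^sup>2)"
      by (simp add: algebra_simps)
    moreover have "0 \<le> (norm (z + \<zeta>))\<^sup>2 * (norm \<zeta>)\<^sup>2" by (intro mult_nonneg_nonneg zero_le_power2)
    ultimately show ?thesis using zb by linarith
  qed
  then have "v_weight s z \<le> (2 * ((1 + (norm (z + \<zeta>))\<^sup>2) * (1 + (norm \<zeta>)\<^sup>2))) powr (s / 2)"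
    unfolding v_weight_def using assms by (intro powr_mono2) auto
  also have "\<dots> = 2 powr (s / 2) * (v_weight s (z + \<zeta>) * v_weight s \<zeta>)"
    by (simp add: v_weight_def powr_mult)
  finally show ?thesis .
qed

lemma v_weight_scale:
  assumes "0 \<le> s" "0 \<le> \<sigma>" "norm \<zeta> \<le> \<sigma> * norm w"
  shows "v_weight s \<zeta> \<le> (1 + \<sigma>\<^sup>2) powr (s / 2) * v_weight s w"
proof -
  have "(norm \<zeta>)\<^sup>2 \<le> (\<sigma> * norm w)\<^sup>2" using assms(3) by (rule power_mono) simp
  then have "1 + (norm \<zeta>)\<^sup>2 \<le> (1 + \<sigma>\<^sup>2) * (1 + (norm w)\<^sup>2)"
    by (simp add: power_mult_distrib distrib_left distrib_right add_increasing)
  then have "v_weight s \<zeta> \<le> ((1 + \<sigma>\<^sup>2) * (1 + (norm w)\<^sup>2)) powr (s / 2)"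
    unfolding v_weight_def using assms(1) by (intro powr_mono2) auto
  then show ?thesis by (simp add: v_weight_def powr_mult)
qed

lemma v_weight_gaussian_integrable:
  assumes s: "0 \<le> s"
  shows "integrable lborel (\<lambda>w::'w::euclidean_space. gauss w * v_weight s w)"
proof (rule integrable_dominated)
  define K where "K = nat \<lceil>s\<rceil>"
  show "integrable lborel (\<lambda>w::'w. gauss w * (1 + norm w) ^ K)" by (rule gaussian_poly_integrable)
  have le: "gauss w * v_weight s w \<le> gauss w * (1 + norm w) ^ K" for w :: 'w
  proof (rule mult_left_mono)
    have "1 + (norm w)\<^sup>2 \<le> (1 + norm w)\<^sup>2" by (simp add: power2_sum)
    then have "v_weight s w \<le> ((1 + norm w)\<^sup>2) powr (s / 2)"
      unfolding v_weight_def using s by (intro powr_mono2) auto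
    also have "\<dots> = ((1 + norm w) powr 2) powr (s / 2)"
      using powr_realpow[of "1 + norm w" 2] by (simp add: add_pos_nonneg)
    also have "\<dots> = (1 + norm w) powr s" unfolding powr_powr by simp
    also have "\<dots> \<le> (1 + norm w) powr real K" using s unfolding K_def by (intro powr_mono) (auto simp: of_nat_nat)
    also have "\<dots> = (1 + norm w) ^ K" by (intro powr_realpow add_pos_nonneg) auto
    finally show "v_weight s w \<le> (1 + norm w) ^ K" .
  qed simp
  then show "AE w::'w in lborel. norm (gauss w * v_weight s w) \<le> norm (gauss w * (1 + norm w) ^ K)"
    by (intro AE_I2) (simp add: abs_mult abs_of_pos v_weight_pos)
qed measurable

lemma norm_phase_pair: "norm (pos \<zeta>, freq \<zeta>) = norm \<zeta>"
  by (simp add: norm_eq_sqrt_inner inner_phase)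

lemma v_weight_pair: "v_weight s (pos \<zeta>, freq \<zeta>) = v_weight s \<zeta>"
  by (simp add: v_weight_def norm_phase_pair)

section \<open>Minkowski's integral inequality\<close>

lemma ennreal_powr_ennreal: "0 \<le> x \<Longrightarrow> ennreal_powr (ennreal x) r = ennreal (x powr r)"
  by (simp add: ennreal_powr_def)

lemma ennreal_powr_top [simp]: "ennreal_powr top r = top"
  by (simp add: ennreal_powr_def)

lemma ennreal_powr_0 [simp]: "ennreal_powr 0 r = 0"
  by (simp add: ennreal_powr_def)

lemma ennreal_powr_1 [simp]: "ennreal_powr 1 r = 1"
  by (simp add: ennreal_powr_def)

lemma ennreal_powr_mono:
  assumes "a \<le> b" "0 \<le> r" shows "ennreal_powr a r \<le> ennreal_powr b r"
proof (cases a)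
  case (real x)
  show ?thesis
  proof (cases b)
    case (real y)
    with assms \<open>a = ennreal x\<close> \<open>0 \<le> x\<close> show ?thesis by (simp add: ennreal_powr_ennreal powr_mono2)
  qed simp
next
  case top
  with assms show ?thesis by (simp add: top_unique)
qed

lemma ennreal_powr_mult:
  assumes "0 < r" shows "ennreal_powr (a * b) r = ennreal_powr a r * ennreal_powr b r"
proof (cases a)
  case a: (real x)
  show ?thesis
  proof (cases b)
    case (real y)
    with a show ?thesis by (simp add: ennreal_powr_ennreal powr_mult flip: ennreal_mult)
  next
    case top
    with a assms show ?thesis by (cases "x = 0") (simp_all add: ennreal_mult_top ennreal_powr_ennreal)
  qed
next
  case a: top
  show ?thesis
  proof (cases b)
    case (real y)
    with a assms show ?thesis by (cases "y = 0") (simp_all add: ennreal_top_mult ennreal_powr_ennreal)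
  qed (use a in simp)
qed

lemma ennreal_powr_inverse:
  assumes "0 < r" shows "ennreal_powr (ennreal_powr a r) (1 / r) = a" and "ennreal_powr (ennreal_powr a (1 / r)) r = a"
  using assms by (cases a; simp add: ennreal_powr_ennreal powr_powr)+

lemma ennreal_powr_measurable [measurable]:
  assumes [measurable]: "f \<in> borel_measurable M"
  shows "(\<lambda>x. ennreal_powr (f x) r) \<in> borel_measurable M"
  unfolding ennreal_powr_def by measurable

text \<open>The graph of \<open>h \<mapsto> h\<^sup>p\<close> lies above its tangent at \<open>a\<close>, written so as to make sense for \<open>a = 0\<close>; it is Young's
  inequality for \<open>a\<^sup>p\<close> and \<open>h\<^sup>p\<close>.\<close>

lemma powr_tangent:
  fixes a h p :: real
  assumes p: "1 \<le> p" and a: "0 \<le> a" and h: "0 \<le> h"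
  shows "p * (a powr (p - 1) * h) \<le> h powr p + (p - 1) * a powr p"
proof (cases "a = 0 \<or> h = 0")
  case True
  with p show ?thesis by auto
next
  case False
  then have pos: "a > 0" "h > 0" using a h by auto
  have "a powr (p - 1) * h = (a powr p) powr (1 - 1 / p) * (h powr p) powr (1 / p)"
  proof -
    have "p * (1 - 1 / p) = p - 1" "p * (1 / p) = 1" using p by (simp_all add: field_simps)
    then show ?thesis unfolding powr_powr using pos by simp
  qed
  also have "\<dots> \<le> (1 - 1 / p) * a powr p + (1 / p) * h powr p"
    using p pos by (intro Youngs_inequality_0) auto
  finally have "p * (a powr (p - 1) * h) \<le> p * ((1 - 1 / p) * a powr p + (1 / p) * h powr p)"
    using p by (intro mult_left_mono) auto
  also have "\<dots> = h powr p + (p - 1) * a powr p" using p by (simp add: field_simps)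
  finally show ?thesis .
qed

text \<open>Jensen's inequality for \<open>t \<mapsto> t\<^sup>p\<close>, by integrating the tangent line inequality at the mean.\<close>

lemma ennreal_powr_jensen:
  assumes \<nu>: "emeasure \<nu> (space \<nu>) = 1" and [measurable]: "h \<in> borel_measurable \<nu>" and p: "1 \<le> p"
  shows "ennreal_powr (\<integral>\<^sup>+w. h w \<partial>\<nu>) p \<le> (\<integral>\<^sup>+w. ennreal_powr (h w) p \<partial>\<nu>)"
proof -
  define m where "m = (\<integral>\<^sup>+w. h w \<partial>\<nu>)"
  define J where "J = (\<integral>\<^sup>+w. ennreal_powr (h w) p \<partial>\<nu>)"
  have tangent: "ennreal (p * a powr (p - 1)) * m \<le> J + ennreal ((p - 1) * a powr p)" if a: "0 \<le> a" for a
  proof -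
    have "ennreal (p * a powr (p - 1)) * m = (\<integral>\<^sup>+w. ennreal (p * a powr (p - 1)) * h w \<partial>\<nu>)"
      unfolding m_def by (rule nn_integral_cmult[symmetric]) measurable
    also have "\<dots> \<le> (\<integral>\<^sup>+w. ennreal_powr (h w) p + ennreal ((p - 1) * a powr p) \<partial>\<nu>)"
    proof (rule nn_integral_mono)
      fix w
      show "ennreal (p * a powr (p - 1)) * h w \<le> ennreal_powr (h w) p + ennreal ((p - 1) * a powr p)"
      proof (cases "h w")
        case (real x)
        then show ?thesis using powr_tangent[OF p a, of x] p
          by (simp add: ennreal_powr_ennreal mult.assoc flip: ennreal_mult ennreal_plus)
      qed simp
    qed
    also have "\<dots> = J + (\<integral>\<^sup>+w. ennreal ((p - 1) * a powr p) \<partial>\<nu>)"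
      unfolding J_def by (rule nn_integral_add) measurable
    also have "(\<integral>\<^sup>+w. ennreal ((p - 1) * a powr p) \<partial>\<nu>) = ennreal ((p - 1) * a powr p)" using \<nu> by simp
    finally show ?thesis .
  qed
  show ?thesis
    unfolding m_def[symmetric] J_def[symmetric]
  proof (cases m)
    case (real x)
    show "ennreal_powr m p \<le> J"
    proof (cases J)
      case J: (real j)
      have xx: "x powr (p - 1) * x = x powr p" using real(1) powr_mult_base[of x "p - 1"] by (simp add: mult.commute)
      have "ennreal (p * x powr p) \<le> ennreal (j + (p - 1) * x powr p)"
        using tangent[of x] real J p by (simp add: xx mult.assoc flip: ennreal_mult ennreal_plus)
      then have "p * x powr p \<le> j + (p - 1) * x powr p"
        using J p by (subst (asm) ennreal_le_iff) auto
      then have "x powr p \<le> j" by (simp add: algebra_simps)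
      with real J show ?thesis by (simp add: ennreal_powr_ennreal)
    qed simp
  next
    case top
    with tangent[of 1] p have "J = top" by (simp add: ennreal_mult_top top_unique)
    then show "ennreal_powr m p \<le> J" by simp
  qed
qed

lemma Lp_norm_finite:
  assumes p: "1 \<le> p" "p \<noteq> \<infinity>"
  obtains r where "1 \<le> r" "\<And>F. Lp_norm p F = ennreal_powr (\<integral>\<^sup>+x. ennreal_powr (F x) r \<partial>lborel) (1 / r)"
proof (rule that[of "enn2real p"])
  show "1 \<le> enn2real p" using p by (cases p) auto
  show "Lp_norm p F = ennreal_powr (\<integral>\<^sup>+x. ennreal_powr (F x) (enn2real p) \<partial>lborel) (1 / enn2real p)" for F :: "'a \<Rightarrow> ennreal"
    using p by (simp add: Lp_norm_def)
qed

lemma Lp_norm_mono: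
  assumes p: "1 \<le> p" and F: "F \<in> borel_measurable borel" and le: "\<And>x. F x \<le> G x"
  shows "Lp_norm p F \<le> Lp_norm p G"
proof (cases "p = \<infinity>")
  case True
  then show ?thesis using F le by (simp add: Lp_norm_def esssup_mono)
next
  case False
  from p False obtain r where r: "1 \<le> r" "\<And>F :: 'a \<Rightarrow> ennreal. Lp_norm p F = ennreal_powr (\<integral>\<^sup>+x. ennreal_powr (F x) r \<partial>lborel) (1 / r)"
    by (rule Lp_norm_finite) (rule that)
  show ?thesis unfolding r(2) using r(1) by (intro ennreal_powr_mono nn_integral_mono le) auto
qed

lemma Lp_norm_translate_le:
  fixes F :: "'a::euclidean_space \<Rightarrow> ennreal"
  assumes p: "1 \<le> p" and F: "F \<in> borel_measurable borel"
  shows "Lp_norm p (\<lambda>x. F (x + t)) \<le> Lp_norm p F"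
proof (cases "p = \<infinity>")
  case True
  have m: "(\<lambda>x. F (x + t)) \<in> borel_measurable lborel"
    using measurable_compose[OF _ F, of "\<lambda>x. x + t" borel] by simp
  have "AE x in lborel. F (x + t) \<le> esssup lborel F"
    using AE_translate[OF esssup_AE[where M=lborel and f=F]] by simp
  then show ?thesis using True m by (simp add: Lp_norm_def esssup_I)
next
  case False
  from p False obtain r where r: "1 \<le> r" "\<And>F :: 'a \<Rightarrow> ennreal. Lp_norm p F = ennreal_powr (\<integral>\<^sup>+x. ennreal_powr (F x) r \<partial>lborel) (1 / r)"
    by (rule Lp_norm_finite) (rule that)
  have "(\<lambda>x. ennreal_powr (F x) r) \<in> borel_measurable borel" using F by measurable
  from nn_integral_translate[OF this, of t] show ?thesis unfolding r(2) by simp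
qed

text \<open>For \<open>p = \<infinity>\<close> the norm exceeds \<open>c\<close> exactly where the measure of the set on which \<open>K w\<close> exceeds \<open>c\<close> is not zero, and that
  measure depends measurably on \<open>w\<close>.\<close>

lemma Lp_norm_measurable:
  fixes K :: "'w::euclidean_space \<Rightarrow> 'a::euclidean_space \<Rightarrow> ennreal"
  assumes p: "1 \<le> p" and K [measurable]: "(\<lambda>(w, x). K w x) \<in> borel_measurable (borel \<Otimes>\<^sub>M borel)"
  shows "(\<lambda>w. Lp_norm p (K w)) \<in> borel_measurable borel"
proof (cases "p = \<infinity>")
  case True
  have Kw [measurable]: "K w \<in> borel_measurable borel" for w using measurable_Pair2[OF K, of w] by simp
  show ?thesis
  proof (rule borel_measurableI_greater)
    fix c
    have Q: "{q \<in> space (borel \<Otimes>\<^sub>M lborel). c < (case q of (w, x) \<Rightarrow> K w x)} \<in> sets (borel \<Otimes>\<^sub>M lborel)"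
      by measurable
    have eq: "c < Lp_norm p (K w) \<longleftrightarrow> emeasure lborel (Pair w -` {q \<in> space (borel \<Otimes>\<^sub>M lborel). c < (case q of (w, x) \<Rightarrow> K w x)}) \<noteq> 0" for w
    proof -
      have s: "Pair w -` {q \<in> space (borel \<Otimes>\<^sub>M lborel). c < (case q of (w, x) \<Rightarrow> K w x)} = {x \<in> space lborel. c < K w x}"
        by (auto simp: space_pair_measure)
      have "emeasure lborel {x \<in> space lborel. c < K w x} = 0 \<longleftrightarrow> (AE x in lborel. K w x \<le> c)"
        by (subst AE_iff_measurable[OF _ refl]) (auto simp: not_le)
      also have "\<dots> \<longleftrightarrow> esssup lborel (K w) \<le> c"
      proof
        assume "AE x in lborel. K w x \<le> c" then show "esssup lborel (K w) \<le> c" by (intro esssup_I) auto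
      next
        assume c: "esssup lborel (K w) \<le> c"
        show "AE x in lborel. K w x \<le> c"
          using esssup_AE[where M=lborel and f="K w"] by eventually_elim (rule order_trans[OF _ c])
      qed
      finally show ?thesis unfolding s using True by (simp add: Lp_norm_def not_le[symmetric])
    qed
    show "{w \<in> space borel. c < Lp_norm p (K w)} \<in> sets borel"
      unfolding eq using lborel.measurable_emeasure_Pair[OF Q] by measurable
  qed
next
  case False
  from p False obtain r where r: "1 \<le> r" "\<And>F :: 'a \<Rightarrow> ennreal. Lp_norm p F = ennreal_powr (\<integral>\<^sup>+x. ennreal_powr (F x) r \<partial>lborel) (1 / r)"
    by (rule Lp_norm_finite) (rule that)
  have [measurable]: "(\<lambda>(w, x). K w x) \<in> borel_measurable (borel \<Otimes>\<^sub>M lborel)" using K by simp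
  show ?thesis unfolding r(2) by measurable
qed

text \<open>The integral of a family of norms is first replaced by the integral of a strictly positive majorant
  \<open>\<psi>\<close> of these norms; dividing \<open>K w\<close> by \<open>\<psi> w\<close> turns the inequality into Jensen's inequality for the
  probability density \<open>\<psi> / \<integral>\<psi>\<close>.\<close>

lemma minkowski_majorant:
  fixes K :: "'w::euclidean_space \<Rightarrow> 'a::euclidean_space \<Rightarrow> ennreal"
  assumes r: "1 \<le> r" and \<mu>: "finite_measure \<mu>" and s: "sets \<mu> = sets borel"
    and K [measurable]: "(\<lambda>(w, x). K w x) \<in> borel_measurable (borel \<Otimes>\<^sub>M borel)"
    and \<psi>m [measurable]: "\<psi> \<in> borel_measurable borel" and \<psi>0: "\<And>w. \<psi> w > 0" and fin: "(\<integral>\<^sup>+w. \<psi> w \<partial>\<mu>) < \<infinity>"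
    and le: "\<And>w. (\<integral>\<^sup>+x. ennreal_powr (K w x) r \<partial>lborel) \<le> ennreal_powr (\<psi> w) r"
  shows "(\<integral>\<^sup>+x. ennreal_powr (\<integral>\<^sup>+w. K w x \<partial>\<mu>) r \<partial>lborel) \<le> ennreal_powr (\<integral>\<^sup>+w. \<psi> w \<partial>\<mu>) r"
proof -
  interpret \<mu>: finite_measure \<mu> by (rule \<mu>)
  have meq: "measurable \<mu> N = measurable borel N" for N :: "ennreal measure" by (rule measurable_cong_sets[OF s refl])
  define \<Psi> where "\<Psi> = (\<integral>\<^sup>+w. \<psi> w \<partial>\<mu>)"
  have Kx: "(\<lambda>w. K w x) \<in> borel_measurable \<mu>" for x
    unfolding meq using measurable_Pair1[OF K, of x] by simp
  have Kw: "K w \<in> borel_measurable borel" for w using measurable_Pair2[OF K, of w] by simp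
  have \<psi>\<mu> [measurable]: "\<psi> \<in> borel_measurable \<mu>" unfolding meq by (rule \<psi>m)
  show ?thesis
  proof (cases "\<Psi> = 0")
    case True
    then have "AE w in \<mu>. \<psi> w = 0" unfolding \<Psi>_def by (simp add: nn_integral_0_iff_AE)
    then have F: "AE w in \<mu>. False" by eventually_elim (use \<psi>0 in \<open>metis less_irrefl\<close>)
    have "(\<integral>\<^sup>+w. K w x \<partial>\<mu>) = 0" for x
      unfolding nn_integral_0_iff_AE[OF Kx] using F by eventually_elim simp
    then show ?thesis by simp
  next
    case False
    have \<Psi>: "\<Psi> \<noteq> top" using fin unfolding \<Psi>_def by simp
    define \<nu> where "\<nu> = density \<mu> (\<lambda>w. \<psi> w / \<Psi>)"
    have dm: "(\<lambda>w. \<psi> w / \<Psi>) \<in> borel_measurable \<mu>" by measurable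
    have \<nu>1: "emeasure \<nu> (space \<nu>) = 1"
    proof -
      have "emeasure \<nu> (space \<nu>) = (\<integral>\<^sup>+w. \<psi> w / \<Psi> * indicator (space \<mu>) w \<partial>\<mu>)"
        unfolding \<nu>_def using dm by (simp add: emeasure_density)
      also have "\<dots> = (\<integral>\<^sup>+w. \<psi> w / \<Psi> \<partial>\<mu>)" by (rule nn_integral_cong) simp
      also have "\<dots> = \<Psi> / \<Psi>" unfolding \<Psi>_def by (rule nn_integral_divide) measurable
      finally show ?thesis using False \<Psi> by (simp add: ennreal_divide_self less_top)
    qed
    have s\<nu>: "sets \<nu> = sets borel" unfolding \<nu>_def by (simp add: s)
    have meq\<nu>: "measurable \<nu> N = measurable borel N" for N :: "ennreal measure" by (rule measurable_cong_sets[OF s\<nu> refl])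
    interpret \<nu>: finite_measure \<nu> by (rule finite_measureI) (simp add: \<nu>1)
    interpret pair_sigma_finite \<nu> "lborel :: 'a measure" ..
    define k where "k = (\<lambda>w x. K w x / \<psi> w)"
    have km [measurable]: "(\<lambda>(w, x). k w x) \<in> borel_measurable (borel \<Otimes>\<^sub>M borel)" unfolding k_def by measurable
    have kx: "(\<lambda>w. k w x) \<in> borel_measurable \<nu>" for x
      unfolding meq\<nu> using measurable_Pair1[OF km, of x] by simp
    have AEfin: "AE w in \<mu>. \<psi> w \<noteq> top"
      using nn_integral_PInf_AE[OF \<psi>\<mu>] \<Psi> unfolding \<Psi>_def by simp
    have H: "(\<integral>\<^sup>+w. K w x \<partial>\<mu>) = \<Psi> * (\<integral>\<^sup>+w. k w x \<partial>\<nu>)" for x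
    proof -
      have "\<Psi> * (\<integral>\<^sup>+w. k w x \<partial>\<nu>) = (\<integral>\<^sup>+w. \<Psi> * (\<psi> w / \<Psi> * k w x) \<partial>\<mu>)"
        unfolding \<nu>_def using kx[of x, unfolded meq\<nu>, folded meq] dm
        by (subst nn_integral_density) (auto simp: nn_integral_cmult)
      also have "\<dots> = (\<integral>\<^sup>+w. K w x \<partial>\<mu>)"
      proof (rule nn_integral_cong_AE)
        show "AE w in \<mu>. \<Psi> * (\<psi> w / \<Psi> * k w x) = K w x"
          using AEfin
        proof eventually_elim
          fix w assume w: "\<psi> w \<noteq> top"
          have "\<Psi> * (\<psi> w / \<Psi> * k w x) = (\<Psi> * inverse \<Psi>) * ((\<psi> w * inverse (\<psi> w)) * K w x)"
            by (simp add: k_def divide_ennreal_def mult_ac)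
          moreover have "\<psi> w \<noteq> 0" using \<psi>0[of w] by auto
          ultimately show "\<Psi> * (\<psi> w / \<Psi> * k w x) = K w x"
            using ennreal_divide_self[of \<Psi>] ennreal_divide_self[of "\<psi> w"] w False \<Psi>
            by (simp add: divide_ennreal_def less_top)
        qed
      qed
      finally show ?thesis ..
    qed
    have "(\<integral>\<^sup>+x. ennreal_powr (\<integral>\<^sup>+w. K w x \<partial>\<mu>) r \<partial>lborel) \<le> (\<integral>\<^sup>+x. ennreal_powr \<Psi> r * (\<integral>\<^sup>+w. ennreal_powr (k w x) r \<partial>\<nu>) \<partial>lborel)"
      unfolding H using r by (simp add: ennreal_powr_mult) (intro nn_integral_mono mult_left_mono ennreal_powr_jensen \<nu>1 kx; simp)
    also have "\<dots> = ennreal_powr \<Psi> r * (\<integral>\<^sup>+x. (\<integral>\<^sup>+w. ennreal_powr (k w x) r \<partial>\<nu>) \<partial>lborel)"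
    proof (rule nn_integral_cmult)
      have "(\<lambda>(x, w). ennreal_powr (k w x) r) \<in> borel_measurable (lborel \<Otimes>\<^sub>M \<nu>)"
        unfolding measurable_cong_sets[OF sets_pair_measure_cong[OF sets_lborel s\<nu>] refl] by measurable
      then show "(\<lambda>x. \<integral>\<^sup>+w. ennreal_powr (k w x) r \<partial>\<nu>) \<in> borel_measurable lborel" by (rule \<nu>.borel_measurable_nn_integral)
    qed
    also have "(\<integral>\<^sup>+x. (\<integral>\<^sup>+w. ennreal_powr (k w x) r \<partial>\<nu>) \<partial>lborel) = (\<integral>\<^sup>+w. (\<integral>\<^sup>+x. ennreal_powr (k w x) r \<partial>lborel) \<partial>\<nu>)"
    proof (rule Fubini')
      show "(\<lambda>(w, x). ennreal_powr (k w x) r) \<in> borel_measurable (\<nu> \<Otimes>\<^sub>M lborel)"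
        unfolding measurable_cong_sets[OF sets_pair_measure_cong[OF s\<nu> sets_lborel] refl] by measurable
    qed
    also have "\<dots> \<le> (\<integral>\<^sup>+w. 1 \<partial>\<nu>)"
    proof (rule nn_integral_mono)
      fix w
      have "(\<integral>\<^sup>+x. ennreal_powr (k w x) r \<partial>lborel) = (\<integral>\<^sup>+x. ennreal_powr (inverse (\<psi> w)) r * ennreal_powr (K w x) r \<partial>lborel)"
        using r by (simp add: k_def divide_ennreal_def ennreal_powr_mult mult.commute)
      also have "\<dots> = ennreal_powr (inverse (\<psi> w)) r * (\<integral>\<^sup>+x. ennreal_powr (K w x) r \<partial>lborel)"
        using Kw[of w] by (intro nn_integral_cmult) measurable
      also have "\<dots> \<le> ennreal_powr (inverse (\<psi> w)) r * ennreal_powr (\<psi> w) r"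
        by (intro mult_left_mono le) simp
      also have "\<dots> = ennreal_powr (inverse (\<psi> w) * \<psi> w) r" using r by (simp add: ennreal_powr_mult)
      also have "\<dots> \<le> ennreal_powr 1 r"
      proof (rule ennreal_powr_mono)
        show "inverse (\<psi> w) * \<psi> w \<le> 1"
          using ennreal_divide_self[of "\<psi> w"] \<psi>0[of w]
          by (cases "\<psi> w = top") (auto simp: divide_ennreal_def mult.commute less_top)
      qed (use r in simp)
      finally show "(\<integral>\<^sup>+x. ennreal_powr (k w x) r \<partial>lborel) \<le> 1" by simp
    qed
    finally show ?thesis unfolding \<Psi>_def[symmetric] by (simp add: \<nu>1 mult_left_mono)
  qed
qed

text \<open>For finite \<open>p\<close> the majorants \<open>\<psi> = \<phi> + \<epsilon>\<close> of the norms \<open>\<phi>\<close> are admissible because the measure is finite, and \<open>\<epsilon>\<close> tends to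
  zero. For \<open>p = \<infinity>\<close> the bound holds almost everywhere in each fibre, and Tonelli exchanges the quantifiers.\<close>

theorem minkowski_integral_inequality:
  fixes K :: "'w::euclidean_space \<Rightarrow> 'a::euclidean_space \<Rightarrow> ennreal"
  assumes p: "1 \<le> p" and \<mu>: "finite_measure \<mu>" and s: "sets \<mu> = sets borel"
    and K [measurable]: "(\<lambda>(w, x). K w x) \<in> borel_measurable (borel \<Otimes>\<^sub>M borel)"
  shows "Lp_norm p (\<lambda>x. \<integral>\<^sup>+w. K w x \<partial>\<mu>) \<le> (\<integral>\<^sup>+w. Lp_norm p (K w) \<partial>\<mu>)"
proof -
  interpret \<mu>: finite_measure \<mu> by (rule \<mu>)
  interpret pair_sigma_finite \<mu> "lborel :: 'a measure" ..
  have meq: "measurable \<mu> N = measurable borel N" for N :: "ennreal measure" by (rule measurable_cong_sets[OF s refl])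
  define \<phi> where "\<phi> = (\<lambda>w. Lp_norm p (K w))"
  have \<phi>m [measurable]: "\<phi> \<in> borel_measurable borel" unfolding \<phi>_def by (rule Lp_norm_measurable[OF p K])
  have \<phi>\<mu>: "\<phi> \<in> borel_measurable \<mu>" unfolding meq by (rule \<phi>m)
  have "Lp_norm p (\<lambda>x. \<integral>\<^sup>+w. K w x \<partial>\<mu>) \<le> (\<integral>\<^sup>+w. \<phi> w \<partial>\<mu>)"
  proof (cases "p = \<infinity>")
    case True
    have Km: "(\<lambda>(x, w). K w x) \<in> borel_measurable (lborel \<Otimes>\<^sub>M \<mu>)"
      unfolding measurable_cong_sets[OF sets_pair_measure_cong[OF sets_lborel s] refl] by measurable
    have "AE w in \<mu>. AE x in lborel. K w x \<le> \<phi> w"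
    proof (rule AE_I2)
      show "AE x in lborel. K w x \<le> \<phi> w" for w
        using True esssup_AE[where M=lborel and f="K w"] by (simp add: \<phi>_def Lp_norm_def)
    qed
    moreover have "{q \<in> space (\<mu> \<Otimes>\<^sub>M lborel). K (fst q) (snd q) \<le> \<phi> (fst q)} \<in> sets (\<mu> \<Otimes>\<^sub>M lborel)"
    proof -
      have "(\<lambda>q. K (fst q) (snd q)) \<in> borel_measurable (\<mu> \<Otimes>\<^sub>M lborel)" "(\<lambda>q. \<phi> (fst q)) \<in> borel_measurable (\<mu> \<Otimes>\<^sub>M (lborel :: 'a measure))"
        unfolding measurable_cong_sets[OF sets_pair_measure_cong[OF s sets_lborel] refl] by measurable
      then show ?thesis by measurable
    qed
    ultimately have "AE x in lborel. AE w in \<mu>. K w x \<le> \<phi> w"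
      using AE_commute[of "\<lambda>w x. K w x \<le> \<phi> w"] by simp
    then have "AE x in lborel. (\<integral>\<^sup>+w. K w x \<partial>\<mu>) \<le> (\<integral>\<^sup>+w. \<phi> w \<partial>\<mu>)"
      by eventually_elim (rule nn_integral_mono_AE)
    moreover have "(\<lambda>x. \<integral>\<^sup>+w. K w x \<partial>\<mu>) \<in> borel_measurable lborel"
      using Km by (rule \<mu>.borel_measurable_nn_integral)
    ultimately show ?thesis using True by (simp add: Lp_norm_def esssup_I)
  next
    case False
    from p False obtain r where r: "1 \<le> r" "\<And>F :: 'a \<Rightarrow> ennreal. Lp_norm p F = ennreal_powr (\<integral>\<^sup>+x. ennreal_powr (F x) r \<partial>lborel) (1 / r)"
      by (rule Lp_norm_finite) (rule that)
    show ?thesis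
    proof (rule ennreal_le_epsilon)
      fix e :: real assume e: "0 < e" and fin: "(\<integral>\<^sup>+w. \<phi> w \<partial>\<mu>) < top"
      define m where "m = measure \<mu> (space \<mu>)"
      \<comment> \<open>so that adding \<open>\<epsilon>\<close> increases the integral by \<open>\<epsilon> m \<le> e\<close>\<close>
      define \<epsilon> where "\<epsilon> = e / (1 + m)"
      have m: "0 \<le> m" by (simp add: m_def)
      then have \<epsilon>: "0 < \<epsilon>" using e by (simp add: \<epsilon>_def add_pos_nonneg)
      define \<psi> where "\<psi> = (\<lambda>w. \<phi> w + ennreal \<epsilon>)"
      have "(\<integral>\<^sup>+w. \<psi> w \<partial>\<mu>) = (\<integral>\<^sup>+w. \<phi> w \<partial>\<mu>) + (\<integral>\<^sup>+w. ennreal \<epsilon> \<partial>\<mu>)"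
        unfolding \<psi>_def by (rule nn_integral_add[OF \<phi>\<mu>]) simp
      also have "(\<integral>\<^sup>+w. ennreal \<epsilon> \<partial>\<mu>) = ennreal (\<epsilon> * m)"
        using \<epsilon> m by (simp add: \<mu>.emeasure_eq_measure m_def ennreal_mult)
      finally have \<psi>i: "(\<integral>\<^sup>+w. \<psi> w \<partial>\<mu>) = (\<integral>\<^sup>+w. \<phi> w \<partial>\<mu>) + ennreal (\<epsilon> * m)" .
      have em: "\<epsilon> * m \<le> e"
        using e m by (simp add: \<epsilon>_def field_simps)
      have "(\<integral>\<^sup>+x. ennreal_powr (\<integral>\<^sup>+w. K w x \<partial>\<mu>) r \<partial>lborel) \<le> ennreal_powr (\<integral>\<^sup>+w. \<psi> w \<partial>\<mu>) r"
      proof (rule minkowski_majorant[OF r(1) \<mu> s K])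
        show "\<psi> \<in> borel_measurable borel" unfolding \<psi>_def by measurable
        show "0 < \<psi> w" for w using \<epsilon> by (simp add: \<psi>_def add_nonneg_pos)
        show "(\<integral>\<^sup>+w. \<psi> w \<partial>\<mu>) < \<infinity>" unfolding \<psi>i using fin by (simp add: less_top)
        fix w
        have "(\<integral>\<^sup>+x. ennreal_powr (K w x) r \<partial>lborel) = ennreal_powr (\<phi> w) r"
          unfolding \<phi>_def r(2) using r(1) by (simp add: ennreal_powr_inverse)
        also have "\<dots> \<le> ennreal_powr (\<psi> w) r" using r(1) by (intro ennreal_powr_mono) (auto simp: \<psi>_def)
        finally show "(\<integral>\<^sup>+x. ennreal_powr (K w x) r \<partial>lborel) \<le> ennreal_powr (\<psi> w) r" .
      qed
      then have "Lp_norm p (\<lambda>x. \<integral>\<^sup>+w. K w x \<partial>\<mu>) \<le> ennreal_powr (ennreal_powr (\<integral>\<^sup>+w. \<psi> w \<partial>\<mu>) r) (1 / r)"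
        unfolding r(2) using r(1) by (intro ennreal_powr_mono) auto
      also have "\<dots> = (\<integral>\<^sup>+w. \<psi> w \<partial>\<mu>)" using r(1) by (simp add: ennreal_powr_inverse)
      also have "\<dots> \<le> (\<integral>\<^sup>+w. \<phi> w \<partial>\<mu>) + ennreal e" unfolding \<psi>i using em by (intro add_left_mono ennreal_leI)
      finally show "Lp_norm p (\<lambda>x. \<integral>\<^sup>+w. K w x \<partial>\<mu>) \<le> (\<integral>\<^sup>+w. \<phi> w \<partial>\<mu>) + ennreal e" .
    qed
  qed
  then show ?thesis by (simp add: \<phi>_def)
qed

text \<open>Mixed norms of an average of phase-space translates: Minkowski's inequality is applied once in each
  variable, and translation invariance makes all inner norms equal.\<close>

theorem mixed_norm_translates:
  fixes F H :: "'a::euclidean_space \<Rightarrow> 'a \<Rightarrow> ennreal" and A B :: "'w::euclidean_space \<Rightarrow> 'a"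
  assumes p: "1 \<le> p" and q: "1 \<le> q" and \<mu>: "finite_measure \<mu>" and s: "sets \<mu> = sets borel"
    and F [measurable]: "(\<lambda>(x, \<xi>). F x \<xi>) \<in> borel_measurable (borel \<Otimes>\<^sub>M borel)"
    and H [measurable]: "(\<lambda>(x, \<xi>). H x \<xi>) \<in> borel_measurable (borel \<Otimes>\<^sub>M borel)"
    and A [measurable]: "A \<in> borel_measurable borel" and B [measurable]: "B \<in> borel_measurable borel"
    and le: "\<And>x \<xi>. H x \<xi> \<le> (\<integral>\<^sup>+w. F (x + A w) (\<xi> + B w) \<partial>\<mu>)"
  shows "mixed_norm p q H \<le> emeasure \<mu> (space \<mu>) * mixed_norm p q F"
proof -
  define \<phi> where "\<phi> = (\<lambda>\<xi>. Lp_norm p (\<lambda>x. F x \<xi>))"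
  have F1: "(\<lambda>x. F x \<xi>) \<in> borel_measurable borel" for \<xi> using measurable_Pair1[OF F, of \<xi>] by simp
  have H1: "(\<lambda>x. H x \<xi>) \<in> borel_measurable borel" for \<xi> using measurable_Pair1[OF H, of \<xi>] by simp
  have \<phi>m [measurable]: "\<phi> \<in> borel_measurable borel"
    unfolding \<phi>_def by (rule Lp_norm_measurable[OF p]) measurable
  have inner: "Lp_norm p (\<lambda>x. H x \<xi>) \<le> (\<integral>\<^sup>+w. \<phi> (\<xi> + B w) \<partial>\<mu>)" for \<xi>
  proof -
    have "Lp_norm p (\<lambda>x. H x \<xi>) \<le> Lp_norm p (\<lambda>x. \<integral>\<^sup>+w. F (x + A w) (\<xi> + B w) \<partial>\<mu>)"
      by (intro Lp_norm_mono p H1 le)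
    also have "\<dots> \<le> (\<integral>\<^sup>+w. Lp_norm p (\<lambda>x. F (x + A w) (\<xi> + B w)) \<partial>\<mu>)"
      by (rule minkowski_integral_inequality[OF p \<mu> s]) measurable
    also have "\<dots> \<le> (\<integral>\<^sup>+w. \<phi> (\<xi> + B w) \<partial>\<mu>)"
      unfolding \<phi>_def by (intro nn_integral_mono Lp_norm_translate_le p F1)
    finally show ?thesis .
  qed
  have "mixed_norm p q H \<le> Lp_norm q (\<lambda>\<xi>. \<integral>\<^sup>+w. \<phi> (\<xi> + B w) \<partial>\<mu>)"
    unfolding mixed_norm_def
  proof (intro Lp_norm_mono q inner Lp_norm_measurable p)
    show "(\<lambda>(\<xi>, x). H x \<xi>) \<in> borel_measurable (borel \<Otimes>\<^sub>M borel)" by measurable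
  qed
  also have "\<dots> \<le> (\<integral>\<^sup>+w. Lp_norm q (\<lambda>\<xi>. \<phi> (\<xi> + B w)) \<partial>\<mu>)"
    by (rule minkowski_integral_inequality[OF q \<mu> s]) measurable
  also have "\<dots> \<le> (\<integral>\<^sup>+w. Lp_norm q \<phi> \<partial>\<mu>)"
    by (intro nn_integral_mono Lp_norm_translate_le q \<phi>m)
  also have "\<dots> = emeasure \<mu> (space \<mu>) * mixed_norm p q F" by (simp add: mixed_norm_def \<phi>_def mult.commute)
  finally show ?thesis .
qed

section \<open>Boundedness on modulation spaces\<close>

lemma weighted_stft_measurable:
  assumes u: "tempered u" and g: "schwartz (g :: 'a::euclidean_space \<Rightarrow> complex)"
  shows "(\<lambda>(x, \<xi>). ennreal (v_weight s (x, \<xi>) * norm (stft g u x \<xi>))) \<in> borel_measurable (borel \<Otimes>\<^sub>M borel)"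
proof -
  have "(\<lambda>q::'a \<times> 'a. ennreal (v_weight s q * norm (stft g u (fst q) (snd q)))) \<in> borel_measurable borel"
    using stft_norm_measurable[OF u g] by measurable
  then show ?thesis by (simp add: split_beta' borel_prod)
qed

text \<open>The short-time Fourier transform of \<open>Z u\<close> is dominated by the Gaussian average of the translates of that
  of \<open>u\<close>; Peetre's inequality moves the weight onto the translates.\<close>

theorem mod_norm_extend_op:
  fixes Z :: "(real^'d::finite) L2 \<Rightarrow> (real^'d) L2"
  assumes Z: "mp_factorization Z U V A" and g: "schwartz g" and p: "1 \<le> p" and q: "1 \<le> q" and s: "0 \<le> s"
    and u: "tempered u"
  shows "tempered (extend_op Z u)"
    and "mod_norm g p q s (extend_op Z u) \<le>
      ennreal (2 powr (s / 2) * (LBINT x. gauss x * v_weight s (x :: real^('d + 'd))) *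
        (\<Prod>j\<in>UNIV. inverse (cosh (atom_angle (A j) / 2))) *
        (1 + (sigma_max (sqrt_Sigma_matrix A ** matrix_inv V))\<^sup>2) powr (s / 2)) * mod_norm g p q s u"
proof -
  from Z have U: "mp_projection U V" by (auto simp: mp_factorization_def)
  define a where "a = (\<lambda>w. pos (shift_of V A w))"
  define b where "b = (\<lambda>w. freq (shift_of V A w))"
  define c where "c = (\<Prod>j\<in>UNIV. inverse (cosh (atom_angle (A j) / 2)))"
  define \<sigma> where "\<sigma> = sigma_max (sqrt_Sigma_matrix A ** matrix_inv V)"
  define G where "G = (\<lambda>w::real^('d + 'd). gauss w)"
  define \<kappa> where "\<kappa> = (\<lambda>w. c * (2 powr (s / 2) * (G w * v_weight s (shift_of V A w))))"
  have c0: "0 \<le> c" unfolding c_def by (intro prod_nonneg) simp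
  have lin: "linear a" "linear b"
    using linear_compose[OF linear_shift_of linear_pos] linear_compose[OF linear_shift_of linear_freq]
    by (simp_all add: a_def b_def comp_def)
  have form: "cinner_L2 (Z f) h = complex_of_real c * gauss_form a b f h" for f h
    unfolding mp_factorization_gauss_form[OF Z] c_def of_real_prod a_def b_def ..
  show t: "tempered (extend_op Z u)" by (rule tempered_extend_op[OF form lin u])
  have sm [measurable]: "shift_of V A \<in> borel_measurable borel" "a \<in> borel_measurable borel" "b \<in> borel_measurable borel"
    using linear_shift_of[of V A] lin
    by (auto intro!: borel_measurable_continuous_onI linear_continuous_on simp: linear_conv_bounded_linear)
  have Gm [measurable]: "G \<in> borel_measurable borel" by (simp add: G_def)
  have G0: "0 \<le> G w" for w by (simp add: G_def)
  have \<kappa>0: "0 \<le> \<kappa> w" for w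
    unfolding \<kappa>_def using c0 G0 v_weight_pos[of s "shift_of V A w"] by simp
  have \<kappa>m [measurable]: "\<kappa> \<in> borel_measurable borel" unfolding \<kappa>_def by measurable
  define D where "D = c * (2 powr (s / 2) * (1 + \<sigma>\<^sup>2) powr (s / 2))"
  have \<kappa>le: "\<kappa> w \<le> D * (G w * v_weight s w)" for w
  proof -
    have "v_weight s (shift_of V A w) \<le> (1 + \<sigma>\<^sup>2) powr (s / 2) * v_weight s w"
      unfolding \<sigma>_def by (intro v_weight_scale s sigma_max_bound norm_shift_of_le mp_projection_covariance[OF U])
    then have "\<kappa> w \<le> c * (2 powr (s / 2) * (G w * ((1 + \<sigma>\<^sup>2) powr (s / 2) * v_weight s w)))"
      unfolding \<kappa>_def using c0 G0 by (intro mult_left_mono) auto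
    then show ?thesis by (simp add: D_def mult_ac)
  qed
  have Gv: "integrable lborel (\<lambda>w. G w * v_weight s w)" unfolding G_def by (rule v_weight_gaussian_integrable[OF s])
  have \<kappa>i: "integrable lborel \<kappa>"
  proof (rule integrable_dominated)
    show "integrable lborel (\<lambda>w. D * (G w * v_weight s w))" using Gv by simp
    show "AE w in lborel. norm (\<kappa> w) \<le> norm (D * (G w * v_weight s w))"
      unfolding real_norm_def abs_of_nonneg[OF \<kappa>0] by (intro AE_I2 order_trans[OF \<kappa>le] abs_ge_self)
  qed simp
  define \<mu> where "\<mu> = density lborel (\<lambda>w. ennreal (\<kappa> w))"
  have s\<mu>: "sets \<mu> = sets borel" by (simp add: \<mu>_def)
  have e\<mu>: "emeasure \<mu> (space \<mu>) = ennreal (LBINT w. \<kappa> w)"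
  proof -
    have "emeasure \<mu> (space \<mu>) = (\<integral>\<^sup>+w. ennreal (\<kappa> w) \<partial>lborel)"
      by (simp add: \<mu>_def emeasure_density)
    also have "\<dots> = ennreal (LBINT w. \<kappa> w)"
      by (rule nn_integral_eq_integral[OF \<kappa>i]) (simp add: \<kappa>0)
    finally show ?thesis .
  qed
  have fin: "finite_measure \<mu>" by (rule finite_measureI) (simp add: e\<mu>)
  define F where "F = (\<lambda>x \<xi>. ennreal (v_weight s (x, \<xi>) * norm (stft g u x \<xi>)))"
  define H where "H = (\<lambda>x \<xi>. ennreal (v_weight s (x, \<xi>) * norm (stft g (extend_op Z u) x \<xi>)))"
  have Fm: "(\<lambda>(x, \<xi>). F x \<xi>) \<in> borel_measurable (borel \<Otimes>\<^sub>M borel)"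
    unfolding F_def by (rule weighted_stft_measurable[OF u g])
  have Hm: "(\<lambda>(x, \<xi>). H x \<xi>) \<in> borel_measurable (borel \<Otimes>\<^sub>M borel)"
    unfolding H_def by (rule weighted_stft_measurable[OF t g])
  have "mixed_norm p q H \<le> emeasure \<mu> (space \<mu>) * mixed_norm p q F"
  proof (rule mixed_norm_translates[OF p q fin s\<mu> Fm Hm sm(2,3)])
    fix x \<xi>
    define S where "S = (\<lambda>w. G w * norm (stft g u (x + a w) (\<xi> + b w)))"
    have Si: "integrable lborel S" unfolding S_def G_def by (rule stft_extend_op(2)[OF form lin u g])
    have v0: "0 \<le> v_weight s (x, \<xi>)" using v_weight_pos[of s "(x, \<xi>)"] by simp
    have Fw: "(\<lambda>w. F (x + a w) (\<xi> + b w)) \<in> borel_measurable borel"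
      using measurable_compose[OF measurable_Pair Fm, of "\<lambda>w. x + a w" borel "\<lambda>w. \<xi> + b w"] by simp
    have "v_weight s (x, \<xi>) * norm (stft g (extend_op Z u) x \<xi>) \<le> v_weight s (x, \<xi>) * (\<bar>c\<bar> * (LBINT w. S w))"
      unfolding S_def G_def by (intro mult_left_mono stft_extend_op(1)[OF form lin u g] v0)
    also have "\<dots> = (LBINT w. v_weight s (x, \<xi>) * c * S w)" using c0 by simp
    finally have "H x \<xi> \<le> ennreal (LBINT w. v_weight s (x, \<xi>) * c * S w)" unfolding H_def by (rule ennreal_leI)
    also have "\<dots> = (\<integral>\<^sup>+w. ennreal (v_weight s (x, \<xi>) * c * S w) \<partial>lborel)"
      using Si v0 c0 G0 by (intro nn_integral_eq_integral[symmetric] integrable_mult_right AE_I2) (auto simp: S_def)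
    also have "\<dots> \<le> (\<integral>\<^sup>+w. ennreal (\<kappa> w) * F (x + a w) (\<xi> + b w) \<partial>lborel)"
    proof (rule nn_integral_mono)
      fix w
      have "v_weight s (x, \<xi>) \<le> 2 powr (s / 2) * (v_weight s ((x, \<xi>) + (a w, b w)) * v_weight s (a w, b w))"
        by (rule v_weight_peetre[OF s])
      then have "v_weight s (x, \<xi>) \<le> 2 powr (s / 2) * (v_weight s (x + a w, \<xi> + b w) * v_weight s (shift_of V A w))"
        by (simp add: a_def b_def v_weight_pair)
      then have "v_weight s (x, \<xi>) * (c * S w) \<le> 2 powr (s / 2) * (v_weight s (x + a w, \<xi> + b w) * v_weight s (shift_of V A w)) * (c * S w)"
        using c0 G0 by (intro mult_right_mono) (auto simp: S_def)
      then have "v_weight s (x, \<xi>) * c * S w \<le> \<kappa> w * (v_weight s (x + a w, \<xi> + b w) * norm (stft g u (x + a w) (\<xi> + b w)))"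
        by (simp add: \<kappa>_def S_def mult_ac)
      then have "ennreal (v_weight s (x, \<xi>) * c * S w) \<le> ennreal (\<kappa> w * (v_weight s (x + a w, \<xi> + b w) * norm (stft g u (x + a w) (\<xi> + b w))))"
        by (rule ennreal_leI)
      then show "ennreal (v_weight s (x, \<xi>) * c * S w) \<le> ennreal (\<kappa> w) * F (x + a w) (\<xi> + b w)"
        unfolding F_def by (simp add: ennreal_mult'[OF \<kappa>0])
    qed
    also have "\<dots> = (\<integral>\<^sup>+w. F (x + a w) (\<xi> + b w) \<partial>\<mu>)"
      unfolding \<mu>_def using Fw by (intro nn_integral_density[symmetric]) measurable
    finally show "H x \<xi> \<le> (\<integral>\<^sup>+w. F (x + a w) (\<xi> + b w) \<partial>\<mu>)" .
  qed
  also have "emeasure \<mu> (space \<mu>) \<le> ennreal (D * (LBINT w. G w * v_weight s w))"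
  proof -
    have "(LBINT w. \<kappa> w) \<le> (LBINT w. D * (G w * v_weight s w))"
      by (rule Bochner_Integration.integral_mono[OF \<kappa>i _ \<kappa>le]) (use Gv in simp)
    then show ?thesis unfolding e\<mu> by (intro ennreal_leI) simp
  qed
  finally show "mod_norm g p q s (extend_op Z u) \<le>
      ennreal (2 powr (s / 2) * (LBINT x. gauss x * v_weight s (x :: real^('d + 'd))) *
        (\<Prod>j\<in>UNIV. inverse (cosh (atom_angle (A j) / 2))) *
        (1 + (sigma_max (sqrt_Sigma_matrix A ** matrix_inv V))\<^sup>2) powr (s / 2)) * mod_norm g p q s u"
    unfolding mod_norm_def F_def H_def D_def G_def \<sigma>_def c_def by (simp add: mult_ac mult_right_mono)
qed

theorem theorem7p1:
  shows "(\<forall>(Z :: (real^'d) L2 \<Rightarrow> (real^'d) L2) U V A.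
      Z \<in> Mp_zero \<and> mp_factorization Z U V A \<longrightarrow>
      is_Opw Z (fun_dist (\<lambda>z. complex_of_real ((\<Prod>j\<in>UNIV. inverse (cosh (atom_angle (A j) / 2))) *
        exp (- pi * (((transpose (matrix_inv V) ** Sigma_matrix A ** matrix_inv V) *v z) \<bullet> z))))))
    \<and> (\<forall>(g :: real^'d \<Rightarrow> complex) (p::ennreal) (q::ennreal) (s::real).
      schwartz g \<and> g \<noteq> (\<lambda>x. 0) \<and> 1 \<le> p \<and> 1 \<le> q \<and> 0 \<le> s \<longrightarrow>
      (\<exists>C::real. C > 0 \<and> (\<forall>(Z :: (real^'d) L2 \<Rightarrow> (real^'d) L2) U V A.
        Z \<in> Mp_zero \<and> mp_factorization Z U V A \<longrightarrow>
        (\<forall>u \<in> mod_space g p q s.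
          extend_op Z u \<in> mod_space g p q s \<and>
          mod_norm g p q s (extend_op Z u) \<le>
            ennreal (C * (\<integral>x. exp (- pi * (norm x)\<^sup>2) * v_weight s (x :: real^('d + 'd)) \<partial>lborel) *
              (\<Prod>j\<in>UNIV. inverse (cosh (atom_angle (A j) / 2))) *
              (1 + (sigma_max (sqrt_Sigma_matrix A ** matrix_inv V))\<^sup>2) powr (s / 2)) *
            mod_norm g p q s u))))"
proof (intro conjI allI impI)
  fix Z :: "(real^'d) L2 \<Rightarrow> (real^'d) L2" and U V A
  assume "Z \<in> Mp_zero \<and> mp_factorization Z U V A"
  then show "is_Opw Z (fun_dist (\<lambda>z. complex_of_real ((\<Prod>j\<in>UNIV. inverse (cosh (atom_angle (A j) / 2))) *
        exp (- pi * (((transpose (matrix_inv V) ** Sigma_matrix A ** matrix_inv V) *v z) \<bullet> z)))))"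
    using weyl_symbol by blast
next
  fix g :: "real^'d \<Rightarrow> complex" and p q :: ennreal and s :: real
  assume h: "schwartz g \<and> g \<noteq> (\<lambda>x. 0) \<and> 1 \<le> p \<and> 1 \<le> q \<and> 0 \<le> s"
  show "\<exists>C::real. C > 0 \<and> (\<forall>(Z :: (real^'d) L2 \<Rightarrow> (real^'d) L2) U V A.
        Z \<in> Mp_zero \<and> mp_factorization Z U V A \<longrightarrow>
        (\<forall>u \<in> mod_space g p q s.
          extend_op Z u \<in> mod_space g p q s \<and>
          mod_norm g p q s (extend_op Z u) \<le>
            ennreal (C * (\<integral>x. exp (- pi * (norm x)\<^sup>2) * v_weight s (x :: real^('d + 'd)) \<partial>lborel) *
              (\<Prod>j\<in>UNIV. inverse (cosh (atom_angle (A j) / 2))) *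
              (1 + (sigma_max (sqrt_Sigma_matrix A ** matrix_inv V))\<^sup>2) powr (s / 2)) *
            mod_norm g p q s u))"
  proof (intro exI[of _ "2 powr (s / 2)"] conjI allI impI ballI)
    fix Z :: "(real^'d) L2 \<Rightarrow> (real^'d) L2" and U V A u
    assume Z: "Z \<in> Mp_zero \<and> mp_factorization Z U V A" and u: "u \<in> mod_space g p q s"
    note bound = mod_norm_extend_op[of Z U V A g p q s u]
    show b: "mod_norm g p q s (extend_op Z u) \<le>
            ennreal (2 powr (s / 2) * (\<integral>x. exp (- pi * (norm x)\<^sup>2) * v_weight s (x :: real^('d + 'd)) \<partial>lborel) *
              (\<Prod>j\<in>UNIV. inverse (cosh (atom_angle (A j) / 2))) *
              (1 + (sigma_max (sqrt_Sigma_matrix A ** matrix_inv V))\<^sup>2) powr (s / 2)) *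
            mod_norm g p q s u"
      using bound(2) Z u h by (simp add: mod_space_def)
    have "mod_norm g p q s (extend_op Z u) < \<infinity>"
      by (rule le_less_trans[OF b]) (use u in \<open>simp add: mod_space_def ennreal_mult_less_top\<close>)
    then show "extend_op Z u \<in> mod_space g p q s"
      using bound(1) Z u h by (simp add: mod_space_def)
  qed simp
qed

end
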